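(* Let $\lambda\in\mathbb{C}$ with $|\lambda|>1$, let $\varphi\in\mathrm{Diff}^\infty([0,\infty))$ be expanding, and let $R$ be the corresponding Reeb component of real dimension $3$ given by the Hopf construction, with boundary elliptic curve $H$. The group $\mathrm{Aut}\,R$ admits the following sequence of extensions by the abelian groups $\mathrm{Aut}_0H$, $Z_\varphi$ and $\mathcal{K}_{\lambda,\varphi}$ (both sequences being exact): $$0\to\mathrm{Aut}(R,H)\to\mathrm{Aut}\,R\to\mathrm{Aut}_0H\to0,$$ $$0\to\mathcal{K}_{\lambda,\varphi}\to\mathrm{Aut}(R,H)\to Z_\varphi\to0,$$ where $\mathrm{Aut}_0H\cong\mathbb{C}^*/\lambda^{\mathbb{Z}}$ records the multiplication by the constant linear part $a$ modulo $\lambda^{\mathbb{Z}}$ of a lift $(z,x)\mapsto(az+b(x),\eta(x))$, $Z_\varphi$ is the centralizer of $\varphi$ in $\mathrm{Diff}^\infty([0,\infty))$, and $\mathcal{K}_{\lambda,\varphi}$ is identified with the space of $b\in C^\infty([0,\infty);\mathbb{C})$ satisfying $b(\varphi(x))=\lambda b(x)$. Moreover, $\mathcal{K}_{\lambda,\varphi}$ is isomorphic to the infinite dimensional vector space $\mathcal{Z}_{\lambda,\varphi}$ in Cases (2) and (3), while in Case (1) it is a complex vector space of dimension $1$ or $0$ according to whether the resonance condition $\lambda=(\varphi'(0))^n$ for some $n\in\mathbb{N}$ holds or not.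
   Context: $\varphi$ is expanding if $\varphi(0)=0$ and $\varphi(x)-x>0$ for all $x>0$. Hopf construction: let $\tilde R=\mathbb{C}\times[0,\infty)\setminus\{(0,0)\}$ with coordinates $(z,x)$, foliated by the leaves $\mathbb{C}\times\{x\}$ ($x>0$) and $\mathbb{C}^*\times\{0\}$ with natural complex structures, and let $T(z,x)=(\lambda z,\varphi(x))$. Then $R=\tilde R/T^{\mathbb{Z}}$ with the induced foliation and leafwise complex structure; its boundary is the elliptic curve $H=\mathbb{C}^*/\lambda^{\mathbb{Z}}$. $\mathrm{Aut}\,R$ is the group of all $C^\infty$ diffeomorphisms of $R$ which map leaves to leaves and are holomorphic on each leaf. $\mathrm{Aut}(R,H)$ is the subgroup of elements restricting to the identity on $H$. $\mathrm{Aut}_0H$ is the identity component of the group of holomorphic automorphisms of $H$. The map $\mathrm{Aut}\,R\to\mathrm{Aut}_0H$ is restriction to $H$. Each element of $\mathrm{Aut}(R,H)$ has a unique lift to $\tilde R$ that is the identity on $\mathbb{C}^*\times\{0\}$; it has the form $(z,x)\mapsto(z+b(x),\eta(x))$, and the map $\mathrm{Aut}(R,H)\to Z_\varphi$ is $\eta$. $\mathcal{Z}_{\lambda,\varphi}$ is the space of $\beta\in C^\infty((0,\infty);\mathbb{C})$ with $\beta(\varphi(x))=\lambda\beta(x)$ for all $x>0$. Cases: (1) $\varphi'(0)=\mu>1$; (2) for some $n\ge2$, $j^{n-1}\varphi(0)=j^{n-1}\mathrm{id}(0)$ and $\varphi^{(n)}(0)>0$; (3) $j^\infty\varphi(0)=j^\infty\mathrm{id}(0)$,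 where $j^i$ denotes the $i$-th jet. *)

theory Defs
  imports
    "HOL-Complex_Analysis.Complex_Analysis"
    "HOL-Library.Function_Algebras"
    "HOL-Algebra.Bij"
    "HOL-Algebra.Coset"
begin

section \<open>Smooth functions\<close>

primrec Ck_on :: "nat \<Rightarrow> ('a::real_normed_vector \<Rightarrow> 'b::real_normed_vector) \<Rightarrow> 'a set \<Rightarrow> bool" where
  "Ck_on 0 f S \<longleftrightarrow> continuous_on S f"
| "Ck_on (Suc k) f S \<longleftrightarrow> (\<forall>x\<in>S. f differentiable (at x)) \<and>
     (\<forall>v. Ck_on k (\<lambda>x. frechet_derivative f (at x) v) S)"

text \<open>Smoothness on an arbitrary subset of a Euclidean space (such as a relatively open subset
  of a half-space) means local extendability to a smooth function on an open set.
  Only the values of the function on the subset matter.\<close>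

definition smooth_on :: "'a::euclidean_space set \<Rightarrow> ('a \<Rightarrow> 'b::euclidean_space) \<Rightarrow> bool" where
  "smooth_on S f \<longleftrightarrow> (\<forall>x\<in>S. \<exists>U g. open U \<and> x \<in> U \<and> (\<forall>k. Ck_on k g U) \<and> (\<forall>y\<in>S \<inter> U. g y = f y))"

text \<open>Iterated derivatives on the half-line, one-sided at the end point.\<close>

primrec half_deriv :: "nat \<Rightarrow> (real \<Rightarrow> real) \<Rightarrow> real \<Rightarrow> real" where
  "half_deriv 0 f = f"
| "half_deriv (Suc k) f = (\<lambda>x. vector_derivative (half_deriv k f) (at x within {0..}))"

text \<open>Equality at 0 of the \<open>k\<close>-jets of two functions on the half-line.\<close>

definition jet_eq :: "nat \<Rightarrow> (real \<Rightarrow> real) \<Rightarrow> (real \<Rightarrow> real) \<Rightarrow> bool" where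
  "jet_eq k f g \<longleftrightarrow> (\<forall>i\<le>k. half_deriv i f 0 = half_deriv i g 0)"

section \<open>Exact sequences\<close>

text \<open>The library's \<open>short_exact_sequence\<close> requires the three groups to have the same element
  type. Here \<open>i\<close> is the inclusion \<open>A \<rightarrow> B\<close> and \<open>p\<close> the projection \<open>B \<rightarrow> C\<close>.\<close>

definition short_exact ::
  "'a monoid \<Rightarrow> 'b monoid \<Rightarrow> 'c monoid \<Rightarrow> ('a \<Rightarrow> 'b) \<Rightarrow> ('b \<Rightarrow> 'c) \<Rightarrow> bool" where
  "short_exact A B C i p \<longleftrightarrow> group A \<and> group B \<and> group C \<and>
     i \<in> mon A B \<and> p \<in> epi B C \<and> i ` carrier A = kernel B C p"

section \<open>Diffeomorphisms of the half-line\<close>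

text \<open>As in \<^const>\<open>BijGroup\<close>, maps of a set are represented by functions that are
  \<^const>\<open>undefined\<close> outside of it.\<close>

definition Diff_half :: "(real \<Rightarrow> real) monoid" where
  "Diff_half = BijGroup {0..}\<lparr>carrier :=
     {f \<in> Bij {0..}. smooth_on {0..} f \<and> smooth_on {0..} (inv_into {0..} f)}\<rparr>"

definition expanding :: "(real \<Rightarrow> real) \<Rightarrow> bool" where
  "expanding \<phi> \<longleftrightarrow> \<phi> 0 = 0 \<and> (\<forall>x>0. \<phi> x - x > 0)"

definition Z_centralizer :: "(real \<Rightarrow> real) \<Rightarrow> (real \<Rightarrow> real) monoid" where
  "Z_centralizer \<phi> = Diff_half\<lparr>carrier :=
     {g \<in> carrier Diff_half. g \<otimes>\<^bsub>Diff_half\<^esub> \<phi> = \<phi> \<otimes>\<^bsub>Diff_half\<^esub> g}\<rparr>"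

section \<open>The Hopf construction\<close>

definition reeb_cover :: "(complex \<times> real) set" where
  "reeb_cover = UNIV \<times> {0..} - {(0, 0)}"

definition hopf_map :: "complex \<Rightarrow> (real \<Rightarrow> real) \<Rightarrow> complex \<times> real \<Rightarrow> complex \<times> real" where
  "hopf_map lam \<phi> = (\<lambda>(z, x). (lam * z, \<phi> x))"

text \<open>The projection of \<^const>\<open>reeb_cover\<close> to its quotient by the group generated by the Hopf map
  \<open>T\<close> sends a point to its orbit. The points \<open>q\<close> with \<open>T\<^sup>n q = p\<close> are the \<open>T\<^sup>-\<^sup>n p\<close>.\<close>

definition reeb_proj :: "complex \<Rightarrow> (real \<Rightarrow> real) \<Rightarrow> complex \<times> real \<Rightarrow> (complex \<times> real) set" where
  "reeb_proj lam \<phi> p = {q \<in> reeb_cover. \<exists>n.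
     (hopf_map lam \<phi> ^^ n) p = q \<or> (hopf_map lam \<phi> ^^ n) q = p}"

definition reeb :: "complex \<Rightarrow> (real \<Rightarrow> real) \<Rightarrow> (complex \<times> real) set set" where
  "reeb lam \<phi> = reeb_proj lam \<phi> ` reeb_cover"

definition reeb_leaves :: "complex \<Rightarrow> (real \<Rightarrow> real) \<Rightarrow> (complex \<times> real) set set set" where
  "reeb_leaves lam \<phi> = {reeb_proj lam \<phi> ` (reeb_cover \<inter> UNIV \<times> {x}) | x. x \<ge> 0}"

definition reeb_bdry :: "complex \<Rightarrow> (real \<Rightarrow> real) \<Rightarrow> (complex \<times> real) set set" where
  "reeb_bdry lam \<phi> = reeb_proj lam \<phi> ` ((- {0}) \<times> {0})"

text \<open>A chart of the quotient is the inverse of the projection on a relatively open set \<open>U\<close> on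
  which the projection is injective. Similarly, a chart of a leaf is the inverse of
  \<open>w \<mapsto> reeb_proj lam \<phi> (w, x)\<close> on an open set \<open>W\<close>; in particular leaves carry the
  leaf topology. Charts are represented by the sets \<open>U\<close> and \<open>W\<close>.\<close>

definition reeb_chart :: "complex \<Rightarrow> (real \<Rightarrow> real) \<Rightarrow> (complex \<times> real) set \<Rightarrow> bool" where
  "reeb_chart lam \<phi> U \<longleftrightarrow>
     openin (top_of_set reeb_cover) U \<and> inj_on (reeb_proj lam \<phi>) U"

definition leaf_chart :: "complex \<Rightarrow> (real \<Rightarrow> real) \<Rightarrow> real \<Rightarrow> complex set \<Rightarrow> bool" where
  "leaf_chart lam \<phi> x W \<longleftrightarrow>
     open W \<and> W \<times> {x} \<subseteq> reeb_cover \<and> inj_on (\<lambda>w. reeb_proj lam \<phi> (w, x)) W"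

text \<open>In the next two definitions, \<open>G\<close> and \<open>g\<close> are the expressions of \<open>f\<close> in charts.\<close>

definition reeb_smooth ::
  "complex \<Rightarrow> (real \<Rightarrow> real) \<Rightarrow> ((complex \<times> real) set \<Rightarrow> (complex \<times> real) set) \<Rightarrow> bool" where
  "reeb_smooth lam \<phi> f \<longleftrightarrow> (\<forall>p\<in>reeb_cover. \<exists>U V G.
     reeb_chart lam \<phi> U \<and> p \<in> U \<and> reeb_chart lam \<phi> V \<and> G ` U \<subseteq> V \<and> smooth_on U G \<and>
     (\<forall>q\<in>U. f (reeb_proj lam \<phi> q) = reeb_proj lam \<phi> (G q)))"

text \<open>Holomorphy of \<open>f\<close> on the leaf that is the image of the level \<open>x\<close>.\<close>

definition leaf_holomorphic ::
  "complex \<Rightarrow> (real \<Rightarrow> real) \<Rightarrow> real \<Rightarrow> ((complex \<times> real) set \<Rightarrow> (complex \<times> real) set) \<Rightarrow> bool" where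
  "leaf_holomorphic lam \<phi> x f \<longleftrightarrow> (\<forall>z. (z, x) \<in> reeb_cover \<longrightarrow> (\<exists>W y W' g.
     leaf_chart lam \<phi> x W \<and> z \<in> W \<and> leaf_chart lam \<phi> y W' \<and> g ` W \<subseteq> W' \<and> g holomorphic_on W \<and>
     (\<forall>w\<in>W. f (reeb_proj lam \<phi> (w, x)) = reeb_proj lam \<phi> (g w, y))))"

section \<open>Automorphism groups\<close>

definition Aut_reeb ::
  "complex \<Rightarrow> (real \<Rightarrow> real) \<Rightarrow> ((complex \<times> real) set \<Rightarrow> (complex \<times> real) set) monoid" where
  "Aut_reeb lam \<phi> = BijGroup (reeb lam \<phi>)\<lparr>carrier := {f \<in> Bij (reeb lam \<phi>).
     reeb_smooth lam \<phi> f \<and> reeb_smooth lam \<phi> (inv_into (reeb lam \<phi>) f) \<and>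
     (\<forall>L\<in>reeb_leaves lam \<phi>. f ` L \<in> reeb_leaves lam \<phi>) \<and>
     (\<forall>x\<ge>0. leaf_holomorphic lam \<phi> x f)}\<rparr>"

definition Aut_reeb_rel ::
  "complex \<Rightarrow> (real \<Rightarrow> real) \<Rightarrow> ((complex \<times> real) set \<Rightarrow> (complex \<times> real) set) monoid" where
  "Aut_reeb_rel lam \<phi> = Aut_reeb lam \<phi>\<lparr>carrier :=
     {f \<in> carrier (Aut_reeb lam \<phi>). \<forall>P\<in>reeb_bdry lam \<phi>. f P = P}\<rparr>"

definition Aut_bdry ::
  "complex \<Rightarrow> (real \<Rightarrow> real) \<Rightarrow> ((complex \<times> real) set \<Rightarrow> (complex \<times> real) set) monoid" where
  "Aut_bdry lam \<phi> = BijGroup (reeb_bdry lam \<phi>)\<lparr>carrier := {f \<in> Bij (reeb_bdry lam \<phi>).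
     leaf_holomorphic lam \<phi> 0 f \<and> leaf_holomorphic lam \<phi> 0 (inv_into (reeb_bdry lam \<phi>) f)}\<rparr>"

text \<open>The quotient topology of the boundary, and the compact-open topology on its holomorphic
  automorphism group.\<close>

definition bdry_topology :: "complex \<Rightarrow> (real \<Rightarrow> real) \<Rightarrow> (complex \<times> real) set topology" where
  "bdry_topology lam \<phi> = topology (\<lambda>W. W \<subseteq> reeb_bdry lam \<phi> \<and>
     open {z. z \<noteq> 0 \<and> reeb_proj lam \<phi> (z, 0) \<in> W})"

lemma openin_bdry_topology:
  "openin (bdry_topology lam \<phi>) W \<longleftrightarrow> W \<subseteq> reeb_bdry lam \<phi> \<and>
     open {z. z \<noteq> 0 \<and> reeb_proj lam \<phi> (z, 0) \<in> W}"
proof -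
  have "istopology (\<lambda>W. W \<subseteq> reeb_bdry lam \<phi> \<and> open {z. z \<noteq> 0 \<and> reeb_proj lam \<phi> (z, 0) \<in> W})"
    unfolding istopology_def
  proof safe
    fix S T
    assume "open {z. z \<noteq> 0 \<and> reeb_proj lam \<phi> (z, 0) \<in> S}"
      and "open {z. z \<noteq> 0 \<and> reeb_proj lam \<phi> (z, 0) \<in> T}"
    then have "open ({z. z \<noteq> 0 \<and> reeb_proj lam \<phi> (z, 0) \<in> S} \<inter>
        {z. z \<noteq> 0 \<and> reeb_proj lam \<phi> (z, 0) \<in> T})"
      by (rule open_Int)
    also have "\<dots> = {z. z \<noteq> 0 \<and> reeb_proj lam \<phi> (z, 0) \<in> S \<inter> T}" by auto
    finally show "open {z. z \<noteq> 0 \<and> reeb_proj lam \<phi> (z, 0) \<in> S \<inter> T}" .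
  next
    fix \<K>
    assume "\<forall>K\<in>\<K>. K \<subseteq> reeb_bdry lam \<phi> \<and> open {z. z \<noteq> 0 \<and> reeb_proj lam \<phi> (z, 0) \<in> K}"
    then have "open (\<Union>K\<in>\<K>. {z. z \<noteq> 0 \<and> reeb_proj lam \<phi> (z, 0) \<in> K})" by blast
    also have "\<dots> = {z. z \<noteq> 0 \<and> reeb_proj lam \<phi> (z, 0) \<in> \<Union>\<K>}" by auto
    finally show "open {z. z \<noteq> 0 \<and> reeb_proj lam \<phi> (z, 0) \<in> \<Union>\<K>}" .
  qed blast+
  then show ?thesis unfolding bdry_topology_def by simp
qed

definition Aut_bdry_topology ::
  "complex \<Rightarrow> (real \<Rightarrow> real) \<Rightarrow> ((complex \<times> real) set \<Rightarrow> (complex \<times> real) set) topology" where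
  "Aut_bdry_topology lam \<phi> = topology_generated_by
     {{f \<in> carrier (Aut_bdry lam \<phi>). f ` C \<subseteq> W} | C W.
        compactin (bdry_topology lam \<phi>) C \<and> openin (bdry_topology lam \<phi>) W}"

definition Aut0_bdry ::
  "complex \<Rightarrow> (real \<Rightarrow> real) \<Rightarrow> ((complex \<times> real) set \<Rightarrow> (complex \<times> real) set) monoid" where
  "Aut0_bdry lam \<phi> = Aut_bdry lam \<phi>\<lparr>carrier :=
     {f. connected_component_of (Aut_bdry_topology lam \<phi>) \<one>\<^bsub>Aut_bdry lam \<phi>\<^esub> f}\<rparr>"

definition restrict_bdry ::
  "complex \<Rightarrow> (real \<Rightarrow> real) \<Rightarrow> ((complex \<times> real) set \<Rightarrow> (complex \<times> real) set)
    \<Rightarrow> (complex \<times> real) set \<Rightarrow> (complex \<times> real) set" where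
  "restrict_bdry lam \<phi> f = restrict f (reeb_bdry lam \<phi>)"

definition C_star :: "complex monoid" where
  "C_star = \<lparr>carrier = - {0}, mult = (*), one = 1\<rparr>"

section \<open>Lifts\<close>

definition is_lift ::
  "complex \<Rightarrow> (real \<Rightarrow> real) \<Rightarrow> ((complex \<times> real) set \<Rightarrow> (complex \<times> real) set)
    \<Rightarrow> (complex \<times> real \<Rightarrow> complex \<times> real) \<Rightarrow> bool" where
  "is_lift lam \<phi> f F \<longleftrightarrow> continuous_on reeb_cover F \<and> F ` reeb_cover \<subseteq> reeb_cover \<and>
     (\<forall>p\<in>reeb_cover. f (reeb_proj lam \<phi> p) = reeb_proj lam \<phi> (F p))"

definition affine_form ::
  "complex \<Rightarrow> (real \<Rightarrow> complex) \<Rightarrow> (real \<Rightarrow> real) \<Rightarrow> (complex \<times> real \<Rightarrow> complex \<times> real) \<Rightarrow> bool" where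
  "affine_form a b \<eta> F \<longleftrightarrow> (\<forall>z x. (z, x) \<in> reeb_cover \<longrightarrow> F (z, x) = (a * z + b x, \<eta> x))"

text \<open>The component \<open>\<eta>\<close> of the lift that is the identity on the boundary
  of \<^const>\<open>reeb_cover\<close>.\<close>

definition transverse ::
  "complex \<Rightarrow> (real \<Rightarrow> real) \<Rightarrow> ((complex \<times> real) set \<Rightarrow> (complex \<times> real) set) \<Rightarrow> real \<Rightarrow> real" where
  "transverse lam \<phi> f = (THE \<eta>. \<eta> \<in> extensional {0..} \<and> (\<exists>F b. is_lift lam \<phi> f F \<and>
     (\<forall>z. z \<noteq> 0 \<longrightarrow> F (z, 0) = (z, 0)) \<and> affine_form 1 b \<eta> F))"

section \<open>The function spaces\<close>

text \<open>Functions on a subset of the real line are normalised to vanish outside of it, so that the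
  function spaces are subspaces of the complex vector space of all functions.\<close>

definition K_space :: "complex \<Rightarrow> (real \<Rightarrow> real) \<Rightarrow> (real \<Rightarrow> complex) set" where
  "K_space lam \<phi> = {b. smooth_on {0..} b \<and> (\<forall>x\<ge>0. b (\<phi> x) = lam * b x) \<and> (\<forall>x<0. b x = 0)}"

definition Z_space :: "complex \<Rightarrow> (real \<Rightarrow> real) \<Rightarrow> (real \<Rightarrow> complex) set" where
  "Z_space lam \<phi> = {\<beta>. smooth_on {0<..} \<beta> \<and> (\<forall>x>0. \<beta> (\<phi> x) = lam * \<beta> x) \<and> (\<forall>x\<le>0. \<beta> x = 0)}"

definition K_group :: "complex \<Rightarrow> (real \<Rightarrow> real) \<Rightarrow> (real \<Rightarrow> complex) monoid" where
  "K_group lam \<phi> = \<lparr>carrier = K_space lam \<phi>, mult = (+), one = 0\<rparr>"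

text \<open>The automorphism induced by \<open>(z, x) \<mapsto> (z + b x, x)\<close>. Points of the quotient are orbits,
  and this map, commuting with the Hopf map, sends orbits to orbits.\<close>

definition K_action ::
  "complex \<Rightarrow> (real \<Rightarrow> real) \<Rightarrow> (real \<Rightarrow> complex) \<Rightarrow> (complex \<times> real) set \<Rightarrow> (complex \<times> real) set" where
  "K_action lam \<phi> b = (\<lambda>P\<in>reeb lam \<phi>. (\<lambda>(z, x). (z + b x, x)) ` P)"

definition cscale :: "complex \<Rightarrow> (real \<Rightarrow> complex) \<Rightarrow> real \<Rightarrow> complex" where
  "cscale c f = (\<lambda>x. c * f x)"

global_interpretation cfun: vector_space cscale
  by unfold_locales (auto simp: cscale_def fun_eq_iff algebra_simps)

text \<open>This predicate is needed because \<^const>\<open>cfun.dim\<close> is 0 for infinite dimensional spaces.\<close>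

definition fin_dim :: "(real \<Rightarrow> complex) set \<Rightarrow> bool" where
  "fin_dim V \<longleftrightarrow> (\<exists>B. finite B \<and> V \<subseteq> cfun.span B)"

definition linear_iso :: "(real \<Rightarrow> complex) set \<Rightarrow> (real \<Rightarrow> complex) set
    \<Rightarrow> ((real \<Rightarrow> complex) \<Rightarrow> (real \<Rightarrow> complex)) \<Rightarrow> bool" where
  "linear_iso V W h \<longleftrightarrow> bij_betw h V W \<and> (\<forall>u\<in>V. \<forall>v\<in>V. h (u + v) = h u + h v) \<and>
     (\<forall>c. \<forall>v\<in>V. h (cscale c v) = cscale c (h v))"

section \<open>The three cases\<close>

definition case1 :: "(real \<Rightarrow> real) \<Rightarrow> bool" where
  "case1 \<phi> \<longleftrightarrow> half_deriv 1 \<phi> 0 > 1"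

definition case2 :: "(real \<Rightarrow> real) \<Rightarrow> bool" where
  "case2 \<phi> \<longleftrightarrow> (\<exists>n\<ge>2. jet_eq (n - 1) \<phi> (\<lambda>x. x) \<and> half_deriv n \<phi> 0 > 0)"

definition case3 :: "(real \<Rightarrow> real) \<Rightarrow> bool" where
  "case3 \<phi> \<longleftrightarrow> (\<forall>k. jet_eq k \<phi> (\<lambda>x. x))"

end

theory Submission imports Defs begin

text \<open>An automorphism is studied through its lift to the cover \<open>reeb_cover\<close>. The cover is contractible,
  and a positive function \<open>E\<close> on it is multiplied by \<open>norm lam\<close> under the Hopf map; its normalized logarithm
  \<open>logE\<close> increases by 1, so it defines a map of the Reeb component to the circle, and lifting a map to
  the cover amounts to lifting a circle-valued function to the line (\<open>lifting\<close>). A lift is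
  holomorphic and injective on every leaf \<open>\<complex> \<times> {x}\<close>, hence affine there (\<open>injective_entire_affine\<close>); on
  the boundary it is linear, because its quotient by \<open>z\<close> is invariant under multiplication by \<open>lam\<close>
  (\<open>multiplicatively_periodic_constant\<close>). The lift commutes with the Hopf map, so its linear coefficient
  is \<open>\<phi>\<close>-invariant and, by continuity at the boundary, constant. Therefore the automorphisms are exactly
  the maps induced by \<open>(z, x) \<mapsto> (a * z + b x, \<eta> x)\<close> with \<open>a \<noteq> 0\<close>, \<open>b\<close> in \<open>K_space lam \<phi>\<close> and \<open>\<eta>\<close> in
  the centralizer of \<open>\<phi>\<close> (\<open>Aut_iff_act\<close>), and both exact sequences can be read off.

  The restriction of such a map to the boundary curve is multiplication by \<open>a\<close>. That these
  multiplications form the identity component follows from the shape \<open>w \<mapsto> \<alpha> * w + L\<close> of every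
  automorphism of the curve in the logarithmic coordinate (\<open>Aut_bdry_log_lift\<close>): the preimage of
  the trivial class is a discrete lattice, so \<open>\<alpha>\<close> is locally constant in the compact-open topology
  (\<open>linear_part_locally_constant\<close>), while the multiplications, those with \<open>\<alpha> = 1\<close>, are a continuous image
  of the punctured plane.

  The centralizer is commutative by an argument of Szekeres and Kopell: an infinite product of
  derivatives along the backward orbits yields a density in whose coordinate all its elements are affine
  (\<open>Szekeres_density\<close>, \<open>Z_centralizer_commute\<close>).

  If \<open>\<phi>\<close> has derivative 1 at 0, every solution \<open>b\<close> of \<open>b (\<phi> x) = lam * b x\<close> on the open half-line, extended
  by zero, is smooth: it tends to 0 because \<open>norm lam > 1\<close>, and its derivatives satisfy equations of the
  same kind (\<open>twisted_Ck\<close>). So \<open>K_space lam \<phi>\<close> and \<open>Z_space lam \<phi>\<close> coincide. If the derivative \<open>\<mu>\<close> at 0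
  is greater than 1, comparing leading terms shows that a solution smooth up to 0 which is not flat has
  an order \<open>n\<close> with \<open>lam = \<mu> ^ n\<close> (\<open>K_resonance\<close>), and a flat one vanishes (\<open>K_flat_zero\<close>). In the
  resonant case a solution is the \<open>n\<close>-th power of a coordinate linearizing \<open>\<phi>\<close>; such a coordinate comes from
  a contracting functional equation for the logarithmic derivative of its derivative
  (\<open>linearization_germ\<close>).\<close>

section \<open>Calculus of smooth maps\<close>

lemma Ck_on_subset: "Ck_on k f S \<Longrightarrow> T \<subseteq> S \<Longrightarrow> Ck_on k f T"
  by (induction k arbitrary: f) (auto intro: continuous_on_subset)

lemma Ck_on_cong:
  assumes "open S" "\<And>x. x \<in> S \<Longrightarrow> f x = g x"
  shows "Ck_on k f S \<longleftrightarrow> Ck_on k g S"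
proof -
  have *: "Ck_on k g S" if "Ck_on k f S" "\<And>x. x \<in> S \<Longrightarrow> f x = g x" for f g
    using that
  proof (induction k arbitrary: f g)
    case 0 then show ?case by (auto cong: continuous_on_cong)
  next
    case (Suc k)
    have D: "(g has_derivative frechet_derivative f (at x)) (at x)" if "x \<in> S" for x
    proof -
      have "(f has_derivative frechet_derivative f (at x)) (at x)"
        using Suc.prems that by (auto simp: frechet_derivative_works)
      then show ?thesis
        using assms(1) that Suc.prems(2) by (rule has_derivative_transform_within_open)
    qed
    then have "frechet_derivative g (at x) = frechet_derivative f (at x)" if "x \<in> S" for x
      using frechet_derivative_at that by metis
    then have "Ck_on k (\<lambda>x. frechet_derivative g (at x) v) S" for v
      using Suc.IH[of "\<lambda>x. frechet_derivative f (at x) v"] Suc.prems by auto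
    then show ?case using D by (auto simp: differentiable_def)
  qed
  show ?thesis using *[of f g] *[of g f] assms(2) by metis
qed

lemma Ck_on_Suc:
  assumes "open S" "\<And>x. x \<in> S \<Longrightarrow> (f has_derivative f' x) (at x)"
  shows "Ck_on (Suc k) f S \<longleftrightarrow> (\<forall>v. Ck_on k (\<lambda>x. f' x v) S)"
proof -
  have "frechet_derivative f (at x) = f' x" if "x \<in> S" for x
    using assms(2)[OF that] frechet_derivative_at by metis
  then have "Ck_on k (\<lambda>x. frechet_derivative f (at x) v) S \<longleftrightarrow> Ck_on k (\<lambda>x. f' x v) S" for v
    by (intro Ck_on_cong assms) auto
  then show ?thesis using assms(2) by (auto simp: differentiable_def)
qed

lemma Ck_on_SucD: "Ck_on (Suc k) f S \<Longrightarrow> Ck_on k f S"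
proof (induction k arbitrary: f)
  case 0
  then show ?case
    by (auto intro!: continuous_at_imp_continuous_on differentiable_imp_continuous_within)
qed auto

lemma Ck_on_mono: "Ck_on k f S \<Longrightarrow> j \<le> k \<Longrightarrow> Ck_on j f S"
proof (induction k)
  case (Suc k)
  then show ?case using Ck_on_SucD by (cases "j = Suc k") (auto simp del: Ck_on.simps)
qed auto

lemma Ck_on_has_derivative:
  assumes "Ck_on (Suc k) f S" "x \<in> S"
  shows "(f has_derivative frechet_derivative f (at x)) (at x)"
  using assms by (auto simp: frechet_derivative_works)

lemma Ck_on_continuous: "Ck_on k f S \<Longrightarrow> continuous_on S f"
  using Ck_on_mono[of k f S 0] by simp

lemma Ck_on_const: "open S \<Longrightarrow> Ck_on k (\<lambda>x. c) S"
proof (induction k arbitrary: c)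
  case (Suc k)
  then show ?case by (subst Ck_on_Suc[where f' = "\<lambda>x v. 0"]) auto
qed auto

lemma Ck_on_linear:
  assumes "open S" "bounded_linear L"
  shows "Ck_on k L S"
proof (cases k)
  case 0
  then show ?thesis using assms by (auto intro: linear_continuous_on)
next
  case (Suc j)
  then show ?thesis
    using assms by (simp only: Ck_on_Suc[OF assms(1) bounded_linear_imp_has_derivative[OF assms(2)]])
      (auto intro: Ck_on_const)
qed

lemma Ck_on_add:
  assumes "open S" "Ck_on k f S" "Ck_on k g S"
  shows "Ck_on k (\<lambda>x. f x + g x) S"
  using assms(2,3)
proof (induction k arbitrary: f g)
  case 0 then show ?case by (auto intro: continuous_intros)
next
  case (Suc k)
  have "Ck_on (Suc k) (\<lambda>x. f x + g x) S \<longleftrightarrow>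
     (\<forall>v. Ck_on k (\<lambda>x. frechet_derivative f (at x) v + frechet_derivative g (at x) v) S)"
    using Suc.prems
    by (intro Ck_on_Suc assms has_derivative_add Ck_on_has_derivative[where k=k]) auto
  then show ?case using Suc.IH Suc.prems by auto
qed

lemma Ck_on_bilinear:
  assumes "open S" "bounded_bilinear h" "Ck_on k f S" "Ck_on k g S"
  shows "Ck_on k (\<lambda>x. h (f x) (g x)) S"
  using assms(3,4)
proof (induction k arbitrary: f g)
  case 0 then show ?case
    using bounded_bilinear.continuous_on[OF assms(2)] by auto
next
  case (Suc k)
  have "Ck_on (Suc k) (\<lambda>x. h (f x) (g x)) S \<longleftrightarrow>
     (\<forall>v. Ck_on k (\<lambda>x. h (f x) (frechet_derivative g (at x) v) + h (frechet_derivative f (at x) v) (g x)) S)"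
    using Suc.prems
    by (intro Ck_on_Suc assms bounded_bilinear.FDERIV[OF assms(2)] Ck_on_has_derivative[where k=k]) auto
  moreover have "Ck_on k (\<lambda>x. h (f x) (frechet_derivative g (at x) v) + h (frechet_derivative f (at x) v) (g x)) S" for v
    using Suc.prems by (intro Ck_on_add[OF assms(1) Suc.IH Suc.IH]) (use Suc.prems[THEN Ck_on_SucD] in auto)
  ultimately show ?case by blast
qed

lemma Ck_on_sum:
  assumes "open S" "\<And>i. i \<in> I \<Longrightarrow> Ck_on k (f i) S"
  shows "Ck_on k (\<lambda>x. \<Sum>i\<in>I. f i x) S"
  using assms(2) by (induction I rule: infinite_finite_induct) (auto intro: Ck_on_const Ck_on_add assms(1))

text \<open>The derivative of a composite is a sum, over a basis of the intermediate space, of products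
  of a partial derivative of the outer map with a coordinate of the derivative of the inner one.
  So the induction on the order of differentiability only needs products and sums.\<close>

lemma Ck_on_compose:
  fixes f :: "'a::real_normed_vector \<Rightarrow> 'b::euclidean_space"
    and g :: "'b \<Rightarrow> 'c::real_normed_vector"
  assumes "open S" "open T" "f ` S \<subseteq> T" "Ck_on k f S" "Ck_on k g T"
  shows "Ck_on k (\<lambda>x. g (f x)) S"
  using assms(4,5)
proof (induction k arbitrary: g)
  case 0 then show ?case using assms(3) by (auto intro: continuous_on_compose2)
next
  case (Suc k)
  let ?D = "\<lambda>x v. \<Sum>b\<in>Basis. (frechet_derivative f (at x) v \<bullet> b) *\<^sub>R frechet_derivative g (at (f x)) b"
  have D: "((\<lambda>x. g (f x)) has_derivative ?D x) (at x)" if "x \<in> S" for x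
  proof -
    have f: "(f has_derivative frechet_derivative f (at x)) (at x)"
      using Suc.prems(1) that by (rule Ck_on_has_derivative)
    have g: "(g has_derivative frechet_derivative g (at (f x))) (at (f x))"
      using Suc.prems(2) that assms(3) by (intro Ck_on_has_derivative) auto
    then interpret g: bounded_linear "frechet_derivative g (at (f x))"
      by (rule has_derivative_bounded_linear)
    have "frechet_derivative g (at (f x)) u
        = (\<Sum>b\<in>Basis. (u \<bullet> b) *\<^sub>R frechet_derivative g (at (f x)) b)" for u
      using arg_cong[OF euclidean_representation[of u], of "frechet_derivative g (at (f x))"]
      by (simp only: g.sum g.scaleR)
    then have D: "(\<lambda>v. frechet_derivative g (at (f x)) (frechet_derivative f (at x) v)) = ?D x"
      by (rule ext)
    have "((\<lambda>x. g (f x)) has_derivative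
        (\<lambda>v. frechet_derivative g (at (f x)) (frechet_derivative f (at x) v))) (at x)"
      using has_derivative_compose[OF f g] .
    from this[unfolded D] show ?thesis .
  qed
  have "Ck_on k (\<lambda>x. ?D x v) S" for v
  proof (intro Ck_on_sum assms Ck_on_bilinear[OF assms(1) bounded_bilinear_scaleR]
        Ck_on_bilinear[OF assms(1) bounded_bilinear_inner] Ck_on_const)
    show "Ck_on k (\<lambda>x. frechet_derivative f (at x) v) S" using Suc.prems by simp
    show "Ck_on k (\<lambda>x. frechet_derivative g (at (f x)) b) S" for b
      using Suc.IH[OF Ck_on_SucD[OF Suc.prems(1)], of "\<lambda>y. frechet_derivative g (at y) b"] Suc.prems(2)
      by simp
  qed
  then show ?case using Ck_on_Suc[OF assms(1) D] by blast
qed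

lemma Ck_on_local:
  assumes "\<And>x. x \<in> S \<Longrightarrow> \<exists>U. open U \<and> x \<in> U \<and> Ck_on k f U"
  shows "Ck_on k f S"
  using assms
proof (induction k arbitrary: f)
  case 0
  have "isCont f x" if "x \<in> S" for x
    using 0[OF that] continuous_on_eq_continuous_at by auto
  then show ?case by (simp add: continuous_at_imp_continuous_on)
next
  case (Suc k)
  have "Ck_on k (\<lambda>x. frechet_derivative f (at x) v) S" for v
  proof (rule Suc.IH)
    fix x assume "x \<in> S"
    then obtain U where "open U" "x \<in> U" "Ck_on (Suc k) f U" using Suc.prems by blast
    then show "\<exists>U. open U \<and> x \<in> U \<and> Ck_on k (\<lambda>x. frechet_derivative f (at x) v) U"
      by (intro exI[of _ U]) simp
  qed
  moreover have "f differentiable at x" if "x \<in> S" for x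
    using Suc.prems[OF that] by auto
  ultimately show ?case by simp
qed

lemma smooth_on_open:
  assumes "open S"
  shows "smooth_on S f \<longleftrightarrow> (\<forall>k. Ck_on k f S)"
proof
  assume f: "smooth_on S f"
  show "\<forall>k. Ck_on k f S"
  proof (intro allI Ck_on_local)
    fix k x assume "x \<in> S"
    then obtain U g where U: "open U" "x \<in> U" "\<forall>k. Ck_on k g U" "\<forall>y\<in>S \<inter> U. g y = f y"
      using f by (auto simp: smooth_on_def)
    then have "Ck_on k g (S \<inter> U)" by (auto intro: Ck_on_subset)
    then have "Ck_on k f (S \<inter> U)"
      using Ck_on_cong[of "S \<inter> U" g f k] U assms by auto
    then show "\<exists>U. open U \<and> x \<in> U \<and> Ck_on k f U"
      using U assms \<open>x \<in> S\<close> by (intro exI[of _ "S \<inter> U"]) auto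
  qed
next
  assume "\<forall>k. Ck_on k f S"
  then show "smooth_on S f" using assms unfolding smooth_on_def by blast
qed

lemma smooth_onE:
  assumes "smooth_on S f" "x \<in> S"
  obtains U g where "open U" "x \<in> U" "smooth_on U g" "\<And>y. y \<in> S \<Longrightarrow> y \<in> U \<Longrightarrow> g y = f y"
proof -
  obtain U g where "open U" "x \<in> U" "\<forall>k. Ck_on k g U" "\<forall>y\<in>S \<inter> U. g y = f y"
    using assms unfolding smooth_on_def by blast
  then show ?thesis using that[of U g] by (auto simp: smooth_on_open)
qed

lemma smooth_onI:
  assumes "\<And>x. x \<in> S \<Longrightarrow> \<exists>U g. open U \<and> x \<in> U \<and> smooth_on U g \<and> (\<forall>y\<in>S \<inter> U. g y = f y)"
  shows "smooth_on S f"
  unfolding smooth_on_def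
proof
  fix x assume "x \<in> S"
  then obtain U g where "open U" "x \<in> U" "smooth_on U g" "\<forall>y\<in>S \<inter> U. g y = f y" using assms by blast
  then show "\<exists>U g. open U \<and> x \<in> U \<and> (\<forall>k. Ck_on k g U) \<and> (\<forall>y\<in>S \<inter> U. g y = f y)"
    by (auto simp: smooth_on_open)
qed

lemma smooth_on_subset:
  assumes "smooth_on S f" "T \<subseteq> S"
  shows "smooth_on T f"
proof (rule smooth_onI)
  fix x assume "x \<in> T"
  then obtain U g where "open U" "x \<in> U" "smooth_on U g" "\<And>y. y \<in> S \<Longrightarrow> y \<in> U \<Longrightarrow> g y = f y"
    using smooth_onE[OF assms(1), of x] assms(2) by blast
  then show "\<exists>U g. open U \<and> x \<in> U \<and> smooth_on U g \<and> (\<forall>y\<in>T \<inter> U. g y = f y)"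
    using assms(2) by (intro exI[of _ U] exI[of _ g]) auto
qed

lemma smooth_on_cong:
  assumes "smooth_on S f" "\<And>x. x \<in> S \<Longrightarrow> f x = g x"
  shows "smooth_on S g"
  using assms unfolding smooth_on_def by simp

lemma smooth_on_continuous:
  assumes "smooth_on S f" shows "continuous_on S f"
  unfolding continuous_on_eq_continuous_within
proof
  fix x assume "x \<in> S"
  then obtain U g where U: "open U" "x \<in> U" "smooth_on U g" "\<And>y. y \<in> S \<Longrightarrow> y \<in> U \<Longrightarrow> g y = f y"
    using smooth_onE[OF assms] by blast
  then have "continuous_on U g" using Ck_on_continuous smooth_on_open by blast
  then have "continuous (at x within S) g"
    using U by (simp add: continuous_at_imp_continuous_at_within continuous_on_eq_continuous_at)
  then show "continuous (at x within S) f"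
    by (rule continuous_transform_within_openin[OF _ openin_open_Int[OF U(1)], of x S g f])
      (use U \<open>x \<in> S\<close> in auto)
qed

lemma smooth_on_const: "smooth_on S (\<lambda>x. c)"
  unfolding smooth_on_def by (auto intro!: exI[of _ UNIV] exI[of _ "\<lambda>x. c"] Ck_on_const)

lemma smooth_on_linear: "bounded_linear L \<Longrightarrow> smooth_on S L"
  unfolding smooth_on_def by (auto intro!: exI[of _ UNIV] exI[of _ "L"] Ck_on_linear)

lemma smooth_on_compose:
  fixes f :: "'a::euclidean_space \<Rightarrow> 'b::euclidean_space" and g :: "'b \<Rightarrow> 'c::euclidean_space"
  assumes "smooth_on S f" "smooth_on T g" "f ` S \<subseteq> T"
  shows "smooth_on S (\<lambda>x. g (f x))"
proof (rule smooth_onI)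
  fix x assume x: "x \<in> S"
  obtain U f' where U: "open U" "x \<in> U" "smooth_on U f'" "\<And>y. y \<in> S \<Longrightarrow> y \<in> U \<Longrightarrow> f' y = f y"
    using smooth_onE[OF assms(1) x] by blast
  obtain V g' where V: "open V" "f x \<in> V" "smooth_on V g'" "\<And>y. y \<in> T \<Longrightarrow> y \<in> V \<Longrightarrow> g' y = g y"
    using smooth_onE[OF assms(2), of "f x"] assms(3) x by blast
  let ?W = "U \<inter> f' -` V"
  have W: "open ?W"
    using continuous_open_preimage[OF smooth_on_continuous[OF U(3)] U(1) V(1)] .
  moreover have "smooth_on ?W (\<lambda>x. g' (f' x))"
  proof -
    have "Ck_on k (\<lambda>x. g' (f' x)) ?W" for k
    proof (rule Ck_on_compose[OF W V(1)])
      show "Ck_on k f' ?W"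
        using U(1,3) by (rule_tac Ck_on_subset[of k f' U]) (simp_all add: smooth_on_open)
      show "Ck_on k g' V" using V(1,3) by (simp add: smooth_on_open)
    qed auto
    then show ?thesis using W by (simp add: smooth_on_open)
  qed
  ultimately show "\<exists>U h. open U \<and> x \<in> U \<and> smooth_on U h \<and> (\<forall>y\<in>S \<inter> U. h y = g (f y))"
    using U(2,4) V(2,4) x assms(3) by (intro exI[of _ ?W] exI[of _ "\<lambda>x. g' (f' x)"]) auto
qed

lemma smooth_on_Pair:
  fixes f :: "'a::euclidean_space \<Rightarrow> 'b::euclidean_space" and g :: "'a \<Rightarrow> 'c::euclidean_space"
  assumes "smooth_on S f" "smooth_on S g"
  shows "smooth_on S (\<lambda>x. (f x, g x))"
proof (rule smooth_onI)
  fix x assume x: "x \<in> S"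
  obtain U f' where U: "open U" "x \<in> U" "smooth_on U f'" "\<And>y. y \<in> S \<Longrightarrow> y \<in> U \<Longrightarrow> f' y = f y"
    using smooth_onE[OF assms(1) x] by blast
  obtain V g' where V: "open V" "x \<in> V" "smooth_on V g'" "\<And>y. y \<in> S \<Longrightarrow> y \<in> V \<Longrightarrow> g' y = g y"
    using smooth_onE[OF assms(2) x] by blast
  have l: "bounded_linear (\<lambda>u::'b. (u, 0::'c))" "bounded_linear (\<lambda>u::'c. (0::'b, u))"
    by (auto intro!: bounded_linear_Pair bounded_linear_ident bounded_linear_zero)
  have "Ck_on k (\<lambda>x. (f' x, 0::'c) + (0, g' x)) (U \<inter> V)" for k
  proof -
    have o: "open (U \<inter> V)" using U(1) V(1) by (rule open_Int)
    have f: "Ck_on k f' (U \<inter> V)"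
      using U(1,3) by (rule_tac Ck_on_subset[of k f' U]) (simp_all add: smooth_on_open)
    have g: "Ck_on k g' (U \<inter> V)"
      using V(1,3) by (rule_tac Ck_on_subset[of k g' V]) (simp_all add: smooth_on_open)
    show ?thesis
      by (rule Ck_on_add[OF o Ck_on_compose[OF o open_UNIV _ f Ck_on_linear[OF open_UNIV l(1)]]
          Ck_on_compose[OF o open_UNIV _ g Ck_on_linear[OF open_UNIV l(2)]]]) auto
  qed
  then have "smooth_on (U \<inter> V) (\<lambda>x. (f' x, g' x))" using U V by (simp add: smooth_on_open open_Int)
  then show "\<exists>U h. open U \<and> x \<in> U \<and> smooth_on U h \<and> (\<forall>y\<in>S \<inter> U. h y = (f y, g y))"
    using U(1,2,4) V(1,2,4) by (intro exI[of _ "U \<inter> V"] exI[of _ "\<lambda>x. (f' x, g' x)"]) auto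
qed

lemma smooth_on_linear_compose:
  fixes f :: "'a::euclidean_space \<Rightarrow> 'b::euclidean_space" and L :: "'b \<Rightarrow> 'c::euclidean_space"
  assumes "smooth_on S f" "bounded_linear L"
  shows "smooth_on S (\<lambda>x. L (f x))"
  using assms smooth_on_compose[OF assms(1) smooth_on_linear[OF assms(2), of UNIV]] by auto

lemma smooth_on_bilinear_compose:
  fixes f :: "'a::euclidean_space \<Rightarrow> 'b::euclidean_space" and g :: "'a \<Rightarrow> 'c::euclidean_space"
    and h :: "'b \<Rightarrow> 'c \<Rightarrow> 'd::euclidean_space"
  assumes "smooth_on S f" "smooth_on S g" "bounded_bilinear h"
  shows "smooth_on S (\<lambda>x. h (f x) (g x))"
proof -
  have "smooth_on UNIV (\<lambda>p. h (fst p) (snd p))"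
    unfolding smooth_on_open[OF open_UNIV]
    by (intro allI Ck_on_bilinear[OF open_UNIV assms(3)] Ck_on_linear[OF open_UNIV]
      bounded_linear_fst bounded_linear_snd)
  from smooth_on_compose[OF smooth_on_Pair[OF assms(1,2)] this] show ?thesis by simp
qed

lemma smooth_on_add:
  fixes f :: "'a::euclidean_space \<Rightarrow> 'b::euclidean_space"
  assumes "smooth_on S f" "smooth_on S g"
  shows "smooth_on S (\<lambda>x. f x + g x)"
proof -
  have "bounded_linear (\<lambda>p::'b \<times> 'b. fst p + snd p)"
    by (intro bounded_linear_add bounded_linear_fst bounded_linear_snd)
  from smooth_on_linear_compose[OF smooth_on_Pair[OF assms] this] show ?thesis by simp
qed

lemma smooth_on_cmult:
  fixes f :: "'a::euclidean_space \<Rightarrow> complex"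
  assumes "smooth_on S f" shows "smooth_on S (\<lambda>x. c * f x)"
  using smooth_on_linear_compose[OF assms bounded_linear_mult_right[of c]] .

lemma smooth_on_diff:
  fixes f :: "'a::euclidean_space \<Rightarrow> 'b::euclidean_space"
  assumes "smooth_on S f" "smooth_on S g"
  shows "smooth_on S (\<lambda>x. f x - g x)"
  using smooth_on_add[OF assms(1) smooth_on_linear_compose[OF assms(2)
    bounded_linear_minus[OF bounded_linear_ident]]] by simp

lemma smooth_on_local:
  assumes "\<And>x. x \<in> S \<Longrightarrow> \<exists>U. openin (top_of_set S) U \<and> x \<in> U \<and> smooth_on U f"
  shows "smooth_on S f"
proof (rule smooth_onI)
  fix x assume "x \<in> S"
  then obtain U where U: "openin (top_of_set S) U" "x \<in> U" "smooth_on U f" using assms by blast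
  then obtain U' where U': "open U'" "U = S \<inter> U'" by (auto simp: openin_open)
  obtain V g where V: "open V" "x \<in> V" "smooth_on V g" "\<And>y. y \<in> U \<Longrightarrow> y \<in> V \<Longrightarrow> g y = f y"
    using smooth_onE[OF U(3,2)] by blast
  then show "\<exists>U g. open U \<and> x \<in> U \<and> smooth_on U g \<and> (\<forall>y\<in>S \<inter> U. g y = f y)"
    using U U' by (intro exI[of _ "U' \<inter> V"] exI[of _ g]) (auto intro: smooth_on_subset)
qed

section \<open>Functions of a real variable\<close>

lemma Ck_on_congI: "Ck_on k f S \<Longrightarrow> open S \<Longrightarrow> (\<And>x. x \<in> S \<Longrightarrow> f x = g x) \<Longrightarrow> Ck_on k g S"
  using Ck_on_cong[of S f g k] by simp

lemma Ck_on_Suc_real: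
  assumes "open S" "\<And>x. x \<in> S \<Longrightarrow> (f has_vector_derivative f' x) (at x)"
  shows "Ck_on (Suc k) f S \<longleftrightarrow> Ck_on k f' S"
proof -
  have 1: "Ck_on (Suc k) f S \<longleftrightarrow> (\<forall>v. Ck_on k (\<lambda>x. v *\<^sub>R f' x) S)"
    using assms by (intro Ck_on_Suc) (auto simp: has_vector_derivative_def)
  have "Ck_on k (\<lambda>x. v *\<^sub>R f' x) S" if "Ck_on k f' S" for v
    by (rule Ck_on_bilinear[OF assms(1) bounded_bilinear_scaleR Ck_on_const[OF assms(1)] that])
  moreover have "Ck_on k f' S" if "\<forall>v. Ck_on k (\<lambda>x. v *\<^sub>R f' x) S"
    using that[rule_format, of 1] by simp
  ultimately show ?thesis using 1 by blast
qed

lemma Ck_on_has_vector_derivative: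
  fixes f :: "real \<Rightarrow> 'b::real_normed_vector"
  assumes "Ck_on (Suc k) f S" "x \<in> S"
  shows "(f has_vector_derivative vector_derivative f (at x)) (at x)"
  using assms by (auto simp: vector_derivative_works[symmetric])

lemma Ck_on_Suc_iff:
  fixes f :: "real \<Rightarrow> 'b::real_normed_vector"
  assumes "open S"
  shows "Ck_on (Suc k) f S \<longleftrightarrow>
    (\<forall>x\<in>S. f differentiable at x) \<and> Ck_on k (\<lambda>x. vector_derivative f (at x)) S"
  using Ck_on_Suc_real[OF assms, of f "\<lambda>x. vector_derivative f (at x)" k]
    Ck_on_has_vector_derivative[of k f S] by (auto simp: vector_derivative_works)

lemma smooth_on_has_vector_derivative:
  fixes f :: "real \<Rightarrow> 'b::euclidean_space"
  assumes "open S" "smooth_on S f" "x \<in> S"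
  shows "(f has_vector_derivative vector_derivative f (at x)) (at x)"
  using assms Ck_on_has_vector_derivative[of 0 f S x] by (auto simp: smooth_on_open)

lemma smooth_on_vector_derivative:
  fixes f :: "real \<Rightarrow> 'b::euclidean_space"
  assumes "open S" "smooth_on S f"
  shows "smooth_on S (\<lambda>x. vector_derivative f (at x))"
  using assms Ck_on_Suc_iff[OF assms(1), of _ f] by (auto simp: smooth_on_open)

lemma smooth_on_antiderivative:
  fixes f :: "real \<Rightarrow> 'b::euclidean_space"
  assumes "open S" "\<And>x. x \<in> S \<Longrightarrow> (f has_vector_derivative f' x) (at x)" "smooth_on S f'"
  shows "smooth_on S f"
proof -
  have "Ck_on (Suc k) f S" for k
    using Ck_on_Suc_real[OF assms(1,2)] assms(1,3) by (simp add: smooth_on_open)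
  then have "Ck_on k f S" for k using Ck_on_SucD by blast
  then show ?thesis using assms(1) by (simp add: smooth_on_open)
qed

lemma smooth_on_exp: "smooth_on S (exp :: real \<Rightarrow> real)"
proof -
  have "Ck_on k (exp :: real \<Rightarrow> real) UNIV" for k
  proof (induction k)
    case (Suc k)
    have "(exp has_vector_derivative exp x) (at x)" for x :: real
      using DERIV_exp has_real_derivative_iff_has_vector_derivative by blast
    then show ?case using Ck_on_Suc_real[OF open_UNIV] Suc by blast
  qed (auto intro: continuous_intros)
  then show ?thesis by (auto simp: smooth_on_open intro: smooth_on_subset[of UNIV])
qed

lemma smooth_on_scaleR:
  fixes f :: "'a::euclidean_space \<Rightarrow> real" and g :: "'a \<Rightarrow> 'b::euclidean_space"
  assumes "smooth_on S f" "smooth_on S g"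
  shows "smooth_on S (\<lambda>x. f x *\<^sub>R g x)"
  using smooth_on_bilinear_compose[OF assms bounded_bilinear_scaleR] .

lemma smooth_on_mult:
  fixes f :: "'a::euclidean_space \<Rightarrow> real"
  assumes "smooth_on S f" "smooth_on S g"
  shows "smooth_on S (\<lambda>x. f x * g x)"
  using smooth_on_scaleR[OF assms] by simp

lemma smooth_on_power:
  fixes f :: "'a::euclidean_space \<Rightarrow> real"
  assumes "smooth_on S f"
  shows "smooth_on S (\<lambda>x. f x ^ n)"
  by (induction n) (auto intro: smooth_on_const smooth_on_mult assms)

lemma smooth_on_id: "smooth_on S (\<lambda>x::'a::euclidean_space. x)"
  by (rule smooth_on_linear) (rule bounded_linear_ident)

lemma smooth_on_inverse: "smooth_on (- {0}) (inverse :: real \<Rightarrow> real)"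
proof -
  have "Ck_on k (inverse :: real \<Rightarrow> real) (- {0})" for k
  proof (induction k)
    case 0 show ?case by (auto intro!: continuous_intros)
  next
    case (Suc k)
    have o: "open (- {0::real})" by auto
    have D: "(inverse has_vector_derivative (- 1) * (inverse x * inverse x)) (at x)"
      if "x \<in> - {0}" for x :: real
      using DERIV_inverse[of x UNIV] that
      by (auto simp: has_real_derivative_iff_has_vector_derivative[symmetric] power2_eq_square)
    have "Ck_on k (\<lambda>x::real. (- 1) * (inverse x * inverse x)) (- {0})"
      by (intro Ck_on_bilinear[OF o bounded_bilinear_mult] Ck_on_const o Suc)
    then show ?case using Ck_on_Suc_real[OF o D] by blast
  qed
  then show ?thesis by (simp add: smooth_on_open open_Compl)
qed

lemma smooth_on_inverse_compose:
  fixes f :: "'a::euclidean_space \<Rightarrow> real"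
  assumes "smooth_on S f" "\<And>x. x \<in> S \<Longrightarrow> f x \<noteq> 0"
  shows "smooth_on S (\<lambda>x. inverse (f x))"
  by (rule smooth_on_compose[OF assms(1) smooth_on_inverse]) (use assms(2) in auto)

subsection \<open>One-sided derivatives\<close>

definition hderiv :: "(real \<Rightarrow> 'b::real_normed_vector) \<Rightarrow> real \<Rightarrow> 'b" where
  "hderiv f x = vector_derivative f (at x within {0..})"

lemma half_line_limit_point: "x \<ge> (0::real) \<Longrightarrow> at x within {0..} \<noteq> bot"
proof
  assume "x \<ge> 0" "at x within {0..} = bot"
  then have "at_right x \<le> bot" using at_le[of "{x<..}" "{0..}" x] by (simp add: subset_iff)
  then show False using trivial_limit_at_right_real[of x] by (simp add: bot_unique)
qed

lemma smooth_on_half_extension: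
  fixes f :: "real \<Rightarrow> 'b::euclidean_space"
  assumes "smooth_on {0..} f" "x \<ge> 0"
  obtains U g where "open U" "x \<in> U" "smooth_on U g" "\<And>y. y \<in> U \<Longrightarrow> y \<ge> 0 \<Longrightarrow> g y = f y"
    "\<And>y. y \<in> U \<Longrightarrow> y \<ge> 0 \<Longrightarrow> (f has_vector_derivative hderiv f y) (at y within {0..})"
    "\<And>y. y \<in> U \<Longrightarrow> y \<ge> 0 \<Longrightarrow> hderiv f y = vector_derivative g (at y)"
proof -
  obtain U g where U: "open U" "x \<in> U" "smooth_on U g" "\<And>y. y \<in> {0..} \<Longrightarrow> y \<in> U \<Longrightarrow> g y = f y"
    using smooth_onE[OF assms(1), of x] assms(2) by auto
  have *: "(f has_vector_derivative vector_derivative g (at y)) (at y within {0..})"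
    if y: "y \<in> U" "y \<ge> 0" for y
  proof -
    have "(g has_vector_derivative vector_derivative g (at y)) (at y)"
      using smooth_on_has_vector_derivative U y by blast
    then have "(g has_vector_derivative vector_derivative g (at y)) (at y within {0..})"
      by (rule has_vector_derivative_at_within)
    then have g: "(g has_vector_derivative vector_derivative g (at y)) (at y within ({0..} \<inter> U))"
      by (rule has_vector_derivative_within_subset) auto
    have "(f has_vector_derivative vector_derivative g (at y)) (at y within ({0..} \<inter> U))"
      by (rule has_vector_derivative_transform[OF _ _ g]) (use y U in auto)
    then show ?thesis
      using at_within_nhd[of y U "{0..} \<inter> U" "{0..}"] U y by auto
  qed
  have **: "hderiv f y = vector_derivative g (at y)" if y: "y \<in> U" "y \<ge> 0" for y
    unfolding hderiv_def using vector_derivative_within[OF half_line_limit_point[OF y(2)] *[OF y]] .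
  show ?thesis
  proof (rule that[OF U(1-3)])
    show "g y = f y" if "y \<in> U" "y \<ge> 0" for y using U(4)[of y] that by simp
    show "(f has_vector_derivative hderiv f y) (at y within {0..})" if "y \<in> U" "y \<ge> 0" for y
      using *[OF that] **[OF that] by simp
  qed (rule **)
qed

lemma
  fixes f :: "real \<Rightarrow> 'b::euclidean_space"
  assumes "smooth_on {0..} f"
  shows hderiv_works: "x \<ge> 0 \<Longrightarrow> (f has_vector_derivative hderiv f x) (at x within {0..})"
    and smooth_on_hderiv: "smooth_on {0..} (hderiv f)"
proof -
  show "(f has_vector_derivative hderiv f x) (at x within {0..})" if x: "x \<ge> 0"
  proof -
    obtain U g where U: "open U" "x \<in> U" "smooth_on U g" "\<And>y. y \<in> U \<Longrightarrow> y \<ge> 0 \<Longrightarrow> g y = f y"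
      "\<And>y. y \<in> U \<Longrightarrow> y \<ge> 0 \<Longrightarrow> (f has_vector_derivative hderiv f y) (at y within {0..})"
      "\<And>y. y \<in> U \<Longrightarrow> y \<ge> 0 \<Longrightarrow> hderiv f y = vector_derivative g (at y)"
      using smooth_on_half_extension[OF assms x] by blast
    show ?thesis using U(5)[OF U(2) x] .
  qed
  show "smooth_on {0..} (hderiv f)"
  proof (rule smooth_onI)
    fix x :: real assume "x \<in> {0..}"
    then have x: "x \<ge> 0" by simp
    obtain U g where U: "open U" "x \<in> U" "smooth_on U g" "\<And>y. y \<in> U \<Longrightarrow> y \<ge> 0 \<Longrightarrow> g y = f y"
      "\<And>y. y \<in> U \<Longrightarrow> y \<ge> 0 \<Longrightarrow> (f has_vector_derivative hderiv f y) (at y within {0..})"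
      "\<And>y. y \<in> U \<Longrightarrow> y \<ge> 0 \<Longrightarrow> hderiv f y = vector_derivative g (at y)"
      using smooth_on_half_extension[OF assms x] by blast
    show "\<exists>U g. open U \<and> x \<in> U \<and> smooth_on U g \<and> (\<forall>y\<in>{0..} \<inter> U. g y = hderiv f y)"
      using smooth_on_vector_derivative[OF U(1,3)] U(1,2,6)
      by (intro exI[of _ U] exI[of _ "\<lambda>y. vector_derivative g (at y)"]) auto
  qed
qed

lemma hderiv_works_interior:
  fixes f :: "real \<Rightarrow> 'b::euclidean_space"
  assumes "smooth_on {0..} f" "x > 0"
  shows "(f has_vector_derivative hderiv f x) (at x)"
proof -
  have "at x within {0..} = at x"
    by (rule at_within_open_subset[of x "{0<..}"]) (use assms(2) in auto)
  then show ?thesis using hderiv_works[OF assms(1), of x] assms(2) by simp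
qed

lemma hderiv_unique:
  fixes f :: "real \<Rightarrow> 'b::real_normed_vector"
  assumes "(f has_vector_derivative d) (at x within {0..})" "x \<ge> 0"
  shows "hderiv f x = d"
  unfolding hderiv_def using half_line_limit_point assms by (intro vector_derivative_within) auto

lemma half_deriv_1: "half_deriv 1 f = hderiv f"
  by (simp add: hderiv_def fun_eq_iff)

subsection \<open>Extending functions by zero\<close>

text \<open>If a function vanishes on the negative half-line and is continuous, and its derivative on the
  positive half-line tends to 0, the mean value inequality makes it differentiable at 0.\<close>

lemma Ck_on_Suc_zero_extension:
  fixes f :: "real \<Rightarrow> 'b::euclidean_space"
  assumes "continuous_on UNIV f" "\<And>x. x \<le> 0 \<Longrightarrow> f x = 0" "\<And>x. x \<le> 0 \<Longrightarrow> g x = 0"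
    and D: "\<And>x. x > 0 \<Longrightarrow> (f has_vector_derivative g x) (at x)" and "Ck_on k g UNIV"
  shows "Ck_on (Suc k) f UNIV"
proof -
  have g: "isCont g 0" using Ck_on_continuous[OF assms(5)] by (simp add: continuous_on_eq_continuous_at)
  have D0: "(f has_vector_derivative 0) (at 0)"
    unfolding has_vector_derivative_def has_derivative_at_alt
  proof (intro conjI allI impI)
    fix e :: real assume "e > 0"
    then obtain d where d: "d > 0" "\<And>x. \<bar>x\<bar> < d \<Longrightarrow> norm (g x) < e"
      using g assms(3)[of 0] by (auto simp: continuous_at_eps_delta dist_norm)
    have "norm (f x) \<le> e * \<bar>x\<bar>" if "\<bar>x\<bar> < d" for x
    proof (cases "x > 0")
      case True
      have "norm (f x - f 0) \<le> e * x - e * 0"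
      proof (rule differentiable_bound_general[OF True])
        show "continuous_on {0..x} f" using assms(1) continuous_on_subset by blast
        show "(f has_vector_derivative g y) (at y)" if "0 < y" for y using D that .
        show "norm (g y) \<le> e" if "0 < y" "y < x" for y using d(2)[of y] that \<open>\<bar>x\<bar> < d\<close> by auto
        show "((*) e has_vector_derivative e) (at y)" for y
          by (auto simp: has_real_derivative_iff_has_vector_derivative[symmetric] intro!: derivative_eq_intros)
      qed (auto intro: continuous_intros)
      then show ?thesis using assms(2)[of 0] True by simp
    next
      case False
      then show ?thesis using assms(2)[of x] \<open>e > 0\<close> by (simp add: mult_nonneg_nonpos)
    qed
    then show "\<exists>d>0. \<forall>y. norm (y - 0) < d \<longrightarrow> norm (f y - f 0 - (y - 0) *\<^sub>R 0) \<le> e * norm (y - 0)"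
      using d(1) assms(2)[of 0] by auto
  qed auto
  have "(f has_vector_derivative g x) (at x)" for x
  proof -
    consider "x > 0" | "x = 0" | "x < 0" by linarith
    then show ?thesis
    proof cases
      case 3
      have "((\<lambda>_. 0) has_vector_derivative g x) (at x)" using 3 assms(3) by auto
      then show ?thesis
        by (rule has_vector_derivative_transform_within_open[where S = "{..<0}"]) (use 3 assms(2) in auto)
    qed (use D D0 assms(3) in auto)
  qed
  then show ?thesis using Ck_on_Suc_real[OF open_UNIV] assms(5) by blast
qed

lemma Ck_on_UNIV_half_line:
  fixes f :: "real \<Rightarrow> 'b::euclidean_space"
  assumes "\<And>x. x \<le> 0 \<Longrightarrow> f x = 0" "Ck_on k f {0<..}" "open U" "0 \<in> U" "Ck_on k f U"
  shows "Ck_on k f UNIV"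
proof (rule Ck_on_local)
  fix x :: real
  consider "x > 0" | "x = 0" | "x < 0" by linarith
  then show "\<exists>U. open U \<and> x \<in> U \<and> Ck_on k f U"
  proof cases
    case 3
    have "Ck_on k f {..<0}"
      using Ck_on_cong[of "{..<0}" f "\<lambda>_. 0" k] assms(1)
        Ck_on_const[of "{..<0::real}" k "0::'b"] by simp
    then show ?thesis using 3 by (intro exI[of _ "{..<0}"]) auto
  next
    case 1
    then show ?thesis using assms(2) by (intro exI[of _ "{0<..}"]) auto
  qed (use assms in auto)
qed

lemma Ck_on_zero_extension_scaleR:
  fixes f :: "real \<Rightarrow> 'b::euclidean_space"
  assumes "\<And>x. x \<le> 0 \<Longrightarrow> f x = 0" "Ck_on k f UNIV" "smooth_on {0..} c"
  shows "Ck_on k (\<lambda>x. c x *\<^sub>R f x) UNIV"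
proof -
  obtain U g where U: "open U" "0 \<in> U" "smooth_on U g" "\<And>y. y \<in> {0..} \<Longrightarrow> y \<in> U \<Longrightarrow> g y = c y"
    using smooth_onE[OF assms(3), of 0] by auto
  have f: "Ck_on k f V" for V using assms(2) by (rule Ck_on_subset) auto
  show ?thesis
  proof (rule Ck_on_UNIV_half_line[OF _ _ U(1,2)])
    have "smooth_on {0<..} c" using assms(3) by (rule smooth_on_subset) auto
    then have c: "Ck_on k c {0<..}" by (simp add: smooth_on_open)
    show "Ck_on k (\<lambda>x. c x *\<^sub>R f x) {0<..}"
      by (rule Ck_on_bilinear[OF open_greaterThan bounded_bilinear_scaleR c f])
    have "Ck_on k g U" using U by (simp add: smooth_on_open)
    then have "Ck_on k (\<lambda>x. g x *\<^sub>R f x) U"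
      by (intro Ck_on_bilinear[OF U(1) bounded_bilinear_scaleR] f)
    moreover have "g x *\<^sub>R f x = c x *\<^sub>R f x" if "x \<in> U" for x
      using that U(4)[of x] assms(1)[of x] by (cases "x \<ge> 0") auto
    ultimately show "Ck_on k (\<lambda>x. c x *\<^sub>R f x) U"
      using Ck_on_cong[OF U(1), of "\<lambda>x. g x *\<^sub>R f x" "\<lambda>x. c x *\<^sub>R f x"] by blast
  qed (use assms(1) in auto)
qed

lemma Ck_on_zero_extension_compose:
  fixes f :: "real \<Rightarrow> 'b::euclidean_space"
  assumes "\<And>x. x \<le> 0 \<Longrightarrow> f x = 0" "Ck_on k f UNIV" "smooth_on {0..} \<phi>" "\<phi> 0 = 0" "hderiv \<phi> 0 > 0"
  shows "Ck_on k (\<lambda>x. if x > 0 then f (\<phi> x) else 0) UNIV"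
proof -
  obtain U g where U: "open U" "0 \<in> U" "smooth_on U g" "\<And>y. y \<in> U \<Longrightarrow> y \<ge> 0 \<Longrightarrow> g y = \<phi> y"
      "\<And>y. y \<in> U \<Longrightarrow> y \<ge> 0 \<Longrightarrow> (\<phi> has_vector_derivative hderiv \<phi> y) (at y within {0..})"
      "\<And>y. y \<in> U \<Longrightarrow> y \<ge> 0 \<Longrightarrow> hderiv \<phi> y = vector_derivative g (at y)"
    using smooth_on_half_extension[OF assms(3) order_refl] by blast
  have "(g has_vector_derivative hderiv \<phi> 0) (at 0)"
    using smooth_on_has_vector_derivative[OF U(1,3,2)] U(6)[of 0] U(2) by simp
  then have "DERIV g 0 :> hderiv \<phi> 0"
    by (simp add: has_real_derivative_iff_has_vector_derivative)
  then obtain d where d: "d > 0" "\<And>h. h > 0 \<Longrightarrow> h < d \<Longrightarrow> g (0 - h) < g 0"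
    using assms(5) by (metis DERIV_pos_inc_left)
  have g0: "g 0 = 0" using U(2) U(4)[of 0] assms(4) by simp
  have neg: "g x < 0" if "x < 0" "x > - d" for x using d(2)[of "- x"] that g0 by simp
  define V where "V = U \<inter> {-d<..}"
  have V: "open V" "0 \<in> V" unfolding V_def using U d by auto
  show ?thesis
  proof (rule Ck_on_UNIV_half_line[OF _ _ V])
    have "smooth_on {0<..} \<phi>" using assms(3) by (rule smooth_on_subset) auto
    then have "Ck_on k \<phi> {0<..}" by (simp add: smooth_on_open)
    then have "Ck_on k (\<lambda>x. f (\<phi> x)) {0<..}"
      by (rule Ck_on_compose[OF open_greaterThan open_UNIV _ _ assms(2), rotated]) auto
    moreover have "Ck_on k (\<lambda>x. f (\<phi> x)) {0<..} \<longleftrightarrow>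
        Ck_on k (\<lambda>x. if x > 0 then f (\<phi> x) else 0) {0<..}"
      by (rule Ck_on_cong) auto
    ultimately show "Ck_on k (\<lambda>x. if x > 0 then f (\<phi> x) else 0) {0<..}" by blast
    have "smooth_on V g" using U(3) by (rule smooth_on_subset) (simp add: V_def)
    then have "Ck_on k g V" using V(1) by (simp add: smooth_on_open)
    then have "Ck_on k (\<lambda>x. f (g x)) V"
      by (rule Ck_on_compose[OF V(1) open_UNIV _ _ assms(2), rotated]) auto
    then show "Ck_on k (\<lambda>x. if x > 0 then f (\<phi> x) else 0) V"
    proof (rule Ck_on_congI[OF _ V(1)])
      fix x assume "x \<in> V"
      then show "f (g x) = (if x > 0 then f (\<phi> x) else 0)"
        using U(4)[of x] neg[of x] assms(1)[of "g x"] g0 assms(1)[of 0]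
        by (cases x "0::real" rule: linorder_cases) (auto simp: V_def)
    qed
  qed auto
qed

subsection \<open>A smooth bump\<close>

text \<open>The functions \<open>exp (- 1 / x) / x ^ n\<close> all tend to 0 at 0 from the right, and the derivative
  of one of them is a combination of two others.\<close>

definition bump_fn :: "nat \<Rightarrow> real \<Rightarrow> real" where
  "bump_fn n x = (if x > 0 then inverse x ^ n * exp (- inverse x) else 0)"

lemma bump_fn_continuous: "continuous_on UNIV (bump_fn n)"
proof -
  have "((\<lambda>x::real. inverse x ^ n * exp (- inverse x)) \<longlongrightarrow> 0) (at_right 0)"
  proof -
    have "((\<lambda>y::real. y ^ n / exp y) \<longlongrightarrow> 0) at_top" by (rule tendsto_power_div_exp_0)
    then have "((\<lambda>x::real. inverse x ^ n / exp (inverse x)) \<longlongrightarrow> 0) (at_right 0)"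
      by (rule filterlim_compose[OF _ filterlim_inverse_at_top_right])
    then show ?thesis by (simp add: exp_minus divide_inverse)
  qed
  then have "(bump_fn n \<longlongrightarrow> 0) (at_right 0)"
    by (rule Lim_transform_eventually) (auto simp: eventually_at_filter bump_fn_def)
  moreover have "(bump_fn n \<longlongrightarrow> 0) (at_left 0)"
    by (rule Lim_transform_eventually[OF tendsto_const]) (auto simp: eventually_at_filter bump_fn_def)
  ultimately have 0: "isCont (bump_fn n) 0"
    by (simp add: isCont_def filterlim_at_split bump_fn_def)
  have "isCont (bump_fn n) x" for x
  proof -
    consider "x > 0" | "x = 0" | "x < 0" by linarith
    then show ?thesis
    proof cases
      case 1
      have "continuous_on {0<..} (\<lambda>x::real. inverse x ^ n * exp (- inverse x))"
        by (auto intro!: continuous_intros)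
      then have "continuous_on {0<..} (bump_fn n)"
        by (rule continuous_on_eq) (simp add: bump_fn_def)
      then show ?thesis using 1 by (simp add: continuous_on_eq_continuous_at)
    next
      case 3
      have "continuous_on {..<0} (bump_fn n)"
        by (rule continuous_on_eq[of _ "\<lambda>_. 0"]) (auto simp: bump_fn_def)
      then show ?thesis using 3 by (simp add: continuous_on_eq_continuous_at)
    qed (use 0 in simp)
  qed
  then show ?thesis by (simp add: continuous_at_imp_continuous_on)
qed

lemma smooth_on_bump_fn: "smooth_on UNIV (bump_fn n)"
proof -
  have "Ck_on k (bump_fn n) UNIV" for k
  proof (induction k arbitrary: n)
    case 0 then show ?case using bump_fn_continuous by simp
  next
    case (Suc k)
    show ?case
    proof (rule Ck_on_Suc_zero_extension[OF bump_fn_continuous])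
      show "Ck_on k (\<lambda>x. bump_fn (Suc (Suc n)) x + (- real n) * bump_fn (Suc n) x) UNIV"
        by (intro Ck_on_add Ck_on_bilinear[OF open_UNIV bounded_bilinear_mult] Ck_on_const Suc open_UNIV)
      fix x :: real assume x: "x > 0"
      have *: "((\<lambda>x::real. inverse x ^ n * exp (- inverse x)) has_real_derivative
         bump_fn (Suc (Suc n)) x + (- real n) * bump_fn (Suc n) x) (at x)"
      proof (cases n)
        case 0
        then show ?thesis
          using x by (auto intro!: derivative_eq_intros simp: bump_fn_def power2_eq_square)
      next
        case (Suc m)
        show ?thesis
          unfolding Suc
          using x by (auto intro!: derivative_eq_intros simp: bump_fn_def power2_eq_square simp del: power_Suc)
            (simp add: algebra_simps)
      qed
      show "(bump_fn n has_vector_derivative bump_fn (Suc (Suc n)) x + (- real n) * bump_fn (Suc n) x) (at x)"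
        by (rule has_vector_derivative_transform_within_open[OF
            *[unfolded has_real_derivative_iff_has_vector_derivative], of "{0<..}"])
          (use x in \<open>auto simp: bump_fn_def\<close>)
    qed (auto simp: bump_fn_def)
  qed
  then show ?thesis by (simp add: smooth_on_open)
qed

definition bump :: "real \<Rightarrow> real \<Rightarrow> real \<Rightarrow> real" where
  "bump a b x = bump_fn 0 (x - a) * bump_fn 0 (b - x)"

lemma smooth_on_bump: "smooth_on UNIV (bump a b)"
proof -
  have 1: "smooth_on UNIV (\<lambda>x. bump_fn 0 (x - a))"
    by (rule smooth_on_compose[OF smooth_on_diff[OF smooth_on_id smooth_on_const] smooth_on_bump_fn]) simp
  have 2: "smooth_on UNIV (\<lambda>x. bump_fn 0 (b - x))"
    by (rule smooth_on_compose[OF smooth_on_diff[OF smooth_on_const smooth_on_id] smooth_on_bump_fn]) simp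
  show ?thesis unfolding bump_def[abs_def] by (rule smooth_on_mult[OF 1 2])
qed

lemma bump_pos_iff: "bump a b x > 0 \<longleftrightarrow> a < x \<and> x < b"
  and bump_nonneg: "bump a b x \<ge> 0"
  by (auto simp: bump_def bump_fn_def)

section \<open>Groups of bijections\<close>

lemma mult_BijGroup: "f \<in> Bij S \<Longrightarrow> g \<in> Bij S \<Longrightarrow> f \<otimes>\<^bsub>BijGroup S\<^esub> g = compose S f g"
  by (simp add: BijGroup_def)

lemma one_BijGroup: "\<one>\<^bsub>BijGroup S\<^esub> = (\<lambda>x\<in>S. x)"
  by (simp add: BijGroup_def)

lemma subgroup_BijGroupI:
  assumes "H \<subseteq> Bij S" "(\<lambda>x\<in>S. x) \<in> H"
    and "\<And>f g. f \<in> H \<Longrightarrow> g \<in> H \<Longrightarrow> compose S f g \<in> H"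
    and "\<And>f. f \<in> H \<Longrightarrow> restrict (inv_into S f) S \<in> H"
  shows "subgroup H (BijGroup S)"
proof
  show "H \<subseteq> carrier (BijGroup S)" using assms(1) by (simp add: BijGroup_def)
  show "\<one>\<^bsub>BijGroup S\<^esub> \<in> H" using assms(2) by (simp add: one_BijGroup)
  show "f \<otimes>\<^bsub>BijGroup S\<^esub> g \<in> H" if "f \<in> H" "g \<in> H" for f g
    using assms(3)[OF that] mult_BijGroup[OF subsetD[OF assms(1)] subsetD[OF assms(1)], OF that] by simp
  show "inv\<^bsub>BijGroup S\<^esub> f \<in> H" if "f \<in> H" for f
    using assms(4)[OF that] inv_BijGroup[OF subsetD[OF assms(1) that]] by simp
qed

lemma group_sub_BijGroup: "subgroup H (BijGroup S) \<Longrightarrow> group (BijGroup S\<lparr>carrier := H\<rparr>)"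
  using group.subgroup_imp_group[OF group_BijGroup] .

lemma Bij_I:
  assumes "f \<in> extensional S" "\<And>x. x \<in> S \<Longrightarrow> f x \<in> S" "\<And>x. x \<in> S \<Longrightarrow> g x \<in> S"
    "\<And>x. x \<in> S \<Longrightarrow> g (f x) = x" "\<And>x. x \<in> S \<Longrightarrow> f (g x) = x"
  shows "f \<in> Bij S" "\<And>x. x \<in> S \<Longrightarrow> inv_into S f x = g x"
proof -
  have bij: "bij_betw f S S"
    by (rule bij_betwI[where g = g]) (use assms in auto)
  then show "f \<in> Bij S" using assms(1) by (simp add: Bij_def)
  show "inv_into S f x = g x" if "x \<in> S" for x
    using inv_into_f_eq[OF bij_betw_imp_inj_on[OF bij], of "g x" x] assms that by auto
qed

lemma Bij_D:
  assumes "f \<in> Bij S" "x \<in> S"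
  shows "f x \<in> S" "inv_into S f x \<in> S" "inv_into S f (f x) = x" "f (inv_into S f x) = x"
proof -
  have "bij_betw f S S" using assms by (simp add: Bij_def)
  then show "f x \<in> S" "inv_into S f x \<in> S" "inv_into S f (f x) = x" "f (inv_into S f x) = x"
    using assms(2) by (auto simp: bij_betw_def f_inv_into_f inv_into_into)
qed

section \<open>Diffeomorphisms of the half-line\<close>

lemma Diff_half_iff: "f \<in> carrier Diff_half \<longleftrightarrow>
    f \<in> Bij {0..} \<and> smooth_on {0..} f \<and> smooth_on {0..} (inv_into {0..} f)"
  by (simp add: Diff_half_def)

lemma subgroup_Diff_half: "subgroup (carrier Diff_half) (BijGroup {0..})"
proof (rule subgroup_BijGroupI)
  show "carrier Diff_half \<subseteq> Bij {0..}" by (auto simp: Diff_half_iff)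
  let ?I = "\<lambda>x\<in>{0::real..}. x"
  have I: "?I \<in> Bij {0..}" "\<And>x. x \<in> {0..} \<Longrightarrow> inv_into {0..} ?I x = x"
    using Bij_I[of ?I "{0..}" "\<lambda>x. x"] by auto
  show "?I \<in> carrier Diff_half"
    unfolding Diff_half_iff using I
    by (auto intro: smooth_on_cong[OF smooth_on_id])
next
  fix f g assume "f \<in> carrier Diff_half" "g \<in> carrier Diff_half"
  then have f: "f \<in> Bij {0..}" "smooth_on {0..} f" "smooth_on {0..} (inv_into {0..} f)"
    and g: "g \<in> Bij {0..}" "smooth_on {0..} g" "smooth_on {0..} (inv_into {0..} g)"
    by (auto simp: Diff_half_iff)
  let ?h = "compose {0..} f g" and ?k = "\<lambda>x. inv_into {0..} g (inv_into {0..} f x)"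
  have h: "?h \<in> Bij {0..}" "\<And>x. x \<in> {0..} \<Longrightarrow> inv_into {0..} ?h x = ?k x"
    using Bij_I[of ?h "{0..}" ?k] Bij_D[OF f(1)] Bij_D[OF g(1)] by (auto simp: compose_eq)
  have "smooth_on {0..} (\<lambda>x. f (g x))"
    by (rule smooth_on_compose[OF g(2) f(2)]) (use Bij_D(1)[OF g(1)] in auto)
  then have 1: "smooth_on {0..} ?h" by (rule smooth_on_cong) (simp add: compose_eq)
  have "smooth_on {0..} ?k"
    by (rule smooth_on_compose[OF f(3) g(3)]) (use Bij_D(2)[OF f(1)] in auto)
  then have 2: "smooth_on {0..} (inv_into {0..} ?h)" by (rule smooth_on_cong) (simp add: h(2))
  show "?h \<in> carrier Diff_half" using h(1) 1 2 by (simp add: Diff_half_iff)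
next
  fix f assume "f \<in> carrier Diff_half"
  then have f: "f \<in> Bij {0..}" "smooth_on {0..} f" "smooth_on {0..} (inv_into {0..} f)"
    by (auto simp: Diff_half_iff)
  let ?h = "restrict (inv_into {0..} f) {0..}"
  have h: "?h \<in> Bij {0..}" "\<And>x. x \<in> {0..} \<Longrightarrow> inv_into {0..} ?h x = f x"
    using Bij_I[of ?h "{0..}" f] Bij_D[OF f(1)] by auto
  have 1: "smooth_on {0..} ?h" using f(3) by (rule smooth_on_cong) simp
  have 2: "smooth_on {0..} (inv_into {0..} ?h)" using f(2) by (rule smooth_on_cong) (simp add: h(2))
  show "?h \<in> carrier Diff_half" using h(1) 1 2 by (simp add: Diff_half_iff)
qed

lemma Diff_half_eq: "Diff_half = BijGroup {0..}\<lparr>carrier := carrier Diff_half\<rparr>"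
  by (simp add: Diff_half_def)

lemma group_Diff_half: "group Diff_half"
  using group_sub_BijGroup[OF subgroup_Diff_half] Diff_half_eq by simp

lemma mult_Diff_half:
  assumes "f \<in> carrier Diff_half" "g \<in> carrier Diff_half"
  shows "f \<otimes>\<^bsub>Diff_half\<^esub> g = compose {0..} f g"
proof -
  have "f \<otimes>\<^bsub>Diff_half\<^esub> g = f \<otimes>\<^bsub>BijGroup {0..}\<^esub> g" by (simp add: Diff_half_def)
  then show ?thesis using assms by (simp add: mult_BijGroup Diff_half_iff)
qed

lemma one_Diff_half: "\<one>\<^bsub>Diff_half\<^esub> = (\<lambda>x\<in>{0..}. x)"
  by (simp add: Diff_half_def one_BijGroup)

lemma inv_Diff_half:
  assumes "f \<in> carrier Diff_half"
  shows "inv\<^bsub>Diff_half\<^esub> f = restrict (inv_into {0..} f) {0..}"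
proof -
  have "inv\<^bsub>Diff_half\<^esub> f = inv\<^bsub>BijGroup {0..}\<^esub> f"
    using group.m_inv_consistent[OF group_BijGroup subgroup_Diff_half assms] Diff_half_eq by simp
  then show ?thesis using assms by (simp add: inv_BijGroup Diff_half_iff)
qed

context
  fixes f assumes f: "f \<in> carrier Diff_half"
begin

lemma Diff_half_nonneg: "x \<ge> 0 \<Longrightarrow> f x \<ge> 0"
  using f Bij_D(1)[of f "{0..}" x] by (auto simp: Diff_half_iff)

lemma Diff_half_smooth: "smooth_on {0..} f"
  using f by (simp add: Diff_half_iff)

lemma Diff_half_strict_mono: "0 \<le> x \<Longrightarrow> x < y \<Longrightarrow> f x < f y"
proof -
  have bij: "bij_betw f {0..} {0..}" using f by (auto simp: Diff_half_iff Bij_def)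
  have cont: "continuous_on {0..} f" using Diff_half_smooth by (rule smooth_on_continuous)
  have "strict_mono_on {0..} f \<or> strict_antimono_on {0..} f"
    using injective_eq_monotone_map[of "{0::real..}" f] cont bij by (auto simp: bij_betw_def is_interval_ci)
  moreover have "\<not> strict_antimono_on {0..} f"
  proof
    assume a: "strict_antimono_on {0..} f"
    have "f 0 \<ge> 0" using Diff_half_nonneg by simp
    then obtain y where y: "y \<in> {0..}" "f y = f 0 + 1"
      using bij by (auto simp: bij_betw_def image_iff dest!: equalityD2 dest: subsetD[where c = "f 0 + 1"])
    then have "y > 0" by (cases "y = 0") auto
    then have "f y < f 0" using a by (auto simp: monotone_on_def)
    then show False using y by simp
  qed
  ultimately show "0 \<le> x \<Longrightarrow> x < y \<Longrightarrow> f x < f y" by (auto simp: monotone_on_def)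
qed

lemma Diff_half_less_iff: "0 \<le> x \<Longrightarrow> 0 \<le> y \<Longrightarrow> f x < f y \<longleftrightarrow> x < y"
  using Diff_half_strict_mono by (metis less_asym linorder_neqE_linordered_idom)

lemma Diff_half_0: "f 0 = 0"
proof -
  have "inv_into {0..} f 0 \<ge> 0" "f (inv_into {0..} f 0) = 0"
    using Bij_D[of f "{0..}" 0] f by (auto simp: Diff_half_iff)
  then show ?thesis using Diff_half_strict_mono[of 0 "inv_into {0..} f 0"] Diff_half_nonneg[of 0]
    by (cases "inv_into {0..} f 0 = 0") auto
qed

lemma Diff_half_pos: "x > 0 \<Longrightarrow> f x > 0"
  using Diff_half_strict_mono[of 0 x] Diff_half_0 by simp

lemma Diff_half_hderiv_pos:
  assumes "x \<ge> 0"
  shows "hderiv f x > 0"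
proof -
  let ?g = "inv_into {0..} f"
  have g: "smooth_on {0..} ?g" using f by (simp add: Diff_half_iff)
  have D: "(f has_vector_derivative hderiv f x) (at x within {0..})"
    using hderiv_works Diff_half_smooth assms by blast
  have "(?g has_vector_derivative hderiv ?g (f x)) (at (f x) within f ` {0..})"
    using hderiv_works[OF g, of "f x"] Diff_half_nonneg assms
    by (auto intro: has_vector_derivative_within_subset)
  from vector_diff_chain_within[OF D this]
  have "(?g \<circ> f has_vector_derivative hderiv f x * hderiv ?g (f x)) (at x within {0..})" by simp
  moreover have "(?g \<circ> f has_vector_derivative 1) (at x within {0..})"
    by (rule has_vector_derivative_transform[OF _ _ has_vector_derivative_id])
      (use assms Bij_D(3)[of f "{0..}"] f in \<open>auto simp: Diff_half_iff\<close>)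
  ultimately have "hderiv f x * hderiv ?g (f x) = 1"
    using hderiv_unique[OF _ assms] by metis
  then have "hderiv f x \<noteq> 0" by auto
  moreover have "\<not> hderiv f x < 0"
  proof
    assume "hderiv f x < 0"
    then obtain d where d: "d > 0" "\<forall>h>0. x + h \<in> {0..} \<longrightarrow> h < d \<longrightarrow> f (x + h) < f x"
      using has_real_derivative_neg_dec_right[of f "hderiv f x" x "{0..}"] D
      by (auto simp: has_real_derivative_iff_has_vector_derivative)
    then have "f (x + d / 2) < f x" using assms by auto
    moreover have "f x < f (x + d / 2)" using Diff_half_strict_mono[of x "x + d / 2"] assms d by auto
    ultimately show False by simp
  qed
  ultimately show ?thesis by simp
qed

end

section \<open>Iterates of an expanding diffeomorphism\<close>

locale expanding_diffeo =
  fixes \<phi> :: "real \<Rightarrow> real"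
  assumes phi: "\<phi> \<in> carrier Diff_half" and expanding: "expanding \<phi>"
begin

interpretation D: group Diff_half by (rule group_Diff_half)

definition itr :: "int \<Rightarrow> real \<Rightarrow> real" where "itr n = \<phi> [^]\<^bsub>Diff_half\<^esub> n"

lemma itr_carrier: "itr n \<in> carrier Diff_half"
  unfolding itr_def using phi by simp

lemmas itr_nonneg = Diff_half_nonneg[OF itr_carrier]
  and itr_smooth = Diff_half_smooth[OF itr_carrier]
  and itr_less_iff = Diff_half_less_iff[OF itr_carrier]
  and itr_zero = Diff_half_0[OF itr_carrier]
  and itr_pos = Diff_half_pos[OF itr_carrier]

lemma itr_le_iff: "0 \<le> x \<Longrightarrow> 0 \<le> y \<Longrightarrow> itr n x \<le> itr n y \<longleftrightarrow> x \<le> y"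
  using itr_less_iff[of y x] by (simp flip: not_less)

lemma itr_0: "x \<ge> 0 \<Longrightarrow> itr 0 x = x"
  by (simp add: itr_def one_Diff_half)

lemma itr_1: "itr 1 = \<phi>"
  unfolding itr_def using phi by (simp add: D.int_pow_1)

lemma itr_add: "x \<ge> 0 \<Longrightarrow> itr (m + n) x = itr m (itr n x)"
proof -
  assume "x \<ge> 0"
  moreover have "itr (m + n) = compose {0..} (itr m) (itr n)"
    using D.int_pow_mult[OF phi, of m n] mult_Diff_half[OF itr_carrier itr_carrier, of m n]
    unfolding itr_def by simp
  ultimately show ?thesis by (simp add: compose_eq)
qed

lemma itr_phi: "x \<ge> 0 \<Longrightarrow> itr n (\<phi> x) = itr (n + 1) x"
  and phi_itr: "x \<ge> 0 \<Longrightarrow> \<phi> (itr n x) = itr (n + 1) x"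
  using itr_add[of x n 1] itr_add[of x 1 n] by (auto simp: itr_1 add.commute)

lemma itr_minus [simp]: "x \<ge> 0 \<Longrightarrow> itr (- n) (itr n x) = x" "x \<ge> 0 \<Longrightarrow> itr n (itr (- n) x) = x"
  using itr_add[of x "- n" n] itr_add[of x n "- n"] itr_0 by auto

lemma itr_less: "x > 0 \<Longrightarrow> m < n \<Longrightarrow> itr m x < itr n x"
proof -
  assume x: "x > 0" and "m < n"
  have "itr m x < itr (m + int (Suc k)) x" for k
  proof (induction k)
    case 0
    then show ?case
      using expanding phi_itr[of x m] itr_pos[OF x, of m] x by (auto simp: expanding_def)
  next
    case (Suc k)
    have "itr (m + int (Suc k)) x < itr (m + int (Suc (Suc k))) x"
      using expanding phi_itr[of x "m + int (Suc k)"] itr_pos[OF x, of "m + int (Suc k)"] x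
      by (auto simp: expanding_def ac_simps)
    then show ?case using Suc by simp
  qed
  moreover obtain k where "n = m + int (Suc k)"
    using \<open>m < n\<close> zless_iff_Suc_zadd by auto
  ultimately show ?thesis by simp
qed

lemma itr_less_index_iff: "x > 0 \<Longrightarrow> itr m x < itr n x \<longleftrightarrow> m < n"
  using itr_less by (metis less_asym linorder_neqE_linordered_idom)

lemma itr_eq_index_iff: "x > 0 \<Longrightarrow> itr m x = itr n x \<longleftrightarrow> m = n"
  using itr_less_index_iff by (metis less_irrefl linorder_neqE_linordered_idom)

lemma itr_unbounded:
  assumes "x > 0"
  shows "\<exists>n::nat. y < itr (int n) x"
proof (rule ccontr)
  assume "\<not> ?thesis"
  then have y: "itr (int n) x \<le> y" for n :: nat by (auto simp: not_less)
  have inc: "incseq (\<lambda>n. itr (int n) x)"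
    using itr_less[OF assms] by (intro incseq_SucI) (simp add: less_imp_le)
  then obtain L where L: "(\<lambda>n. itr (int n) x) \<longlonglongrightarrow> L" "\<And>n. itr (int n) x \<le> L"
    using incseq_convergent[OF inc] y by metis
  have "L > 0" using L(2)[of 0] assms itr_0[of x] by simp
  have "continuous_on {0<..} \<phi>"
    using smooth_on_continuous[OF Diff_half_smooth[OF phi]] by (rule continuous_on_subset) auto
  then have "isCont \<phi> L" using \<open>L > 0\<close> by (simp add: continuous_on_eq_continuous_at)
  then have "(\<lambda>n. \<phi> (itr (int n) x)) \<longlonglongrightarrow> \<phi> L" using L(1) by (rule isCont_tendsto_compose)
  then have "(\<lambda>n. itr (int (Suc n)) x) \<longlonglongrightarrow> \<phi> L"
    using phi_itr[of x] assms by (simp add: add.commute)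
  then have "\<phi> L = L" using LIMSEQ_Suc[OF L(1)] LIMSEQ_unique by blast
  then show False using expanding \<open>L > 0\<close> by (auto simp: expanding_def)
qed

lemma itr_small:
  assumes "x > 0" "y > 0"
  shows "\<exists>n::nat. itr (- int n) x < y"
proof -
  obtain n :: nat where "x < itr (int n) y" using itr_unbounded[OF assms(2)] by blast
  then have "itr (- int n) x < itr (- int n) (itr (int n) y)"
    using assms itr_nonneg[of y] by (simp add: itr_less_iff del: itr_minus)
  then show ?thesis using assms by auto
qed

lemma itr_tendsto_0: "x > 0 \<Longrightarrow> (\<lambda>n. itr (- int n) x) \<longlonglongrightarrow> 0"
proof (rule LIMSEQ_I)
  fix e :: real assume x: "x > 0" and "e > 0"
  then obtain N :: nat where N: "itr (- int N) x < e" using itr_small[OF x] by blast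
  have "norm (itr (- int n) x - 0) < e" if "n \<ge> N" for n
    using itr_pos[OF x, of "- int n"] itr_less[OF x, of "- int n" "- int N"] that N
    by (cases "n = N") auto
  then show "\<exists>N. \<forall>n\<ge>N. norm (itr (- int n) x - 0) < e" by blast
qed

text \<open>The interval \<open>[c, \<phi> c)\<close> is a fundamental domain.\<close>

lemma itr_index_ex:
  assumes "x > 0" "c > 0"
  shows "\<exists>n. itr n c \<le> x \<and> x < itr (n + 1) c"
proof -
  obtain m :: nat where m: "itr (- int m) c < x" using itr_small[OF assms(2,1)] by blast
  obtain k :: nat where k: "x < itr (int k) c" using itr_unbounded[OF assms(2)] by blast
  define P where "P = (\<lambda>j::nat. x < itr (- int m + int j) c)"
  have P: "P (k + m)" using k by (simp add: P_def)
  define j where "j = (LEAST j. P j)"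
  have j: "P j" "\<And>i. i < j \<Longrightarrow> \<not> P i" unfolding j_def using P by (auto intro: LeastI dest: not_less_Least)
  have "\<not> P 0" using m by (simp add: P_def)
  then obtain i where i: "j = Suc i" using j by (cases j) auto
  have "\<not> P i" using j i by simp
  then show ?thesis using j(1) i
    by (intro exI[of _ "- int m + int i"]) (auto simp: P_def algebra_simps)
qed

lemma itr_index_unique:
  assumes "c > 0" "itr n c \<le> x" "x < itr (n + 1) c" "itr m c \<le> x" "x < itr (m + 1) c"
  shows "m = n"
proof -
  have "itr m c < itr (n + 1) c" "itr n c < itr (m + 1) c" using assms by auto
  then show ?thesis using itr_less_index_iff[OF assms(1)] by auto
qed

definition index :: "real \<Rightarrow> real \<Rightarrow> int" where
  "index c x = (THE n. itr n c \<le> x \<and> x < itr (n + 1) c)"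

lemma index_eqI: "c > 0 \<Longrightarrow> itr n c \<le> x \<Longrightarrow> x < itr (n + 1) c \<Longrightarrow> index c x = n"
  unfolding index_def using itr_index_unique by (intro the_equality) auto

lemma index_works: "x > 0 \<Longrightarrow> c > 0 \<Longrightarrow> itr (index c x) c \<le> x \<and> x < itr (index c x + 1) c"
  using itr_index_ex[of x c] index_eqI by blast

lemma commuting_itr:
  assumes "g \<in> carrier Diff_half" "\<And>x. x \<ge> 0 \<Longrightarrow> g (\<phi> x) = \<phi> (g x)" "x \<ge> 0"
  shows "g (itr n x) = itr n (g x)"
proof -
  have pos: "g (itr (int k) x) = itr (int k) (g x)" if "x \<ge> 0" for k x
  proof (induction k)
    case 0 then show ?case using that Diff_half_nonneg[OF assms(1)] by (simp add: itr_0)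
  next
    case (Suc k)
    then show ?case
      using assms(2)[of "itr (int k) x"] itr_nonneg[OF that] phi_itr[OF that, of "int k"]
        phi_itr[of "g x" "int k"] Diff_half_nonneg[OF assms(1) that]
      by (simp add: add.commute)
  qed
  show ?thesis
  proof (cases n)
    case (nonneg k) then show ?thesis using pos assms by simp
  next
    case (neg k)
    let ?y = "itr n x"
    have n: "int (Suc k) = - n" using neg by simp
    have "g (itr (- n) ?y) = itr (- n) (g ?y)"
      using pos[of ?y "Suc k", unfolded n] itr_nonneg[OF assms(3), of n] by simp
    then have "itr n (g x) = itr n (itr (- n) (g ?y))" using assms(3) by simp
    then show ?thesis
      using Diff_half_nonneg[OF assms(1)] itr_nonneg[OF assms(3)] by simp
  qed
qed

lemma equivariant_itr:
  fixes b :: "real \<Rightarrow> 'b::field"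
  assumes "\<And>x. x \<in> X \<Longrightarrow> b (\<phi> x) = c * b x" "c \<noteq> 0" "X = {0..} \<or> X = {0<..}" "x \<in> X"
  shows "b (itr n x) = c powi n * b x"
proof -
  have X: "itr n x \<in> X" if "x \<in> X" for n x
    using assms(3) that itr_nonneg itr_pos by auto
  have X0: "x \<ge> 0" if "x \<in> X" for x using assms(3) that by auto
  have pos: "b (itr (int k) x) = c ^ k * b x" if "x \<in> X" for k x
  proof (induction k)
    case 0 then show ?case using X0[OF that] by (simp add: itr_0)
  next
    case (Suc k)
    then show ?case
      using assms(1)[OF X[OF that, of "int k"]] phi_itr[OF X0[OF that], of "int k"]
      by (simp add: add.commute)
  qed
  show ?thesis
  proof (cases n)
    case (nonneg k) then show ?thesis using pos assms by simp
  next
    case (neg k)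
    let ?y = "itr n x"
    have n: "int (Suc k) = - n" using neg by simp
    have "b x = c ^ Suc k * b ?y"
      using pos[OF X[OF assms(4), of n], of "Suc k", unfolded n]
        itr_minus(1)[OF X0[OF assms(4)], of n] by (simp only:)
    moreover have "c powi n = inverse (c ^ Suc k)"
      using neg by (simp only: power_int_minus) (metis n neg power_int_minus power_int_of_nat)
    ultimately show ?thesis using assms(2) by (simp add: field_simps)
  qed
qed

end

context expanding_diffeo
begin

section \<open>Twisted equations near the fixed point\<close>

text \<open>Away from 0, \<open>f\<close> is controlled by its values on one fundamental domain; each backward step
  multiplies it by a factor of norm less than 1 up to the small error \<open>e\<close>.\<close>

lemma twisted_continuous:
  fixes f e :: "real \<Rightarrow> complex" and a :: "real \<Rightarrow> real"
  assumes "continuous_on {0<..} f" and f0: "\<And>x. x \<le> 0 \<Longrightarrow> f x = 0"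
    and eq: "\<And>x. x > 0 \<Longrightarrow> lam * f x = a x *\<^sub>R f (\<phi> x) + e x"
    and "continuous_on {0..} a" "\<bar>a 0\<bar> < norm lam" "continuous_on UNIV e" "e 0 = 0"
  shows "continuous_on UNIV f"
proof -
  let ?L = "norm lam"
  have L: "?L > 0" using assms(5) by (meson abs_ge_zero le_less_trans)
  obtain \<theta> where \<theta>: "\<bar>a 0\<bar> / ?L < \<theta>" "\<theta> < 1"
    using dense[of "\<bar>a 0\<bar> / ?L" 1] assms(5) L by auto
  have \<theta>0: "\<theta> \<ge> 0" using \<theta>(1) L by (meson abs_ge_zero divide_nonneg_pos less_imp_le order_trans)
  have a0: "\<bar>a 0\<bar> < \<theta> * ?L" using \<theta>(1) L by (simp add: field_simps)
  have small: "\<exists>d>0. \<forall>x. 0 < x \<and> x < d \<longrightarrow> norm (f x) < t" if t: "t > 0" for t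
  proof -
    define \<eta> where "\<eta> = t * (1 - \<theta>) / 4"
    have \<eta>: "\<eta> > 0" using t \<theta> by (simp add: \<eta>_def)
    obtain d1 where d1: "d1 > 0" "\<And>x. 0 \<le> x \<Longrightarrow> x < d1 \<Longrightarrow> \<bar>a x\<bar> < \<theta> * ?L"
    proof -
      obtain d where "d > 0" "\<And>x. x \<in> {0..} \<Longrightarrow> dist x 0 < d \<Longrightarrow> dist (a x) (a 0) < \<theta> * ?L - \<bar>a 0\<bar>"
        using assms(4) a0 by (auto simp: continuous_on_iff dest: bspec[of _ _ 0] dest!: spec[of _ "\<theta> * ?L - \<bar>a 0\<bar>"])
      then show ?thesis by (intro that[of d]) (force simp: dist_real_def)+
    qed
    obtain d2 where d2: "d2 > 0" "\<And>x. 0 \<le> x \<Longrightarrow> x < d2 \<Longrightarrow> norm (e x) < \<eta> * ?L"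
    proof -
      have "\<eta> * ?L > 0" using \<eta> L by simp
      then obtain d where "d > 0" "\<And>x. dist x 0 < d \<Longrightarrow> dist (e x) (e 0) < \<eta> * ?L"
        using assms(6) unfolding continuous_on_iff by blast
      then show ?thesis using assms(7) by (intro that[of d]) (auto simp: dist_real_def)
    qed
    define \<delta> where "\<delta> = min d1 d2 / 2"
    have \<delta>: "\<delta> > 0" "\<delta> < d1" "\<delta> < d2" using d1(1) d2(1) by (auto simp: \<delta>_def)
    have step: "norm (f x) \<le> \<theta> * norm (f (\<phi> x)) + \<eta>" if x: "0 < x" "x \<le> \<delta>" for x
    proof -
      have "?L * norm (f x) \<le> \<bar>a x\<bar> * norm (f (\<phi> x)) + norm (e x)"
        using eq[OF x(1)] by (metis norm_mult norm_scaleR norm_triangle_ineq)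
      also have "\<dots> \<le> \<theta> * ?L * norm (f (\<phi> x)) + \<eta> * ?L"
        using d1(2)[of x] d2(2)[of x] x \<delta> by (intro add_mono mult_right_mono) auto
      also have "\<dots> = ?L * (\<theta> * norm (f (\<phi> x)) + \<eta>)" by (simp add: algebra_simps)
      finally show ?thesis using L by simp
    qed
    have "continuous_on {\<delta>..\<phi> \<delta>} f"
      using assms(1) by (rule continuous_on_subset) (use \<delta> in auto)
    then have "bounded (f ` {\<delta>..\<phi> \<delta>})" by (intro compact_imp_bounded compact_continuous_image) auto
    then obtain M where M: "M > 0" "\<And>x. x \<in> {\<delta>..\<phi> \<delta>} \<Longrightarrow> norm (f x) \<le> M"
      by (auto simp: bounded_pos)
    define R where "R = \<eta> / (1 - \<theta>)"
    have R: "\<theta> * R + \<eta> = R" "R = t / 4" "R > 0" using \<theta> \<eta> t by (auto simp: R_def \<eta>_def field_simps)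
    have bound: "norm (f x) \<le> \<theta> ^ n * M + R" if "itr (- int n) \<delta> \<le> x" "x \<le> itr (- int n) (\<phi> \<delta>)" for n x
      using that
    proof (induction n arbitrary: x)
      case 0
      then show ?case using M(2)[of x] \<delta> R Diff_half_nonneg[OF phi, of \<delta>] by (simp add: itr_0)
    next
      case (Suc n)
      have x: "x > 0" using Suc.prems(1) itr_pos[of \<delta> "- int (Suc n)"] \<delta> by linarith
      have i: "itr (- int (Suc n)) (\<phi> y) = itr (- int n) y" "\<phi> (itr (- int (Suc n)) y) = itr (- int n) y"
        if "y \<ge> 0" for y
        using itr_phi[OF that, of "- int (Suc n)"] phi_itr[OF that, of "- int (Suc n)"] by auto
      have le: "\<phi> u \<le> \<phi> v \<longleftrightarrow> u \<le> v" if "0 \<le> u" "0 \<le> v" for u v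
        using itr_le_iff[of u v 1] that by (simp add: itr_1)
      have p: "\<phi> \<delta> \<ge> 0" "itr (- int (Suc n)) \<delta> \<ge> 0" "itr (- int (Suc n)) (\<phi> \<delta>) \<ge> 0"
        using Diff_half_nonneg[OF phi] itr_nonneg \<delta> by auto
      have "x \<le> itr (- int n) \<delta>" using Suc.prems(2) i(1)[of \<delta>] \<delta> by simp
      also have "\<dots> \<le> \<delta>" using itr_less[of \<delta> "- int n" 0] \<delta> by (cases n) (auto simp: itr_0)
      finally have "x \<le> \<delta>" .
      moreover have "norm (f (\<phi> x)) \<le> \<theta> ^ n * M + R"
        using Suc.prems i(2)[of \<delta>] i(2)[of "\<phi> \<delta>"] le[of "itr (- int (Suc n)) \<delta>" x]
          le[of x "itr (- int (Suc n)) (\<phi> \<delta>)"] p x \<delta>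
        by (intro Suc.IH) auto
      ultimately have "norm (f x) \<le> \<theta> * (\<theta> ^ n * M + R) + \<eta>"
        using step[OF x] mult_left_mono[OF _ \<theta>0] by (meson add_right_mono order_trans)
      then show ?case using R(1) by (simp add: algebra_simps)
    qed
    obtain N where N: "\<theta> ^ N < t / 2 / M"
      using real_arch_pow_inv[of "t / 2 / M" \<theta>] t M \<theta> by auto
    show ?thesis
    proof (intro exI[of _ "itr (- int N) \<delta>"] conjI allI impI)
      show "itr (- int N) \<delta> > 0" using itr_pos \<delta> by auto
      fix x assume x: "0 < x \<and> x < itr (- int N) \<delta>"
      define m where "m = index \<delta> x"
      have m: "itr m \<delta> \<le> x" "x < itr (m + 1) \<delta>" using index_works[of x \<delta>] x \<delta> by (auto simp: m_def)
      then have "itr m \<delta> < itr (- int N) \<delta>" using x by linarith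
      then have "m < - int N" using itr_less_index_iff \<delta> by blast
      define n where "n = nat (- m)"
      have n: "m = - int n" "N < n" using \<open>m < - int N\<close> by (auto simp: n_def)
      have "norm (f x) \<le> \<theta> ^ n * M + R"
        using m n itr_phi[of \<delta> m] \<delta> by (intro bound) auto
      also have "\<dots> \<le> \<theta> ^ N * M + R"
        using \<theta> \<theta>0 n M by (intro add_right_mono mult_right_mono power_decreasing) auto
      also have "\<dots> < t" using N M R t by (simp add: field_simps)
      finally show "norm (f x) < t" .
    qed
  qed
  have "isCont f 0"
    unfolding continuous_at_eps_delta
  proof (intro allI impI)
    fix t :: real assume t: "t > 0"
    then obtain d where d: "d > 0" "\<And>x. 0 < x \<Longrightarrow> x < d \<Longrightarrow> norm (f x) < t" using small[OF t] by blast
    have "dist (f x) (f 0) < t" if "dist x 0 < d" for x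
      using d(2)[of x] f0[of x] f0[of 0] that t by (cases "x > 0") (auto simp: dist_real_def)
    then show "\<exists>d>0. \<forall>x'. dist x' 0 < d \<longrightarrow> dist (f x') (f 0) < t" using d(1) by blast
  qed
  moreover have "isCont f x" if "x > 0" for x
    using assms(1) that by (simp add: continuous_on_eq_continuous_at)
  moreover have "isCont f x" if "x < 0" for x
  proof -
    have "continuous_on {..<0} f"
      by (rule continuous_on_eq[of _ "\<lambda>_. 0"]) (auto simp: f0)
    then show ?thesis using that by (simp add: continuous_on_eq_continuous_at)
  qed
  ultimately have "isCont f x" for x by (cases x "0::real" rule: linorder_cases) auto
  then show ?thesis by (simp add: continuous_at_imp_continuous_on)
qed

text \<open>If \<open>\<phi>\<close> has derivative 1 at 0, differentiating the equation reproduces an equation of the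
  same kind for the derivative, with the same value of \<open>a\<close> at 0: so all derivatives tend to 0.\<close>

lemma twisted_Ck:
  fixes f e :: "real \<Rightarrow> complex" and a :: "real \<Rightarrow> real"
  assumes tangent: "hderiv \<phi> 0 = 1"
    and "smooth_on {0<..} f" "\<And>x. x \<le> 0 \<Longrightarrow> f x = 0"
    and "\<And>x. x > 0 \<Longrightarrow> lam * f x = a x *\<^sub>R f (\<phi> x) + e x"
    and "smooth_on {0..} a" "\<bar>a 0\<bar> < norm lam" "Ck_on k e UNIV" "\<And>x. x \<le> 0 \<Longrightarrow> e x = 0"
  shows "Ck_on k f UNIV"
  using assms(2-)
proof (induction k arbitrary: f a e)
  case 0
  show ?case
    unfolding Ck_on.simps
    by (rule twisted_continuous[of f lam a e]) (use 0 in \<open>simp_all add: smooth_on_continuous\<close>)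
next
  case (Suc k)
  have e_k: "Ck_on k e UNIV" using Ck_on_SucD[OF Suc.prems(6)] .
  have f_k: "Ck_on k f UNIV"
    by (rule Suc.IH[of f a e]) (use Suc.prems e_k in auto)
  define g where "g x = (if x > 0 then vector_derivative f (at x) else 0)" for x
  define e' where "e' x = vector_derivative e (at x)" for x
  have e': "(e has_vector_derivative e' x) (at x)" for x
    unfolding e'_def using Ck_on_has_vector_derivative[OF Suc.prems(6)] by auto
  have e'_k: "Ck_on k e' UNIV"
    using Suc.prems(6) e' Ck_on_Suc_real[OF open_UNIV, of e e' k] by blast
  have e'_neg: "e' x = 0" if "x \<le> 0" for x
  proof (rule continuous_constant_on_closure[where f = e' and S = "{..<0}" and x = x and a = 0])
    show "continuous_on (closure {..<0}) e'"
      using Ck_on_continuous[OF e'_k] continuous_on_subset by blast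
    show "x \<in> closure {..<0}" using that by simp
    fix y :: real assume y: "y \<in> {..<0}"
    have "((\<lambda>_. 0) has_vector_derivative e' y) (at y)"
      by (rule has_vector_derivative_transform_within_open[OF e', of "{..<0}"]) (use y Suc.prems(7) in auto)
    then show "e' y = 0" using vector_derivative_unique_at[OF _ has_vector_derivative_const] by blast
  qed
  have g: "(f has_vector_derivative g x) (at x)" if "x > 0" for x
    unfolding g_def using smooth_on_has_vector_derivative[OF open_greaterThan Suc.prems(1)] that by auto
  define fp where "fp x = (if x > 0 then f (\<phi> x) else 0)" for x
  define e1 where "e1 x = hderiv a x *\<^sub>R fp x + e' x" for x
  have fp: "Ck_on k fp UNIV"
    unfolding fp_def using Suc.prems(2) f_k tangent Diff_half_smooth[OF phi] Diff_half_0[OF phi]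
    by (intro Ck_on_zero_extension_compose) auto
  have e1_k: "Ck_on k e1 UNIV"
    unfolding e1_def
    by (rule Ck_on_add[OF open_UNIV Ck_on_zero_extension_scaleR[OF _ fp smooth_on_hderiv[OF Suc.prems(4)]] e'_k])
      (simp add: fp_def)
  have eq1: "lam * g x = (a x * hderiv \<phi> x) *\<^sub>R g (\<phi> x) + e1 x" if x: "x > 0" for x
  proof -
    have px: "\<phi> x > 0" using Diff_half_pos[OF phi x] .
    have 1: "((\<lambda>y. lam * f y) has_vector_derivative lam * g x) (at x)"
      using bounded_linear.has_vector_derivative[OF bounded_linear_mult_right g[OF x]] .
    have 2: "((\<lambda>y. f (\<phi> y)) has_vector_derivative hderiv \<phi> x *\<^sub>R g (\<phi> x)) (at x)"
      using vector_diff_chain_at[OF hderiv_works_interior[OF Diff_half_smooth[OF phi] x] g[OF px]]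
      by (simp add: o_def)
    have 3: "(a has_real_derivative hderiv a x) (at x)"
      using hderiv_works_interior[OF Suc.prems(4) x] by (simp add: has_real_derivative_iff_has_vector_derivative)
    have 4: "((\<lambda>y. a y *\<^sub>R f (\<phi> y) + e y) has_vector_derivative
        (a x *\<^sub>R (hderiv \<phi> x *\<^sub>R g (\<phi> x)) + hderiv a x *\<^sub>R f (\<phi> x)) + e' x) (at x)"
      by (intro has_vector_derivative_add has_vector_derivative_scaleR 2 3 e')
    have "((\<lambda>y. lam * f y) has_vector_derivative
        (a x *\<^sub>R (hderiv \<phi> x *\<^sub>R g (\<phi> x)) + hderiv a x *\<^sub>R f (\<phi> x)) + e' x) (at x)"
      by (rule has_vector_derivative_transform_within_open[OF 4, of "{0<..}"]) (use x Suc.prems(3) in auto)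
    then show ?thesis
      using vector_derivative_unique_at[OF 1] x by (simp add: e1_def fp_def)
  qed
  have g_smooth: "smooth_on {0<..} g"
    by (rule smooth_on_cong[OF smooth_on_vector_derivative[OF open_greaterThan Suc.prems(1)]])
      (simp add: g_def)
  have "Ck_on k g UNIV"
  proof (rule Suc.IH[of g "\<lambda>x. a x * hderiv \<phi> x" e1])
    show "smooth_on {0..} (\<lambda>x. a x * hderiv \<phi> x)"
      by (intro smooth_on_mult Suc.prems(4) smooth_on_hderiv Diff_half_smooth phi)
    show "e1 x = 0" if "x \<le> 0" for x using that e'_neg by (simp add: e1_def fp_def)
    show "g x = 0" if "x \<le> 0" for x using that by (simp add: g_def)
  qed (use g_smooth eq1 e1_k tangent Suc.prems(5) in auto)
  then show ?case
    using Suc.prems(2) g Ck_on_continuous[OF f_k]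
    by (intro Ck_on_Suc_zero_extension[of f g]) (auto simp: g_def)
qed

section \<open>The function spaces\<close>

lemma K_space_zero:
  assumes "b \<in> K_space lam \<phi>" "norm lam > 1" "x \<le> 0"
  shows "b x = 0"
proof (cases "x = 0")
  case True
  have "b (\<phi> 0) = lam * b 0" using assms(1) unfolding K_space_def by blast
  then have "b 0 = lam * b 0" using Diff_half_0[OF phi] by simp
  then show ?thesis using True assms(2) by auto
qed (use assms in \<open>auto simp: K_space_def\<close>)

lemma K_subset_Z:
  assumes "norm lam > 1"
  shows "K_space lam \<phi> \<subseteq> Z_space lam \<phi>"
proof
  fix b assume b: "b \<in> K_space lam \<phi>"
  then have "smooth_on {0..} b" "\<forall>x\<ge>0. b (\<phi> x) = lam * b x" by (auto simp: K_space_def)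
  moreover from this(1) have "smooth_on {0<..} b" by (rule smooth_on_subset) auto
  ultimately show "b \<in> Z_space lam \<phi>"
    using K_space_zero[OF b assms] by (simp add: Z_space_def)
qed

text \<open>The defining equation is a twisted equation with \<open>a = 1\<close> and \<open>e = 0\<close>.\<close>

lemma K_eq_Z:
  assumes "norm lam > 1" "hderiv \<phi> 0 = 1"
  shows "K_space lam \<phi> = Z_space lam \<phi>"
proof (intro subset_antisym K_subset_Z assms subsetI)
  fix b assume b: "b \<in> Z_space lam \<phi>"
  have "Ck_on k b UNIV" for k
    by (rule twisted_Ck[OF assms(2), where f = b and a = "\<lambda>_. 1" and e = "\<lambda>_. 0" and lam = lam])
      (use b assms in \<open>simp_all add: Z_space_def smooth_on_const Ck_on_const\<close>)
  then have "smooth_on UNIV b" by (simp add: smooth_on_open)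
  then have "smooth_on {0..} b" by (rule smooth_on_subset) simp
  then show "b \<in> K_space lam \<phi>"
    using b Diff_half_0[OF phi] by (auto simp: K_space_def Z_space_def le_less)
qed

lemma subspace_K: "cfun.subspace (K_space lam \<phi>)"
proof (rule cfun.subspaceI)
  show "0 \<in> K_space lam \<phi>" by (simp add: K_space_def zero_fun_def smooth_on_const)
  show "u + v \<in> K_space lam \<phi>" if "u \<in> K_space lam \<phi>" "v \<in> K_space lam \<phi>" for u v
    using that smooth_on_add by (auto simp: K_space_def plus_fun_def algebra_simps)
  show "cscale c u \<in> K_space lam \<phi>" if "u \<in> K_space lam \<phi>" for c u
    using that smooth_on_cmult by (auto simp: K_space_def cscale_def)
qed

lemma subspace_Z: "cfun.subspace (Z_space lam \<phi>)"
proof (rule cfun.subspaceI)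
  show "0 \<in> Z_space lam \<phi>" by (simp add: Z_space_def zero_fun_def smooth_on_const)
  show "u + v \<in> Z_space lam \<phi>" if "u \<in> Z_space lam \<phi>" "v \<in> Z_space lam \<phi>" for u v
    using that smooth_on_add by (auto simp: Z_space_def plus_fun_def algebra_simps)
  show "cscale c u \<in> Z_space lam \<phi>" if "u \<in> Z_space lam \<phi>" for c u
    using that smooth_on_cmult by (auto simp: Z_space_def cscale_def)
qed

text \<open>A solution of the equation is determined by its values on the fundamental domain of \<open>c\<close>, and
  these are arbitrary as long as they fit together smoothly at the end points; they do if they vanish
  there to infinite order.\<close>

definition spread :: "complex \<Rightarrow> real \<Rightarrow> (real \<Rightarrow> real) \<Rightarrow> real \<Rightarrow> complex" where
  "spread lam c \<rho> x =
     (if x > 0 then lam powi index c x * of_real (\<rho> (itr (- index c x) x)) else 0)"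

lemma spread_in_Z:
  assumes "lam \<noteq> 0" "c > 0" "smooth_on UNIV \<rho>" and supp: "\<And>x. \<rho> x \<noteq> 0 \<Longrightarrow> c < x \<and> x < \<phi> c"
  shows "spread lam c \<rho> \<in> Z_space lam \<phi>"
proof -
  have term_smooth: "smooth_on {0<..} (\<lambda>x. lam powi n * of_real (\<rho> (itr (- n) x)))" for n
    by (intro smooth_on_cmult smooth_on_linear_compose[OF _ bounded_linear_of_real]
        smooth_on_compose[OF smooth_on_subset[OF itr_smooth] assms(3)]) auto
  have "smooth_on {0<..} (spread lam c \<rho>)"
  proof (rule smooth_on_local)
    fix x :: real assume x: "x \<in> {0<..}"
    define n where "n = index c x"
    let ?U = "{itr (n - 1) c <..< itr (n + 1) c}"
    have n: "itr n c \<le> x" "x < itr (n + 1) c" using index_works x assms(2) by (auto simp: n_def)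
    have sub: "?U \<subseteq> {0<..}" using itr_pos[OF assms(2), of "n - 1"] by auto
    have "smooth_on ?U (\<lambda>x. lam powi n * of_real (\<rho> (itr (- n) x)) +
        lam powi (n - 1) * of_real (\<rho> (itr (- (n - 1)) x)))"
      by (intro smooth_on_add smooth_on_subset[OF term_smooth sub])
    then have "smooth_on ?U (spread lam c \<rho>)"
    proof (rule smooth_on_cong)
      fix y assume y: "y \<in> ?U"
      then have y0: "y > 0" using sub by auto
      have ph: "\<phi> (itr (- n) y) = itr (- (n - 1)) y" using phi_itr[of y "- n"] y0 by simp
      have cn: "itr (- n) (itr n c) = c" "itr (- n) (itr (n + 1) c) = \<phi> c" "itr n c > 0"
        using assms(2) itr_add[of c "- n" "n + 1"] itr_pos by (auto simp: itr_1)
      show "lam powi n * of_real (\<rho> (itr (- n) y)) + lam powi (n - 1) * of_real (\<rho> (itr (- (n - 1)) y))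
          = spread lam c \<rho> y"
      proof (cases "itr n c \<le> y")
        case True
        have "index c y = n" using True y assms(2) by (intro index_eqI) auto
        moreover have "itr (- (n - 1)) y \<ge> \<phi> c"
          using True itr_le_iff[of "itr n c" y "- (n - 1)"] cn(3) y0 assms(2) itr_add[of c "- (n - 1)" n]
          by (simp add: itr_1)
        ultimately show ?thesis using supp[of "itr (- (n - 1)) y"] y0 by (auto simp: spread_def)
      next
        case False
        have "index c y = n - 1" using False y assms(2) by (intro index_eqI) auto
        moreover have "itr (- n) y \<le> c"
          using False itr_le_iff[of y "itr n c" "- n"] cn y0 by simp
        ultimately show ?thesis using supp[of "itr (- n) y"] y0 by (auto simp: spread_def)
      qed
    qed
    moreover have "x \<in> ?U" using n itr_less[OF assms(2), of "n - 1" n] by auto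
    moreover have "openin (top_of_set {0<..}) ?U" using sub by (simp add: open_subset)
    ultimately show "\<exists>U. openin (top_of_set {0<..}) U \<and> x \<in> U \<and> smooth_on U (spread lam c \<rho>)" by blast
  qed
  moreover have "spread lam c \<rho> (\<phi> x) = lam * spread lam c \<rho> x" if x: "x > 0" for x
  proof -
    define n where "n = index c x"
    have n: "itr n c \<le> x" "x < itr (n + 1) c" using index_works x assms(2) by (auto simp: n_def)
    have "itr 1 (itr n c) \<le> itr 1 x" "itr 1 x < itr 1 (itr (n + 1) c)"
      using n itr_le_iff itr_less_iff x itr_nonneg assms(2) by (auto simp: less_imp_le)
    then have "itr (n + 1) c \<le> \<phi> x" "\<phi> x < itr (n + 1 + 1) c"
      using itr_add[of c 1 n] itr_add[of c 1 "n + 1"] assms(2) by (simp_all add: itr_1 ac_simps)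
    then have "index c (\<phi> x) = n + 1" using assms(2) by (intro index_eqI)
    moreover have "itr (- (n + 1)) (\<phi> x) = itr (- n) x" using itr_phi[of x "- (n + 1)"] x by simp
    ultimately show ?thesis
      using x Diff_half_pos[OF phi x] assms(1) by (simp add: spread_def n_def power_int_add)
  qed
  ultimately show ?thesis by (auto simp: Z_space_def spread_def)
qed

lemma spread_fundamental:
  assumes "c > 0" "c \<le> x" "x < \<phi> c"
  shows "spread lam c \<rho> x = of_real (\<rho> x)"
proof -
  have "index c x = 0" using assms by (intro index_eqI) (auto simp: itr_0 itr_1)
  then show ?thesis using assms by (simp add: spread_def itr_0)
qed

text \<open>Bumps with disjoint supports inside one fundamental domain spread to independent solutions.\<close>

lemma not_fin_dim_Z:
  assumes "lam \<noteq> 0"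
  shows "\<not> fin_dim (Z_space lam \<phi>)"
proof
  assume "fin_dim (Z_space lam \<phi>)"
  then obtain B where B: "finite B" "Z_space lam \<phi> \<subseteq> cfun.span B" by (auto simp: fin_dim_def)
  have p1: "\<phi> 1 > 1" using expanding by (auto simp: expanding_def)
  define a where "a i = 1 + (\<phi> 1 - 1) / real (i + 2)" for i
  define m where "m i = (a (Suc i) + a i) / 2" for i
  have a_less: "a (Suc i) < a i" for i using p1 by (simp add: a_def divide_strict_left_mono)
  have a_mono: "a j \<le> a i" if "i \<le> j" for i j
    using lift_Suc_antimono_le[of a] a_less that by (meson less_imp_le)
  have a_bounds: "1 < a i" "a i < \<phi> 1" for i
  proof -
    have "(\<phi> 1 - 1) / real (i + 2) < (\<phi> 1 - 1) / 1"
      using p1 by (intro divide_strict_left_mono) auto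
    then show "1 < a i" "a i < \<phi> 1" using p1 by (auto simp: a_def)
  qed
  define \<beta> where "\<beta> i = spread lam 1 (bump (a (Suc i)) (a i))" for i
  have \<beta>: "\<beta> i \<in> Z_space lam \<phi>" for i
    unfolding \<beta>_def
  proof (rule spread_in_Z[OF assms zero_less_one smooth_on_bump])
    fix x assume "bump (a (Suc i)) (a i) x \<noteq> 0"
    then show "1 < x \<and> x < \<phi> 1"
      using bump_nonneg[of "a (Suc i)" "a i" x] bump_pos_iff[of "a (Suc i)" "a i" x]
        a_bounds(1)[of "Suc i"] a_bounds(2)[of i] by auto
  qed
  have val: "\<beta> i (m j) \<noteq> 0 \<longleftrightarrow> i = j" for i j
  proof -
    have mj: "a (Suc j) < m j" "m j < a j" using a_less[of j] by (auto simp: m_def)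
    have "\<beta> i (m j) = of_real (bump (a (Suc i)) (a i) (m j))"
      unfolding \<beta>_def using mj a_bounds(1)[of "Suc j"] a_bounds(2)[of j] by (intro spread_fundamental) auto
    then have "\<beta> i (m j) \<noteq> 0 \<longleftrightarrow> a (Suc i) < m j \<and> m j < a i"
      using bump_nonneg[of "a (Suc i)" "a i" "m j"] bump_pos_iff[of "a (Suc i)" "a i" "m j"] by auto
    also have "\<dots> \<longleftrightarrow> i = j"
      using mj a_mono[of i j] a_mono[of "Suc i" j] a_mono[of "Suc j" i]
      by (cases i j rule: linorder_cases) auto
    finally show ?thesis .
  qed
  have inj: "inj \<beta>" using val by (intro injI) metis
  have "cfun.independent (range \<beta>)"
    unfolding cfun.dependent_explicit
  proof clarify
    fix S u f assume S: "finite S" "S \<subseteq> range \<beta>" "(\<Sum>v\<in>S. cscale (u v) v) = 0" "f \<in> S" "u f \<noteq> 0"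
    obtain j where j: "f = \<beta> j" using S by auto
    have "(\<Sum>v\<in>S. cscale (u v) v) x = (\<Sum>v\<in>S. u v * v x)" for x
      using S(1) by (induction S) (auto simp: cscale_def)
    then have "0 = (\<Sum>v\<in>S. u v * v (m j))" using S(3) by (metis zero_fun_apply)
    also have "\<dots> = (\<Sum>v\<in>S. if v = f then u f * f (m j) else 0)"
    proof (intro sum.cong refl)
      fix v assume "v \<in> S"
      then obtain i where "v = \<beta> i" using S(2) by auto
      then show "u v * v (m j) = (if v = f then u f * f (m j) else 0)"
        using val[of i j] j by auto
    qed
    also have "\<dots> = u f * f (m j)" using S by simp
    finally show False using S(5) val[of j j] j by simp
  qed
  then have "finite (range \<beta>)"
    using cfun.independent_span_bound[OF B(1)] B(2) \<beta> by blast
  then show False using finite_imageD[OF _ inj] by simp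
qed

text \<open>One spread bump vanishes on an orbit, that of the end points of its fundamental domain. The
  translates of the interiors of two overlapping domains cover the half-line, so that the norms of two
  spread bumps have a positive sum; continuity at 0 comes from the equation.\<close>

lemma expanding_potential:
  fixes r :: real
  assumes "r > 1"
  obtains e :: "real \<Rightarrow> real" where "continuous_on {0..} e" "e 0 = 0" "\<And>x. x > 0 \<Longrightarrow> e x > 0"
    "\<And>x. x \<ge> 0 \<Longrightarrow> e (\<phi> x) = r * e x"
proof -
  let ?r = "of_real r :: complex"
  have p1: "\<phi> 1 > 1" using expanding by (auto simp: expanding_def)
  define c where "c = (1 + \<phi> 1) / 2"
  have c: "1 < c" "c < \<phi> 1" using p1 by (auto simp: c_def)
  have pc: "\<phi> 1 < \<phi> c" using Diff_half_strict_mono[OF phi, of 1 c] c by simp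
  define \<beta> where "\<beta> d = spread ?r d (bump d (\<phi> d))" for d
  have Z: "\<beta> d \<in> Z_space ?r \<phi>" if "d > 0" for d
    unfolding \<beta>_def
  proof (rule spread_in_Z[OF _ that smooth_on_bump])
    fix x assume "bump d (\<phi> d) x \<noteq> 0"
    then show "d < x \<and> x < \<phi> d"
      using bump_nonneg[of d "\<phi> d" x] bump_pos_iff[of d "\<phi> d" x] by auto
  qed (use assms in auto)
  have eq: "\<beta> d (\<phi> x) = ?r * \<beta> d x" if "d > 0" "x \<ge> 0" for d x
    using Z[OF that(1)] that(2) Diff_half_0[OF phi] by (cases "x = 0") (auto simp: Z_space_def)
  have cont: "continuous_on {0..} (\<beta> d)" if "d > 0" for d
  proof (rule continuous_on_subset)
    show "continuous_on UNIV (\<beta> d)"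
      by (rule twisted_continuous[of "\<beta> d" ?r "\<lambda>_. 1" "\<lambda>_. 0"])
        (use Z[OF that] assms in \<open>auto simp: Z_space_def intro: smooth_on_continuous\<close>)
  qed auto
  have pos_fund: "\<beta> d x \<noteq> 0" if "0 < d" "d < x" "x < \<phi> d" for d x
    unfolding \<beta>_def using that bump_pos_iff[of d "\<phi> d" x] by (subst spread_fundamental) auto
  define e where "e x = norm (\<beta> 1 x) + norm (\<beta> c x)" for x
  show ?thesis
  proof (rule that)
    show "continuous_on {0..} e"
      unfolding e_def using cont c by (auto intro!: continuous_intros)
    show "e 0 = 0" using Z[of 1] Z[of c] c by (auto simp: e_def Z_space_def)
    show e_eq: "e (\<phi> x) = r * e x" if "x \<ge> 0" for x
      using eq[of 1 x] eq[of c x] that assms c by (simp add: e_def norm_mult algebra_simps)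
    show "e x > 0" if x: "x > 0" for x
    proof -
      define n where "n = index 1 x"
      have n: "itr n 1 \<le> x" "x < itr (n + 1) 1" using index_works x by (auto simp: n_def)
      define y where "y = itr (- n) x"
      have y: "1 \<le> y" "y < \<phi> 1"
        using itr_le_iff[of "itr n 1" x "- n"] itr_less_iff[of x "itr (n + 1) 1" "- n"] n x
          itr_nonneg[of 1] itr_add[of 1 "- n" "n + 1"] by (auto simp: y_def itr_1)
      have "e y > 0"
      proof (cases "y = 1")
        case True
        have "\<beta> c (\<phi> 1) \<noteq> 0" using c pc by (intro pos_fund) auto
        then have "\<beta> c 1 \<noteq> 0" using eq[of c 1] c by auto
        then show ?thesis using True by (simp add: e_def add_nonneg_pos)
      next
        case False
        then have "\<beta> 1 y \<noteq> 0" using y by (intro pos_fund) auto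
        then show ?thesis by (simp add: e_def add_pos_nonneg)
      qed
      moreover have "e (itr n y) = r powi n * e y"
        using e_eq assms y by (intro equivariant_itr[where X = "{0..}"]) auto
      ultimately show ?thesis using assms x by (simp add: y_def)
    qed
  qed
qed

end

section \<open>A linear functional equation over a contraction\<close>

locale contraction_germ =
  fixes f f' :: "real \<Rightarrow> real" and \<epsilon> q :: real
  assumes eps: "\<epsilon> > 0" and q: "0 < q" "q < 1"
    and f_smooth: "smooth_on {-\<epsilon><..<\<epsilon>} f"
    and f_le: "\<And>x. x \<in> {-\<epsilon><..<\<epsilon>} \<Longrightarrow> \<bar>f x\<bar> \<le> \<bar>x\<bar>"
    and f': "\<And>x. x \<in> {-\<epsilon><..<\<epsilon>} \<Longrightarrow> (f has_vector_derivative f' x) (at x)"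
    and f'_le: "\<And>x. x \<in> {-\<epsilon><..<\<epsilon>} \<Longrightarrow> \<bar>f' x\<bar> \<le> 1"
begin

abbreviation "I \<equiv> {-\<epsilon><..<\<epsilon>}"

lemma f_I: "x \<in> I \<Longrightarrow> f x \<in> I"
  using f_le[of x] by auto

text \<open>The iterates of the affine operator \<open>X \<mapsto> \<psi> + a * X \<circ> f\<close>. It contracts by the factor \<open>q\<close> that bounds
  \<open>a\<close>, because \<open>f\<close> maps the intervals around 0 into themselves; \<open>\<bar>f'\<bar> \<le> 1\<close> makes the operator for the
  derivative of a solution contract as well.\<close>

primrec picard :: "(real \<Rightarrow> real) \<Rightarrow> (real \<Rightarrow> real) \<Rightarrow> nat \<Rightarrow> real \<Rightarrow> real" where
  "picard a \<psi> 0 x = 0"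
| "picard a \<psi> (Suc n) x = \<psi> x + a x * picard a \<psi> n (f x)"

definition sol :: "(real \<Rightarrow> real) \<Rightarrow> (real \<Rightarrow> real) \<Rightarrow> real \<Rightarrow> real" where
  "sol a \<psi> x = lim (\<lambda>n. picard a \<psi> n x)"

lemma compact_bound:
  fixes g :: "real \<Rightarrow> real"
  assumes "continuous_on I g" "\<rho> < \<epsilon>"
  obtains M where "M > 0" "\<And>x. \<bar>x\<bar> \<le> \<rho> \<Longrightarrow> \<bar>g x\<bar> \<le> M"
proof -
  have "continuous_on {-\<rho>..\<rho>} g" using assms(1) by (rule continuous_on_subset) (use assms(2) in auto)
  then have "bounded (g ` {-\<rho>..\<rho>})" by (intro compact_imp_bounded compact_continuous_image) auto
  then obtain M where "M > 0" "\<forall>y\<in>g ` {-\<rho>..\<rho>}. norm y \<le> M" by (auto simp: bounded_pos)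
  then show ?thesis by (intro that[of M]) (auto simp: abs_le_iff)
qed

lemma
  assumes a: "\<And>x. x \<in> I \<Longrightarrow> \<bar>a x\<bar> \<le> q" and "continuous_on I \<psi>"
  shows picard_tendsto: "x \<in> I \<Longrightarrow> (\<lambda>n. picard a \<psi> n x) \<longlonglongrightarrow> sol a \<psi> x"
    and sol_eq: "x \<in> I \<Longrightarrow> sol a \<psi> x = \<psi> x + a x * sol a \<psi> (f x)"
    and picard_error: "\<rho> < \<epsilon> \<Longrightarrow> \<exists>M>0. \<forall>n x. \<bar>x\<bar> \<le> \<rho> \<longrightarrow> \<bar>picard a \<psi> n x - sol a \<psi> x\<bar> \<le> M * q ^ n"
proof -
  show lim: "(\<lambda>n. picard a \<psi> n x) \<longlonglongrightarrow> sol a \<psi> x" if x: "x \<in> I" for x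
  proof -
    obtain M where M: "M > 0" "\<And>y. \<bar>y\<bar> \<le> \<bar>x\<bar> \<Longrightarrow> \<bar>\<psi> y\<bar> \<le> M"
    proof -
      have "\<bar>x\<bar> < \<epsilon>" using x by auto
      then show ?thesis using compact_bound[OF assms(2), of "\<bar>x\<bar>" thesis] that by blast
    qed
    have "\<bar>picard a \<psi> (Suc n) y - picard a \<psi> n y\<bar> \<le> M * q ^ n" if "\<bar>y\<bar> \<le> \<bar>x\<bar>" for n y
      using that
    proof (induction n arbitrary: y)
      case 0 then show ?case using M by simp
    next
      case (Suc n)
      then have y: "y \<in> I" using x by auto
      have "\<bar>picard a \<psi> (Suc (Suc n)) y - picard a \<psi> (Suc n) y\<bar> =
          \<bar>a y\<bar> * \<bar>picard a \<psi> (Suc n) (f y) - picard a \<psi> n (f y)\<bar>"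
        by (simp add: algebra_simps flip: abs_mult)
      also have "\<dots> \<le> q * (M * q ^ n)"
        using Suc.prems f_le[OF y] a[OF y] q by (intro mult_mono Suc.IH) auto
      finally show ?case by (simp add: algebra_simps)
    qed
    then have le: "norm (picard a \<psi> (Suc n) x - picard a \<psi> n x) \<le> M * q ^ n" for n
      unfolding real_norm_def by blast
    have "summable (\<lambda>n. M * q ^ n)" using q by (intro summable_mult summable_geometric) simp
    then have "summable (\<lambda>n. picard a \<psi> (Suc n) x - picard a \<psi> n x)"
      by (rule summable_comparison_test') (rule le)
    then have "convergent (\<lambda>n. \<Sum>i<n. picard a \<psi> (Suc i) x - picard a \<psi> i x)"
      using summable_iff_convergent by blast
    then have "convergent (\<lambda>n. picard a \<psi> n x)"
      unfolding sum_lessThan_telescope[of "\<lambda>i. picard a \<psi> i x"] by simp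
    then show ?thesis unfolding sol_def by (simp add: convergent_LIMSEQ_iff)
  qed
  show eq: "sol a \<psi> x = \<psi> x + a x * sol a \<psi> (f x)" if x: "x \<in> I" for x
  proof -
    have "(\<lambda>n. picard a \<psi> (Suc n) x) \<longlonglongrightarrow> \<psi> x + a x * sol a \<psi> (f x)"
      using lim[OF f_I[OF x]] by (auto intro!: tendsto_intros)
    then show ?thesis using LIMSEQ_Suc[OF lim[OF x]] LIMSEQ_unique by blast
  qed
  show "\<exists>M>0. \<forall>n x. \<bar>x\<bar> \<le> \<rho> \<longrightarrow> \<bar>picard a \<psi> n x - sol a \<psi> x\<bar> \<le> M * q ^ n" if \<rho>: "\<rho> < \<epsilon>"
  proof -
    obtain M where M: "M > 0" "\<And>y. \<bar>y\<bar> \<le> \<rho> \<Longrightarrow> \<bar>\<psi> y\<bar> \<le> M"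
      using compact_bound[OF assms(2) \<rho>] by blast
    have I: "x \<in> I" "\<bar>f x\<bar> \<le> \<rho>" if "\<bar>x\<bar> \<le> \<rho>" for x
    proof -
      show "x \<in> I" using that \<rho> by auto
      then show "\<bar>f x\<bar> \<le> \<rho>" using that f_le[of x] by simp
    qed
    define R where "R = M / (1 - q)"
    have R: "M + q * R = R" "R > 0" using q M by (auto simp: R_def field_simps)
    have "\<bar>picard a \<psi> n x\<bar> \<le> R" if "\<bar>x\<bar> \<le> \<rho>" for n x
      using that
    proof (induction n arbitrary: x)
      case 0 then show ?case using R by simp
    next
      case (Suc n)
      have "\<bar>picard a \<psi> (Suc n) x\<bar> \<le> \<bar>\<psi> x\<bar> + \<bar>a x\<bar> * \<bar>picard a \<psi> n (f x)\<bar>"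
        by (metis abs_mult abs_triangle_ineq picard.simps(2))
      also have "\<dots> \<le> M + q * R"
        using M(2)[OF Suc.prems] a[OF I(1)[OF Suc.prems]] Suc.IH[OF I(2)[OF Suc.prems]] q
        by (intro add_mono mult_mono) auto
      finally show ?case using R by simp
    qed
    then have sol_le: "\<bar>sol a \<psi> x\<bar> \<le> R" if "\<bar>x\<bar> \<le> \<rho>" for x
      using that I(1)[OF that] LIMSEQ_le_const2[OF tendsto_rabs[OF lim]] by blast
    have "\<bar>picard a \<psi> n x - sol a \<psi> x\<bar> \<le> R * q ^ n" if "\<bar>x\<bar> \<le> \<rho>" for n x
      using that
    proof (induction n arbitrary: x)
      case 0 then show ?case using sol_le by simp
    next
      case (Suc n)
      have "\<bar>picard a \<psi> (Suc n) x - sol a \<psi> x\<bar> = \<bar>a x\<bar> * \<bar>picard a \<psi> n (f x) - sol a \<psi> (f x)\<bar>"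
        using eq[OF I(1)[OF Suc.prems]] by (simp add: algebra_simps flip: abs_mult)
      also have "\<dots> \<le> q * (R * q ^ n)"
        using a[OF I(1)[OF Suc.prems]] Suc.IH[OF I(2)[OF Suc.prems]] q by (intro mult_mono) auto
      finally show ?case by (simp add: algebra_simps)
    qed
    then show ?thesis using R(2) by blast
  qed
qed

lemma sol_continuous:
  assumes a: "\<And>x. x \<in> I \<Longrightarrow> \<bar>a x\<bar> \<le> q" "continuous_on I a" and \<psi>: "continuous_on I \<psi>"
  shows "continuous_on I (sol a \<psi>)"
proof -
  have picard: "continuous_on I (picard a \<psi> n)" for n
  proof (induction n)
    case (Suc n)
    have "continuous_on I (\<lambda>x. picard a \<psi> n (f x))"
      by (rule continuous_on_compose2[OF Suc smooth_on_continuous[OF f_smooth]]) (use f_I in blast)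
    then show ?case using a \<psi> by (auto intro!: continuous_intros)
  qed auto
  have "isCont (sol a \<psi>) x" if x: "x \<in> I" for x
  proof -
    define \<rho> where "\<rho> = (\<bar>x\<bar> + \<epsilon>) / 2"
    have \<rho>: "\<bar>x\<bar> < \<rho>" "\<rho> < \<epsilon>" using x by (auto simp: \<rho>_def)
    obtain M where M: "M > 0" "\<And>n x. \<bar>x\<bar> \<le> \<rho> \<Longrightarrow> \<bar>picard a \<psi> n x - sol a \<psi> x\<bar> \<le> M * q ^ n"
      using picard_error[of a \<psi> \<rho>, OF a(1) \<psi> \<rho>(2)] by blast
    have "uniform_limit {-\<rho><..<\<rho>} (picard a \<psi>) (sol a \<psi>) sequentially"
      unfolding uniform_limit_iff
    proof (intro allI impI)
      fix e :: real assume "e > 0"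
      have "(\<lambda>n. M * q ^ n) \<longlonglongrightarrow> M * 0" using q by (intro tendsto_intros LIMSEQ_power_zero) auto
      then have "\<forall>\<^sub>F n in sequentially. M * q ^ n < e"
        using \<open>e > 0\<close> by (intro order_tendstoD) auto
      then show "\<forall>\<^sub>F n in sequentially. \<forall>x\<in>{-\<rho><..<\<rho>}. dist (picard a \<psi> n x) (sol a \<psi> x) < e"
      proof (rule eventually_mono)
        fix n assume n: "M * q ^ n < e"
        show "\<forall>x\<in>{-\<rho><..<\<rho>}. dist (picard a \<psi> n x) (sol a \<psi> x) < e"
        proof
          fix x assume "x \<in> {-\<rho><..<\<rho>}"
          then have "\<bar>x\<bar> \<le> \<rho>" by auto
          then show "dist (picard a \<psi> n x) (sol a \<psi> x) < e" using M(2)[of x n] n by (simp add: dist_real_def)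
        qed
      qed
    qed
    then have "continuous_on {-\<rho><..<\<rho>} (sol a \<psi>)"
      by (rule uniform_limit_theorem[rotated])
        (use \<rho> in \<open>auto intro!: always_eventually continuous_on_subset[OF picard]\<close>)
    then show ?thesis using \<rho> by (simp add: continuous_on_eq_continuous_at abs_less_iff)
  qed
  then show ?thesis by (simp add: continuous_at_imp_continuous_on)
qed

text \<open>The derivative of the solution satisfies the differentiated equation; this is checked on
  the approximations, whose derivatives differ from the approximations of the expected limit
  by at most a constant times \<open>n * q ^ n\<close>.\<close>

lemma sol_has_derivative:
  assumes a: "\<And>x. x \<in> I \<Longrightarrow> \<bar>a x\<bar> \<le> q"
    and Da: "\<And>x. x \<in> I \<Longrightarrow> (a has_vector_derivative a' x) (at x)" "continuous_on I a'"
    and D\<psi>: "\<And>x. x \<in> I \<Longrightarrow> (\<psi> has_vector_derivative \<psi>' x) (at x)" "continuous_on I \<psi>'"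
    and "continuous_on I f'"
  defines "A \<equiv> \<lambda>x. a x * f' x" and "\<Psi> \<equiv> \<lambda>x. \<psi>' x + a' x * sol a \<psi> (f x)"
  assumes x: "x \<in> I"
  shows "(sol a \<psi> has_vector_derivative sol A \<Psi> x) (at x)"
proof -
  have ca: "continuous_on I a" and c\<psi>: "continuous_on I \<psi>"
    using Da(1) D\<psi>(1) has_vector_derivative_continuous
    by (blast intro!: continuous_at_imp_continuous_on)+
  have csol: "continuous_on I (sol a \<psi>)" using sol_continuous[of a \<psi>, OF a ca c\<psi>] .
  have c\<Psi>: "continuous_on I \<Psi>"
    unfolding \<Psi>_def using f_I
    by (intro continuous_intros D\<psi>(2) Da(2) continuous_on_compose2[OF csol smooth_on_continuous[OF f_smooth]]) auto
  have A: "\<bar>A y\<bar> \<le> q" if "y \<in> I" for y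
    using a[OF that] f'_le[OF that] q mult_mono[of "\<bar>a y\<bar>" q "\<bar>f' y\<bar>" 1] by (simp add: A_def abs_mult)
  define dpicard where "dpicard = rec_nat (\<lambda>y. 0) (\<lambda>n d y. \<psi>' y + (a' y * picard a \<psi> n (f y) + a y * (f' y * d (f y))))"
  have dpicard_0: "dpicard 0 y = 0"
    and dpicard_Suc: "dpicard (Suc n) y = \<psi>' y + (a' y * picard a \<psi> n (f y) + a y * (f' y * dpicard n (f y)))" for n y
    by (simp_all add: dpicard_def)
  have D: "(picard a \<psi> n has_vector_derivative dpicard n y) (at y)" if "y \<in> I" for n y
    using that
  proof (induction n arbitrary: y)
    case 0 then show ?case by (simp add: dpicard_0 picard.simps(1)[abs_def])
  next
    case (Suc n)
    have 1: "((\<lambda>y. picard a \<psi> n (f y)) has_vector_derivative f' y * dpicard n (f y)) (at y)"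
      using vector_diff_chain_at[OF f'[OF Suc.prems] Suc.IH[OF f_I[OF Suc.prems]]] by (simp add: o_def)
    have "((\<lambda>y. \<psi> y + a y * picard a \<psi> n (f y)) has_vector_derivative
        \<psi>' y + (a y * (f' y * dpicard n (f y)) + a' y * picard a \<psi> n (f y))) (at y)"
      by (intro has_vector_derivative_add D\<psi>(1) Suc.prems has_vector_derivative_mult Da(1) 1)
    then show ?case by (simp add: dpicard_Suc add.commute picard.simps(2)[abs_def])
  qed
  define \<rho> where "\<rho> = (\<bar>x\<bar> + \<epsilon>) / 2"
  have \<rho>: "\<bar>x\<bar> < \<rho>" "\<rho> < \<epsilon>" using x by (auto simp: \<rho>_def)
  obtain M where M: "M > 0" "\<And>n y. \<bar>y\<bar> \<le> \<rho> \<Longrightarrow> \<bar>picard a \<psi> n y - sol a \<psi> y\<bar> \<le> M * q ^ n"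
    using picard_error[of a \<psi> \<rho>, OF a c\<psi> \<rho>(2)] by blast
  obtain N where N: "N > 0" "\<And>n y. \<bar>y\<bar> \<le> \<rho> \<Longrightarrow> \<bar>picard A \<Psi> n y - sol A \<Psi> y\<bar> \<le> N * q ^ n"
    using picard_error[of A \<Psi> \<rho>, OF A c\<Psi> \<rho>(2)] by blast
  obtain C where C: "C > 0" "\<And>y. \<bar>y\<bar> \<le> \<rho> \<Longrightarrow> \<bar>a' y\<bar> \<le> C"
    using compact_bound[OF Da(2) \<rho>(2)] by blast
  define B where "B = C * M / q"
  have B: "B > 0" "C * M = B * q" using C M q by (auto simp: B_def)
  have inI: "y \<in> I" "\<bar>f y\<bar> \<le> \<rho>" if "\<bar>y\<bar> \<le> \<rho>" for y
  proof -
    show "y \<in> I" using that \<rho> by auto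
    then show "\<bar>f y\<bar> \<le> \<rho>" using that f_le[of y] by simp
  qed
  have err: "\<bar>dpicard n y - picard A \<Psi> n y\<bar> \<le> B * real n * q ^ n" if "\<bar>y\<bar> \<le> \<rho>" for n y
    using that
  proof (induction n arbitrary: y)
    case 0 then show ?case by (simp add: dpicard_0)
  next
    case (Suc n)
    note y = inI[OF Suc.prems]
    have eq: "dpicard (Suc n) y - picard A \<Psi> (Suc n) y =
        a' y * (picard a \<psi> n (f y) - sol a \<psi> (f y)) + A y * (dpicard n (f y) - picard A \<Psi> n (f y))"
      by (simp add: dpicard_Suc \<Psi>_def A_def algebra_simps)
    have "\<bar>dpicard (Suc n) y - picard A \<Psi> (Suc n) y\<bar> \<le>
        \<bar>a' y\<bar> * \<bar>picard a \<psi> n (f y) - sol a \<psi> (f y)\<bar> + \<bar>A y\<bar> * \<bar>dpicard n (f y) - picard A \<Psi> n (f y)\<bar>"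
      unfolding eq abs_mult[symmetric] by (rule abs_triangle_ineq)
    also have "\<dots> \<le> C * (M * q ^ n) + q * (B * real n * q ^ n)"
      using C(2)[OF Suc.prems] M(2)[OF y(2), of n] A[OF y(1)] Suc.IH[OF y(2)] C(1) q
      by (intro add_mono mult_mono) auto
    also have "\<dots> = (C * M) * q ^ n + q * (B * real n * q ^ n)" by simp
    also have "\<dots> = B * real (Suc n) * q ^ Suc n" unfolding B(2) by (simp add: algebra_simps)
    finally show ?case .
  qed
  let ?S = "{-\<rho><..<\<rho>}"
  have "\<exists>g. \<forall>y\<in>?S. (\<lambda>n. picard a \<psi> n y) \<longlonglongrightarrow> g y \<and> (g has_derivative (\<lambda>h. h *\<^sub>R sol A \<Psi> y)) (at y within ?S)"
  proof (rule has_derivative_sequence)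
    show "(picard a \<psi> n has_derivative (\<lambda>h. h *\<^sub>R dpicard n y)) (at y within ?S)" if "y \<in> ?S" for n y
      using D[of y n] inI(1)[of y] that
      by (auto simp: has_vector_derivative_def intro: has_derivative_at_withinI)
    show "(\<lambda>n. picard a \<psi> n x) \<longlonglongrightarrow> sol a \<psi> x" using picard_tendsto[of a \<psi>, OF a c\<psi> x] .
    show "x \<in> ?S" using \<rho> by auto
    fix e :: real assume e: "e > 0"
    have "(\<lambda>n. B * (real n * q ^ n) + N * q ^ n) \<longlonglongrightarrow> B * 0 + N * 0"
      using powser_times_n_limit_0[of q] q by (intro tendsto_intros LIMSEQ_power_zero) auto
    then have "\<forall>\<^sub>F n in sequentially. B * (real n * q ^ n) + N * q ^ n < e"
      using e by (intro order_tendstoD) auto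
    then show "\<forall>\<^sub>F n in sequentially. \<forall>y\<in>?S. \<forall>h. norm (h *\<^sub>R dpicard n y - h *\<^sub>R sol A \<Psi> y) \<le> e * norm h"
    proof (rule eventually_mono)
      fix n assume n: "B * (real n * q ^ n) + N * q ^ n < e"
      show "\<forall>y\<in>?S. \<forall>h. norm (h *\<^sub>R dpicard n y - h *\<^sub>R sol A \<Psi> y) \<le> e * norm h"
      proof (intro ballI allI)
        fix y h assume "y \<in> ?S"
        then have "\<bar>y\<bar> \<le> \<rho>" by auto
        then have "\<bar>dpicard n y - sol A \<Psi> y\<bar> \<le> e" using err[of y n] N(2)[of y n] n by (simp add: mult.assoc)
        then have "\<bar>h\<bar> * \<bar>dpicard n y - sol A \<Psi> y\<bar> \<le> \<bar>h\<bar> * e" by (rule mult_left_mono) simp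
        then show "norm (h *\<^sub>R dpicard n y - h *\<^sub>R sol A \<Psi> y) \<le> e * norm h"
          by (simp add: mult.commute flip: abs_mult right_diff_distrib)
      qed
    qed
  qed (auto simp: convex_real_interval)
  then obtain g where g: "\<And>y. y \<in> ?S \<Longrightarrow> (\<lambda>n. picard a \<psi> n y) \<longlonglongrightarrow> g y"
    "\<And>y. y \<in> ?S \<Longrightarrow> (g has_derivative (\<lambda>h. h *\<^sub>R sol A \<Psi> y)) (at y within ?S)" by blast
  have g_sol: "g y = sol a \<psi> y" if "y \<in> ?S" for y
    using LIMSEQ_unique[OF g(1)[OF that] picard_tendsto[of a \<psi>, OF a c\<psi>]] inI(1)[of y] that by auto
  have xS: "x \<in> ?S" using \<rho> by auto
  have "(g has_vector_derivative sol A \<Psi> x) (at x)"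
    using g(2)[OF xS] xS at_within_open[of x ?S] by (simp add: has_vector_derivative_def)
  then show ?thesis
    by (rule has_vector_derivative_transform_within_open[OF _ open_greaterThanLessThan xS]) (rule g_sol)
qed

lemma sol_smooth:
  assumes "\<And>x. x \<in> I \<Longrightarrow> \<bar>a x\<bar> \<le> q" "smooth_on I a" "smooth_on I \<psi>"
  shows "smooth_on I (sol a \<psi>)"
proof -
  have f'_Ck: "Ck_on k f' I" for k
    using Ck_on_Suc_real[of I f f' k, OF _ f'] f_smooth
    by (simp add: smooth_on_open del: Ck_on.simps)
  have f_Ck: "Ck_on k f I" for k using f_smooth by (simp add: smooth_on_open)
  have "Ck_on k (sol a \<psi>) I" if "\<And>x. x \<in> I \<Longrightarrow> \<bar>a x\<bar> \<le> q" "Ck_on k a I" "Ck_on k \<psi> I" for k a \<psi>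
    using that
  proof (induction k arbitrary: a \<psi>)
    case 0 then show ?case using sol_continuous by simp
  next
    case (Suc k)
    define a' where "a' x = vector_derivative a (at x)" for x
    define \<psi>' where "\<psi>' x = vector_derivative \<psi> (at x)" for x
    have Da: "(a has_vector_derivative a' x) (at x)" and D\<psi>: "(\<psi> has_vector_derivative \<psi>' x) (at x)"
      if "x \<in> I" for x
      using Ck_on_has_vector_derivative[OF Suc.prems(2) that] Ck_on_has_vector_derivative[OF Suc.prems(3) that]
      by (simp_all add: a'_def \<psi>'_def)
    have a'_k: "Ck_on k a' I" and \<psi>'_k: "Ck_on k \<psi>' I"
      using Ck_on_Suc_real[of I a a' k, OF _ Da] Ck_on_Suc_real[of I \<psi> \<psi>' k, OF _ D\<psi>] Suc.prems(2,3)
      by (simp_all del: Ck_on.simps)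
    have a_k: "Ck_on k a I" and \<psi>_k: "Ck_on k \<psi> I" using Suc.prems(2,3) Ck_on_SucD by blast+
    have sol_k: "Ck_on k (sol a \<psi>) I" using Suc.IH[of a \<psi>, OF Suc.prems(1) a_k \<psi>_k] .
    have solf_k: "Ck_on k (\<lambda>x. sol a \<psi> (f x)) I"
      by (rule Ck_on_compose[OF open_greaterThanLessThan open_greaterThanLessThan _ f_Ck sol_k]) (use f_I in auto)
    let ?A = "\<lambda>x. a x * f' x" and ?\<Psi> = "\<lambda>x. \<psi>' x + a' x * sol a \<psi> (f x)"
    have A: "\<bar>?A y\<bar> \<le> q" if "y \<in> I" for y
      using Suc.prems(1)[OF that] f'_le[OF that] q mult_mono[of "\<bar>a y\<bar>" q "\<bar>f' y\<bar>" 1] by (simp add: abs_mult)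
    have A_k: "Ck_on k ?A I"
      by (rule Ck_on_bilinear[OF open_greaterThanLessThan bounded_bilinear_mult a_k f'_Ck])
    have \<Psi>_k: "Ck_on k ?\<Psi> I"
      by (rule Ck_on_add[OF open_greaterThanLessThan \<psi>'_k
          Ck_on_bilinear[OF open_greaterThanLessThan bounded_bilinear_mult a'_k solf_k]])
    have "Ck_on k (sol ?A ?\<Psi>) I" using Suc.IH[of ?A ?\<Psi>, OF A A_k \<Psi>_k] .
    moreover have "(sol a \<psi> has_vector_derivative sol ?A ?\<Psi> x) (at x)" if "x \<in> I" for x
      by (rule sol_has_derivative[OF Suc.prems(1) Da _ D\<psi> _ _ that])
        (use Ck_on_continuous[OF a'_k] Ck_on_continuous[OF \<psi>'_k] Ck_on_continuous[OF f'_Ck] in auto)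
    ultimately show ?case
      using Ck_on_Suc_real[of I "sol a \<psi>" "sol ?A ?\<Psi>" k] by (simp del: Ck_on.simps)
  qed
  then show ?thesis using assms by (simp add: smooth_on_open)
qed

end

section \<open>Linearization of a hyperbolic germ\<close>

text \<open>The logarithmic derivative \<open>X\<close> of the derivative of the linearizing coordinate \<open>h\<close> satisfies
  \<open>X = f'' / f' + f' * X \<circ> f\<close>, which is contracting; two integrations recover \<open>h\<close>.\<close>

lemma antiderivative_germ:
  fixes g :: "real \<Rightarrow> real"
  assumes "\<epsilon> > 0" "smooth_on {-\<epsilon><..<\<epsilon>} g"
  obtains G where "G 0 = 0" "\<And>x. x \<in> {-\<epsilon>/2<..<\<epsilon>/2} \<Longrightarrow> (G has_vector_derivative g x) (at x)"
    "smooth_on {-\<epsilon>/2<..<\<epsilon>/2} G"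
proof -
  let ?J = "{-\<epsilon>/2..\<epsilon>/2}" and ?I = "{-\<epsilon>/2<..<\<epsilon>/2}"
  have "continuous_on ?J g"
    using smooth_on_continuous[OF assms(2)] by (rule continuous_on_subset) (use assms(1) in auto)
  then obtain G where G: "\<And>x. x \<in> ?J \<Longrightarrow> (G has_vector_derivative g x) (at x within ?J)"
    using antiderivative_continuous by blast
  have D: "((\<lambda>x. G x - G 0) has_vector_derivative g x) (at x)" if "x \<in> ?I" for x
  proof -
    have "at x within ?J = at x"
      by (rule at_within_open_subset[of x ?I]) (use that in auto)
    then have "(G has_vector_derivative g x) (at x)" using G[of x] that by auto
    then show ?thesis by (auto intro!: derivative_eq_intros)
  qed
  have "smooth_on ?I g" using assms(2) by (rule smooth_on_subset) (use assms(1) in auto)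
  then have "smooth_on ?I (\<lambda>x. G x - G 0)"
    by (intro smooth_on_antiderivative[OF open_greaterThanLessThan D]) auto
  then show ?thesis using D by (intro that[of "\<lambda>x. G x - G 0"]) auto
qed

lemma linearization_germ:
  fixes f :: "real \<Rightarrow> real"
  assumes "open U" "0 \<in> U" "smooth_on U f" "f 0 = 0"
    and \<nu>: "vector_derivative f (at 0) = \<nu>" "0 < \<nu>" "\<nu> < 1"
  obtains d h where "d > 0" "smooth_on {-d<..<d} h" "\<And>x. x \<in> {-d<..<d} \<Longrightarrow> x \<in> U \<and> h (f x) = \<nu> * h x"
    "\<And>x. 0 < x \<Longrightarrow> x < d \<Longrightarrow> h x > 0"
proof -
  define f' where "f' x = vector_derivative f (at x)" for x
  define q where "q = (\<nu> + 1) / 2"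
  have q: "\<nu> < q" "0 < q" "q < 1" using \<nu> by (auto simp: q_def)
  have f'_smooth: "smooth_on U f'"
    unfolding f'_def using smooth_on_vector_derivative assms by blast
  have "continuous_on U f'" using f'_smooth by (rule smooth_on_continuous)
  then have "open (U \<inter> f' -` {0<..<q})"
    using assms(1) open_greaterThanLessThan by (rule continuous_open_preimage)
  moreover have "0 \<in> U \<inter> f' -` {0<..<q}" using assms(2) \<nu> q by (simp add: f'_def)
  ultimately obtain \<epsilon> where \<epsilon>: "\<epsilon> > 0" "ball 0 \<epsilon> \<subseteq> U \<inter> f' -` {0<..<q}"
    using open_contains_ball[of "U \<inter> f' -` {0<..<q}"] by blast
  have inI: "x \<in> U" "0 < f' x" "f' x < q" if "x \<in> {-\<epsilon><..<\<epsilon>}" for x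
  proof -
    have "x \<in> ball 0 \<epsilon>" using that by (auto simp: dist_real_def)
    then have "x \<in> U \<inter> f' -` {0<..<q}" using \<epsilon>(2) by (rule subsetD[rotated])
    then show "x \<in> U" "0 < f' x" "f' x < q" by auto
  qed
  have f_I: "smooth_on {-\<epsilon><..<\<epsilon>} f" using assms(3) by (rule smooth_on_subset) (use inI in auto)
  have Df: "(f has_vector_derivative f' x) (at x)" if "x \<in> {-\<epsilon><..<\<epsilon>}" for x
    unfolding f'_def using smooth_on_has_vector_derivative[OF assms(1,3)] inI(1)[OF that] .
  have f_le: "\<bar>f x\<bar> \<le> \<bar>x\<bar>" if x: "x \<in> {-\<epsilon><..<\<epsilon>}" for x
  proof -
    let ?S = "{-\<epsilon><..<\<epsilon>}"
    have "norm (f x - f 0) \<le> 1 * norm (x - 0)"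
    proof (rule differentiable_bound[of ?S f "\<lambda>y h. h *\<^sub>R f' y"])
      show "(f has_derivative (\<lambda>h. h *\<^sub>R f' y)) (at y within ?S)" if "y \<in> ?S" for y
        using Df[OF that] by (auto simp: has_vector_derivative_def intro: has_derivative_at_withinI)
      show "onorm (\<lambda>h. h *\<^sub>R f' y) \<le> 1" if "y \<in> ?S" for y
        using inI[OF that] q by (intro onorm_le) (auto simp: abs_mult intro: mult_left_le)
    qed (use x \<epsilon> in auto)
    then show ?thesis using assms(4) by simp
  qed
  interpret contraction_germ f f' \<epsilon> q
  proof
    show "\<bar>f' x\<bar> \<le> 1" if "x \<in> {-\<epsilon><..<\<epsilon>}" for x using inI[OF that] q by simp
  qed (use \<epsilon>(1) q f_I f_le Df in auto)
  have f'_I: "smooth_on I f'" using f'_smooth by (rule smooth_on_subset) (use inI in auto)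
  define f'' where "f'' x = vector_derivative f' (at x)" for x
  have Df': "(f' has_vector_derivative f'' x) (at x)" if "x \<in> I" for x
    unfolding f''_def using smooth_on_has_vector_derivative[OF open_greaterThanLessThan f'_I that] .
  have f''_I: "smooth_on I f''"
    unfolding f''_def using smooth_on_vector_derivative[OF open_greaterThanLessThan f'_I] .
  let ?\<psi> = "\<lambda>x. f'' x * inverse (f' x)"
  have \<psi>: "smooth_on I ?\<psi>"
    by (intro smooth_on_mult f''_I smooth_on_inverse_compose f'_I) (use inI in force)
  define X where "X = sol f' ?\<psi>"
  have f'_q: "\<bar>f' x\<bar> \<le> q" if "x \<in> I" for x using inI[OF that] by simp
  have X: "smooth_on I X" "\<And>x. x \<in> I \<Longrightarrow> X x = ?\<psi> x + f' x * X (f x)"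
    unfolding X_def
    using sol_smooth[of f' ?\<psi>, OF f'_q f'_I \<psi>] sol_eq[of f' ?\<psi>, OF f'_q smooth_on_continuous[OF \<psi>]] by blast+
  obtain W where W: "W 0 = 0" "\<And>x. x \<in> {-\<epsilon>/2<..<\<epsilon>/2} \<Longrightarrow> (W has_vector_derivative X x) (at x)"
    "smooth_on {-\<epsilon>/2<..<\<epsilon>/2} W"
    using antiderivative_germ[OF eps X(1)] by blast
  let ?J = "{-\<epsilon>/2<..<\<epsilon>/2}"
  define V where "V x = exp (W x)" for x
  have V: "smooth_on ?J V"
    unfolding V_def by (rule smooth_on_compose[OF W(3) smooth_on_exp[of UNIV]]) auto
  have DV: "(V has_real_derivative V x * X x) (at x)" if "x \<in> ?J" for x
    unfolding V_def using W(2)[OF that]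
    by (auto intro!: derivative_eq_intros simp: has_real_derivative_iff_has_vector_derivative[symmetric])
  have JI: "x \<in> I" "f x \<in> ?J" if "x \<in> ?J" for x
  proof -
    show "x \<in> I" using that eps by auto
    then show "f x \<in> ?J" using f_le[of x] that by auto
  qed
  have Df_real: "(f has_real_derivative f' x) (at x)" if "x \<in> I" for x
    using Df[OF that] by (simp add: has_real_derivative_iff_has_vector_derivative)
  have V_eq: "V (f x) * f' x = \<nu> * V x" if x: "x \<in> ?J" for x
  proof -
    define Q where "Q x = V (f x) * f' x / V x" for x
    have DQ: "(Q has_real_derivative 0) (at y)" if y: "y \<in> ?J" for y
    proof -
      note y' = JI[OF y]
      have 1: "((\<lambda>y. V (f y)) has_real_derivative (V (f y) * X (f y)) * f' y) (at y)"
        using DERIV_chain2[OF DV[OF y'(2)] Df_real[OF y'(1)]] .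
      have 2: "(f' has_real_derivative f'' y) (at y)"
        using Df'[OF y'(1)] by (simp add: has_real_derivative_iff_has_vector_derivative)
      have V0: "V y \<noteq> 0" by (simp add: V_def)
      have "(Q has_real_derivative
          (((V (f y) * X (f y)) * f' y * f' y + f'' y * V (f y)) * V y - V (f y) * f' y * (V y * X y)) / (V y * V y)) (at y)"
        unfolding Q_def[abs_def] by (rule DERIV_divide[OF DERIV_mult[OF 1 2] DV[OF y] V0])
      moreover have e: "f'' y = f' y * X y - f' y * f' y * X (f y)"
        using X(2)[OF y'(1)] inI(2)[OF y'(1)] by (simp add: field_simps)
      have "((V (f y) * X (f y)) * f' y * f' y + f'' y * V (f y)) * V y - V (f y) * f' y * (V y * X y) = 0"
        unfolding e by (simp add: algebra_simps)
      ultimately show ?thesis by simp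
    qed
    have "Q x = Q 0"
      using DERIV_isconst3[of "-\<epsilon>/2" "\<epsilon>/2" x 0 Q] eps x DQ by auto
    also have "Q 0 = \<nu>" using assms(4) \<nu>(1) by (simp add: Q_def V_def f'_def)
    finally show ?thesis by (simp add: Q_def V_def field_simps)
  qed
  obtain h where h: "h 0 = 0" "\<And>x. x \<in> {-(\<epsilon>/2)/2<..<(\<epsilon>/2)/2} \<Longrightarrow> (h has_vector_derivative V x) (at x)"
    "smooth_on {-(\<epsilon>/2)/2<..<(\<epsilon>/2)/2} h"
    using antiderivative_germ[of "\<epsilon>/2" V] V eps by auto
  define d where "d = \<epsilon> / 2 / 2"
  let ?D = "{-d<..<d}"
  have d: "d > 0" "d < \<epsilon> / 2" using eps by (auto simp: d_def)
  have Dh: "(h has_real_derivative V x) (at x)" if "x \<in> ?D" for x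
    using h(2)[of x] that by (simp add: d_def has_real_derivative_iff_has_vector_derivative)
  have DJ: "x \<in> ?J" "f x \<in> ?D" if "x \<in> ?D" for x
  proof -
    show "x \<in> ?J" using that d by auto
    then show "f x \<in> ?D" using f_le[of x] JI(1)[of x] that by auto
  qed
  have h_eq: "h (f x) = \<nu> * h x" if x: "x \<in> ?D" for x
  proof -
    let ?P = "\<lambda>x. h (f x) - \<nu> * h x"
    have "(?P has_real_derivative 0) (at y)" if y: "y \<in> ?D" for y
    proof -
      have "(?P has_real_derivative V (f y) * f' y - \<nu> * V y) (at y)"
        using DERIV_chain2[OF Dh[OF DJ(2)[OF y]] Df_real[OF JI(1)[OF DJ(1)[OF y]]]] Dh[OF y]
        by (auto intro!: derivative_eq_intros)
      then show ?thesis using V_eq[OF DJ(1)[OF y]] by simp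
    qed
    then have "?P x = ?P 0" using DERIV_isconst3[of "-d" d x 0 ?P] d x by auto
    then show ?thesis using h(1) assms(4) by simp
  qed
  have "h x > 0" if x: "0 < x" "x < d" for x
  proof -
    have "h 0 < h x"
    proof (rule DERIV_pos_imp_increasing[OF x(1)])
      fix y assume "0 \<le> y" "y \<le> x"
      then show "\<exists>l. (h has_real_derivative l) (at y) \<and> 0 < l"
        using Dh[of y] x d by (intro exI[of _ "V y"]) (auto simp: V_def)
    qed
    then show ?thesis using h(1) by simp
  qed
  moreover have "smooth_on ?D h" using h(3) by (simp add: d_def)
  ultimately show ?thesis
    using that[of d h] d h_eq inI(1) JI(1) DJ(1) by blast
qed

section \<open>The hyperbolic case\<close>

lemma mean_value_power:
  fixes b b' :: "real \<Rightarrow> complex"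
  assumes "continuous_on {0..} b" "b 0 = 0"
    and "\<And>x. 0 < x \<Longrightarrow> (b has_vector_derivative b' x) (at x)"
    and "\<And>x. 0 < x \<Longrightarrow> x < d \<Longrightarrow> norm (b' x) \<le> C * x ^ N"
    and x: "0 \<le> x" "x < d"
  shows "norm (b x) \<le> C / real (Suc N) * x ^ Suc N"
proof (cases "x = 0")
  case False
  let ?p = "\<lambda>x. C / real (Suc N) * x ^ Suc N"
  have "norm (b x - b 0) \<le> ?p x - ?p 0"
  proof (rule differentiable_bound_general)
    show "0 < x" using x False by simp
    show "continuous_on {0..x} b" using assms(1) by (rule continuous_on_subset) auto
    show "continuous_on {0..x} ?p" by (intro continuous_intros)
    show "(?p has_vector_derivative C * y ^ N) (at y)" for y
    proof -
      have "(?p has_real_derivative C / real (Suc N) * (real (Suc N) * y ^ N)) (at y)"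
        by (rule derivative_eq_intros refl)+ simp
      then show ?thesis by (simp add: has_real_derivative_iff_has_vector_derivative del: of_nat_Suc)
    qed
  qed (use assms in auto)
  then show ?thesis using assms(2) by simp
qed (use assms in auto)

text \<open>Unless \<open>b 0 \<noteq> 0\<close>, either alternative for the derivative passes to \<open>b\<close> by integration.\<close>

lemma order_dichotomy:
  fixes b :: "real \<Rightarrow> complex"
  assumes "smooth_on {0..} b"
  shows "(\<exists>j<N. \<exists>c. c \<noteq> 0 \<and> ((\<lambda>x. b x / of_real x ^ j) \<longlongrightarrow> c) (at_right 0)) \<or>
    (\<exists>C d. d > 0 \<and> (\<forall>x. 0 \<le> x \<and> x < d \<longrightarrow> norm (b x) \<le> C * x ^ N))"
  using assms
proof (induction N arbitrary: b)
  case 0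
  have "continuous_on {0..1} b"
    using smooth_on_continuous[OF 0] by (rule continuous_on_subset) auto
  then have "bounded (b ` {0..1})" by (intro compact_imp_bounded compact_continuous_image) auto
  then obtain C where "\<forall>y\<in>b ` {0..1}. norm y \<le> C" by (auto simp: bounded_pos)
  then show ?case by (intro disjI2 exI[of _ C] exI[of _ 1]) auto
next
  case (Suc N)
  have cont: "continuous_on {0..} b" using Suc.prems by (rule smooth_on_continuous)
  show ?case
  proof (cases "b 0 = 0")
    case False
    have "(b \<longlongrightarrow> b 0) (at 0 within {0..})" using cont by (simp add: continuous_on_def)
    then have "(b \<longlongrightarrow> b 0) (at_right 0)" by (rule tendsto_within_subset) auto
    then show ?thesis using False by (intro disjI1 exI[of _ 0]) auto
  next
    case True
    have D: "(b has_vector_derivative hderiv b x) (at x)" if "0 < x" for x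
      using hderiv_works_interior[OF Suc.prems that] .
    consider (lead) j c where "j < N" "c \<noteq> 0" "((\<lambda>x. hderiv b x / of_real x ^ j) \<longlongrightarrow> c) (at_right 0)"
      | (flat) C d where "d > 0" "\<And>x. 0 \<le> x \<Longrightarrow> x < d \<Longrightarrow> norm (hderiv b x) \<le> C * x ^ N"
      using Suc.IH[OF smooth_on_hderiv[OF Suc.prems]] by blast
    then show ?thesis
    proof cases
      case flat
      then show ?thesis
        using mean_value_power[OF cont True D, of d C N]
        by (intro disjI2 exI[of _ "C / real (Suc N)"] exI[of _ d]) auto
    next
      case lead
      let ?c = "c / of_nat (Suc j)"
      have "((\<lambda>x. b x / of_real x ^ Suc j) \<longlongrightarrow> ?c) (at_right 0)"
      proof (rule tendstoI)
        fix e :: real assume e: "e > 0"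
        then have "\<forall>\<^sub>F x in at_right 0. dist (hderiv b x / of_real x ^ j) c < e / 2"
          using tendstoD[OF lead(3), of "e / 2"] by simp
        then obtain d where d: "d > 0" "\<And>x. 0 < x \<Longrightarrow> x < d \<Longrightarrow> dist (hderiv b x / of_real x ^ j) c < e / 2"
          unfolding eventually_at_right_field by blast
        define g where "g x = b x - ?c * of_real x ^ Suc j" for x
        have g_D: "(g has_vector_derivative hderiv b x - c * of_real x ^ j) (at x)" if "0 < x" for x
        proof -
          have "((\<lambda>z::complex. ?c * z ^ Suc j) has_field_derivative ?c * (of_nat (Suc j) * of_real x ^ j)) (at (of_real x))"
            by (rule derivative_eq_intros refl)+ simp
          then have "((\<lambda>z::complex. ?c * z ^ Suc j) has_field_derivative c * of_real x ^ j) (at (of_real x))"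
            by (simp del: of_nat_Suc)
          from has_vector_derivative_real_field[OF this]
          have "((\<lambda>x::real. ?c * of_real x ^ Suc j) has_vector_derivative c * of_real x ^ j) (at x)"
            by (simp add: o_def)
          then show ?thesis unfolding g_def by (intro has_vector_derivative_diff D that)
        qed
        have g_le: "norm (hderiv b x - c * of_real x ^ j) \<le> e / 2 * x ^ j" if "0 < x" "x < d" for x
        proof -
          have "hderiv b x - c * of_real x ^ j = (hderiv b x / of_real x ^ j - c) * of_real x ^ j"
            using that by (simp add: field_simps)
          then have "norm (hderiv b x - c * of_real x ^ j) = norm (hderiv b x / of_real x ^ j - c) * x ^ j"
            using that by (simp add: norm_mult norm_power)
          also have "\<dots> \<le> e / 2 * x ^ j"
            using d(2)[OF that] that by (intro mult_right_mono) (auto simp: dist_norm)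
          finally show ?thesis .
        qed
        have cont_g: "continuous_on {0..} g" unfolding g_def by (intro continuous_intros cont)
        have g0: "g 0 = 0" using True by (simp add: g_def)
        have "dist (b x / of_real x ^ Suc j) ?c < e" if x: "0 < x" "x < d" for x
        proof -
          have "norm (g x) \<le> e / 2 / real (Suc j) * x ^ Suc j"
            using x by (intro mean_value_power[OF cont_g g0 g_D g_le, of d]) auto
          also have "\<dots> \<le> e / 2 * x ^ Suc j"
            using x e by (intro mult_right_mono) (auto simp: field_simps)
          finally have "norm (g x) \<le> e / 2 * x ^ Suc j" .
          moreover have "b x / of_real x ^ Suc j - ?c = g x / of_real x ^ Suc j"
            using x unfolding g_def by (simp add: diff_divide_distrib)
          ultimately have "norm (b x / of_real x ^ Suc j - ?c) \<le> e / 2"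
            using x by (simp add: norm_divide norm_mult norm_power field_simps)
          then show ?thesis using e by (simp add: dist_norm)
        qed
        then show "\<forall>\<^sub>F x in at_right 0. dist (b x / of_real x ^ Suc j) ?c < e"
          unfolding eventually_at_right_field using d(1) by blast
      qed
      moreover have "?c \<noteq> 0" using lead(2) of_nat_neq_0[of j] by (simp del: of_nat_Suc)
      ultimately show ?thesis using lead(1) by blast
    qed
  qed
qed

context expanding_diffeo
begin

lemma phi_ratio: "((\<lambda>x. \<phi> x / x) \<longlongrightarrow> hderiv \<phi> 0) (at_right 0)"
proof -
  have "(\<phi> has_real_derivative hderiv \<phi> 0) (at 0 within {0..})"
    using hderiv_works[OF Diff_half_smooth[OF phi]] by (simp add: has_real_derivative_iff_has_vector_derivative)
  then have "((\<lambda>x. (\<phi> x - \<phi> 0) / (x - 0)) \<longlongrightarrow> hderiv \<phi> 0) (at 0 within {0..})"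
    by (simp add: has_field_derivative_iff)
  then have "((\<lambda>x. (\<phi> x - \<phi> 0) / (x - 0)) \<longlongrightarrow> hderiv \<phi> 0) (at_right 0)"
    by (rule tendsto_within_subset) auto
  then show ?thesis using Diff_half_0[OF phi] by simp
qed

lemma phi_right: "filterlim \<phi> (at_right 0) (at_right 0)"
proof -
  have "(\<phi> \<longlongrightarrow> \<phi> 0) (at 0 within {0..})"
    using smooth_on_continuous[OF Diff_half_smooth[OF phi]] by (simp add: continuous_on_def)
  then have "(\<phi> \<longlongrightarrow> 0) (at_right 0)"
    using Diff_half_0[OF phi] by (auto intro: tendsto_within_subset)
  moreover have "\<forall>\<^sub>F x in at_right 0. \<phi> x \<in> {0<..}"
    using Diff_half_pos[OF phi] by (auto simp: eventually_at_filter)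
  ultimately show ?thesis by (simp add: filterlim_at eventually_mono)
qed

text \<open>Comparing leading terms at 0 on both sides of the equation.\<close>

lemma K_resonance:
  assumes "b \<in> K_space lam \<phi>" "c \<noteq> 0" and lim: "((\<lambda>x. b x / of_real x ^ j) \<longlongrightarrow> c) (at_right 0)"
  shows "lam = of_real (hderiv \<phi> 0) ^ j"
proof -
  have 1: "((\<lambda>x. b (\<phi> x) / of_real (\<phi> x) ^ j) \<longlongrightarrow> c) (at_right 0)"
    using filterlim_compose[OF lim phi_right] .
  have "((\<lambda>x. b (\<phi> x) / of_real (\<phi> x) ^ j * of_real (\<phi> x / x) ^ j) \<longlongrightarrow> c * of_real (hderiv \<phi> 0) ^ j) (at_right 0)"
    by (intro tendsto_intros 1 phi_ratio)
  moreover have "\<forall>\<^sub>F x in at_right 0. b (\<phi> x) / of_real (\<phi> x) ^ j * of_real (\<phi> x / x) ^ j =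
      lam * (b x / of_real x ^ j)"
    unfolding eventually_at_filter
  proof (rule always_eventually, intro allI impI)
    fix x :: real assume "x \<noteq> 0" "x \<in> {0<..}"
    then have "\<phi> x > 0" "x > 0" "b (\<phi> x) = lam * b x"
      using Diff_half_pos[OF phi] assms(1) by (auto simp: K_space_def)
    then show "b (\<phi> x) / of_real (\<phi> x) ^ j * of_real (\<phi> x / x) ^ j = lam * (b x / of_real x ^ j)"
      by (simp add: field_simps)
  qed
  ultimately have "((\<lambda>x. lam * (b x / of_real x ^ j)) \<longlongrightarrow> c * of_real (hderiv \<phi> 0) ^ j) (at_right 0)"
    by (rule Lim_transform_eventually)
  moreover have "((\<lambda>x. lam * (b x / of_real x ^ j)) \<longlongrightarrow> lam * c) (at_right 0)"
    by (intro tendsto_intros lim)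
  ultimately have "c * of_real (hderiv \<phi> 0) ^ j = lam * c"
    using tendsto_unique trivial_limit_at_right_real by blast
  then show ?thesis using assms(2) by simp
qed

text \<open>Along a backward orbit, \<open>x\<close> decreases at least like \<open>\<kappa> ^ - n\<close> with \<open>\<kappa> > 1\<close>, whereas \<open>b x\<close> decreases exactly
  like \<open>lam ^ - n\<close>. Vanishing to an order \<open>N\<close> with \<open>norm lam < \<kappa> ^ N\<close> is too fast for \<open>b x \<noteq> 0\<close>.\<close>

lemma K_flat_zero:
  assumes "hderiv \<phi> 0 > 1" "norm lam > 1" and b: "b \<in> K_space lam \<phi>"
    and flat: "\<And>N. \<exists>C d. d > 0 \<and> (\<forall>x. 0 \<le> x \<and> x < d \<longrightarrow> norm (b x) \<le> C * x ^ N)"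
  shows "b = 0"
proof -
  obtain \<kappa> where \<kappa>: "1 < \<kappa>" "\<kappa> < hderiv \<phi> 0" using dense assms(1) by blast
  obtain d0 where d0: "d0 > 0" "\<And>x. 0 < x \<Longrightarrow> x < d0 \<Longrightarrow> \<kappa> < \<phi> x / x"
    using order_tendstoD(1)[OF phi_ratio \<kappa>(2)] unfolding eventually_at_right_field by blast
  have eqv: "b (itr n x) = lam powi n * b x" if "x \<ge> 0" for n x
    using b assms(2) that by (intro equivariant_itr[where X = "{0..}"]) (auto simp: K_space_def)
  have small_zero: "b y = 0" if y: "0 < y" "y < d0" for y
  proof -
    have decay: "itr (- int n) y \<le> y / \<kappa> ^ n" for n
    proof (induction n)
      case 0 then show ?case using y by (simp add: itr_0)
    next
      case (Suc n)
      define u where "u = itr (- int (Suc n)) y"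
      have u: "u > 0" "\<phi> u = itr (- int n) y"
        using itr_pos[OF y(1)] phi_itr[of y "- int (Suc n)"] y by (auto simp: u_def)
      have "u < y" using itr_less[OF y(1), of "- int (Suc n)" 0] y by (simp add: u_def itr_0)
      then have "\<kappa> * u < \<phi> u" using d0(2)[OF u(1)] u(1) y by (simp add: field_simps)
      then have "\<kappa> * u \<le> y / \<kappa> ^ n" using Suc u(2) by simp
      then have "u \<le> y / \<kappa> ^ Suc n" using \<kappa> by (simp add: field_simps)
      then show ?case unfolding u_def .
    qed
    obtain N where N: "norm lam < \<kappa> ^ N" using real_arch_pow \<kappa>(1) by blast
    obtain C d where C: "d > 0" "\<And>x. 0 \<le> x \<Longrightarrow> x < d \<Longrightarrow> norm (b x) \<le> C * x ^ N"
      using flat[of N] by blast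
    have C0: "C \<ge> 0"
    proof -
      have "0 \<le> C * (d / 2) ^ N" using C(2)[of "d / 2"] C(1) norm_ge_zero[of "b (d / 2)"] by linarith
      moreover have "(d / 2) ^ N > 0" using C(1) by simp
      ultimately show ?thesis by (metis not_le mult_neg_pos)
    qed
    define r where "r = norm lam / \<kappa> ^ N"
    have r: "0 \<le> r" "r < 1" using N \<kappa> by (auto simp: r_def)
    have "(\<lambda>n. y * (1 / \<kappa>) ^ n) \<longlonglongrightarrow> y * 0"
      using \<kappa> by (intro tendsto_intros LIMSEQ_power_zero) auto
    then have ev: "\<forall>\<^sub>F n in sequentially. y * (1 / \<kappa>) ^ n < d"
      using C(1) by (intro order_tendstoD) auto
    have "\<forall>\<^sub>F n in sequentially. norm (b y) \<le> C * y ^ N * r ^ n"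
    proof (rule eventually_mono[OF ev])
      fix n assume n: "y * (1 / \<kappa>) ^ n < d"
      let ?u = "itr (- int n) y"
      have u: "?u > 0" "?u \<le> y / \<kappa> ^ n" "?u < d"
        using itr_pos[OF y(1)] decay[of n] n by (auto simp: power_one_over field_simps)
      have "b y = lam ^ n * b ?u"
        using eqv[of ?u "int n"] itr_minus(2)[of y "int n"] u y by simp
      then have "norm (b y) = norm lam ^ n * norm (b ?u)" by (simp add: norm_mult norm_power)
      also have "\<dots> \<le> norm lam ^ n * (C * (y / \<kappa> ^ n) ^ N)"
        using C(2)[of ?u] u C0
        by (intro mult_left_mono order.trans[OF C(2)] power_mono) (auto simp: less_imp_le)
      also have "\<dots> = C * y ^ N * r ^ n"
        using \<kappa> by (simp add: r_def power_divide power_mult[symmetric] mult.commute)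
      finally show "norm (b y) \<le> C * y ^ N * r ^ n" .
    qed
    moreover have "(\<lambda>n. C * y ^ N * r ^ n) \<longlonglongrightarrow> C * y ^ N * 0"
      using r by (intro tendsto_intros LIMSEQ_power_zero) auto
    ultimately have "norm (b y) \<le> C * y ^ N * 0"
      by (intro tendsto_lowerbound[of _ _ sequentially]) auto
    then show ?thesis by simp
  qed
  show ?thesis
  proof
    fix x
    show "b x = 0 x"
    proof (cases "x > 0")
      case True
      obtain n :: nat where n: "itr (- int n) x < d0" using itr_small[OF True d0(1)] by blast
      have "b (itr (- int n) x) = 0" using small_zero n itr_pos[OF True] by blast
      then have "b x = 0"
        using eqv[of x "- int n"] True assms(2) by (auto simp: power_int_eq_0_iff)
      then show ?thesis by simp
    next
      case False
      then show ?thesis using K_space_zero[OF b assms(2), of x] by simp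
    qed
  qed
qed

lemma K_leading:
  assumes "hderiv \<phi> 0 > 1" "norm lam > 1" "b \<in> K_space lam \<phi>" "b \<noteq> 0"
  obtains j c where "c \<noteq> 0" "((\<lambda>x. b x / of_real x ^ j) \<longlongrightarrow> c) (at_right 0)"
    "lam = of_real (hderiv \<phi> 0) ^ j"
proof -
  have "smooth_on {0..} b" using assms(3) by (simp add: K_space_def)
  from order_dichotomy[OF this]
  have "\<exists>j c. c \<noteq> 0 \<and> ((\<lambda>x. b x / of_real x ^ j) \<longlongrightarrow> c) (at_right 0)"
    using K_flat_zero[OF assms(1-3)] assms(4) by blast
  then show ?thesis using K_resonance[OF assms(3)] that by blast
qed

lemma hderiv_inverse: "hderiv (itr (- 1)) 0 = 1 / hderiv \<phi> 0"
proof -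
  let ?g = "itr (- 1)"
  have "\<phi> ` {0..} \<subseteq> {0..}" using Diff_half_nonneg[OF phi] by auto
  then have "(?g has_vector_derivative hderiv ?g (\<phi> 0)) (at (\<phi> 0) within \<phi> ` {0..})"
    using hderiv_works[OF itr_smooth[of "- 1"], of "\<phi> 0"] Diff_half_0[OF phi]
    by (auto intro: has_vector_derivative_within_subset)
  from vector_diff_chain_within[OF hderiv_works[OF Diff_half_smooth[OF phi] order_refl] this]
  have "(?g \<circ> \<phi> has_vector_derivative hderiv \<phi> 0 * hderiv ?g 0) (at 0 within {0..})"
    using Diff_half_0[OF phi] by simp
  moreover have "(?g \<circ> \<phi> has_vector_derivative 1) (at 0 within {0..})"
    by (rule has_vector_derivative_transform[OF _ _ has_vector_derivative_id])
      (use itr_phi[of _ "- 1"] itr_0 in auto)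
  ultimately have "hderiv \<phi> 0 * hderiv ?g 0 = 1" using hderiv_unique[OF _ order_refl] by metis
  then show ?thesis using Diff_half_hderiv_pos[OF phi order_refl] by (simp add: field_simps)
qed

text \<open>Near 0, the power of order \<open>m\<close> of a coordinate linearizing the inverse of \<open>\<phi>\<close> solves the equation,
  and the equation itself continues this solution along the orbits.\<close>

lemma K_exists:
  assumes "hderiv \<phi> 0 > 1" "lam = of_real (hderiv \<phi> 0) ^ m"
  obtains b where "b \<in> K_space lam \<phi>" "b \<noteq> 0"
proof -
  let ?g = "itr (- 1)" and ?\<mu> = "hderiv \<phi> 0"
  obtain U g where U: "open U" "0 \<in> U" "smooth_on U g" "\<And>y. y \<in> U \<Longrightarrow> y \<ge> 0 \<Longrightarrow> g y = ?g y"
      "\<And>y. y \<in> U \<Longrightarrow> y \<ge> 0 \<Longrightarrow> (?g has_vector_derivative hderiv ?g y) (at y within {0..})"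
      "\<And>y. y \<in> U \<Longrightarrow> y \<ge> 0 \<Longrightarrow> hderiv ?g y = vector_derivative g (at y)"
    using smooth_on_half_extension[OF itr_smooth[of "- 1"] order_refl] by blast
  have g0: "g 0 = 0" "vector_derivative g (at 0) = 1 / ?\<mu>"
    using U(4)[of 0] U(6)[of 0] U(2) itr_zero hderiv_inverse by auto
  obtain d h where d: "d > 0" and h_smooth: "smooth_on {-d<..<d} h"
    and h: "\<And>x. x \<in> {-d<..<d} \<Longrightarrow> x \<in> U \<and> h (g x) = 1 / ?\<mu> * h x"
    and h_pos: "\<And>x. 0 < x \<Longrightarrow> x < d \<Longrightarrow> h x > 0"
    using linearization_germ[OF U(1,2,3) g0] assms(1) by auto
  have h_eq: "h (?g x) = h x / ?\<mu>" if "0 \<le> x" "x < d" for x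
    using h[of x] U(4)[of x] that by auto
  define B where "B x = (of_real (h x ^ m) :: complex)" for x
  define val where "val n x = lam ^ n * B (itr (- int n) x)" for n x
  have val_Suc: "itr (- int (Suc n)) x < d \<and> val (Suc n) x = val n x"
    if "x \<ge> 0" "itr (- int n) x < d" for n x
  proof -
    let ?y = "itr (- int n) x"
    have y: "?y \<ge> 0" using itr_nonneg[OF that(1)] .
    have gy: "itr (- int (Suc n)) x = ?g ?y" using itr_add[OF that(1), of "- 1" "- int n"] by simp
    have "?g ?y \<le> ?y"
      using itr_less[of ?y "- 1" 0] y itr_0[OF y] itr_zero by (cases "?y = 0") auto
    moreover have "B (?g ?y) = B ?y / lam"
      using h_eq[OF y that(2)] assms(2) by (simp add: B_def power_divide)
    moreover have "lam \<noteq> 0" using assms by simp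
    ultimately show ?thesis using that gy by (simp add: val_def)
  qed
  have val_ge: "itr (- int (n + k)) x < d \<and> val (n + k) x = val n x"
    if "x \<ge> 0" "itr (- int n) x < d" for n k x
  proof (induction k)
    case 0 then show ?case using that by simp
  next
    case (Suc k)
    then show ?case using val_Suc[OF that(1), of "n + k"] by simp
  qed
  define b where "b x = (if x \<ge> 0 then val (LEAST n. itr (- int n) x < d) x else 0)" for x
  have b_eq: "b x = val n x" if "x \<ge> 0" "itr (- int n) x < d" for n x
  proof -
    let ?l = "LEAST n. itr (- int n) x < d"
    have "itr (- int ?l) x < d" using that(2) by (rule LeastI)
    moreover have "?l \<le> n" using that(2) by (rule Least_le)
    ultimately show ?thesis using val_ge[OF that(1), of ?l "n - ?l"] that(1) by (simp add: b_def)
  qed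
  have ex: "\<exists>n::nat. itr (- int n) x < d" if "x \<ge> 0" for x
    using itr_small[OF _ d, of x] that d itr_zero by (cases "x = 0") auto
  have "smooth_on {0..} b"
  proof (rule smooth_on_local)
    fix x :: real assume "x \<in> {0..}"
    then have x: "x \<ge> 0" by simp
    then obtain n where n: "itr (- int n) x < d" using ex by blast
    let ?W = "{0..} \<inter> itr (- int n) -` {..<d}"
    have "openin (top_of_set {0..}) ?W"
      using smooth_on_continuous[OF itr_smooth] by (rule continuous_openin_preimage_gen) auto
    moreover have "smooth_on ?W b"
    proof (rule smooth_on_cong)
      have "smooth_on {-d<..<d} (\<lambda>x. of_real (h x ^ m) :: complex)"
        by (intro smooth_on_linear_compose[OF _ bounded_linear_of_real] smooth_on_power h_smooth)
      then have B: "smooth_on {-d<..<d} B" by (simp add: B_def[abs_def])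
      have sub: "itr (- int n) ` ?W \<subseteq> {-d<..<d}"
      proof
        fix u assume "u \<in> itr (- int n) ` ?W"
        then obtain y where "u = itr (- int n) y" "y \<ge> 0" "itr (- int n) y < d" by auto
        then show "u \<in> {-d<..<d}" using itr_nonneg[of y "- int n"] d by simp
      qed
      have "smooth_on ?W (itr (- int n))"
        using itr_smooth by (rule smooth_on_subset) simp
      from smooth_on_compose[OF this B sub] show "smooth_on ?W (val n)"
        unfolding val_def by (rule smooth_on_cmult)
      show "val n y = b y" if "y \<in> ?W" for y using b_eq[of y n] that by simp
    qed
    ultimately show "\<exists>U. openin (top_of_set {0..}) U \<and> x \<in> U \<and> smooth_on U b"
      using x n by (intro exI[of _ ?W]) auto
  qed
  moreover have "b (\<phi> x) = lam * b x" if x: "x \<ge> 0" for x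
  proof -
    obtain n where n: "itr (- int n) x < d" using ex[OF x] by blast
    have i: "itr (- int (Suc n)) (\<phi> x) = itr (- int n) x" using itr_phi[OF x, of "- int (Suc n)"] by simp
    show ?thesis
      using b_eq[OF x n] b_eq[of "\<phi> x" "Suc n"] i n Diff_half_nonneg[OF phi x] by (simp add: val_def)
  qed
  ultimately have "b \<in> K_space lam \<phi>" by (simp add: K_space_def b_def)
  moreover have "b (d / 2) \<noteq> 0"
  proof -
    have "b (d / 2) = B (d / 2)" using b_eq[of "d / 2" 0] d by (simp add: val_def itr_0)
    then show ?thesis using h_pos[of "d / 2"] d by (simp add: B_def)
  qed
  then have "b \<noteq> 0" by auto
  ultimately show ?thesis using that by blast
qed

text \<open>All nonzero solutions have the order given by the resonance. A combination of two of them in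
  which the leading terms cancel has a larger order, hence vanishes.\<close>

lemma K_case1:
  assumes "hderiv \<phi> 0 > 1" "norm lam > 1"
  shows "fin_dim (K_space lam \<phi>) \<and> cfun.dim (K_space lam \<phi>) =
    (if \<exists>n::nat. lam = of_real (hderiv \<phi> 0) ^ n then 1 else 0)"
proof (cases "\<exists>n::nat. lam = of_real (hderiv \<phi> 0) ^ n")
  case False
  have zero: "K_space lam \<phi> \<subseteq> {0}"
    using K_leading[OF assms] False by blast
  have "0 \<in> K_space lam \<phi>" using cfun.subspace_0[OF subspace_K] .
  then have "K_space lam \<phi> = cfun.span {}" using zero by auto
  moreover have "cfun.dim (cfun.span {}) = card ({} :: (real \<Rightarrow> complex) set)"
    by (rule cfun.dim_span_eq_card_independent) (rule cfun.independent_empty)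
  ultimately show ?thesis using False by (auto simp: fin_dim_def simp del: cfun.span_empty intro!: exI[of _ "{}"])
next
  case True
  then obtain m where m: "lam = of_real (hderiv \<phi> 0) ^ m" by blast
  obtain b0 where b0: "b0 \<in> K_space lam \<phi>" "b0 \<noteq> 0" using K_exists[OF assms(1) m] by blast
  have lead: "\<exists>c. c \<noteq> 0 \<and> ((\<lambda>x. b x / of_real x ^ m) \<longlongrightarrow> c) (at_right 0)"
    if b: "b \<in> K_space lam \<phi>" "b \<noteq> 0" for b
  proof -
    obtain j c where jc: "c \<noteq> 0" "((\<lambda>x. b x / of_real x ^ j) \<longlongrightarrow> c) (at_right 0)"
      "lam = of_real (hderiv \<phi> 0) ^ j" using K_leading[OF assms b] by blast
    then have "(of_real (hderiv \<phi> 0 ^ j) :: complex) = of_real (hderiv \<phi> 0 ^ m)" using m by simp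
    then have "hderiv \<phi> 0 ^ j = hderiv \<phi> 0 ^ m" using of_real_eq_iff by blast
    then have "j = m" using assms(1) power_inject_exp by blast
    then show ?thesis using jc by blast
  qed
  obtain c0 where c0: "c0 \<noteq> 0" "((\<lambda>x. b0 x / of_real x ^ m) \<longlongrightarrow> c0) (at_right 0)" using lead[OF b0] by blast
  have sub: "K_space lam \<phi> \<subseteq> cfun.span {b0}"
  proof
    fix b assume b: "b \<in> K_space lam \<phi>"
    have "\<exists>c. b = cscale c b0"
    proof (cases "b = 0")
      case True then show ?thesis by (intro exI[of _ 0]) (auto simp: cscale_def)
    next
      case False
      then obtain c where c: "((\<lambda>x. b x / of_real x ^ m) \<longlongrightarrow> c) (at_right 0)" using lead b by blast
      define g where "g = b - cscale (c / c0) b0"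
      have g: "g \<in> K_space lam \<phi>"
        unfolding g_def using cfun.subspace_diff[OF subspace_K b cfun.subspace_scale[OF subspace_K b0(1)]] .
      have "((\<lambda>x. b x / of_real x ^ m - (c / c0) * (b0 x / of_real x ^ m)) \<longlongrightarrow> c - (c / c0) * c0) (at_right 0)"
        by (intro tendsto_intros c c0)
      then have "((\<lambda>x. g x / of_real x ^ m) \<longlongrightarrow> 0) (at_right 0)"
        using c0(1) by (simp add: g_def cscale_def diff_divide_distrib)
      then have "g = 0" using lead[OF g] tendsto_unique trivial_limit_at_right_real by blast
      then have "b = cscale (c / c0) b0" by (simp add: g_def)
      then show ?thesis by blast
    qed
    then show "b \<in> cfun.span {b0}" using cfun.span_scale[OF cfun.span_base[of b0 "{b0}"]] by auto
  qed
  moreover have "cfun.span {b0} \<subseteq> K_space lam \<phi>"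
    using b0(1) subspace_K by (intro cfun.span_minimal) auto
  ultimately have K: "K_space lam \<phi> = cfun.span {b0}" by blast
  have "cfun.dim (cfun.span {b0}) = card {b0}"
    using b0(2) by (intro cfun.dim_span_eq_card_independent) simp
  then show ?thesis using True K by (auto simp: fin_dim_def intro: exI[of _ "{b0}"])
qed

end

section \<open>The centralizer is commutative\<close>

context expanding_diffeo
begin

interpretation D: group Diff_half by (rule group_Diff_half)

lemma Z_centralizer_iff:
  "g \<in> carrier (Z_centralizer \<phi>) \<longleftrightarrow> g \<in> carrier Diff_half \<and> (\<forall>x\<ge>0. g (\<phi> x) = \<phi> (g x))"
proof -
  have "g \<otimes>\<^bsub>Diff_half\<^esub> \<phi> = \<phi> \<otimes>\<^bsub>Diff_half\<^esub> g \<longleftrightarrow> (\<forall>x\<ge>0. g (\<phi> x) = \<phi> (g x))"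
    if g: "g \<in> carrier Diff_half"
  proof
    assume "g \<otimes>\<^bsub>Diff_half\<^esub> \<phi> = \<phi> \<otimes>\<^bsub>Diff_half\<^esub> g"
    then have "compose {0..} g \<phi> = compose {0..} \<phi> g" using g phi by (simp add: mult_Diff_half)
    then show "\<forall>x\<ge>0. g (\<phi> x) = \<phi> (g x)" by (metis atLeast_iff compose_eq)
  next
    assume "\<forall>x\<ge>0. g (\<phi> x) = \<phi> (g x)"
    then show "g \<otimes>\<^bsub>Diff_half\<^esub> \<phi> = \<phi> \<otimes>\<^bsub>Diff_half\<^esub> g"
      using g phi by (simp add: mult_Diff_half compose_def fun_eq_iff restrict_def)
  qed
  then show ?thesis by (auto simp: Z_centralizer_def)
qed

lemma Z_centralizer_itr:
  assumes "g \<in> carrier (Z_centralizer \<phi>)" "x \<ge> 0"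
  shows "g (itr n x) = itr n (g x)"
  using assms by (intro commuting_itr) (auto simp: Z_centralizer_iff)

text \<open>The density is the product of the derivatives of the inverse of \<open>\<phi>\<close> along a backward orbit,
  relative to the orbit of 1. It converges because the orbits of two points interlace and so have finite
  total distance. For \<open>g\<close> commuting with \<open>\<phi>\<close>, the chain rule turns the quotient of the products at
  \<open>g x\<close> and \<open>x\<close> into a telescoping one, whose limit involves the derivative of \<open>g\<close> at 0.\<close>

lemma Szekeres_density:
  obtains u :: "real \<Rightarrow> real" where "continuous_on {0<..} u" "\<And>x. x > 0 \<Longrightarrow> u x > 0"
    "\<And>g x. g \<in> carrier (Z_centralizer \<phi>) \<Longrightarrow> x > 0 \<Longrightarrow> u (g x) * hderiv g x = hderiv g 0 * u x"
proof -
  let ?\<psi> = "itr (- 1)"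
  define l where "l x = ln (hderiv ?\<psi> x)" for x
  have pos: "hderiv ?\<psi> x > 0" if "x \<ge> 0" for x using Diff_half_hderiv_pos[OF itr_carrier that] .
  have sm: "smooth_on {0..} (hderiv ?\<psi>)" using smooth_on_hderiv[OF itr_smooth] .
  define l' where "l' x = hderiv (hderiv ?\<psi>) x * inverse (hderiv ?\<psi> x)" for x
  have "smooth_on {0..} l'"
    unfolding l'_def using pos
    by (intro smooth_on_mult smooth_on_hderiv smooth_on_inverse_compose sm) force
  then have l'_cont: "continuous_on {0..} l'" by (rule smooth_on_continuous)
  have l_D: "(l has_real_derivative l' x) (at x within {0..})" if "x \<ge> 0" for x
  proof -
    have "(hderiv ?\<psi> has_real_derivative hderiv (hderiv ?\<psi>) x) (at x within {0..})"
      using hderiv_works[OF sm that] by (simp add: has_real_derivative_iff_has_vector_derivative)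
    then show ?thesis
      unfolding l_def l'_def using pos[OF that]
      by (auto intro!: derivative_eq_intros simp: field_simps)
  qed
  have Lip: "\<exists>C>0. \<forall>x\<in>{0..M}. \<forall>y\<in>{0..M}. \<bar>l x - l y\<bar> \<le> C * \<bar>x - y\<bar>" for M
  proof -
    have "continuous_on {0..M} l'" using l'_cont by (rule continuous_on_subset) auto
    then have "bounded (l' ` {0..M})" by (intro compact_imp_bounded compact_continuous_image) auto
    then obtain C where C: "C > 0" "\<forall>y\<in>l' ` {0..M}. norm y \<le> C" by (auto simp: bounded_pos)
    have "norm (l x - l y) \<le> C * norm (x - y)" if "x \<in> {0..M}" "y \<in> {0..M}" for x y
    proof (rule field_differentiable_bound[of "{0..M}" l l'])
      show "(l has_field_derivative l' z) (at z within {0..M})" if "z \<in> {0..M}" for z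
        using l_D[of z] that by (auto intro: DERIV_subset)
    qed (use C that in auto)
    then show ?thesis using C(1) by auto
  qed
  have c_tendsto: "summable (\<lambda>i. itr (- int i) M - itr (- int (i + k)) M)" if "M > 0" for M k
  proof -
    have "decseq (\<lambda>i. itr (- int i) M)"
      using itr_less[OF that] by (intro decseq_SucI less_imp_le) auto
    moreover have "\<And>i. 0 \<le> itr (- int i) M" using itr_nonneg that by auto
    ultimately obtain L where L: "(\<lambda>i. itr (- int i) M) \<longlonglongrightarrow> L"
      using decseq_convergent by blast
    have "summable (\<lambda>i. itr (- int (i + j)) M - itr (- int (i + Suc j)) M)" for j
      using telescope_summable'[OF LIMSEQ_ignore_initial_segment[OF L, of j]] by simp
    then have "summable (\<lambda>i. \<Sum>j<k. itr (- int (i + j)) M - itr (- int (i + Suc j)) M)"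
      by (intro summable_sum) auto
    moreover have "(\<Sum>j<k. itr (- int (i + j)) M - itr (- int (i + Suc j)) M) =
        itr (- int i) M - itr (- int (i + k)) M" for i
      using sum_lessThan_telescope'[of "\<lambda>j. itr (- int (i + j)) M" k] by simp
    ultimately show ?thesis by simp
  qed
  define t where "t i x = l (itr (- int i) x) - l (itr (- int i) 1)" for i x
  define S where "S x = suminf (\<lambda>i. t i x)" for x
  have unif: "uniform_limit {itr (- int k) M..M} (\<lambda>n x. \<Sum>i<n. t i x) S sequentially"
    if M: "M \<ge> 1" "itr (- int k) M \<le> 1" for M k
  proof -
    obtain C where C: "C > 0" "\<And>x y. x \<in> {0..M} \<Longrightarrow> y \<in> {0..M} \<Longrightarrow> \<bar>l x - l y\<bar> \<le> C * \<bar>x - y\<bar>"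
      using Lip by blast
    let ?m = "itr (- int k) M"
    have m: "?m > 0" using itr_pos M by auto
    have "norm (t i x) \<le> C * (itr (- int i) M - itr (- int (i + k)) M)" if x: "x \<in> {?m..M}" for i x
    proof -
      have mono: "itr (- int i) ?m \<le> itr (- int i) y" "itr (- int i) y \<le> itr (- int i) M"
        if "?m \<le> y" "y \<le> M" for y
        using that m M itr_le_iff by auto
      have bnd: "itr (- int i) y \<in> {0..M}" if "?m \<le> y" "y \<le> M" for y
        using mono[OF that] itr_nonneg[of y "- int i"] itr_less[of M "- int i" 0] M that m itr_0[of M]
        by (cases i) auto
      have "\<bar>t i x\<bar> \<le> C * \<bar>itr (- int i) x - itr (- int i) 1\<bar>"
        unfolding t_def using bnd[of x] bnd[of 1] x M by (intro C(2)) auto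
      also have "\<bar>itr (- int i) x - itr (- int i) 1\<bar> \<le> itr (- int i) M - itr (- int i) ?m"
        using mono[of x] mono[of 1] x M by auto
      also have "itr (- int i) ?m = itr (- int (i + k)) M"
        using itr_add[of M "- int i" "- int k"] M by simp
      finally show ?thesis using C(1) by simp
    qed
    moreover have "summable (\<lambda>i. C * (itr (- int i) M - itr (- int (i + k)) M))"
      using M by (intro summable_mult c_tendsto) auto
    ultimately show ?thesis unfolding S_def by (rule Weierstrass_m_test)
  qed
  have cover: "\<exists>M k. M \<ge> 1 \<and> itr (- int k) M \<le> 1 \<and> x \<in> {itr (- int k) M<..<M}" if x: "x > 0" for x
  proof -
    define M where "M = max 1 x + 1"
    have M: "M > 0" "M \<ge> 1" "M > x" using x by (auto simp: M_def)
    obtain k :: nat where "itr (- int k) M < min 1 x" using itr_small[OF M(1), of "min 1 x"] x by auto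
    then show ?thesis using M by (intro exI[of _ M] exI[of _ k]) auto
  qed
  have t_cont: "continuous_on {0<..} (t i)" for i
  proof -
    have "continuous_on {0..} l" using l_D by (auto intro!: DERIV_continuous_on[of _ l l'])
    then have "continuous_on {0<..} (\<lambda>x. l (itr (- int i) x))"
      by (rule continuous_on_compose2)
        (auto intro: continuous_on_subset[OF smooth_on_continuous[OF itr_smooth]] itr_nonneg)
    then show ?thesis unfolding t_def by (intro continuous_intros)
  qed
  have S_lim: "(\<lambda>n. \<Sum>i<n. t i x) \<longlonglongrightarrow> S x" if x: "x > 0" for x
  proof -
    obtain M k where "M \<ge> 1" "itr (- int k) M \<le> 1" "x \<in> {itr (- int k) M<..<M}" using cover[OF x] by blast
    then show ?thesis using tendsto_uniform_limitI[OF unif, of M k x] by auto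
  qed
  have S_cont: "isCont S x" if x: "x > 0" for x
  proof -
    obtain M k where Mk: "M \<ge> 1" "itr (- int k) M \<le> 1" "x \<in> {itr (- int k) M<..<M}" using cover[OF x] by blast
    let ?I = "{itr (- int k) M<..<M}"
    have sub: "?I \<subseteq> {0<..}" using itr_pos[of M "- int k"] Mk by auto
    have "uniform_limit ?I (\<lambda>n x. \<Sum>i<n. t i x) S sequentially"
      using unif[OF Mk(1,2)] by (rule uniform_limit_on_subset) auto
    then have "continuous_on ?I S"
      by (rule uniform_limit_theorem[rotated])
        (use sub in \<open>auto intro!: always_eventually continuous_on_sum continuous_on_subset[OF t_cont]\<close>)
    then show ?thesis using Mk(3) continuous_on_eq_continuous_at[OF open_greaterThanLessThan] by blast
  qed
  show ?thesis
  proof (rule that[of "\<lambda>x. exp (S x)"])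
    show "continuous_on {0<..} (\<lambda>x. exp (S x))"
      using S_cont by (intro continuous_intros continuous_at_imp_continuous_on) auto
    fix g x assume g: "g \<in> carrier (Z_centralizer \<phi>)" and x: "x > (0::real)"
    have gD: "g \<in> carrier Diff_half" using g by (simp add: Z_centralizer_iff)
    note g_sm = Diff_half_smooth[OF gD]
    define \<gamma> where "\<gamma> y = ln (hderiv g y)" for y
    have g_pos: "hderiv g y > 0" if "y \<ge> 0" for y using Diff_half_hderiv_pos[OF gD that] .
    have chain: "l (g y) - l y = \<gamma> (?\<psi> y) - \<gamma> y" if y: "y > 0" for y
    proof -
      have gy: "g y > 0" and \<psi>y: "?\<psi> y > 0" using Diff_half_pos[OF gD y] itr_pos[OF y] by auto
      have 1: "((\<lambda>y. g (?\<psi> y)) has_vector_derivative hderiv ?\<psi> y * hderiv g (?\<psi> y)) (at y)"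
        using vector_diff_chain_at[OF hderiv_works_interior[OF itr_smooth y] hderiv_works_interior[OF g_sm \<psi>y]]
        by (simp add: o_def)
      have 2: "((\<lambda>y. ?\<psi> (g y)) has_vector_derivative hderiv g y * hderiv ?\<psi> (g y)) (at y)"
        using vector_diff_chain_at[OF hderiv_works_interior[OF g_sm y] hderiv_works_interior[OF itr_smooth gy]]
        by (simp add: o_def)
      have "((\<lambda>y. g (?\<psi> y)) has_vector_derivative hderiv g y * hderiv ?\<psi> (g y)) (at y)"
        by (rule has_vector_derivative_transform_within_open[OF 2, of "{0<..}"])
          (use y Z_centralizer_itr[OF g] in auto)
      then have "hderiv ?\<psi> y * hderiv g (?\<psi> y) = hderiv g y * hderiv ?\<psi> (g y)"
        using vector_derivative_unique_at[OF 1] by blast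
      then have "ln (hderiv ?\<psi> y * hderiv g (?\<psi> y)) = ln (hderiv g y * hderiv ?\<psi> (g y))" by simp
      then show ?thesis
        using pos[of y] pos[of "g y"] g_pos[of y] g_pos[of "?\<psi> y"] y gy \<psi>y
        by (simp add: ln_mult l_def \<gamma>_def)
    qed
    have gx: "g x > 0" using Diff_half_pos[OF gD x] .
    have step: "t i (g x) - t i x = \<gamma> (itr (- int (Suc i)) x) - \<gamma> (itr (- int i) x)" for i
      using chain[OF itr_pos[OF x, of "- int i"]] Z_centralizer_itr[OF g, of x "- int i"] x
        itr_add[of x "- 1" "- int i"] by (simp add: t_def)
    have "(\<Sum>i<n. t i (g x)) - (\<Sum>i<n. t i x) = \<gamma> (itr (- int n) x) - \<gamma> x" for n
      using sum_lessThan_telescope[of "\<lambda>i. \<gamma> (itr (- int i) x)" n] x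
      by (simp add: step itr_0 flip: sum_subtractf)
    then have 1: "(\<lambda>n. \<gamma> (itr (- int n) x) - \<gamma> x) \<longlonglongrightarrow> S (g x) - S x"
      using tendsto_diff[OF S_lim[OF gx] S_lim[OF x]] by simp
    have "continuous_on {0..} \<gamma>"
      unfolding \<gamma>_def using smooth_on_continuous[OF smooth_on_hderiv[OF g_sm]] g_pos
      by (intro continuous_on_ln) force+
    then have "(\<lambda>n. \<gamma> (itr (- int n) x)) \<longlonglongrightarrow> \<gamma> 0"
      by (rule continuous_on_tendsto_compose[OF _ itr_tendsto_0[OF x]])
        (use itr_nonneg[of x] x in \<open>auto intro!: always_eventually\<close>)
    then have "(\<lambda>n. \<gamma> (itr (- int n) x) - \<gamma> x) \<longlonglongrightarrow> \<gamma> 0 - \<gamma> x"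
      by (intro tendsto_diff tendsto_const)
    then have "S (g x) - S x = \<gamma> 0 - \<gamma> x" using LIMSEQ_unique[OF 1] by blast
    then have "exp (S (g x) + \<gamma> x) = exp (\<gamma> 0 + S x)" by (simp add: algebra_simps)
    then show "exp (S (g x)) * hderiv g x = hderiv g 0 * exp (S x)"
      using g_pos[of x] g_pos[of 0] x by (simp add: exp_add \<gamma>_def)
  qed auto
qed

text \<open>In the coordinate obtained by integrating the density, every element of the centralizer is
  affine. All these affine maps commute with the affine map that represents \<open>\<phi>\<close>, which is not the
  identity: they have the same fixed point if it has one, and are translations if it has none.\<close>

lemma Z_centralizer_commute:
  assumes g: "g \<in> carrier (Z_centralizer \<phi>)" and h: "h \<in> carrier (Z_centralizer \<phi>)" and x: "x > 0"
  shows "g (h x) = h (g x)"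
proof -
  obtain u where u: "continuous_on {0<..} u" "\<And>x. x > 0 \<Longrightarrow> u x > 0"
    "\<And>g x. g \<in> carrier (Z_centralizer \<phi>) \<Longrightarrow> x > 0 \<Longrightarrow> u (g x) * hderiv g x = hderiv g 0 * u x"
    using Szekeres_density by blast
  have "\<exists>F. \<forall>x :: real. 0 < ereal x \<longrightarrow> ereal x < \<infinity> \<longrightarrow> (F has_vector_derivative u x) (at x)"
    using u(1) by (intro einterval_antiderivative) (auto simp: continuous_on_eq_continuous_at)
  then obtain U where "\<And>x. x > 0 \<Longrightarrow> (U has_vector_derivative u x) (at x)" by auto
  then have DU: "(U has_real_derivative u x) (at x)" if "x > 0" for x
    using that by (simp add: has_real_derivative_iff_has_vector_derivative)
  have U_mono: "U x < U y" if "0 < x" "x < y" for x y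
  proof (rule DERIV_pos_imp_increasing[OF that(2)])
    fix z assume "x \<le> z" "z \<le> y"
    then show "\<exists>l. (U has_real_derivative l) (at z) \<and> 0 < l"
      using DU[of z] u(2)[of z] that by (intro exI[of _ "u z"]) auto
  qed
  then have U_inj: "x = y" if "U x = U y" "0 < x" "0 < y" for x y
    using that by (metis less_irrefl linorder_neqE_linordered_idom)
  have affine: "\<exists>c. \<forall>x>0. U (g x) = hderiv g 0 * U x + c" if g: "g \<in> carrier (Z_centralizer \<phi>)" for g
  proof -
    have gD: "g \<in> carrier Diff_half" using g by (simp add: Z_centralizer_iff)
    have "((\<lambda>x. U (g x) - hderiv g 0 * U x) has_field_derivative 0) (at x within {0<..})"
      if x: "x \<in> {0<..}" for x
    proof -
      have Dg: "(g has_real_derivative hderiv g x) (at x)"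
        using hderiv_works_interior[OF Diff_half_smooth[OF gD], of x] x
        by (simp add: has_real_derivative_iff_has_vector_derivative)
      have gx: "g x > 0" using Diff_half_pos[OF gD] x by simp
      have "((\<lambda>x. U (g x) - hderiv g 0 * U x) has_field_derivative u (g x) * hderiv g x - hderiv g 0 * u x) (at x)"
        using DERIV_chain2[OF DU[OF gx] Dg] DU[of x] x by (auto intro!: derivative_eq_intros)
      then show ?thesis using u(3)[OF g, of x] x by (simp add: has_field_derivative_at_within)
    qed
    then obtain c where "\<forall>x\<in>{0<..}. U (g x) - hderiv g 0 * U x = c"
      using has_field_derivative_zero_constant[of "{0<..}" "\<lambda>x. U (g x) - hderiv g 0 * U x"]
        convex_real_interval(3)[of "0::real"] by blast
    then show ?thesis by (intro exI[of _ c]) (auto simp: algebra_simps)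
  qed
  have phiZ: "\<phi> \<in> carrier (Z_centralizer \<phi>)" using phi by (simp add: Z_centralizer_iff)
  obtain c where c: "\<And>x. x > 0 \<Longrightarrow> U (g x) = hderiv g 0 * U x + c" using affine[OF g] by blast
  obtain d where d: "\<And>x. x > 0 \<Longrightarrow> U (h x) = hderiv h 0 * U x + d" using affine[OF h] by blast
  obtain t where t: "\<And>x. x > 0 \<Longrightarrow> U (\<phi> x) = hderiv \<phi> 0 * U x + t" using affine[OF phiZ] by blast
  let ?a = "hderiv g 0" and ?b = "hderiv h 0" and ?\<mu> = "hderiv \<phi> 0"
  have pos: "g x > 0" "h x > 0" "\<phi> x > 0" if "x > 0" for x
    using that g h phi Diff_half_pos by (auto simp: Z_centralizer_iff)
  have "g (\<phi> 1) = \<phi> (g 1)" "h (\<phi> 1) = \<phi> (h 1)" using g h by (auto simp: Z_centralizer_iff)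
  then have "U (g (\<phi> 1)) = U (\<phi> (g 1))" "U (h (\<phi> 1)) = U (\<phi> (h 1))" by simp_all
  then have com: "(?a - 1) * t = (?\<mu> - 1) * c" "(?b - 1) * t = (?\<mu> - 1) * d"
    using c[of 1] c[OF pos(3)[of 1]] d[of 1] d[OF pos(3)[of 1]] t[of 1] t[OF pos(1)[of 1]] t[OF pos(2)[of 1]]
    by (simp_all add: algebra_simps)
  have "\<phi> 1 - 1 > 0" using expanding unfolding expanding_def by simp
  then have nontriv: "?\<mu> \<noteq> 1 \<or> t \<noteq> 0" using t[of 1] U_inj[of "\<phi> 1" 1] pos(3)[of 1] by force
  have "(?a - 1) * d = (?b - 1) * c"
  proof (cases "t = 0")
    case True
    then show ?thesis using com nontriv by simp
  next
    case False
    have "((?a - 1) * d) * t = ((?a - 1) * t) * d" by simp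
    also have "\<dots> = ((?\<mu> - 1) * d) * c" unfolding com(1) by simp
    also have "\<dots> = ((?b - 1) * c) * t" unfolding com(2)[symmetric] by simp
    finally show ?thesis using False by simp
  qed
  then have "U (g (h x)) = U (h (g x))"
    using c[OF pos(2)[OF x]] d[OF pos(1)[OF x]] c[OF x] d[OF x] by (simp add: algebra_simps)
  then show ?thesis using U_inj pos x by blast
qed

lemma subgroup_Z_centralizer: "subgroup (carrier (Z_centralizer \<phi>)) Diff_half"
proof
  show "carrier (Z_centralizer \<phi>) \<subseteq> carrier Diff_half" by (auto simp: Z_centralizer_iff)
  show "\<one>\<^bsub>Diff_half\<^esub> \<in> carrier (Z_centralizer \<phi>)"
    using phi by (auto simp: Z_centralizer_def)
  show "f \<otimes>\<^bsub>Diff_half\<^esub> g \<in> carrier (Z_centralizer \<phi>)"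
    if "f \<in> carrier (Z_centralizer \<phi>)" "g \<in> carrier (Z_centralizer \<phi>)" for f g
    using that phi by (simp add: Z_centralizer_def) (metis D.m_assoc)
  show "inv\<^bsub>Diff_half\<^esub> f \<in> carrier (Z_centralizer \<phi>)" if "f \<in> carrier (Z_centralizer \<phi>)" for f
    using that phi by (simp add: Z_centralizer_def) (metis D.inv_closed D.inv_solve_left D.inv_solve_right D.m_closed D.m_assoc)
qed

lemma comm_group_Z_centralizer: "comm_group (Z_centralizer \<phi>)"
proof -
  have eq: "Z_centralizer \<phi> = Diff_half\<lparr>carrier := carrier (Z_centralizer \<phi>)\<rparr>"
    by (simp add: Z_centralizer_def)
  have "group (Z_centralizer \<phi>)"
    using D.subgroup_imp_group[OF subgroup_Z_centralizer] eq by simp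
  moreover have "f \<otimes>\<^bsub>Z_centralizer \<phi>\<^esub> g = g \<otimes>\<^bsub>Z_centralizer \<phi>\<^esub> f"
    if f: "f \<in> carrier (Z_centralizer \<phi>)" and g: "g \<in> carrier (Z_centralizer \<phi>)" for f g
  proof -
    have D: "f \<in> carrier Diff_half" "g \<in> carrier Diff_half" using f g by (auto simp: Z_centralizer_iff)
    have "f (g x) = g (f x)" if "x \<ge> 0" for x
      using Z_centralizer_commute[OF f g, of x] that Diff_half_0[OF D(1)] Diff_half_0[OF D(2)] by (cases "x = 0") auto
    then have "compose {0..} f g = compose {0..} g f" by (auto simp: compose_def fun_eq_iff restrict_def)
    then show ?thesis using D by (simp add: Z_centralizer_def mult_Diff_half)
  qed
  ultimately show ?thesis by (intro group.group_comm_groupI) auto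
qed

end

section \<open>The Hopf construction\<close>

lemma at_within_openin:
  assumes "openin (top_of_set S) U" "x \<in> U"
  shows "at x within U = at x within S"
proof -
  obtain V where "open V" "U = S \<inter> V" using assms(1) by (auto simp: openin_open)
  then show ?thesis using at_within_nhd[of x V U S] assms(2) by auto
qed

lemma ln_power_int: "x > 0 \<Longrightarrow> ln (x powi n) = of_int n * ln (x :: real)"
  by (simp add: ln_powr flip: powr_real_of_int')

lemma reeb_cover_iff: "(z, x) \<in> reeb_cover \<longleftrightarrow> x \<ge> 0 \<and> (z \<noteq> 0 \<or> x \<noteq> 0)"
  by (auto simp: reeb_cover_def)

lemma contractible_reeb_cover: "contractible reeb_cover"
proof (rule starlike_imp_contractible)
  have "closed_segment (0, 1) (z, x) \<subseteq> reeb_cover" if "(z, x) \<in> reeb_cover" for z x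
  proof
    fix p assume "p \<in> closed_segment (0 :: complex, 1 :: real) (z, x)"
    then obtain u where u: "0 \<le> u" "u \<le> 1" "p = (1 - u) *\<^sub>R (0, 1) + u *\<^sub>R (z, x)"
      by (auto simp: closed_segment_def)
    have x: "x \<ge> 0" "z \<noteq> 0 \<or> x \<noteq> 0" using that by (auto simp: reeb_cover_iff)
    have p: "p = (u *\<^sub>R z, (1 - u) + u * x)" using u(3) by simp
    show "p \<in> reeb_cover"
    proof (cases "u = 1")
      case False
      then have "(1 - u) + u * x > 0" using u x by (intro add_pos_nonneg mult_nonneg_nonneg) auto
      then show ?thesis by (simp add: p reeb_cover_iff)
    qed (use p x in \<open>simp add: reeb_cover_iff\<close>)
  qed
  then show "starlike (reeb_cover :: (complex \<times> real) set)"
    unfolding starlike_def by (intro bexI[of _ "(0, 1)"] ballI) (simp_all add: split_paired_all reeb_cover_iff)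
qed

locale hopf = expanding_diffeo +
  fixes lam :: complex
  assumes lam: "norm lam > 1"
begin

abbreviation "proj \<equiv> reeb_proj lam \<phi>"

lemma lam_nz [simp]: "lam \<noteq> 0" using lam by auto

definition T :: "int \<Rightarrow> complex \<times> real \<Rightarrow> complex \<times> real" where
  "T n p = (lam powi n * fst p, itr n (snd p))"

lemma T_pair: "T n (z, x) = (lam powi n * z, itr n x)"
  by (simp add: T_def)

lemma itr_eq_0_iff: "x \<ge> 0 \<Longrightarrow> itr n x = 0 \<longleftrightarrow> x = 0"
  using itr_pos[of x n] itr_zero by (cases "x = 0") auto

lemma T_cover: "p \<in> reeb_cover \<Longrightarrow> T n p \<in> reeb_cover"
  by (cases p) (auto simp: T_pair reeb_cover_iff itr_nonneg itr_eq_0_iff)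

lemma T_0: "p \<in> reeb_cover \<Longrightarrow> T 0 p = p"
  by (cases p) (auto simp: T_pair reeb_cover_iff itr_0)

lemma T_add: "p \<in> reeb_cover \<Longrightarrow> T (m + n) p = T m (T n p)"
  by (cases p) (auto simp: T_pair reeb_cover_iff itr_add power_int_add)

lemma T_minus: "p \<in> reeb_cover \<Longrightarrow> T (- n) (T n p) = p" "p \<in> reeb_cover \<Longrightarrow> T n (T (- n) p) = p"
  using T_add[of p "- n" n] T_add[of p n "- n"] T_0 by auto

lemma hopf_map_funpow: "p \<in> reeb_cover \<Longrightarrow> (hopf_map lam \<phi> ^^ n) p = T (int n) p"
proof (induction n)
  case 0 then show ?case by (simp add: T_0)
next
  case (Suc n)
  have "hopf_map lam \<phi> q = T 1 q" for q by (cases q) (simp add: hopf_map_def T_pair itr_1)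
  then show ?case using Suc T_add[of p 1 "int n"] by simp
qed

lemma proj_eq: "p \<in> reeb_cover \<Longrightarrow> proj p = range (\<lambda>n. T n p)" (is "_ \<Longrightarrow> ?thesis")
proof -
  assume p: "p \<in> reeb_cover"
  show ?thesis
  proof (intro equalityI subsetI)
    fix q assume "q \<in> proj p"
    then obtain n where q: "q \<in> reeb_cover" "(hopf_map lam \<phi> ^^ n) p = q \<or> (hopf_map lam \<phi> ^^ n) q = p"
      by (auto simp: reeb_proj_def)
    then have "q = T (int n) p \<or> q = T (- int n) p"
      using p T_minus(1)[of q "int n"] by (auto simp: hopf_map_funpow)
    then show "q \<in> range (\<lambda>n. T n p)" by blast
  next
    fix q assume "q \<in> range (\<lambda>n. T n p)"
    then obtain n where q: "q = T n p" by blast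
    have "(hopf_map lam \<phi> ^^ nat n) p = q \<or> (hopf_map lam \<phi> ^^ nat (- n)) q = p"
      using p q T_cover[OF p, of n] T_minus(1)[OF p, of n] by (cases "n \<ge> 0") (auto simp: hopf_map_funpow)
    moreover have "q \<in> reeb_cover" using q T_cover[OF p] by simp
    ultimately show "q \<in> proj p" unfolding reeb_proj_def by blast
  qed
qed

lemma proj_T [simp]: "p \<in> reeb_cover \<Longrightarrow> proj (T n p) = proj p"
proof -
  assume p: "p \<in> reeb_cover"
  have "T m p = T (m - n) (T n p)" for m using T_add[OF p, of "m - n" n] by simp
  then have "range (\<lambda>m. T m p) \<subseteq> range (\<lambda>m. T m (T n p))" by blast
  moreover have "T m (T n p) = T (m + n) p" for m using T_add[OF p] by simp
  then have "range (\<lambda>m. T m (T n p)) \<subseteq> range (\<lambda>m. T m p)" by blast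
  ultimately show ?thesis unfolding proj_eq[OF p] proj_eq[OF T_cover[OF p]] by blast
qed

lemma proj_eq_iff:
  assumes "p \<in> reeb_cover" "q \<in> reeb_cover"
  shows "proj p = proj q \<longleftrightarrow> (\<exists>n. q = T n p)"
proof
  assume "proj p = proj q"
  moreover have "q \<in> proj q" using T_0[OF assms(2)] proj_eq[OF assms(2)] by (metis rangeI)
  ultimately show "\<exists>n. q = T n p" using proj_eq[OF assms(1)] by auto
qed (use assms in auto)

lemma T_continuous: "continuous_on reeb_cover (T n)"
proof -
  have "continuous_on {0..} (itr n)" using itr_smooth by (rule smooth_on_continuous)
  then have "continuous_on (reeb_cover :: (complex \<times> real) set) (\<lambda>p. itr n (snd p))"
    by (rule continuous_on_compose2) (auto intro: continuous_intros simp: reeb_cover_def)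
  then show ?thesis unfolding T_def[abs_def] by (intro continuous_intros)
qed

lemma T_smooth: "smooth_on reeb_cover (T n)"
proof -
  have snd: "smooth_on reeb_cover (snd :: complex \<times> real \<Rightarrow> real)"
    by (rule smooth_on_linear) (rule bounded_linear_snd)
  have fst: "smooth_on reeb_cover (fst :: complex \<times> real \<Rightarrow> complex)"
    by (rule smooth_on_linear) (rule bounded_linear_fst)
  have "smooth_on (reeb_cover :: (complex \<times> real) set) (\<lambda>p. itr n (snd p))"
    by (rule smooth_on_compose[OF snd itr_smooth]) (auto simp: reeb_cover_def)
  then show ?thesis unfolding T_def[abs_def] by (intro smooth_on_Pair smooth_on_cmult fst)
qed

text \<open>A positive function multiplied by a constant under the Hopf map separates the translates of
  a point: it gives charts, and its logarithm reduces the lifting of maps to that of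
  functions with values in the circle.\<close>

definition radial :: "real \<Rightarrow> real" where
  "radial = (SOME e. continuous_on {0..} e \<and> e 0 = 0 \<and> (\<forall>x>0. e x > 0) \<and>
     (\<forall>x\<ge>0. e (\<phi> x) = norm lam * e x))"

lemma radial: "continuous_on {0..} radial" "radial 0 = 0" "x > 0 \<Longrightarrow> radial x > 0"
  "x \<ge> 0 \<Longrightarrow> radial (\<phi> x) = norm lam * radial x"
proof -
  have "\<exists>e. continuous_on {0..} e \<and> e 0 = 0 \<and> (\<forall>x>0. e x > 0) \<and> (\<forall>x\<ge>0. e (\<phi> x) = norm lam * e x)"
    by (rule expanding_potential[OF lam]) blast
  from someI_ex[OF this] show "continuous_on {0..} radial" "radial 0 = 0" "x > 0 \<Longrightarrow> radial x > 0"
    "x \<ge> 0 \<Longrightarrow> radial (\<phi> x) = norm lam * radial x"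
    unfolding radial_def by blast+
qed

definition E :: "complex \<times> real \<Rightarrow> real" where "E p = norm (fst p) + radial (snd p)"

lemma E_pos: "p \<in> reeb_cover \<Longrightarrow> E p > 0"
proof (cases p)
  case (Pair z x)
  assume "p \<in> reeb_cover"
  then have "x > 0 \<or> x = 0 \<and> z \<noteq> 0" using Pair by (auto simp: reeb_cover_iff)
  then show ?thesis using radial(2) radial(3)[of x] Pair by (auto simp: E_def add_nonneg_pos)
qed

lemma E_T: "p \<in> reeb_cover \<Longrightarrow> E (T n p) = norm lam powi n * E p"
proof (cases p)
  case (Pair z x)
  assume "p \<in> reeb_cover"
  then have x: "x \<ge> 0" using Pair by (auto simp: reeb_cover_iff)
  have "radial (itr n x) = norm lam powi n * radial x"
    using x radial(4) lam by (intro equivariant_itr[where X = "{0..}"]) auto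
  then show ?thesis by (simp add: Pair T_pair E_def norm_mult norm_power_int algebra_simps)
qed

lemma E_continuous: "continuous_on reeb_cover E"
proof -
  have "continuous_on (reeb_cover :: (complex \<times> real) set) (\<lambda>p. radial (snd p))"
    by (rule continuous_on_compose2[OF radial(1)]) (auto intro: continuous_intros simp: reeb_cover_def)
  then show ?thesis unfolding E_def[abs_def] by (intro continuous_intros)
qed

definition logE :: "complex \<times> real \<Rightarrow> real" where "logE p = ln (E p) / ln (norm lam)"

lemma logE_T: "p \<in> reeb_cover \<Longrightarrow> logE (T n p) = logE p + of_int n"
  using E_pos[of p] lam by (simp add: logE_def E_T ln_mult ln_power_int field_simps)

lemma logE_continuous: "continuous_on reeb_cover logE"
  unfolding logE_def[abs_def] using E_pos lam
  by (intro continuous_intros E_continuous) force+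

lemma T_eq_iff: "p \<in> reeb_cover \<Longrightarrow> T m p = T n p \<longleftrightarrow> m = n"
  using logE_T[of p m] logE_T[of p n] by (metis add_left_cancel of_int_eq_iff)

text \<open>A translate other than the point itself changes \<open>logE\<close> by at least 1.\<close>

lemma reeb_chart_ball: "reeb_chart lam \<phi> {q \<in> reeb_cover. \<bar>logE q - logE p\<bar> < 1 / 2}" (is "reeb_chart _ _ ?U")
  unfolding reeb_chart_def
proof
  have "?U = reeb_cover \<inter> (\<lambda>q. \<bar>logE q - logE p\<bar>) -` {..<1/2}" by auto
  then show "openin (top_of_set reeb_cover) ?U"
    by (auto intro!: continuous_openin_preimage_gen continuous_intros logE_continuous)
  show "inj_on proj ?U"
  proof (rule inj_onI)
    fix q r assume q: "q \<in> ?U" and r: "r \<in> ?U" and "proj q = proj r"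
    then obtain n where n: "r = T n q" using proj_eq_iff by blast
    then have "logE r = logE q + of_int n" using q logE_T by auto
    moreover have "\<bar>logE q - logE p\<bar> < 1 / 2" "\<bar>logE r - logE p\<bar> < 1 / 2" using q r by auto
    ultimately have "\<bar>real_of_int n\<bar> < 1" by linarith
    then have "n = 0" by linarith
    then show "q = r" using n q T_0 by auto
  qed
qed

lemma reeb_chart_subset: "reeb_chart lam \<phi> U \<Longrightarrow> openin (top_of_set reeb_cover) V \<Longrightarrow> V \<subseteq> U \<Longrightarrow> reeb_chart lam \<phi> V"
  by (auto simp: reeb_chart_def intro: inj_on_subset)

subsection \<open>Lifting maps to the cover\<close>

text \<open>By continuity of \<open>logE\<close>, the index of the translate is locally constant.\<close>

lemma two_lifts_local:
  fixes F G :: "'a::metric_space \<Rightarrow> complex \<times> real"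
  assumes "continuous_on U F" "F ` U \<subseteq> reeb_cover" "continuous_on U G" "G ` U \<subseteq> reeb_cover"
    and "\<And>y. y \<in> U \<Longrightarrow> proj (F y) = proj (G y)" and "x \<in> U"
  shows "\<exists>n V. openin (top_of_set U) V \<and> x \<in> V \<and> (\<forall>y\<in>V. F y = T n (G y))"
proof -
  define k where "k y = logE (F y) - logE (G y)" for y
  have k: "continuous_on U k"
    unfolding k_def using assms
    by (intro continuous_intros continuous_on_compose2[OF logE_continuous]) auto
  have ex: "\<exists>n::int. F y = T n (G y) \<and> k y = of_int n" if y: "y \<in> U" for y
  proof -
    have c: "F y \<in> reeb_cover" "G y \<in> reeb_cover" using assms(2,4) y by auto
    then obtain n where "F y = T n (G y)" using proj_eq_iff[OF c(2,1)] assms(5)[OF y] by auto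
    then show ?thesis using logE_T[OF c(2)] by (auto simp: k_def)
  qed
  obtain n :: int where n: "F x = T n (G x)" "k x = of_int n" using ex[OF assms(6)] by blast
  define V where "V = U \<inter> k -` {k x - 1 <..< k x + 1}"
  have "openin (top_of_set U) V"
    unfolding V_def using k by (rule continuous_openin_preimage_gen) auto
  moreover have "F y = T n (G y)" if y: "y \<in> V" for y
  proof -
    obtain m :: int where m: "F y = T m (G y)" "k y = of_int m" using ex[of y] y unfolding V_def by blast
    have "\<bar>real_of_int m - real_of_int n\<bar> < 1" using m(2) n(2) that by (auto simp: V_def)
    then have "m = n" by linarith
    then show ?thesis using m by simp
  qed
  moreover have "x \<in> V" using assms(6) by (simp add: V_def)
  ultimately show ?thesis by blast
qed

lemma two_lifts:
  fixes F G :: "'a::metric_space \<Rightarrow> complex \<times> real"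
  assumes "connected U" "continuous_on U F" "F ` U \<subseteq> reeb_cover" "continuous_on U G" "G ` U \<subseteq> reeb_cover"
    and "\<And>y. y \<in> U \<Longrightarrow> proj (F y) = proj (G y)"
  shows "\<exists>n. \<forall>y\<in>U. F y = T n (G y)"
proof -
  define k where "k y = logE (F y) - logE (G y)" for y
  have k: "continuous_on U k"
    unfolding k_def using assms
    by (intro continuous_intros continuous_on_compose2[OF logE_continuous]) auto
  have ex: "\<exists>n::int. F y = T n (G y) \<and> k y = of_int n" if y: "y \<in> U" for y
  proof -
    have c: "F y \<in> reeb_cover" "G y \<in> reeb_cover" using assms(3,5) y by auto
    then obtain n where "F y = T n (G y)" using proj_eq_iff[OF c(2,1)] assms(6)[OF y] by auto
    then show ?thesis using logE_T[OF c(2)] by (auto simp: k_def)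
  qed
  have "k constant_on U"
  proof (rule continuous_discrete_range_constant[OF assms(1) k])
    fix x assume x: "x \<in> U"
    show "\<exists>e>0. \<forall>y. y \<in> U \<and> k y \<noteq> k x \<longrightarrow> e \<le> norm (k y - k x)"
    proof (intro exI[of _ 1] conjI allI impI)
      fix y assume y: "y \<in> U \<and> k y \<noteq> k x"
      obtain m n :: int where "k x = of_int m" "k y = of_int n" using ex x y by blast
      then have "k y - k x = real_of_int (n - m)" "n - m \<noteq> 0" using y by auto
      then have "norm (k y - k x) = of_int \<bar>n - m\<bar>" "\<bar>n - m\<bar> \<ge> 1" by auto
      then show "1 \<le> norm (k y - k x)" by (metis of_int_1_le_iff)
    qed auto
  qed
  then obtain c where c: "\<And>y. y \<in> U \<Longrightarrow> k y = c" unfolding constant_on_def by blast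
  show ?thesis
  proof (cases "U = {}")
    case False
    then obtain x where x: "x \<in> U" by auto
    then obtain n :: int where n: "c = of_int n" using ex[OF x] c by auto
    have "F y = T n (G y)" if y: "y \<in> U" for y
    proof -
      obtain m :: int where "F y = T m (G y)" "k y = of_int m" using ex[OF y] by blast
      then show ?thesis using c[OF y] n by auto
    qed
    then show ?thesis by blast
  qed auto
qed

text \<open>For a contractible source, the circle-valued function \<open>exp (2 \<pi> \<i> logE)\<close> of the image, which
  is well defined on the quotient, has a continuous real logarithm; it selects one point of each orbit.\<close>

lemma lifting:
  fixes h :: "'a::real_normed_vector \<Rightarrow> (complex \<times> real) set"
  assumes "contractible S"
    and local: "\<And>x. x \<in> S \<Longrightarrow> \<exists>U G. openin (top_of_set S) U \<and> x \<in> U \<and> continuous_on U G \<and>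
       G ` U \<subseteq> reeb_cover \<and> (\<forall>y\<in>U. h y = proj (G y))"
  obtains F where "continuous_on S F" "F ` S \<subseteq> reeb_cover" "\<And>x. x \<in> S \<Longrightarrow> h x = proj (F x)"
proof -
  let ?c = "\<lambda>t::real. exp (2 * of_real pi * \<i> * of_real t) :: complex"
  define rep where "rep P = (SOME q. q \<in> reeb_cover \<and> proj q = P)" for P
  define cc where "cc x = ?c (logE (rep (h x)))" for x
  have cc_eq: "cc x = ?c (logE q)" if hq: "h x = proj q" "q \<in> reeb_cover" for x q
  proof -
    have "rep (h x) \<in> reeb_cover \<and> proj (rep (h x)) = h x"
      unfolding rep_def by (rule someI[of _ q]) (use hq in auto)
    then have r: "rep (h x) \<in> reeb_cover" and "proj (rep (h x)) = proj q" using hq by auto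
    then obtain n where "q = T n (rep (h x))" using proj_eq_iff[OF r hq(2)] by blast
    then have eq: "logE q = logE (rep (h x)) + of_int n" using logE_T[OF r] by simp
    have "?c (of_int n) = 1" by (simp add: exp_eq_1)
    then show ?thesis unfolding cc_def eq of_real_add distrib_left exp_add by simp
  qed
  have "continuous_on S cc"
    unfolding continuous_on_eq_continuous_within
  proof (rule ballI)
    fix x assume x: "x \<in> S"
    obtain U G where U: "openin (top_of_set S) U" "x \<in> U" "continuous_on U G"
      "G ` U \<subseteq> reeb_cover" "\<forall>y\<in>U. h y = proj (G y)" using local[OF x] by blast
    have "continuous_on U (\<lambda>y. ?c (logE (G y)))"
      by (intro continuous_intros continuous_on_compose2[OF logE_continuous U(3,4)])
    then have "continuous (at x within U) (\<lambda>y. ?c (logE (G y)))" using U(2) by (simp add: continuous_on_eq_continuous_within)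
    then have "continuous (at x within S) (\<lambda>y. ?c (logE (G y)))"
      using at_within_openin[OF U(1,2)] by simp
    then show "continuous (at x within S) cc"
    proof (rule continuous_transform_within_openin[OF _ U(1,2)])
      show "?c (logE (G y)) = cc y" if "y \<in> U" for y
        using cc_eq[of y "G y"] U(4,5) that by auto
    qed
  qed
  then obtain g where g: "continuous_on S g" "\<And>x. x \<in> S \<Longrightarrow> cc x = exp (g x)"
    using continuous_logarithm_on_contractible[OF _ assms(1), of cc] by (auto simp: cc_def)
  define s where "s x = Im (g x) / (2 * pi)" for x
  have s_cont: "continuous_on S s" unfolding s_def by (intro continuous_intros g(1)) auto
  have s_eq: "cc x = ?c (s x)" if "x \<in> S" for x
  proof -
    have "norm (exp (g x)) = 1" using g(2)[OF that] by (simp add: cc_def norm_exp_eq_Re flip: g(2)[OF that])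
    then have "Re (g x) = 0" by simp
    then have "g x = 2 * of_real pi * \<i> * of_real (s x)" by (simp add: s_def complex_eq_iff)
    then show ?thesis using g(2)[OF that] by simp
  qed
  have ex: "\<exists>q. q \<in> reeb_cover \<and> h x = proj q \<and> logE q = s x" if x: "x \<in> S" for x
  proof -
    obtain q where q: "q \<in> reeb_cover" "h x = proj q" using local[OF x] by blast
    have "?c (logE q) = ?c (s x)" using cc_eq[OF q(2,1)] s_eq[OF x] by simp
    then obtain n :: int where "2 * of_real pi * \<i> * of_real (s x) =
        2 * of_real pi * \<i> * of_real (logE q) + (of_int (2 * n) * pi) * \<i>"
      unfolding exp_eq by (metis exp_eq)
    then have "2 * pi * s x = 2 * pi * logE q + 2 * of_int n * pi" by (simp add: complex_eq_iff)
    also have "\<dots> = 2 * pi * (logE q + of_int n)" by (simp add: algebra_simps)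
    finally have "s x = logE q + of_int n" by simp
    then show ?thesis using q T_cover logE_T by (intro exI[of _ "T n q"]) auto
  qed
  define F where "F x = (SOME q. q \<in> reeb_cover \<and> h x = proj q \<and> logE q = s x)" for x
  have F: "F x \<in> reeb_cover" "h x = proj (F x)" "logE (F x) = s x" if "x \<in> S" for x
    using someI_ex[OF ex[OF that]] unfolding F_def by auto
  have "continuous_on S F"
    unfolding continuous_on_eq_continuous_within
  proof (rule ballI)
    fix x assume x: "x \<in> S"
    obtain U G where U: "openin (top_of_set S) U" "x \<in> U" "continuous_on U G"
      "G ` U \<subseteq> reeb_cover" "\<forall>y\<in>U. h y = proj (G y)" using local[OF x] by blast
    have US: "U \<subseteq> S" using U(1) openin_imp_subset by blast
    define k where "k y = s y - logE (G y)" for y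
    have k: "continuous_on U k"
      unfolding k_def using U US
      by (intro continuous_intros continuous_on_subset[OF s_cont] continuous_on_compose2[OF logE_continuous]) auto
    have int: "\<exists>n::int. F y = T n (G y) \<and> k y = of_int n" if "y \<in> U" for y
    proof -
      have c: "F y \<in> reeb_cover" "G y \<in> reeb_cover" "proj (F y) = proj (G y)" "y \<in> S"
        using U(4,5) US F[of y] that by auto
      then obtain n where "F y = T n (G y)" using proj_eq_iff by metis
      then show ?thesis using logE_T[OF c(2)] F(3)[OF c(4)] by (auto simp: k_def)
    qed
    obtain n :: int where n: "k x = of_int n" using int U(2) by blast
    define V where "V = U \<inter> k -` {k x - 1 <..< k x + 1}"
    have "openin (top_of_set U) V"
      unfolding V_def using k by (rule continuous_openin_preimage_gen) auto
    then have V: "openin (top_of_set S) V" "x \<in> V" using U(1,2) openin_trans by (auto simp: V_def)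
    have FT: "T n (G y) = F y" if y: "y \<in> V" for y
    proof -
      obtain m :: int where m: "F y = T m (G y)" "k y = of_int m" using int[of y] y unfolding V_def by blast
      have "\<bar>real_of_int m - real_of_int n\<bar> < 1" using m(2) n that by (auto simp: V_def)
      then have "m = n" by linarith
      then show ?thesis using m by simp
    qed
    have "continuous_on U (\<lambda>y. T n (G y))"
      by (rule continuous_on_compose2[OF T_continuous U(3,4)])
    then have "continuous (at x within U) (\<lambda>y. T n (G y))" using U(2) by (simp add: continuous_on_eq_continuous_within)
    then have "continuous (at x within S) (\<lambda>y. T n (G y))"
      using at_within_openin[OF U(1,2)] by simp
    then show "continuous (at x within S) F"
      by (rule continuous_transform_within_openin[OF _ V]) (rule FT)
  qed
  then show ?thesis using that[of F] F by blast
qed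

end

section \<open>Two consequences of Liouville's theorem\<close>

text \<open>The reciprocal of the difference quotient at 0 is entire and grows at most linearly, since by
  injectivity values far from 0 avoid a neighbourhood of \<open>f 0\<close>; being without zeros it is constant.\<close>

lemma injective_entire_affine:
  assumes hol: "f holomorphic_on UNIV" and inj: "inj f"
  obtains a b where "a \<noteq> 0" "\<And>z. f z = a * z + b"
proof -
  define q where "q z = (if z = 0 then deriv f 0 else (f z - f 0) / (z - 0))" for z
  have q_hol: "q holomorphic_on UNIV"
    unfolding q_def using pole_lemma[OF hol, of 0] by simp
  have q_nz: "q z \<noteq> 0" for z
    using holomorphic_injective_imp_regular[OF hol open_UNIV inj, of 0] inj by (auto simp: q_def inj_def)
  have p_hol: "(\<lambda>z. inverse (q z)) holomorphic_on UNIV"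
    using q_hol q_nz by (intro holomorphic_intros) auto
  have "open (f ` ball 0 1)"
    using open_mapping_thm3[of f "ball 0 1"] hol inj by (auto intro: holomorphic_on_subset inj_on_subset)
  then obtain r where r: "r > 0" "ball (f 0) r \<subseteq> f ` ball 0 1"
    using open_contains_ball[of "f ` ball 0 1"] by (metis centre_in_ball imageI zero_less_one)
  have bound: "norm (inverse (q z)) \<le> (1 / r) * norm z ^ 1" if "1 \<le> norm z" for z
  proof -
    have "f z \<notin> f ` ball 0 1" using that by (simp add: inj_image_mem_iff[OF inj])
    then have "f z \<notin> ball (f 0) r" using r(2) by blast
    then have "norm (f z - f 0) \<ge> r" by (simp add: dist_norm norm_minus_commute)
    then have "norm z / norm (f z - f 0) \<le> norm z / r" using r(1) by (intro frac_le) auto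
    moreover have "z \<noteq> 0" using that by auto
    ultimately show ?thesis by (simp add: q_def norm_divide)
  qed
  define c0 where "c0 = inverse (q 0)"
  define c1 where "c1 = deriv (\<lambda>z. inverse (q z)) 0"
  have eq: "inverse (q z) = c0 + c1 * z" for z
    using Liouville_polynomial[OF p_hol bound, where \<xi> = z] by (simp add: c0_def c1_def)
  have "c1 = 0"
  proof (rule ccontr)
    assume "c1 \<noteq> 0"
    then have "inverse (q (- c0 / c1)) = 0" by (simp add: eq)
    then show False using q_nz by simp
  qed
  then have "q z = inverse c0" for z using eq[of z] by (metis add.right_neutral inverse_inverse_eq mult_zero_left)
  then have *: "q z = inverse c0" for z .
  have "f z = inverse c0 * z + f 0" for z
  proof (cases "z = 0")
    case False
    then have "(f z - f 0) / z = inverse c0" using *[of z] by (simp add: q_def)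
    then have "f z - f 0 = inverse c0 * z" using False by (simp add: nonzero_divide_eq_eq)
    then show ?thesis by (simp add: algebra_simps)
  qed simp
  moreover have "inverse c0 \<noteq> 0" using q_nz by (simp add: c0_def)
  ultimately show ?thesis using that by blast
qed

lemma multiplicatively_periodic_constant:
  fixes lam :: complex
  assumes lam: "norm lam > 1" and hol: "g holomorphic_on - {0}"
    and per: "\<And>z. z \<noteq> 0 \<Longrightarrow> g (lam * z) = g z"
  obtains c where "\<And>z. z \<noteq> 0 \<Longrightarrow> g z = c"
proof -
  have pow: "g (lam powi k * z) = g z" if z: "z \<noteq> 0" for k z
  proof -
    have nz: "lam \<noteq> 0" using lam by auto
    have nat: "g (lam ^ n * z) = g z" if "z \<noteq> 0" for n z
    proof (induction n)
      case (Suc n)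
      then show ?case using per[of "lam ^ n * z"] nz that by (simp add: mult.assoc)
    qed simp
    show ?thesis
    proof (cases k)
      case (nonneg n) then show ?thesis using nat z by simp
    next
      case (neg n)
      have "g (lam ^ Suc n * (lam powi k * z)) = g (lam powi k * z)"
        by (rule nat) (use nz z in simp)
      moreover have "lam ^ Suc n * (lam powi k * z) = z"
      proof -
        have "lam powi (int (Suc n)) * lam powi k = lam powi (int (Suc n) + k)"
          using nz by (simp add: power_int_add del: of_nat_Suc)
        also have "\<dots> = 1" using neg by simp
        finally show ?thesis by (simp only: power_int_of_nat mult.assoc[symmetric] mult_1)
      qed
      ultimately show ?thesis by (simp only:)
    qed
  qed
  let ?A = "cball (0 :: complex) (norm lam) - ball 0 1"
  have A: "compact ?A" "?A \<subseteq> - {0}" using compact_diff[OF compact_cball open_ball] by auto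
  have "continuous_on ?A g"
    using holomorphic_on_imp_continuous_on[OF hol] A(2) by (rule continuous_on_subset)
  then have "bounded (g ` ?A)" using A(1) by (intro compact_imp_bounded compact_continuous_image)
  then obtain B where B: "\<forall>z\<in>?A. norm (g z) \<le> B" unfolding bounded_iff by blast
  have bound: "norm (g z) \<le> B" if z: "z \<noteq> 0" for z
  proof -
    define k where "k = - \<lfloor>log (norm lam) (norm z)\<rfloor>"
    define y where "y = log (norm lam) (norm z) + of_int k"
    have y: "0 \<le> y" "y < 1" unfolding y_def k_def by linarith+
    have "norm (lam powi k * z) = norm lam powr y"
    proof -
      have "norm lam powr log (norm lam) (norm z) = norm z" using z lam by (intro powr_log_cancel) auto
      moreover have "norm lam powr of_int k = norm lam powi k" using lam by (intro powr_real_of_int') auto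
      ultimately show ?thesis by (simp add: norm_mult norm_power_int y_def powr_add)
    qed
    moreover have "norm lam powr 0 \<le> norm lam powr y" by (rule powr_mono) (use y lam in auto)
    moreover have "norm lam powr y \<le> norm lam powr 1" by (rule powr_mono) (use y lam in auto)
    moreover have "lam \<noteq> 0" using lam by auto
    ultimately have "lam powi k * z \<in> ?A" using lam by auto
    then show ?thesis using B pow[OF z, of k] by metis
  qed
  have "(\<lambda>w. g (exp w)) holomorphic_on UNIV"
    by (rule holomorphic_on_compose_gen[OF holomorphic_on_exp hol, of UNIV, unfolded o_def]) auto
  moreover have "norm (g (exp w)) \<le> B" for w using bound[of "exp w"] by simp
  then have "bounded (range (\<lambda>w. g (exp w)))" unfolding bounded_iff by blast
  ultimately have "(\<lambda>w. g (exp w)) constant_on UNIV" by (rule Liouville_theorem)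
  then obtain c where c: "\<And>w. g (exp w) = c" unfolding constant_on_def by blast
  have "g z = c" if "z \<noteq> 0" for z using c[of "Ln z"] that by simp
  then show ?thesis using that by blast
qed

section \<open>Lifts of automorphisms\<close>

context hopf
begin

lemma reeb_iff: "P \<in> reeb lam \<phi> \<longleftrightarrow> (\<exists>p\<in>reeb_cover. P = proj p)"
  by (auto simp: reeb_def)

lemma connected_reeb_cover: "connected (reeb_cover :: (complex \<times> real) set)"
  using contractible_reeb_cover by (rule contractible_imp_connected)

lemma reeb_smooth_lift:
  assumes "reeb_smooth lam \<phi> f"
  obtains F where "continuous_on reeb_cover F" "F ` reeb_cover \<subseteq> reeb_cover" "smooth_on reeb_cover F"
    "\<And>p. p \<in> reeb_cover \<Longrightarrow> f (proj p) = proj (F p)"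
proof -
  have local: "\<exists>U G. openin (top_of_set reeb_cover) U \<and> p \<in> U \<and> smooth_on U G \<and>
      G ` U \<subseteq> reeb_cover \<and> (\<forall>q\<in>U. f (proj q) = proj (G q))" if "p \<in> reeb_cover" for p
  proof -
    obtain U V G where U: "reeb_chart lam \<phi> U" "p \<in> U" "reeb_chart lam \<phi> V" "G ` U \<subseteq> V" "smooth_on U G"
      "\<forall>q\<in>U. f (proj q) = proj (G q)" using assms \<open>p \<in> reeb_cover\<close> unfolding reeb_smooth_def by blast
    then have "V \<subseteq> reeb_cover" by (auto simp: reeb_chart_def dest: openin_imp_subset)
    then show ?thesis using U by (intro exI[of _ U] exI[of _ G]) (auto simp: reeb_chart_def)
  qed
  have "\<exists>U G. openin (top_of_set reeb_cover) U \<and> p \<in> U \<and> continuous_on U G \<and>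
      G ` U \<subseteq> reeb_cover \<and> (\<forall>q\<in>U. (f \<circ> proj) q = proj (G q))" if "p \<in> reeb_cover" for p
    using local[OF that] smooth_on_continuous unfolding o_def by blast
  from lifting[OF contractible_reeb_cover this] obtain F where
    F: "continuous_on reeb_cover F" "F ` reeb_cover \<subseteq> reeb_cover"
      "\<And>p. p \<in> reeb_cover \<Longrightarrow> (f \<circ> proj) p = proj (F p)" by blast
  have "smooth_on reeb_cover F"
  proof (rule smooth_on_local)
    fix p :: "complex \<times> real" assume p: "p \<in> reeb_cover"
    obtain U G where U: "openin (top_of_set reeb_cover) U" "p \<in> U" "smooth_on U G"
      "G ` U \<subseteq> reeb_cover" "\<forall>q\<in>U. f (proj q) = proj (G q)" using local[OF p] by metis
    have sub: "U \<subseteq> reeb_cover" using U(1) by (rule openin_imp_subset)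
    have eq: "proj (F q) = proj (G q)" if "q \<in> U" for q using F(3)[of q] U(5) that sub by auto
    have FU: "continuous_on U F" "F ` U \<subseteq> reeb_cover"
      using continuous_on_subset[OF F(1) sub] F(2) sub by auto
    obtain n V where V: "openin (top_of_set U) V" "p \<in> V" "\<forall>q\<in>V. F q = T n (G q)"
      using two_lifts_local[OF FU smooth_on_continuous[OF U(3)] U(4) eq U(2)] by blast
    have VU: "V \<subseteq> U" using V(1) by (rule openin_imp_subset)
    have "smooth_on V G" using U(3) VU by (rule smooth_on_subset)
    then have "smooth_on V (\<lambda>q. T n (G q))"
      by (rule smooth_on_compose[OF _ T_smooth]) (use U(4) VU in blast)
    then have "smooth_on V F" by (rule smooth_on_cong) (simp add: V(3))
    moreover have "openin (top_of_set reeb_cover) V" using V(1) U(1) by (rule openin_trans)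
    ultimately show "\<exists>V. openin (top_of_set reeb_cover) V \<and> p \<in> V \<and> smooth_on V F" using V(2) by blast
  qed
  then show ?thesis using that F by auto
qed

definition level :: "real \<Rightarrow> complex set" where "level x = (if x = 0 then - {0} else UNIV)"

lemma level_iff: "x \<ge> 0 \<Longrightarrow> z \<in> level x \<longleftrightarrow> (z, x) \<in> reeb_cover"
  by (auto simp: level_def reeb_cover_iff)

lemma open_level: "open (level x)" and connected_level: "connected (level x)"
  by (auto simp: level_def intro: connected_punctured_universe)

text \<open>A lift is holomorphic along the levels and maps each level into a level, because
  locally it is a translate of a holomorphic map between levels.\<close>

lemma lift_on_level:
  assumes F: "continuous_on reeb_cover F" "F ` reeb_cover \<subseteq> reeb_cover"
      "\<And>p. p \<in> reeb_cover \<Longrightarrow> f (proj p) = proj (F p)"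
    and hol: "leaf_holomorphic lam \<phi> x f" and x: "x \<ge> 0"
  shows "(\<lambda>z. fst (F (z, x))) holomorphic_on level x"
    and "z \<in> level x \<Longrightarrow> w \<in> level x \<Longrightarrow> snd (F (z, x)) = snd (F (w, x))"
proof -
  have local: "\<exists>V h c. open V \<and> z \<in> V \<and> h holomorphic_on V \<and> (\<forall>w\<in>V. F (w, x) = (h w, c))"
    if z: "z \<in> level x" for z
  proof -
    have zx: "(z, x) \<in> reeb_cover" using z x by (simp add: level_iff)
    then obtain W y W' g where W: "leaf_chart lam \<phi> x W" "z \<in> W" "leaf_chart lam \<phi> y W'" "g ` W \<subseteq> W'"
      "g holomorphic_on W" "\<forall>w\<in>W. f (proj (w, x)) = proj (g w, y)"
      using hol unfolding leaf_holomorphic_def by blast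
    have Wc: "open W" "\<And>w. w \<in> W \<Longrightarrow> (w, x) \<in> reeb_cover" "\<And>w. w \<in> W' \<Longrightarrow> (w, y) \<in> reeb_cover"
      using W(1,3) by (auto simp: leaf_chart_def)
    have g: "(\<lambda>w. (g w, y)) ` W \<subseteq> reeb_cover" using Wc W(4) by auto
    have 1: "continuous_on W (\<lambda>w. F (w, x))"
      by (rule continuous_on_compose2[OF F(1)]) (auto intro!: continuous_intros Wc)
    have 2: "(\<lambda>w. F (w, x)) ` W \<subseteq> reeb_cover" using F(2) Wc by auto
    have 3: "continuous_on W (\<lambda>w. (g w, y))"
      using holomorphic_on_imp_continuous_on[OF W(5)] by (intro continuous_intros)
    have 4: "proj (F (w, x)) = proj (g w, y)" if "w \<in> W" for w using F(3)[OF Wc(2)] W(6) that by auto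
    obtain n V where V: "openin (top_of_set W) V" "z \<in> V" "\<forall>w\<in>V. F (w, x) = T n (g w, y)"
      using two_lifts_local[OF 1 2 3 g 4 W(2)] by blast
    have VW: "V \<subseteq> W" "open V" using V(1) Wc(1) openin_imp_subset openin_open_trans by blast+
    have "(\<lambda>w. lam powi n * g w) holomorphic_on V"
      using W(5) VW(1) by (intro holomorphic_intros) (rule holomorphic_on_subset)
    then show ?thesis
      using V VW by (intro exI[of _ V] exI[of _ "\<lambda>w. lam powi n * g w"] exI[of _ "itr n y"]) (auto simp: T_pair)
  qed
  show "(\<lambda>z. fst (F (z, x))) holomorphic_on level x"
  proof -
    have "(\<lambda>z. fst (F (z, x))) field_differentiable (at z)" if "z \<in> level x" for z
    proof -
      obtain V h c where V: "open V" "z \<in> V" "h holomorphic_on V" "\<forall>w\<in>V. F (w, x) = (h w, c)"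
        using local[OF \<open>z \<in> level x\<close>] by blast
      have "(\<lambda>w. fst (F (w, x))) holomorphic_on V"
        using V(3) by (rule holomorphic_transform) (use V(4) in auto)
      then show ?thesis using V(1,2) holomorphic_on_imp_differentiable_at by blast
    qed
    then show ?thesis by (simp add: holomorphic_on_def field_differentiable_at_within)
  qed
  assume zw: "z \<in> level x" "w \<in> level x"
  have D: "((\<lambda>z. snd (F (z, x))) has_derivative (\<lambda>h. 0)) (at z)" if "z \<in> level x" for z
  proof -
    obtain V h c where V: "open V" "z \<in> V" "h holomorphic_on V" "\<forall>w\<in>V. F (w, x) = (h w, c)"
      using local[OF \<open>z \<in> level x\<close>] by blast
    show ?thesis
      by (rule has_derivative_transform_within_open[OF has_derivative_const V(1,2)]) (use V(4) in auto)
  qed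
  show "snd (F (z, x)) = snd (F (w, x))"
    by (rule has_derivative_zero_unique_connected[OF open_level connected_level D zw])
qed

end

section \<open>The structure of automorphisms\<close>

context hopf
begin

lemma Aut_reeb_iff: "f \<in> carrier (Aut_reeb lam \<phi>) \<longleftrightarrow> f \<in> Bij (reeb lam \<phi>) \<and>
    reeb_smooth lam \<phi> f \<and> reeb_smooth lam \<phi> (inv_into (reeb lam \<phi>) f) \<and>
    (\<forall>L\<in>reeb_leaves lam \<phi>. f ` L \<in> reeb_leaves lam \<phi>) \<and> (\<forall>x\<ge>0. leaf_holomorphic lam \<phi> x f)"
  by (simp add: Aut_reeb_def)

lemma proj_reeb: "p \<in> reeb_cover \<Longrightarrow> proj p \<in> reeb lam \<phi>"
  by (auto simp: reeb_iff)

lemma bdry_iff: "P \<in> reeb_bdry lam \<phi> \<longleftrightarrow> (\<exists>z. z \<noteq> 0 \<and> P = proj (z, 0))"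
  by (auto simp: reeb_bdry_def)

lemma bdry_cover: "z \<noteq> 0 \<Longrightarrow> (z, 0) \<in> reeb_cover"
  by (simp add: reeb_cover_iff)

lemma proj_bdry_iff: "p \<in> reeb_cover \<Longrightarrow> proj p \<in> reeb_bdry lam \<phi> \<longleftrightarrow> snd p = 0"
proof
  assume p: "p \<in> reeb_cover"
  show "snd p = 0" if b: "proj p \<in> reeb_bdry lam \<phi>"
  proof -
    obtain z where z: "z \<noteq> 0" "proj (z, 0) = proj p" using b by (auto simp: bdry_iff)
    then obtain n where "p = T n (z, 0)" using proj_eq_iff[OF bdry_cover[OF z(1)] p] by blast
    then show ?thesis by (simp add: T_pair itr_zero)
  qed
  show "snd p = 0 \<Longrightarrow> proj p \<in> reeb_bdry lam \<phi>"
    using p by (cases p) (auto simp: bdry_iff reeb_cover_iff)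
qed

lemma bdry_subset: "reeb_bdry lam \<phi> \<subseteq> reeb lam \<phi>"
  using proj_reeb bdry_cover by (auto simp: bdry_iff)

lemma bdry_leaf: "reeb_bdry lam \<phi> = proj ` (reeb_cover \<inter> UNIV \<times> {0})"
proof -
  have "reeb_cover \<inter> UNIV \<times> {0} = (- {0 :: complex}) \<times> {0}" by (auto simp: reeb_cover_iff)
  then show ?thesis by (simp add: reeb_bdry_def)
qed

text \<open>A leafwise holomorphic injection cannot map the boundary to an interior leaf: it would give a
  nonconstant holomorphic function on the elliptic curve.\<close>

lemma lift_bdry_level:
  assumes F: "continuous_on reeb_cover F" "F ` reeb_cover \<subseteq> reeb_cover"
      "\<And>p. p \<in> reeb_cover \<Longrightarrow> f (proj p) = proj (F p)"
    and hol: "leaf_holomorphic lam \<phi> 0 f" and inj: "inj_on f (reeb lam \<phi>)" and z: "z \<noteq> 0"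
  shows "snd (F (z, 0)) = 0"
proof (rule ccontr)
  let ?h = "\<lambda>z. fst (F (z, 0))" and ?y = "snd (F (1, 0))"
  have h: "?h holomorphic_on - {0}"
    using lift_on_level(1)[of F f 0, OF F hol order_refl] by (simp add: level_def)
  have y: "snd (F (z, 0)) = ?y" if "z \<noteq> 0" for z
    using lift_on_level(2)[of F f 0 z 1, OF F hol order_refl] that by (simp add: level_def)
  assume "snd (F (z, 0)) \<noteq> 0"
  then have "?y \<noteq> 0" using y[OF z] by simp
  moreover have "F (1, 0) \<in> reeb_cover" using F(2) bdry_cover[of 1] by auto
  then have "?y \<ge> 0" by (cases "F (1, 0)") (auto simp: reeb_cover_iff)
  ultimately have y0: "?y > 0" by simp
  have per: "?h (lam * w) = ?h w" if w: "w \<noteq> 0" for w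
  proof -
    have c: "F (w, 0) \<in> reeb_cover" "F (lam * w, 0) \<in> reeb_cover" using F(2) bdry_cover w by auto
    have "proj (lam * w, 0) = proj (w, 0)"
      using proj_T[OF bdry_cover[OF w], of 1] by (simp add: T_pair itr_zero)
    then have "proj (F (w, 0)) = proj (F (lam * w, 0))"
      using F(3)[OF bdry_cover] w by (metis lam_nz mult_eq_0_iff)
    then obtain n where n: "F (lam * w, 0) = T n (F (w, 0))" using proj_eq_iff[OF c] by blast
    then have "itr n ?y = itr 0 ?y" using y[of w] y[of "lam * w"] w y0 by (simp add: T_def itr_0)
    then have "n = 0" using itr_eq_index_iff[OF y0] by blast
    then show ?thesis using n T_0[OF c(1)] by simp
  qed
  obtain c where c: "\<And>z. z \<noteq> 0 \<Longrightarrow> ?h z = c"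
    using multiplicatively_periodic_constant[OF lam h per] by blast
  have "F (1, 0) = F (-1, 0)"
    using c[of 1] c[of "-1"] y[of "-1"] by (simp add: prod_eq_iff)
  then have "f (proj (1, 0)) = f (proj (-1, 0))" using F(3) bdry_cover by simp
  then have "proj (1, 0) = proj (-1, 0)" by (rule inj_onD[OF inj]) (auto intro!: proj_reeb bdry_cover)
  then obtain n where "(-1, 0) = T n (1, 0)" using proj_eq_iff bdry_cover by auto
  then have "logE (-1, 0) = logE (1, 0) + of_int n" using logE_T[OF bdry_cover[of 1], of n] by simp
  then have "n = 0" by (simp add: logE_def E_def)
  then show False using \<open>(-1, 0) = T n (1, 0)\<close> by (simp add: T_pair)
qed

lemma Aut_bdry_image:
  assumes f: "f \<in> carrier (Aut_reeb lam \<phi>)"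
    and F: "continuous_on reeb_cover F" "F ` reeb_cover \<subseteq> reeb_cover"
      "\<And>p. p \<in> reeb_cover \<Longrightarrow> f (proj p) = proj (F p)"
    and p: "p \<in> reeb_cover"
  shows "snd (F p) = 0 \<longleftrightarrow> snd p = 0"
proof -
  have fB: "f \<in> Bij (reeb lam \<phi>)" and hol: "leaf_holomorphic lam \<phi> 0 f" using f by (auto simp: Aut_reeb_iff)
  have inj: "inj_on f (reeb lam \<phi>)" using fB by (auto simp: Bij_def bij_betw_def)
  have b: "snd (F (z, 0)) = 0" if "z \<noteq> 0" for z using lift_bdry_level[of F f z, OF F hol inj that] .
  have Fc: "F q \<in> reeb_cover" if "q \<in> reeb_cover" for q using F(2) that by blast
  have sub: "f ` reeb_bdry lam \<phi> \<subseteq> reeb_bdry lam \<phi>"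
  proof
    fix Q assume "Q \<in> f ` reeb_bdry lam \<phi>"
    then obtain z where z: "z \<noteq> 0" "Q = f (proj (z, 0))" unfolding reeb_bdry_def by auto
    then have "Q = proj (F (z, 0))" using F(3)[OF bdry_cover] by simp
    then show "Q \<in> reeb_bdry lam \<phi>"
      using proj_bdry_iff[OF Fc[OF bdry_cover[OF z(1)]]] b[OF z(1)] by simp
  qed
  have "reeb_bdry lam \<phi> \<in> reeb_leaves lam \<phi>" using bdry_leaf by (auto simp: reeb_leaves_def)
  then have "f ` reeb_bdry lam \<phi> \<in> reeb_leaves lam \<phi>" using f by (auto simp: Aut_reeb_iff)
  then obtain x where x: "x \<ge> 0" "f ` reeb_bdry lam \<phi> = proj ` (reeb_cover \<inter> UNIV \<times> {x})"
    by (auto simp: reeb_leaves_def)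
  have "(1, x) \<in> reeb_cover" using x by (simp add: reeb_cover_iff)
  then have "proj (1, x) \<in> f ` reeb_bdry lam \<phi>" unfolding x(2) by auto
  then have "proj (1, x) \<in> reeb_bdry lam \<phi>" using sub by blast
  then have "x = 0" using proj_bdry_iff[OF \<open>(1, x) \<in> reeb_cover\<close>] by simp
  then have img: "f ` reeb_bdry lam \<phi> = reeb_bdry lam \<phi>" using x(2) bdry_leaf by simp
  show ?thesis
  proof
    assume "snd p = 0"
    then show "snd (F p) = 0" using b[of "fst p"] p by (cases p) (auto simp: reeb_cover_iff)
  next
    assume "snd (F p) = 0"
    then have "f (proj p) \<in> reeb_bdry lam \<phi>" using F(3)[OF p] proj_bdry_iff[OF Fc[OF p]] by simp
    then obtain Q where Q: "Q \<in> reeb_bdry lam \<phi>" "f (proj p) = f Q" using img by blast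
    then have "proj p = Q" using inj_onD[OF inj Q(2) proj_reeb[OF p]] bdry_subset by blast
    then show "snd p = 0" using Q(1) proj_bdry_iff[OF p] by simp
  qed
qed

text \<open>A lift commutes with the Hopf map: it conjugates the deck group to itself, and the generator
  cannot be inverted since the levels of the images of a sequence tending to the boundary
  tend to 0.\<close>

lemma Aut_lift_commutes:
  assumes f: "f \<in> carrier (Aut_reeb lam \<phi>)"
    and F: "continuous_on reeb_cover F" "F ` reeb_cover \<subseteq> reeb_cover"
      "\<And>p. p \<in> reeb_cover \<Longrightarrow> f (proj p) = proj (F p)"
  obtains G where "smooth_on reeb_cover G" "G ` reeb_cover \<subseteq> reeb_cover"
    "\<And>p. p \<in> reeb_cover \<Longrightarrow> F (G p) = p" "\<And>p. p \<in> reeb_cover \<Longrightarrow> G (F p) = p"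
    "\<And>p n. p \<in> reeb_cover \<Longrightarrow> F (T n p) = T n (F p)"
proof -
  let ?R = "reeb lam \<phi>"
  have fB: "f \<in> Bij ?R" and sm: "reeb_smooth lam \<phi> (inv_into ?R f)" using f by (auto simp: Aut_reeb_iff)
  have inj: "inj_on f ?R" using fB by (auto simp: Bij_def bij_betw_def)
  have Fc: "F q \<in> reeb_cover" if "q \<in> reeb_cover" for q using F(2) that by blast
  obtain H where H: "continuous_on reeb_cover H" "H ` reeb_cover \<subseteq> reeb_cover" "smooth_on reeb_cover H"
    "\<And>p. p \<in> reeb_cover \<Longrightarrow> inv_into ?R f (proj p) = proj (H p)"
    using reeb_smooth_lift[OF sm] by metis
  have Hc: "H q \<in> reeb_cover" if "q \<in> reeb_cover" for q using H(2) that by blast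
  have "\<exists>j. \<forall>p\<in>reeb_cover. F (H p) = T j (id p)"
  proof (rule two_lifts[OF connected_reeb_cover])
    show "continuous_on reeb_cover (\<lambda>p. F (H p))" using F(1) H(1,2) by (rule continuous_on_compose2)
    show "proj (F (H p)) = proj (id p)" if "p \<in> reeb_cover" for p
      using F(3)[OF Hc[OF that]] H(4)[OF that] Bij_D(4)[OF fB proj_reeb[OF that]] by simp
  qed (use Fc Hc in \<open>simp_all add: image_subset_iff continuous_on_id\<close>)
  then obtain j where j: "\<And>p. p \<in> reeb_cover \<Longrightarrow> F (H p) = T j p" by auto
  define G where "G p = H (T (- j) p)" for p
  have Gc: "G p \<in> reeb_cover" if "p \<in> reeb_cover" for p using that Hc T_cover by (simp add: G_def)
  have FG: "F (G p) = p" if "p \<in> reeb_cover" for p using that j T_cover T_minus by (simp add: G_def)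
  have "\<exists>k. \<forall>p\<in>reeb_cover. F (T n p) = T k (F p)" for n
  proof (rule two_lifts[OF connected_reeb_cover])
    show "continuous_on reeb_cover (\<lambda>p. F (T n p))"
      using F(1) T_continuous by (rule continuous_on_compose2) (use T_cover in auto)
    show "proj (F (T n p)) = proj (F p)" if "p \<in> reeb_cover" for p
      using F(3)[OF that] F(3)[OF T_cover[OF that, of n]] that by simp
  qed (use F(1,2) Fc T_cover in \<open>simp_all add: image_subset_iff\<close>)
  then obtain k where k: "\<And>n p. p \<in> reeb_cover \<Longrightarrow> F (T n p) = T (k n) (F p)" by metis
  let ?o = "(0 :: complex, 1 :: real)"
  have o: "?o \<in> reeb_cover" by (simp add: reeb_cover_iff)
  have k_add: "k (m + n) = k m + k n" for m n
  proof -
    have "T (k (m + n)) (F ?o) = T (k m + k n) (F ?o)"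
      using k[OF o, of "m + n"] k[OF T_cover[OF o, of n], of m] k[OF o, of n] T_add[OF o, of m n]
        T_add[OF Fc[OF o], of "k m" "k n"] by simp
    then show ?thesis using T_eq_iff[OF Fc[OF o]] by blast
  qed
  have k_nat: "k (int n) = int n * k 1" for n
  proof (induction n)
    case 0 then show ?case using k_add[of 0 0] by simp
  next
    case (Suc n) then show ?case using k_add[of 1 "int n"] by (simp add: algebra_simps)
  qed
  have k_mult: "k m = m * k 1" for m
  proof (cases m)
    case (nonneg n) then show ?thesis using k_nat by simp
  next
    case (neg n)
    then have "m + int (Suc n) = 0" by simp
    then have "k m + k (int (Suc n)) = 0" using k_add[of m "int (Suc n)"] k_nat[of 0] by simp
    then have "k m = - k (int (Suc n))" by linarith
    also have "\<dots> = (- int (Suc n)) * k 1" using k_nat[of "Suc n"] by (simp only: mult_minus_left)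
    finally show ?thesis using neg by (simp only:)
  qed
  have proj_F_inj: "\<exists>m. q = T m p" if "p \<in> reeb_cover" "q \<in> reeb_cover" "proj (F p) = proj (F q)" for p q
  proof -
    have "f (proj p) = f (proj q)" using that F(3) by simp
    then have "proj p = proj q" by (rule inj_onD[OF inj]) (use proj_reeb that in auto)
    then show ?thesis using proj_eq_iff[OF that(1,2)] by simp
  qed
  have "\<exists>m. m * k 1 = 1"
  proof -
    have c: "T 1 (F ?o) \<in> reeb_cover" using T_cover[OF Fc[OF o]] .
    have "proj (F ?o) = proj (F (G (T 1 (F ?o))))" using FG[OF c] Fc[OF o] by simp
    then obtain m where "G (T 1 (F ?o)) = T m ?o" using proj_F_inj[OF o Gc[OF c]] by blast
    then have "T 1 (F ?o) = T (k m) (F ?o)" using FG[OF c] k[OF o, of m] by simp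
    then have "k m = 1" using T_eq_iff[OF Fc[OF o]] by metis
    then show ?thesis using k_mult by metis
  qed
  then have k1: "k 1 = 1 \<or> k 1 = -1" by (metis mult.commute zmult_eq_1_iff)
  have "k 1 \<noteq> -1"
  proof
    assume neg: "k 1 = -1"
    define \<eta> where "\<eta> x = snd (F (1, x))" for x
    have cont: "continuous_on {0..} \<eta>"
      unfolding \<eta>_def
      by (intro continuous_intros continuous_on_compose2[OF F(1)]) (auto simp: reeb_cover_iff)
    have \<eta>0: "\<eta> 0 = 0" using Aut_bdry_image[of f F "(1, 0)", OF f F] by (simp add: \<eta>_def reeb_cover_iff)
    have lev: "snd (F (z, x)) = \<eta> x" if "x > 0" for z x
      using lift_on_level(2)[of F f x z 1, OF F] f that by (simp add: \<eta>_def Aut_reeb_iff level_def)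
    have eq: "\<eta> (itr (- int n) 1) = itr (int n) (\<eta> 1)" for n
    proof -
      have c: "(1, 1) \<in> reeb_cover" by (simp add: reeb_cover_iff)
      have "snd (F (T (- int n) (1, 1))) = itr (int n) (\<eta> 1)"
        using k[OF c, of "- int n"] k_mult[of "- int n"] neg by (simp add: T_def \<eta>_def)
      then show ?thesis using lev[of "itr (- int n) 1"] itr_pos[of 1 "- int n"] by (simp add: T_pair)
    qed
    have \<eta>1: "\<eta> 1 > 0"
    proof -
      have c: "(1, 1) \<in> reeb_cover" by (simp add: reeb_cover_iff)
      have "\<eta> 1 \<noteq> 0" using Aut_bdry_image[of f F "(1, 1)", OF f F c] by (simp add: \<eta>_def)
      moreover have "\<eta> 1 \<ge> 0" using Fc[OF c] by (cases "F (1, 1)") (simp add: \<eta>_def reeb_cover_iff)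
      ultimately show ?thesis by simp
    qed
    have "(\<lambda>n. \<eta> (itr (- int n) 1)) \<longlonglongrightarrow> \<eta> 0"
      by (rule continuous_on_tendsto_compose[OF cont itr_tendsto_0])
        (auto intro!: always_eventually itr_nonneg)
    then have "(\<lambda>n. itr (int n) (\<eta> 1)) \<longlonglongrightarrow> 0" by (simp add: eq \<eta>0)
    moreover have "\<eta> 1 \<le> itr (int n) (\<eta> 1)" for n
      using itr_less[OF \<eta>1, of 0 "int n"] itr_0[of "\<eta> 1"] \<eta>1 by (cases n) auto
    ultimately have "\<eta> 1 \<le> 0" by (intro LIMSEQ_le_const) auto
    then show False using \<eta>1 by simp
  qed
  then have kn: "k n = n" for n using k1 k_mult[of n] by simp
  have GF: "G (F p) = p" if p: "p \<in> reeb_cover" for p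
  proof -
    have "F (G (F p)) = F p" using FG[OF Fc[OF p]] .
    then obtain m where m: "G (F p) = T m p" using proj_F_inj[OF p Gc[OF Fc[OF p]]] by auto
    then have "F p = T m (F p)" using FG[OF Fc[OF p]] k[OF p, of m] kn by simp
    then have "m = 0" using T_eq_iff[OF Fc[OF p], of m 0] T_0[OF Fc[OF p]] by simp
    then show ?thesis using m T_0[OF p] by simp
  qed
  have "smooth_on reeb_cover G"
    unfolding G_def by (rule smooth_on_compose[OF T_smooth H(3)]) (use T_cover in auto)
  moreover have "G ` reeb_cover \<subseteq> reeb_cover" using Gc by blast
  moreover have "F (T n p) = T n (F p)" if "p \<in> reeb_cover" for p n using k[OF that] kn by simp
  ultimately show ?thesis using that[of G] FG GF by blast
qed

lemma smooth_slice:
  assumes "smooth_on reeb_cover F" "z \<noteq> 0"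
  shows "smooth_on {0..} (\<lambda>x. F (z, x))"
proof -
  have "smooth_on {0..} (\<lambda>x::real. (z, x))"
    by (intro smooth_on_Pair smooth_on_const smooth_on_id)
  then show ?thesis
    by (rule smooth_on_compose[OF _ assms(1)]) (use assms(2) in \<open>auto simp: reeb_cover_iff\<close>)
qed

text \<open>On each level a lift is an injective entire function, hence affine. Its linear coefficient is a
  \<open>\<phi>\<close>-invariant continuous function on the closed half-line, hence constant.\<close>

lemma Aut_structure:
  assumes f: "f \<in> carrier (Aut_reeb lam \<phi>)"
  obtains F a b \<eta> where "a \<noteq> 0" "b \<in> K_space lam \<phi>" "\<eta> \<in> carrier (Z_centralizer \<phi>)"
    "is_lift lam \<phi> f F" "affine_form a b \<eta> F"
proof -
  have sm: "reeb_smooth lam \<phi> f" and hol: "\<And>x. x \<ge> 0 \<Longrightarrow> leaf_holomorphic lam \<phi> x f"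
    using f by (auto simp: Aut_reeb_iff)
  obtain F where F: "continuous_on reeb_cover F" "F ` reeb_cover \<subseteq> reeb_cover"
      "\<And>p. p \<in> reeb_cover \<Longrightarrow> f (proj p) = proj (F p)" and F_sm: "smooth_on reeb_cover F"
    using reeb_smooth_lift[OF sm] by metis
  obtain G where G: "smooth_on reeb_cover G" "G ` reeb_cover \<subseteq> reeb_cover"
    "\<And>p. p \<in> reeb_cover \<Longrightarrow> F (G p) = p" "\<And>p. p \<in> reeb_cover \<Longrightarrow> G (F p) = p"
    "\<And>p n. p \<in> reeb_cover \<Longrightarrow> F (T n p) = T n (F p)"
    using Aut_lift_commutes[of f F, OF f F] by metis
  have Fc: "F q \<in> reeb_cover" and Gc: "G q \<in> reeb_cover" if "q \<in> reeb_cover" for q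
    using F(2) G(2) that by blast+
  have c1: "(1, x) \<in> reeb_cover" "(2, x) \<in> reeb_cover" if "x \<ge> 0" for x using that by (auto simp: reeb_cover_iff)
  define \<eta> where "\<eta> x = snd (F (1, x))" for x
  have lev: "snd (F (z, x)) = \<eta> x" if "(z, x) \<in> reeb_cover" for z x
  proof -
    have x: "x \<ge> 0" using that by (simp add: reeb_cover_iff)
    show ?thesis
      using lift_on_level(2)[of F f x z 1, OF F hol[OF x] x] that c1(1)[OF x] level_iff[OF x]
      by (simp add: \<eta>_def)
  qed
  have \<eta>_nonneg: "\<eta> x \<ge> 0" if "x \<ge> 0" for x
    using Fc[OF c1(1)[OF that]] by (cases "F (1, x)") (simp add: \<eta>_def reeb_cover_iff)
  have \<eta>_0: "\<eta> x = 0 \<longleftrightarrow> x = 0" if "x \<ge> 0" for x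
    using Aut_bdry_image[of f F "(1, x)", OF f F c1(1)[OF that]] by (simp add: \<eta>_def)
  have F_inj: "p = q" if "F p = F q" "p \<in> reeb_cover" "q \<in> reeb_cover" for p q
    using G(4) that by metis
  have affine: "\<exists>a b. a \<noteq> 0 \<and> (\<forall>z. F (z, x) = (a * z + b, \<eta> x))" if x: "x > 0" for x
  proof -
    have cx: "(z, x) \<in> reeb_cover" for z using x by (simp add: reeb_cover_iff)
    have "(\<lambda>z. fst (F (z, x))) holomorphic_on UNIV"
      using lift_on_level(1)[of F f x, OF F hol] x by (simp add: level_def)
    moreover have "inj (\<lambda>z. fst (F (z, x)))"
    proof (rule injI)
      fix z w assume "fst (F (z, x)) = fst (F (w, x))"
      then have "F (z, x) = F (w, x)" using lev[OF cx] by (simp add: prod_eq_iff)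
      then show "z = w" using F_inj cx by blast
    qed
    ultimately obtain a b where ab: "a \<noteq> 0" "\<And>z. fst (F (z, x)) = a * z + b"
      using injective_entire_affine by blast
    then have "F (z, x) = (a * z + b, \<eta> x)" for z using lev[OF cx] by (simp add: prod_eq_iff)
    then show ?thesis using ab(1) by blast
  qed
  then obtain a b where ab: "\<And>x z. x > 0 \<Longrightarrow> a x \<noteq> 0 \<and> F (z, x) = (a x * z + b x, \<eta> x)" by metis
  define F0 where "F0 z = fst (F (z, 0))" for z
  have F_bdry: "F (z, 0) = (F0 z, 0)" "F0 z \<noteq> 0" if "z \<noteq> 0" for z
  proof -
    have c: "(z, 0) \<in> reeb_cover" using that by (simp add: reeb_cover_iff)
    show "F (z, 0) = (F0 z, 0)" using lev[OF c] \<eta>_0[of 0] by (simp add: F0_def prod_eq_iff)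
    then show "F0 z \<noteq> 0" using Fc[OF c] by (simp add: reeb_cover_iff)
  qed
  have "F0 holomorphic_on - {0}"
    using lift_on_level(1)[of F f 0, OF F hol] by (simp add: level_def F0_def[abs_def])
  then have "(\<lambda>z. F0 z / z) holomorphic_on - {0}" by (intro holomorphic_intros) auto
  moreover have "F0 (lam * z) / (lam * z) = F0 z / z" if z: "z \<noteq> 0" for z
  proof -
    have "F (T 1 (z, 0)) = T 1 (F (z, 0))" using G(5) z by (simp add: reeb_cover_iff)
    then have "F0 (lam * z) = lam * F0 z"
      using F_bdry(1)[of z] F_bdry(1)[of "lam * z"] z by (simp add: T_pair itr_zero)
    then show ?thesis by simp
  qed
  ultimately obtain a0 where a0: "\<And>z. z \<noteq> 0 \<Longrightarrow> F0 z / z = a0"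
    using multiplicatively_periodic_constant[OF lam] by blast
  have F0_eq: "F0 z = a0 * z" if "z \<noteq> 0" for z using a0[OF that] that by (simp add: field_simps)
  have a0_nz: "a0 \<noteq> 0" using F0_eq[of 1] F_bdry(2)[of 1] by simp
  define A where "A x = fst (F (2, x)) - fst (F (1, x))" for x
  have A_pos: "A x = a x" if "x > 0" for x using ab[OF that] by (simp add: A_def)
  have A_0: "A 0 = a0" using F0_eq[of 1] F0_eq[of 2] by (simp add: A_def F0_def)
  have A_cont: "continuous_on {0..} A"
    unfolding A_def
    by (intro continuous_intros continuous_on_compose2[OF F(1)]) (auto simp: reeb_cover_iff)
  have F_phi: "F (lam powi n * z, itr n x) = (lam powi n * fst (F (z, x)), itr n (\<eta> x))"
    if "(z, x) \<in> reeb_cover" for z x n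
    using G(5)[OF that, of n] lev[OF that] by (simp add: T_pair) (simp add: T_def)
  have a_itr: "a (itr n x) = a x" and b_itr: "b (itr n x) = lam powi n * b x" if x: "x > 0" for x n
  proof -
    have *: "a (itr n x) * (lam powi n * z) + b (itr n x) = lam powi n * (a x * z + b x)" for z
      using F_phi[of z x n] ab[OF x, of z] ab[OF itr_pos[OF x, of n], of "lam powi n * z"] x
      by (simp add: reeb_cover_iff)
    show b: "b (itr n x) = lam powi n * b x" using *[of 0] by simp
    show "a (itr n x) = a x" using *[of 1] b by (simp add: algebra_simps)
  qed
  have a_const: "a x = a0" if x: "x > 0" for x
  proof -
    have "(\<lambda>n. A (itr (- int n) x)) \<longlonglongrightarrow> A 0"
      by (rule continuous_on_tendsto_compose[OF A_cont itr_tendsto_0[OF x]])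
        (use x in \<open>auto intro!: always_eventually itr_nonneg\<close>)
    moreover have "A (itr (- int n) x) = a x" for n using A_pos[OF itr_pos[OF x]] a_itr[OF x] by simp
    ultimately show ?thesis using LIMSEQ_unique[OF tendsto_const] A_0 by auto
  qed
  define b' where "b' x = (if x \<ge> 0 then fst (F (1, x)) - a0 else 0)" for x
  have b'_pos: "b' x = b x" if "x > 0" for x using ab[OF that, of 1] a_const[OF that] that by (simp add: b'_def)
  have b'_0: "b' 0 = 0" using F0_eq[of 1] by (simp add: b'_def F0_def)
  have "smooth_on {0..} (\<lambda>x. fst (F (1, x)) - a0)"
    by (intro smooth_on_diff smooth_on_const smooth_on_linear_compose[OF _ bounded_linear_fst]
        smooth_slice F_sm) simp
  then have "smooth_on {0..} b'" by (rule smooth_on_cong) (simp add: b'_def)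
  moreover have "b' (\<phi> x) = lam * b' x" if "x \<ge> 0" for x
    using b_itr[of x 1] b'_pos[of x] b'_pos[of "\<phi> x"] Diff_half_pos[OF phi, of x] b'_0
      Diff_half_0[OF phi] that by (cases "x = 0") (auto simp: itr_1)
  ultimately have K: "b' \<in> K_space lam \<phi>" by (simp add: K_space_def b'_def)
  define \<theta> where "\<theta> y = snd (G (1, y))" for y
  have \<theta>_nonneg: "\<theta> y \<ge> 0" if "y \<ge> 0" for y
    using Gc[OF c1(1)[OF that]] by (cases "G (1, y)") (simp add: \<theta>_def reeb_cover_iff)
  have \<eta>\<theta>: "\<eta> (\<theta> y) = y" if "y \<ge> 0" for y
    using lev[of "fst (G (1, y))" "\<theta> y"] G(3)[OF c1(1)[OF that]] Gc[OF c1(1)[OF that]]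
    by (simp add: \<theta>_def)
  have \<eta>_inj: "x = y" if "\<eta> x = \<eta> y" "x > 0" "y > 0" for x y
  proof -
    have c: "(z, u) \<in> reeb_cover" if "u > 0" for z u using that by (simp add: reeb_cover_iff)
    have "F ((b y - b x) / a0, x) = F (0, y)"
      using ab[OF that(2), of "(b y - b x) / a0"] ab[OF that(3), of 0] a_const[OF that(2)] a_const[OF that(3)]
        that(1) a0_nz by simp
    then show ?thesis using F_inj c that by blast
  qed
  have \<theta>\<eta>: "\<theta> (\<eta> x) = x" if x: "x \<ge> 0" for x
  proof (cases "x = 0")
    case True
    then show ?thesis using \<eta>\<theta>[of 0] \<eta>_0[of "\<theta> 0"] \<eta>_0[of 0] \<theta>_nonneg[of 0] by simp
  next
    case False
    then have "\<eta> x > 0" using \<eta>_0[OF x] \<eta>_nonneg[OF x] by simp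
    then have "\<eta> (\<theta> (\<eta> x)) = \<eta> x" "\<theta> (\<eta> x) \<ge> 0" using \<eta>\<theta> \<theta>_nonneg by auto
    moreover from this have "\<theta> (\<eta> x) \<noteq> 0" using \<eta>_0[of 0] \<open>\<eta> x > 0\<close> by auto
    ultimately show ?thesis using \<eta>_inj[of "\<theta> (\<eta> x)" x] False x by auto
  qed
  let ?\<eta> = "restrict \<eta> {0..}"
  have bij: "?\<eta> \<in> Bij {0..}" "\<And>y. y \<in> {0..} \<Longrightarrow> inv_into {0..} ?\<eta> y = \<theta> y"
    using Bij_I[of ?\<eta> "{0..}" \<theta>] \<eta>_nonneg \<theta>_nonneg \<eta>\<theta> \<theta>\<eta> by auto
  have "smooth_on {0..} \<eta>" "smooth_on {0..} \<theta>"
    unfolding \<eta>_def \<theta>_def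
    by (intro smooth_on_linear_compose[OF _ bounded_linear_snd] smooth_slice F_sm G(1); simp)+
  then have sm: "smooth_on {0..} ?\<eta>" "smooth_on {0..} (inv_into {0..} ?\<eta>)"
    using smooth_on_cong[of "{0..}" \<eta> ?\<eta>] smooth_on_cong[of "{0..}" \<theta> "inv_into {0..} ?\<eta>"] bij(2) by auto
  have "\<eta> (\<phi> x) = \<phi> (\<eta> x)" if x: "x \<ge> 0" for x
  proof -
    have "snd (F (lam * 1, \<phi> x)) = \<phi> (\<eta> x)" using F_phi[OF c1(1)[OF x], of 1] by (simp add: itr_1)
    then show ?thesis using lev[of "lam * 1" "\<phi> x"] Diff_half_nonneg[OF phi x] by (simp add: reeb_cover_iff)
  qed
  then have Z: "?\<eta> \<in> carrier (Z_centralizer \<phi>)"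
    using bij(1) sm Diff_half_nonneg[OF phi] \<eta>_nonneg by (simp add: Z_centralizer_iff Diff_half_iff)
  have "F (z, x) = (a0 * z + b' x, ?\<eta> x)" if c: "(z, x) \<in> reeb_cover" for z x
  proof (cases "x = 0")
    case True
    then have "z \<noteq> 0" using c by (simp add: reeb_cover_iff)
    then show ?thesis using True F_bdry(1) F0_eq b'_0 \<eta>_0[of 0] by simp
  next
    case False
    then have "x > 0" using c by (simp add: reeb_cover_iff)
    then show ?thesis using ab a_const b'_pos by simp
  qed
  then have "affine_form a0 b' ?\<eta> F" by (simp add: affine_form_def)
  moreover have "is_lift lam \<phi> f F" using F by (auto simp: is_lift_def)
  ultimately show ?thesis using that a0_nz K Z by blast
qed

subsection \<open>The affine automorphisms\<close>

definition M :: "complex \<Rightarrow> (real \<Rightarrow> complex) \<Rightarrow> (real \<Rightarrow> real) \<Rightarrow> complex \<times> real \<Rightarrow> complex \<times> real" where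
  "M a b \<eta> = (\<lambda>(z, x). (a * z + b x, \<eta> x))"

definition act :: "complex \<Rightarrow> (real \<Rightarrow> complex) \<Rightarrow> (real \<Rightarrow> real) \<Rightarrow>
    (complex \<times> real) set \<Rightarrow> (complex \<times> real) set" where
  "act a b \<eta> = (\<lambda>P\<in>reeb lam \<phi>. M a b \<eta> ` P)"

text \<open>For these parameters the affine map \<open>M a b \<eta>\<close> is a diffeomorphism of the cover commuting with
  the Hopf map; every automorphism has such a lift.\<close>

definition params :: "(complex \<times> (real \<Rightarrow> complex) \<times> (real \<Rightarrow> real)) set" where
  "params = (- {0}) \<times> K_space lam \<phi> \<times> carrier (Z_centralizer \<phi>)"

lemma K_itr: "b \<in> K_space lam \<phi> \<Longrightarrow> x \<ge> 0 \<Longrightarrow> b (itr n x) = lam powi n * b x"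
  by (rule equivariant_itr[where X = "{0..}"]) (auto simp: K_space_def)

lemma Z_nonneg: "\<eta> \<in> carrier (Z_centralizer \<phi>) \<Longrightarrow> x \<ge> 0 \<Longrightarrow> \<eta> x \<ge> 0"
  and Z_0: "\<eta> \<in> carrier (Z_centralizer \<phi>) \<Longrightarrow> \<eta> 0 = 0"
  and Z_pos: "\<eta> \<in> carrier (Z_centralizer \<phi>) \<Longrightarrow> x > 0 \<Longrightarrow> \<eta> x > 0"
  using Diff_half_nonneg Diff_half_0 Diff_half_pos by (auto simp: Z_centralizer_iff)

lemma M_cover:
  assumes "(a, b, \<eta>) \<in> params" "p \<in> reeb_cover"
  shows "M a b \<eta> p \<in> reeb_cover"
proof (cases p)
  case (Pair z x)
  have par: "a \<noteq> 0" "b \<in> K_space lam \<phi>" "\<eta> \<in> carrier (Z_centralizer \<phi>)" using assms by (auto simp: params_def)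
  show ?thesis
  proof (cases "x = 0")
    case True
    then show ?thesis using Pair assms(2) par(1) K_space_zero[OF par(2) lam, of 0] Z_0[OF par(3)]
      by (simp add: M_def reeb_cover_iff)
  next
    case False
    then have "x > 0" using Pair assms(2) by (simp add: reeb_cover_iff)
    then show ?thesis using Pair Z_pos[OF par(3)] by (simp add: M_def reeb_cover_iff less_imp_le less_imp_neq[symmetric])
  qed
qed

lemma M_T:
  assumes "(a, b, \<eta>) \<in> params" "p \<in> reeb_cover"
  shows "M a b \<eta> (T n p) = T n (M a b \<eta> p)"
  using assms K_itr[of b "snd p" n] Z_centralizer_itr[of \<eta> "snd p" n]
  by (cases p) (auto simp: params_def M_def T_pair reeb_cover_iff algebra_simps)

lemma act_proj:
  assumes "(a, b, \<eta>) \<in> params" "p \<in> reeb_cover"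
  shows "act a b \<eta> (proj p) = proj (M a b \<eta> p)"
  using assms proj_reeb[OF assms(2)] M_cover[OF assms] M_T[OF assms]
  by (simp add: act_def proj_eq image_image)

lemma act_eqI:
  assumes "(a, b, \<eta>) \<in> params" "f \<in> extensional (reeb lam \<phi>)"
    and "\<And>p. p \<in> reeb_cover \<Longrightarrow> f (proj p) = proj (M a b \<eta> p)"
  shows "f = act a b \<eta>"
proof (rule extensionalityI[OF assms(2)])
  show "act a b \<eta> \<in> extensional (reeb lam \<phi>)" by (simp add: act_def)
  fix P assume "P \<in> reeb lam \<phi>"
  then show "f P = act a b \<eta> P" using assms(3) act_proj[OF assms(1)] by (auto simp: reeb_iff)
qed

lemma params_compose:
  assumes "(a, b, \<eta>) \<in> params" "(a', b', \<eta>') \<in> params"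
  defines "b'' \<equiv> \<lambda>x. if x \<ge> 0 then a * b' x + b (\<eta>' x) else 0"
  shows "(a * a', b'', compose {0..} \<eta> \<eta>') \<in> params"
    and "p \<in> reeb_cover \<Longrightarrow> M a b \<eta> (M a' b' \<eta>' p) = M (a * a') b'' (compose {0..} \<eta> \<eta>') p"
proof -
  have p1: "a \<noteq> 0" "b \<in> K_space lam \<phi>" "\<eta> \<in> carrier (Z_centralizer \<phi>)"
    and p2: "a' \<noteq> 0" "b' \<in> K_space lam \<phi>" "\<eta>' \<in> carrier (Z_centralizer \<phi>)" using assms by (auto simp: params_def)
  have D: "\<eta> \<in> carrier Diff_half" "\<eta>' \<in> carrier Diff_half" using p1 p2 by (auto simp: Z_centralizer_iff)
  have b: "smooth_on {0..} b" and b': "smooth_on {0..} b'" using p1 p2 by (auto simp: K_space_def)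
  have "smooth_on {0..} (\<lambda>x. b (\<eta>' x))"
    by (rule smooth_on_compose[OF Diff_half_smooth[OF D(2)] b]) (use Z_nonneg[OF p2(3)] in auto)
  then have "smooth_on {0..} (\<lambda>x. a * b' x + b (\<eta>' x))" by (intro smooth_on_add smooth_on_cmult b')
  then have "smooth_on {0..} b''" by (rule smooth_on_cong) (simp add: b''_def)
  moreover have "b'' (\<phi> x) = lam * b'' x" if "x \<ge> 0" for x
    using that p1(2) p2(2,3) Diff_half_nonneg[OF phi that] Z_nonneg[OF p2(3) that]
    by (simp add: b''_def K_space_def Z_centralizer_iff algebra_simps)
  ultimately have "b'' \<in> K_space lam \<phi>" by (simp add: K_space_def b''_def)
  moreover have "compose {0..} \<eta> \<eta>' \<in> carrier (Z_centralizer \<phi>)"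
    using subgroup.m_closed[OF subgroup_Z_centralizer p1(3) p2(3)] mult_Diff_half[OF D] by simp
  ultimately show "(a * a', b'', compose {0..} \<eta> \<eta>') \<in> params" using p1 p2 by (simp add: params_def)
  show "p \<in> reeb_cover \<Longrightarrow> M a b \<eta> (M a' b' \<eta>' p) = M (a * a') b'' (compose {0..} \<eta> \<eta>') p"
    by (cases p) (auto simp: M_def b''_def compose_eq reeb_cover_iff algebra_simps)
qed

lemma params_inverse:
  assumes "(a, b, \<eta>) \<in> params"
  obtains a' b' \<eta>' where "(a', b', \<eta>') \<in> params"
    "\<And>p. p \<in> reeb_cover \<Longrightarrow> M a' b' \<eta>' (M a b \<eta> p) = p"
    "\<And>p. p \<in> reeb_cover \<Longrightarrow> M a b \<eta> (M a' b' \<eta>' p) = p"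
proof -
  have p1: "a \<noteq> 0" "b \<in> K_space lam \<phi>" "\<eta> \<in> carrier (Z_centralizer \<phi>)" using assms by (auto simp: params_def)
  have D: "\<eta> \<in> carrier Diff_half" using p1 by (auto simp: Z_centralizer_iff)
  have B: "\<eta> \<in> Bij {0..}" using D by (simp add: Diff_half_iff)
  define \<theta> where "\<theta> = restrict (inv_into {0..} \<eta>) {0..}"
  have "inv\<^bsub>Diff_half\<^esub> \<eta> = \<theta>" using inv_Diff_half[OF D] by (simp add: \<theta>_def)
  then have \<theta>: "\<theta> \<in> carrier (Z_centralizer \<phi>)"
    using subgroup.m_inv_closed[OF subgroup_Z_centralizer p1(3)] by simp
  have inv: "\<theta> (\<eta> x) = x" "\<eta> (\<theta> x) = x" if "x \<ge> 0" for x
    using Bij_D[OF B, of x] that by (auto simp: \<theta>_def)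
  define b' where "b' x = (if x \<ge> 0 then - (1 / a) * b (\<theta> x) else 0)" for x
  have b: "smooth_on {0..} b" using p1 by (auto simp: K_space_def)
  have "smooth_on {0..} (\<lambda>x. b (\<theta> x))"
    by (rule smooth_on_compose[OF Diff_half_smooth b]) (use \<theta> Z_nonneg[OF \<theta>] in \<open>auto simp: Z_centralizer_iff\<close>)
  then have "smooth_on {0..} (\<lambda>x. - (1 / a) * b (\<theta> x))" by (rule smooth_on_cmult)
  then have "smooth_on {0..} b'" by (rule smooth_on_cong) (simp add: b'_def)
  moreover have "b' (\<phi> x) = lam * b' x" if "x \<ge> 0" for x
    using that p1(2) \<theta> Diff_half_nonneg[OF phi that] Z_nonneg[OF \<theta> that]
    by (simp add: b'_def K_space_def Z_centralizer_iff)
  ultimately have "b' \<in> K_space lam \<phi>" by (simp add: K_space_def b'_def)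
  then have "(1 / a, b', \<theta>) \<in> params" using p1 \<theta> by (simp add: params_def)
  moreover have "M (1 / a) b' \<theta> (M a b \<eta> p) = p" "M a b \<eta> (M (1 / a) b' \<theta> p) = p" if "p \<in> reeb_cover" for p
    using that p1(1) inv Z_nonneg[OF p1(3)] Z_nonneg[OF \<theta>]
    by (cases p; auto simp: M_def b'_def reeb_cover_iff field_simps)+
  ultimately show ?thesis using that by blast
qed

lemma M_smooth:
  assumes "(a, b, \<eta>) \<in> params"
  shows "smooth_on reeb_cover (M a b \<eta>)"
proof -
  have p1: "a \<noteq> 0" "b \<in> K_space lam \<phi>" "\<eta> \<in> carrier (Z_centralizer \<phi>)" using assms by (auto simp: params_def)
  have b: "smooth_on {0..} b" using p1 by (auto simp: K_space_def)
  have \<eta>: "smooth_on {0..} \<eta>" using p1(3) Diff_half_smooth by (simp add: Z_centralizer_iff)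
  have snd: "smooth_on reeb_cover (snd :: complex \<times> real \<Rightarrow> real)"
    by (rule smooth_on_linear) (rule bounded_linear_snd)
  have fst: "smooth_on reeb_cover (fst :: complex \<times> real \<Rightarrow> complex)"
    by (rule smooth_on_linear) (rule bounded_linear_fst)
  have sub: "snd ` (reeb_cover :: (complex \<times> real) set) \<subseteq> {0..}" by (auto simp: reeb_cover_def)
  have "smooth_on reeb_cover (\<lambda>p. (a * fst p + b (snd p), \<eta> (snd p)))"
    by (intro smooth_on_Pair smooth_on_add smooth_on_cmult fst smooth_on_compose[OF snd b sub]
        smooth_on_compose[OF snd \<eta> sub])
  then show ?thesis by (simp add: M_def case_prod_beta')
qed

lemma lift_imp_reeb_smooth:
  assumes "smooth_on reeb_cover F" "F ` reeb_cover \<subseteq> reeb_cover"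
    and "\<And>p. p \<in> reeb_cover \<Longrightarrow> f (proj p) = proj (F p)"
  shows "reeb_smooth lam \<phi> f"
  unfolding reeb_smooth_def
proof
  fix p :: "complex \<times> real" assume p: "p \<in> reeb_cover"
  let ?U = "{q \<in> reeb_cover. \<bar>logE q - logE p\<bar> < 1 / 2}" and ?V = "{q \<in> reeb_cover. \<bar>logE q - logE (F p)\<bar> < 1 / 2}"
  let ?W = "?U \<inter> (reeb_cover \<inter> F -` ?V)"
  have V: "reeb_chart lam \<phi> ?V" and U: "reeb_chart lam \<phi> ?U" by (rule reeb_chart_ball)+
  have Fp: "F p \<in> reeb_cover" using assms(2) p by blast
  have "openin (top_of_set reeb_cover) (reeb_cover \<inter> F -` ?V)"
    using smooth_on_continuous[OF assms(1)] V assms(2)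
    by (intro continuous_openin_preimage[where T = reeb_cover]) (auto simp: reeb_chart_def image_subset_iff_funcset)
  moreover have "openin (top_of_set reeb_cover) ?U" using U unfolding reeb_chart_def by blast
  ultimately have "openin (top_of_set reeb_cover) ?W" by (rule openin_Int[rotated])
  then have W: "reeb_chart lam \<phi> ?W" using reeb_chart_subset[OF U] by blast
  have "smooth_on ?W F" using assms(1) by (rule smooth_on_subset) auto
  then show "\<exists>U V G. reeb_chart lam \<phi> U \<and> p \<in> U \<and> reeb_chart lam \<phi> V \<and> G ` U \<subseteq> V \<and> smooth_on U G \<and>
      (\<forall>q\<in>U. f (proj q) = proj (G q))"
    using W V p Fp assms(3) by (intro exI[of _ ?W] exI[of _ ?V] exI[of _ F]) auto
qed

lemma lift_imp_leaf_holomorphic: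
  assumes "x \<ge> 0" "y \<ge> 0" "g holomorphic_on level x" "\<And>z. z \<in> level x \<Longrightarrow> g z \<in> level y"
    and "\<And>z. z \<in> level x \<Longrightarrow> f (proj (z, x)) = proj (g z, y)"
  shows "leaf_holomorphic lam \<phi> x f"
  unfolding leaf_holomorphic_def
proof (intro allI impI)
  fix z assume "(z, x) \<in> reeb_cover"
  then have z: "z \<in> level x" using level_iff assms(1) by blast
  define ball' where "ball' z u = {w \<in> level u. \<bar>logE (w, u) - logE (z, u)\<bar> < 1 / 2}" for z u
  have chart: "leaf_chart lam \<phi> u W" if "W \<subseteq> ball' z u" "open W" "u \<ge> 0" for z u W
  proof -
    have "inj_on (\<lambda>w. proj (w, u)) W"
    proof (rule inj_onI)
      fix v w assume vw: "v \<in> W" "w \<in> W" "proj (v, u) = proj (w, u)"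
      have "inj_on proj {q \<in> reeb_cover. \<bar>logE q - logE (z, u)\<bar> < 1 / 2}"
        using reeb_chart_ball by (simp add: reeb_chart_def)
      moreover have "v \<in> ball' z u" "w \<in> ball' z u" using vw(1,2) that(1) by blast+
      then have "(v, u) \<in> {q \<in> reeb_cover. \<bar>logE q - logE (z, u)\<bar> < 1 / 2}"
        "(w, u) \<in> {q \<in> reeb_cover. \<bar>logE q - logE (z, u)\<bar> < 1 / 2}"
        using level_iff[OF that(3)] by (auto simp: ball'_def)
      ultimately have "(v, u) = (w, u)" using vw(3) unfolding inj_on_def by blast
      then show "v = w" by simp
    qed
    then show ?thesis using that level_iff by (auto simp: leaf_chart_def ball'_def)
  qed
  have op: "open (ball' z u)" if "u \<ge> 0" for z u
  proof -
    have "continuous_on (level u) (\<lambda>w. \<bar>logE (w, u) - logE (z, u)\<bar>)"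
      by (intro continuous_intros continuous_on_compose2[OF logE_continuous])
        (use level_iff[OF that] in auto)
    then have "open (level u \<inter> (\<lambda>w. \<bar>logE (w, u) - logE (z, u)\<bar>) -` {..<1/2})"
      using open_level open_lessThan by (rule continuous_open_preimage)
    then show ?thesis by (simp add: ball'_def vimage_def Int_def)
  qed
  define W where "W = ball' z x \<inter> (level x \<inter> g -` ball' (g z) y)"
  have "open (level x \<inter> g -` ball' (g z) y)"
    using holomorphic_on_imp_continuous_on[OF assms(3)] open_level op[OF assms(2)] by (rule continuous_open_preimage)
  then have oW: "open W" unfolding W_def using op[OF assms(1)] by (rule open_Int[rotated])
  have "z \<in> W" using z assms(4)[OF z] by (simp add: W_def ball'_def)
  moreover have "leaf_chart lam \<phi> x W" using chart[of W z x] oW assms(1) by (simp add: W_def)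
  moreover have "leaf_chart lam \<phi> y (ball' (g z) y)" using chart[OF order_refl op] assms(2) by simp
  moreover have "g ` W \<subseteq> ball' (g z) y" by (auto simp: W_def)
  moreover have "g holomorphic_on W" using assms(3) by (rule holomorphic_on_subset) (auto simp: W_def)
  moreover have "\<forall>w\<in>W. f (proj (w, x)) = proj (g w, y)" using assms(5) by (auto simp: W_def)
  ultimately show "\<exists>W y W' g. leaf_chart lam \<phi> x W \<and> z \<in> W \<and> leaf_chart lam \<phi> y W' \<and> g ` W \<subseteq> W' \<and>
      g holomorphic_on W \<and> (\<forall>w\<in>W. f (proj (w, x)) = proj (g w, y))" by blast
qed

lemma act_inverse:
  assumes p: "(a, b, \<eta>) \<in> params"
  obtains a' b' \<eta>' where "(a', b', \<eta>') \<in> params" "act a b \<eta> \<in> Bij (reeb lam \<phi>)"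
    "\<And>P. P \<in> reeb lam \<phi> \<Longrightarrow> inv_into (reeb lam \<phi>) (act a b \<eta>) P = act a' b' \<eta>' P"
proof -
  obtain a' b' \<eta>' where q: "(a', b', \<eta>') \<in> params"
    "\<forall>p\<in>reeb_cover. M a' b' \<eta>' (M a b \<eta> p) = p" "\<forall>p\<in>reeb_cover. M a b \<eta> (M a' b' \<eta>' p) = p"
    using params_inverse[OF p] by metis
  have inv: "act a b \<eta> P \<in> reeb lam \<phi>" "act a' b' \<eta>' (act a b \<eta> P) = P"
    if p: "(a, b, \<eta>) \<in> params" and q: "(a', b', \<eta>') \<in> params"
      "\<forall>r\<in>reeb_cover. M a' b' \<eta>' (M a b \<eta> r) = r" and P: "P \<in> reeb lam \<phi>" for a b \<eta> a' b' \<eta>' P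
  proof -
    obtain r where r: "r \<in> reeb_cover" "P = proj r" using P reeb_iff by blast
    have e: "act a b \<eta> P = proj (M a b \<eta> r)" using act_proj[OF p r(1)] r(2) by simp
    show "act a b \<eta> P \<in> reeb lam \<phi>" unfolding e by (rule proj_reeb[OF M_cover[OF p r(1)]])
    show "act a' b' \<eta>' (act a b \<eta> P) = P"
      unfolding e act_proj[OF q(1) M_cover[OF p r(1)]] using q(2) r by simp
  qed
  note 1 = inv[OF p q(1,2)] and 2 = inv[OF q(1) p q(3)]
  have "act a b \<eta> \<in> extensional (reeb lam \<phi>)" by (simp add: act_def)
  from Bij_I[of "act a b \<eta>" "reeb lam \<phi>" "act a' b' \<eta>'", OF this 1(1) 2(1) 1(2) 2(2)]
  show ?thesis using that q(1) by blast
qed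

lemma act_Aut:
  assumes p: "(a, b, \<eta>) \<in> params"
  shows "act a b \<eta> \<in> carrier (Aut_reeb lam \<phi>)"
proof -
  obtain a' b' \<eta>' where q: "(a', b', \<eta>') \<in> params" "act a b \<eta> \<in> Bij (reeb lam \<phi>)"
    "\<forall>P\<in>reeb lam \<phi>. inv_into (reeb lam \<phi>) (act a b \<eta>) P = act a' b' \<eta>' P"
    using act_inverse[OF p] by metis
  have par: "a \<noteq> 0" "b \<in> K_space lam \<phi>" "\<eta> \<in> carrier (Z_centralizer \<phi>)" using p by (auto simp: params_def)
  have "reeb_smooth lam \<phi> (act a b \<eta>)"
    by (rule lift_imp_reeb_smooth[OF M_smooth[OF p]]) (use M_cover[OF p] act_proj[OF p] in auto)
  moreover have "reeb_smooth lam \<phi> (inv_into (reeb lam \<phi>) (act a b \<eta>))"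
    by (rule lift_imp_reeb_smooth[OF M_smooth[OF q(1)]])
      (use M_cover[OF q(1)] act_proj[OF q(1)] q(3) proj_reeb in auto)
  moreover have "act a b \<eta> ` L \<in> reeb_leaves lam \<phi>" if "L \<in> reeb_leaves lam \<phi>" for L
  proof -
    obtain x where x: "x \<ge> 0" "L = proj ` (reeb_cover \<inter> UNIV \<times> {x})" using \<open>L \<in> reeb_leaves lam \<phi>\<close>
      by (auto simp: reeb_leaves_def)
    have img: "M a b \<eta> ` (reeb_cover \<inter> UNIV \<times> {x}) = reeb_cover \<inter> UNIV \<times> {\<eta> x}"
    proof
      show "M a b \<eta> ` (reeb_cover \<inter> UNIV \<times> {x}) \<subseteq> reeb_cover \<inter> UNIV \<times> {\<eta> x}"
        using M_cover[OF p] by (auto simp: M_def)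
      show "reeb_cover \<inter> UNIV \<times> {\<eta> x} \<subseteq> M a b \<eta> ` (reeb_cover \<inter> UNIV \<times> {x})"
      proof
        fix r :: "complex \<times> real" assume r: "r \<in> reeb_cover \<inter> UNIV \<times> {\<eta> x}"
        then obtain w where w: "r = (w, \<eta> x)" by auto
        let ?s = "((w - b x) / a, x)"
        have "?s \<in> reeb_cover"
          using r w x(1) par(1) K_space_zero[OF par(2) lam, of 0] Z_0[OF par(3)]
          by (cases "x = 0") (auto simp: reeb_cover_iff)
        moreover have "M a b \<eta> ?s = r" using w par(1) by (simp add: M_def)
        ultimately show "r \<in> M a b \<eta> ` (reeb_cover \<inter> UNIV \<times> {x})" by (intro image_eqI[of _ _ ?s]) auto
      qed
    qed
    have "act a b \<eta> ` L = (\<lambda>q. proj (M a b \<eta> q)) ` (reeb_cover \<inter> UNIV \<times> {x})"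
      unfolding x(2) image_image using act_proj[OF p] by (intro image_cong) auto
    also have "\<dots> = proj ` (reeb_cover \<inter> UNIV \<times> {\<eta> x})" by (simp only: image_image[symmetric] img)
    finally show ?thesis using Z_nonneg[OF par(3) x(1)] unfolding reeb_leaves_def by blast
  qed
  moreover have "leaf_holomorphic lam \<phi> x (act a b \<eta>)" if x: "x \<ge> 0" for x
  proof (rule lift_imp_leaf_holomorphic[where y = "\<eta> x" and g = "\<lambda>z. a * z + b x"])
    show "(\<lambda>z. a * z + b x) holomorphic_on level x" by (intro holomorphic_intros)
    show "a * z + b x \<in> level (\<eta> x)" "act a b \<eta> (proj (z, x)) = proj (a * z + b x, \<eta> x)" if "z \<in> level x" for z
      using that M_cover[OF p, of "(z, x)"] act_proj[OF p, of "(z, x)"] level_iff[OF x] level_iff[OF Z_nonneg[OF par(3) x]]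
      by (auto simp: M_def)
  qed (use x Z_nonneg[OF par(3)] in auto)
  ultimately show ?thesis using q(2) by (simp add: Aut_reeb_iff)
qed

lemma Aut_iff_act: "f \<in> carrier (Aut_reeb lam \<phi>) \<longleftrightarrow> (\<exists>a b \<eta>. (a, b, \<eta>) \<in> params \<and> f = act a b \<eta>)"
proof
  assume f: "f \<in> carrier (Aut_reeb lam \<phi>)"
  obtain F a b \<eta> where F: "a \<noteq> 0" "b \<in> K_space lam \<phi>" "\<eta> \<in> carrier (Z_centralizer \<phi>)"
    "is_lift lam \<phi> f F" "affine_form a b \<eta> F" using Aut_structure[OF f] by metis
  then have par: "(a, b, \<eta>) \<in> params" by (simp add: params_def)
  have "f = act a b \<eta>"
  proof (rule act_eqI[OF par])
    show "f \<in> extensional (reeb lam \<phi>)" using f by (auto simp: Aut_reeb_iff Bij_def)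
    show "f (proj p) = proj (M a b \<eta> p)" if "p \<in> reeb_cover" for p
      using F(4,5) that by (cases p) (simp add: is_lift_def affine_form_def M_def)
  qed
  then show "\<exists>a b \<eta>. (a, b, \<eta>) \<in> params \<and> f = act a b \<eta>" using par by blast
qed (use act_Aut in blast)

lemma act_compose:
  assumes p: "(a, b, \<eta>) \<in> params" and q: "(a', b', \<eta>') \<in> params"
  shows "compose (reeb lam \<phi>) (act a b \<eta>) (act a' b' \<eta>') =
    act (a * a') (\<lambda>x. if x \<ge> 0 then a * b' x + b (\<eta>' x) else 0) (compose {0..} \<eta> \<eta>')"
proof (rule act_eqI[OF params_compose(1)[OF p q]])
  show "compose (reeb lam \<phi>) (act a b \<eta>) (act a' b' \<eta>') \<in> extensional (reeb lam \<phi>)" by (rule compose_extensional)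
  show "compose (reeb lam \<phi>) (act a b \<eta>) (act a' b' \<eta>') (proj r) =
      proj (M (a * a') (\<lambda>x. if x \<ge> 0 then a * b' x + b (\<eta>' x) else 0) (compose {0..} \<eta> \<eta>') r)"
    if "r \<in> reeb_cover" for r
    using that params_compose(2)[OF p q that] act_proj[OF q that] act_proj[OF p M_cover[OF q that]] proj_reeb[OF that]
    by (simp add: compose_eq)
qed

lemma subgroup_Aut: "subgroup (carrier (Aut_reeb lam \<phi>)) (BijGroup (reeb lam \<phi>))"
proof (rule subgroup_BijGroupI)
  show "carrier (Aut_reeb lam \<phi>) \<subseteq> Bij (reeb lam \<phi>)" by (auto simp: Aut_reeb_iff)
  have one: "(1, 0, \<lambda>x\<in>{0..}. x) \<in> params"
    using cfun.subspace_0[OF subspace_K] subgroup.one_closed[OF subgroup_Z_centralizer]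
    by (simp add: params_def one_Diff_half)
  have "(\<lambda>P\<in>reeb lam \<phi>. P) = act 1 0 (\<lambda>x\<in>{0..}. x)"
    by (rule act_eqI[OF one]) (auto simp: M_def reeb_cover_iff proj_reeb split: prod.splits)
  then show "(\<lambda>P\<in>reeb lam \<phi>. P) \<in> carrier (Aut_reeb lam \<phi>)" using one Aut_iff_act by blast
  show "compose (reeb lam \<phi>) f g \<in> carrier (Aut_reeb lam \<phi>)"
    if fg: "f \<in> carrier (Aut_reeb lam \<phi>)" "g \<in> carrier (Aut_reeb lam \<phi>)" for f g
  proof -
    obtain a b \<eta> a' b' \<eta>' where p: "(a, b, \<eta>) \<in> params" "f = act a b \<eta>"
      and q: "(a', b', \<eta>') \<in> params" "g = act a' b' \<eta>'" using fg unfolding Aut_iff_act by blast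
    show ?thesis
      unfolding p(2) q(2) act_compose[OF p(1) q(1)] using params_compose(1)[OF p(1) q(1)] by (rule act_Aut)
  qed
  fix f assume "f \<in> carrier (Aut_reeb lam \<phi>)"
  then obtain a b \<eta> where p: "(a, b, \<eta>) \<in> params" "f = act a b \<eta>" using Aut_iff_act by blast
  obtain a' b' \<eta>' where q: "(a', b', \<eta>') \<in> params"
    "\<forall>P\<in>reeb lam \<phi>. inv_into (reeb lam \<phi>) f P = act a' b' \<eta>' P"
    using act_inverse[OF p(1)] p(2) by metis
  have "restrict (inv_into (reeb lam \<phi>) f) (reeb lam \<phi>) = act a' b' \<eta>'"
    using q(2) by (intro extensionalityI[of _ "reeb lam \<phi>"]) (auto simp: act_def)
  then show "restrict (inv_into (reeb lam \<phi>) f) (reeb lam \<phi>) \<in> carrier (Aut_reeb lam \<phi>)"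
    using q(1) act_Aut by simp
qed

lemma group_Aut: "group (Aut_reeb lam \<phi>)"
proof -
  have "Aut_reeb lam \<phi> = BijGroup (reeb lam \<phi>)\<lparr>carrier := carrier (Aut_reeb lam \<phi>)\<rparr>" by (simp add: Aut_reeb_def)
  then show ?thesis using group_sub_BijGroup[OF subgroup_Aut] by simp
qed

lemma mult_Aut:
  assumes "f \<in> carrier (Aut_reeb lam \<phi>)" "g \<in> carrier (Aut_reeb lam \<phi>)"
  shows "f \<otimes>\<^bsub>Aut_reeb lam \<phi>\<^esub> g = compose (reeb lam \<phi>) f g"
proof -
  have "f \<otimes>\<^bsub>Aut_reeb lam \<phi>\<^esub> g = f \<otimes>\<^bsub>BijGroup (reeb lam \<phi>)\<^esub> g" by (simp add: Aut_reeb_def)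
  then show ?thesis using assms by (simp add: mult_BijGroup Aut_reeb_iff)
qed

section \<open>Automorphisms fixing the boundary\<close>

abbreviation "idR \<equiv> (\<lambda>x::real\<in>{0..}. x)"

lemma idR_Z: "idR \<in> carrier (Z_centralizer \<phi>)"
  using subgroup.one_closed[OF subgroup_Z_centralizer] by (simp add: one_Diff_half)

lemma zero_K: "0 \<in> K_space lam \<phi>"
  using cfun.subspace_0[OF subspace_K] .

lemma itr_Z: "itr n \<in> carrier (Z_centralizer \<phi>)"
  using itr_carrier by (simp add: Z_centralizer_iff itr_phi phi_itr)

lemma K_0: "b \<in> K_space lam \<phi> \<Longrightarrow> b 0 = 0"
  using K_space_zero lam by simp

lemma Aut_rel_iff: "f \<in> carrier (Aut_reeb_rel lam \<phi>) \<longleftrightarrow>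
    f \<in> carrier (Aut_reeb lam \<phi>) \<and> (\<forall>P\<in>reeb_bdry lam \<phi>. f P = P)"
  by (simp add: Aut_reeb_rel_def)

lemma act_bdry:
  assumes "(a, b, \<eta>) \<in> params" "z \<noteq> 0"
  shows "act a b \<eta> (proj (z, 0)) = proj (a * z, 0)"
proof -
  have "b \<in> K_space lam \<phi>" "\<eta> \<in> carrier (Z_centralizer \<phi>)" using assms by (auto simp: params_def)
  then show ?thesis using act_proj[OF assms(1) bdry_cover[OF assms(2)]] by (simp add: M_def K_0 Z_0)
qed

text \<open>If the lift \<open>M a b \<eta>\<close> induces the identity on the boundary, then \<open>a\<close> is a power of \<open>lam\<close>, and composing
  with a power of the Hopf map makes it 1.\<close>

lemma Aut_rel_iff_act: "f \<in> carrier (Aut_reeb_rel lam \<phi>) \<longleftrightarrow> (\<exists>b \<eta>. (1, b, \<eta>) \<in> params \<and> f = act 1 b \<eta>)"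
proof
  assume f: "f \<in> carrier (Aut_reeb_rel lam \<phi>)"
  then have "f \<in> carrier (Aut_reeb lam \<phi>)" using Aut_rel_iff[of f] by blast
  then obtain a b \<eta> where p: "(a, b, \<eta>) \<in> params" "f = act a b \<eta>"
    using Aut_iff_act[of f] by blast
  have a: "a \<noteq> 0" using p(1) by (simp add: params_def)
  have "proj (1, 0) \<in> reeb_bdry lam \<phi>" by (auto simp: reeb_bdry_def)
  then have e: "proj (1, 0) = proj (a, 0)" using act_bdry[OF p(1), of 1] f p(2) by (simp add: Aut_rel_iff)
  have c: "(1, 0) \<in> reeb_cover" "(a, 0) \<in> reeb_cover" using a by (simp_all add: reeb_cover_iff)
  obtain n where "(a, 0) = T n (1, 0)" using proj_eq_iff[OF c] e by blast
  then have an: "a = lam powi n" by (simp add: T_pair)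
  have q: "(lam powi (- n), 0, itr (- n)) \<in> params" using zero_K itr_Z by (simp add: params_def)
  let ?b = "\<lambda>x. if x \<ge> 0 then lam powi (- n) * b x + (0 :: real \<Rightarrow> complex) (\<eta> x) else 0"
  let ?\<eta> = "compose {0..} (itr (- n)) \<eta>"
  have one: "lam powi (- n) * a = 1" using an by (simp add: power_int_minus)
  have r: "(1, ?b, ?\<eta>) \<in> params" using params_compose(1)[OF q p(1)] unfolding one .
  have "f = act 1 ?b ?\<eta>"
  proof (rule act_eqI[OF r])
    show "f \<in> extensional (reeb lam \<phi>)" using p(2) by (simp add: act_def)
    fix s :: "complex \<times> real" assume s: "s \<in> reeb_cover"
    have "M 1 ?b ?\<eta> s = M (lam powi (- n)) 0 (itr (- n)) (M a b \<eta> s)"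
      using params_compose(2)[OF q p(1) s] unfolding one by simp
    also have "\<dots> = T (- n) (M a b \<eta> s)" by (simp add: M_def T_def case_prod_beta')
    finally show "f (proj s) = proj (M 1 ?b ?\<eta> s)"
      using p(2) act_proj[OF p(1) s] M_cover[OF p(1) s] by simp
  qed
  then show "\<exists>b \<eta>. (1, b, \<eta>) \<in> params \<and> f = act 1 b \<eta>" using r by blast
next
  assume "\<exists>b \<eta>. (1, b, \<eta>) \<in> params \<and> f = act 1 b \<eta>"
  then obtain b \<eta> where p: "(1, b, \<eta>) \<in> params" "f = act 1 b \<eta>" by blast
  then show "f \<in> carrier (Aut_reeb_rel lam \<phi>)"
    using act_Aut[OF p(1)] act_bdry[OF p(1)] by (auto simp: Aut_rel_iff bdry_iff)
qed

lemma act_is_lift: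
  assumes "(a, b, \<eta>) \<in> params"
  shows "is_lift lam \<phi> (act a b \<eta>) (M a b \<eta>)" "affine_form a b \<eta> (M a b \<eta>)"
  using M_cover[OF assms] act_proj[OF assms] smooth_on_continuous[OF M_smooth[OF assms]]
  by (simp_all add: is_lift_def image_subset_iff) (simp add: affine_form_def M_def)

text \<open>Two lifts differ by a power of the Hopf map, which moves boundary points unless it is trivial:
  the lift fixing the boundary pointwise is unique.\<close>

lemma transverse_act:
  assumes p: "(1, b, \<eta>) \<in> params"
  shows "transverse lam \<phi> (act 1 b \<eta>) = \<eta>"
  unfolding transverse_def
proof (rule the_equality)
  have par: "b \<in> K_space lam \<phi>" "\<eta> \<in> carrier (Z_centralizer \<phi>)" using p by (auto simp: params_def)
  have ext: "\<eta> \<in> extensional {0..}" using par(2) by (auto simp: Z_centralizer_iff Diff_half_iff Bij_def)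
  have M0: "M 1 b \<eta> (z, 0) = (z, 0)" for z using par by (simp add: M_def K_0 Z_0)
  show "\<eta> \<in> extensional {0..} \<and> (\<exists>F b'. is_lift lam \<phi> (act 1 b \<eta>) F \<and>
      (\<forall>z. z \<noteq> 0 \<longrightarrow> F (z, 0) = (z, 0)) \<and> affine_form 1 b' \<eta> F)"
    using ext act_is_lift[OF p] M0 by blast
  fix \<eta>' assume "\<eta>' \<in> extensional {0..} \<and> (\<exists>F b'. is_lift lam \<phi> (act 1 b \<eta>) F \<and>
      (\<forall>z. z \<noteq> 0 \<longrightarrow> F (z, 0) = (z, 0)) \<and> affine_form 1 b' \<eta>' F)"
  then obtain F b' where F: "\<eta>' \<in> extensional {0..}" "is_lift lam \<phi> (act 1 b \<eta>) F"
    "\<forall>z. z \<noteq> 0 \<longrightarrow> F (z, 0) = (z, 0)" "affine_form 1 b' \<eta>' F" by blast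
  have Fl: "continuous_on reeb_cover F" "F ` reeb_cover \<subseteq> reeb_cover"
    and Fp: "\<forall>s\<in>reeb_cover. act 1 b \<eta> (proj s) = proj (F s)" using F(2) unfolding is_lift_def by blast+
  have Mc: "M 1 b \<eta> ` reeb_cover \<subseteq> reeb_cover" using M_cover[OF p] by blast
  have eq: "proj (F s) = proj (M 1 b \<eta> s)" if "s \<in> reeb_cover" for s using Fp act_proj[OF p that] that by simp
  obtain n where n: "\<forall>s\<in>reeb_cover. F s = T n (M 1 b \<eta> s)"
    using two_lifts[OF connected_reeb_cover Fl smooth_on_continuous[OF M_smooth[OF p]] Mc eq] by blast
  have c: "(1, 0) \<in> reeb_cover" by (simp add: reeb_cover_iff)
  have "T 0 (1, 0) = T n (1, 0)" using n c F(3) M0 T_0[OF c] by auto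
  then have "n = 0" using T_eq_iff[OF c] by simp
  show "\<eta>' = \<eta>"
  proof (rule extensionalityI[OF F(1) ext])
    fix x :: real assume "x \<in> {0..}"
    then have cx: "(1, x) \<in> reeb_cover" by (simp add: reeb_cover_iff)
    have "F (1, x) = M 1 b \<eta> (1, x)" using n cx \<open>n = 0\<close> T_0[OF M_cover[OF p cx]] by simp
    then show "\<eta>' x = \<eta> x" using F(4) cx by (simp add: affine_form_def M_def)
  qed
qed

lemma K_params: "b \<in> K_space lam \<phi> \<Longrightarrow> (1, b, idR) \<in> params"
  using idR_Z by (simp add: params_def)

lemma K_action_eq:
  assumes "b \<in> K_space lam \<phi>"
  shows "K_action lam \<phi> b = act 1 b idR"
  unfolding K_action_def act_def
proof (rule restrict_ext)
  fix P assume "P \<in> reeb lam \<phi>"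
  then obtain p where p: "p \<in> reeb_cover" "P = proj p" using reeb_iff by blast
  have "q \<in> reeb_cover" if "q \<in> P" for q using that T_cover[OF p(1)] by (auto simp: p(2) proj_eq[OF p(1)])
  then show "(\<lambda>(z, x). (z + b x, x)) ` P = M 1 b idR ` P"
    by (intro image_cong) (auto simp: M_def reeb_cover_iff)
qed

lemma subgroup_Aut_rel: "subgroup (carrier (Aut_reeb_rel lam \<phi>)) (BijGroup (reeb lam \<phi>))"
proof (rule subgroup_BijGroupI)
  have B: "f \<in> Bij (reeb lam \<phi>)" if "f \<in> carrier (Aut_reeb lam \<phi>)" for f using that by (simp add: Aut_reeb_iff)
  then show "carrier (Aut_reeb_rel lam \<phi>) \<subseteq> Bij (reeb lam \<phi>)" by (auto simp: Aut_rel_iff)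
  show "(\<lambda>P\<in>reeb lam \<phi>. P) \<in> carrier (Aut_reeb_rel lam \<phi>)"
    using subgroup.one_closed[OF subgroup_Aut] bdry_subset by (auto simp: Aut_rel_iff one_BijGroup)
  show "compose (reeb lam \<phi>) f g \<in> carrier (Aut_reeb_rel lam \<phi>)"
    if "f \<in> carrier (Aut_reeb_rel lam \<phi>)" "g \<in> carrier (Aut_reeb_rel lam \<phi>)" for f g
    using that subgroup.m_closed[OF subgroup_Aut, of f g] mult_BijGroup[OF B B, of f g] bdry_subset
    by (auto simp: Aut_rel_iff compose_eq subset_iff)
  show "restrict (inv_into (reeb lam \<phi>) f) (reeb lam \<phi>) \<in> carrier (Aut_reeb_rel lam \<phi>)"
    if "f \<in> carrier (Aut_reeb_rel lam \<phi>)" for f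
  proof -
    have f: "f \<in> carrier (Aut_reeb lam \<phi>)" "\<forall>P\<in>reeb_bdry lam \<phi>. f P = P" using that by (auto simp: Aut_rel_iff)
    have "inv_into (reeb lam \<phi>) f P = P" if "P \<in> reeb_bdry lam \<phi>" for P
      using Bij_D(3)[OF B[OF f(1)], of P] f(2) that bdry_subset by auto
    then show ?thesis
      using subgroup.m_inv_closed[OF subgroup_Aut f(1)] inv_BijGroup[OF B[OF f(1)]] bdry_subset
      by (auto simp: Aut_rel_iff)
  qed
qed

lemma group_Aut_rel: "group (Aut_reeb_rel lam \<phi>)"
proof -
  have "Aut_reeb_rel lam \<phi> = BijGroup (reeb lam \<phi>)\<lparr>carrier := carrier (Aut_reeb_rel lam \<phi>)\<rparr>"
    by (simp add: Aut_reeb_rel_def Aut_reeb_def)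
  then show ?thesis using group_sub_BijGroup[OF subgroup_Aut_rel] by simp
qed

lemma mult_Aut_rel:
  assumes "f \<in> carrier (Aut_reeb_rel lam \<phi>)" "g \<in> carrier (Aut_reeb_rel lam \<phi>)"
  shows "f \<otimes>\<^bsub>Aut_reeb_rel lam \<phi>\<^esub> g = compose (reeb lam \<phi>) f g"
proof -
  have "f \<otimes>\<^bsub>Aut_reeb_rel lam \<phi>\<^esub> g = f \<otimes>\<^bsub>Aut_reeb lam \<phi>\<^esub> g" by (simp add: Aut_reeb_rel_def)
  then show ?thesis using assms by (simp add: mult_Aut Aut_rel_iff)
qed

lemma comm_group_K: "comm_group (K_group lam \<phi>)"
proof (rule comm_groupI)
  fix u assume "u \<in> carrier (K_group lam \<phi>)"
  then have "- u \<in> carrier (K_group lam \<phi>)" using cfun.subspace_neg[OF subspace_K] by (simp add: K_group_def)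
  then show "\<exists>v\<in>carrier (K_group lam \<phi>). v \<otimes>\<^bsub>K_group lam \<phi>\<^esub> u = \<one>\<^bsub>K_group lam \<phi>\<^esub>"
    by (intro bexI[of _ "- u"]) (simp_all add: K_group_def)
qed (use cfun.subspace_add[OF subspace_K] zero_K in \<open>auto simp: K_group_def algebra_simps\<close>)

lemma compose_idR: "\<eta> \<in> carrier (Z_centralizer \<phi>) \<Longrightarrow> compose {0..} idR \<eta> = \<eta>"
  using Z_nonneg[of \<eta>] by (intro extensionalityI[of _ "{0..}"]) (auto simp: compose_eq Z_centralizer_iff Diff_half_iff Bij_def)

lemma mult_Z:
  "f \<in> carrier (Z_centralizer \<phi>) \<Longrightarrow> g \<in> carrier (Z_centralizer \<phi>) \<Longrightarrow> f \<otimes>\<^bsub>Z_centralizer \<phi>\<^esub> g = compose {0..} f g"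
  by (simp add: Z_centralizer_def mult_Diff_half)

lemma short_exact_transverse:
  "short_exact (K_group lam \<phi>) (Aut_reeb_rel lam \<phi>) (Z_centralizer \<phi>) (K_action lam \<phi>) (transverse lam \<phi>)"
  unfolding short_exact_def
proof (intro conjI)
  show "group (K_group lam \<phi>)" "group (Z_centralizer \<phi>)"
    using comm_group_K comm_group_Z_centralizer by (simp_all add: comm_group_def)
  show "group (Aut_reeb_rel lam \<phi>)" by (rule group_Aut_rel)
  have Kc: "K_action lam \<phi> b \<in> carrier (Aut_reeb_rel lam \<phi>)" if "b \<in> K_space lam \<phi>" for b
    using K_action_eq[OF that] K_params[OF that] Aut_rel_iff_act by blast
  have add: "K_action lam \<phi> (b + b') = compose (reeb lam \<phi>) (K_action lam \<phi> b) (K_action lam \<phi> b')"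
    if b: "b \<in> K_space lam \<phi>" "b' \<in> K_space lam \<phi>" for b b'
  proof -
    have "(\<lambda>x. if x \<ge> 0 then 1 * b' x + b (idR x) else 0) = b + b'"
      using b by (auto simp: fun_eq_iff K_space_def)
    then show ?thesis
      using act_compose[OF K_params[OF b(1)] K_params[OF b(2)]] compose_idR[OF idR_Z] b
        K_action_eq cfun.subspace_add[OF subspace_K] by simp
  qed
  have "K_action lam \<phi> \<in> hom (K_group lam \<phi>) (Aut_reeb_rel lam \<phi>)"
    using Kc add by (auto simp: hom_def K_group_def mult_Aut_rel)
  moreover have "inj_on (K_action lam \<phi>) (carrier (K_group lam \<phi>))"
  proof (rule inj_onI)
    fix b b' assume "b \<in> carrier (K_group lam \<phi>)" "b' \<in> carrier (K_group lam \<phi>)" and eq: "K_action lam \<phi> b = K_action lam \<phi> b'"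
    then have b: "b \<in> K_space lam \<phi>" "b' \<in> K_space lam \<phi>" by (auto simp: K_group_def)
    have "b x = b' x" for x
    proof (cases "x > 0")
      case True
      then have c: "(0, x) \<in> reeb_cover" by (simp add: reeb_cover_iff)
      have m: "M 1 b idR (0, x) = (b x, x)" "M 1 b' idR (0, x) = (b' x, x)" using True by (auto simp: M_def)
      have "proj (b x, x) = proj (b' x, x)"
        using act_proj[OF K_params[OF b(1)] c] act_proj[OF K_params[OF b(2)] c] eq m K_action_eq b by simp
      then obtain n where n: "(b' x, x) = T n (b x, x)"
        using proj_eq_iff[of "(b x, x)" "(b' x, x)"] True by (auto simp: reeb_cover_iff)
      then have "itr n x = itr 0 x" using True by (simp add: T_pair itr_0)
      then have "n = 0" using itr_eq_index_iff[OF True] by simp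
      then show ?thesis using n by (simp add: T_pair)
    next
      case False
      then show ?thesis using K_space_zero[OF b(1) lam, of x] K_space_zero[OF b(2) lam, of x] by simp
    qed
    then show "b = b'" by blast
  qed
  ultimately show "K_action lam \<phi> \<in> mon (K_group lam \<phi>) (Aut_reeb_rel lam \<phi>)" by (simp add: mon_def)
  have tr: "transverse lam \<phi> f \<in> carrier (Z_centralizer \<phi>)" if "f \<in> carrier (Aut_reeb_rel lam \<phi>)" for f
    using that transverse_act by (auto simp: Aut_rel_iff_act params_def)
  have "transverse lam \<phi> (compose (reeb lam \<phi>) f g) = compose {0..} (transverse lam \<phi> f) (transverse lam \<phi> g)"
    if fg: "f \<in> carrier (Aut_reeb_rel lam \<phi>)" "g \<in> carrier (Aut_reeb_rel lam \<phi>)" for f g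
  proof -
    obtain b \<eta> b' \<eta>' where p: "(1, b, \<eta>) \<in> params" "f = act 1 b \<eta>" and q: "(1, b', \<eta>') \<in> params" "g = act 1 b' \<eta>'"
      using fg unfolding Aut_rel_iff_act by blast
    show ?thesis
      using act_compose[OF p(1) q(1)] params_compose(1)[OF p(1) q(1)] p q by (simp add: transverse_act)
  qed
  then have "transverse lam \<phi> \<in> hom (Aut_reeb_rel lam \<phi>) (Z_centralizer \<phi>)"
    using tr by (auto simp: hom_def mult_Aut_rel mult_Z)
  moreover have "carrier (Z_centralizer \<phi>) \<subseteq> transverse lam \<phi> ` carrier (Aut_reeb_rel lam \<phi>)"
  proof
    fix \<eta> assume "\<eta> \<in> carrier (Z_centralizer \<phi>)"
    then have p: "(1, 0, \<eta>) \<in> params" using zero_K by (simp add: params_def)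
    then show "\<eta> \<in> transverse lam \<phi> ` carrier (Aut_reeb_rel lam \<phi>)"
      using transverse_act[OF p] Aut_rel_iff_act by (intro image_eqI[of _ _ "act 1 0 \<eta>"]) auto
  qed
  ultimately show "transverse lam \<phi> \<in> epi (Aut_reeb_rel lam \<phi>) (Z_centralizer \<phi>)"
    using tr by (auto simp: epi_def)
  have one: "\<one>\<^bsub>Z_centralizer \<phi>\<^esub> = idR" by (simp add: Z_centralizer_def one_Diff_half)
  show "K_action lam \<phi> ` carrier (K_group lam \<phi>) = kernel (Aut_reeb_rel lam \<phi>) (Z_centralizer \<phi>) (transverse lam \<phi>)"
  proof (intro equalityI subsetI)
    fix f assume "f \<in> K_action lam \<phi> ` carrier (K_group lam \<phi>)"
    then obtain b where b: "b \<in> K_space lam \<phi>" "f = K_action lam \<phi> b" by (auto simp: K_group_def)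
    then show "f \<in> kernel (Aut_reeb_rel lam \<phi>) (Z_centralizer \<phi>) (transverse lam \<phi>)"
      using Kc[OF b(1)] transverse_act[OF K_params[OF b(1)]] K_action_eq[OF b(1)] by (simp add: kernel_def one)
  next
    fix f assume "f \<in> kernel (Aut_reeb_rel lam \<phi>) (Z_centralizer \<phi>) (transverse lam \<phi>)"
    then have f: "f \<in> carrier (Aut_reeb_rel lam \<phi>)" "transverse lam \<phi> f = idR" by (auto simp: kernel_def one)
    obtain b \<eta> where p: "(1, b, \<eta>) \<in> params" "f = act 1 b \<eta>" using f(1) Aut_rel_iff_act by blast
    then have "\<eta> = idR" using f(2) transverse_act by simp
    moreover have b: "b \<in> K_space lam \<phi>" using p by (simp add: params_def)
    ultimately have "f = K_action lam \<phi> b" using K_action_eq p by simp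
    then show "f \<in> K_action lam \<phi> ` carrier (K_group lam \<phi>)" using b by (auto simp: K_group_def)
  qed
qed

end

section \<open>The boundary elliptic curve\<close>

context hopf
begin

definition bdry_mult :: "complex \<Rightarrow> (complex \<times> real) set \<Rightarrow> (complex \<times> real) set" where
  "bdry_mult a = (\<lambda>P\<in>reeb_bdry lam \<phi>. (\<lambda>(z, x). (a * z, x)) ` P)"

definition Q :: "complex \<Rightarrow> (complex \<times> real) set" where "Q w = proj (exp w, 0)"

definition \<Lambda> :: "complex set" where "\<Lambda> = {l. \<exists>k::int. exp l = lam powi k}"

lemma bdry_projI: "z \<noteq> 0 \<Longrightarrow> proj (z, 0) \<in> reeb_bdry lam \<phi>"
  by (auto simp: reeb_bdry_def)

lemma proj_0_eq_iff: "z \<noteq> 0 \<Longrightarrow> w \<noteq> 0 \<Longrightarrow> proj (z, 0) = proj (w, 0) \<longleftrightarrow> (\<exists>n. w = lam powi n * z)"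
  using proj_eq_iff[OF bdry_cover bdry_cover, of z w] by (simp add: T_pair itr_zero)

lemma Q_eq_iff: "Q v = Q w \<longleftrightarrow> w - v \<in> \<Lambda>"
  using proj_0_eq_iff[of "exp v" "exp w"] by (auto simp: Q_def \<Lambda>_def exp_diff field_simps)

lemma bdry_Q: "P \<in> reeb_bdry lam \<phi> \<longleftrightarrow> (\<exists>w. P = Q w)"
proof
  assume "P \<in> reeb_bdry lam \<phi>"
  then obtain z where "z \<noteq> 0" "P = proj (z, 0)" by (auto simp: bdry_iff)
  then show "\<exists>w. P = Q w" by (intro exI[of _ "Ln z"]) (simp add: Q_def)
qed (auto simp: Q_def intro: bdry_projI)

lemma bdry_mult_proj: "a \<noteq> 0 \<Longrightarrow> z \<noteq> 0 \<Longrightarrow> bdry_mult a (proj (z, 0)) = proj (a * z, 0)" (is "_ \<Longrightarrow> _ \<Longrightarrow> ?thesis")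
proof -
  assume a: "a \<noteq> 0" and z: "z \<noteq> 0"
  have "bdry_mult a (proj (z, 0)) = (\<lambda>(z, x). (a * z, x)) ` proj (z, 0)" using bdry_projI[OF z] by (simp add: bdry_mult_def)
  also have "\<dots> = proj (a * z, 0)"
    using a z by (simp add: proj_eq bdry_cover image_image T_pair mult.left_commute itr_zero)
  finally show ?thesis .
qed

lemma bdry_mult_eqI:
  assumes "a \<noteq> 0" "f \<in> extensional (reeb_bdry lam \<phi>)" "\<And>z. z \<noteq> 0 \<Longrightarrow> f (proj (z, 0)) = proj (a * z, 0)"
  shows "f = bdry_mult a"
proof (rule extensionalityI[OF assms(2)])
  show "bdry_mult a \<in> extensional (reeb_bdry lam \<phi>)" by (simp add: bdry_mult_def)
  fix P assume "P \<in> reeb_bdry lam \<phi>"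
  then show "f P = bdry_mult a P" using assms bdry_mult_proj by (auto simp: bdry_iff)
qed

lemma bdry_mult_eq_iff:
  assumes "a \<noteq> 0" "a' \<noteq> 0"
  shows "bdry_mult a = bdry_mult a' \<longleftrightarrow> (\<exists>n. a' = lam powi n * a)"
proof
  assume "bdry_mult a = bdry_mult a'"
  then have "proj (a, 0) = proj (a', 0)" using bdry_mult_proj[of a 1] bdry_mult_proj[of a' 1] assms by simp
  then show "\<exists>n. a' = lam powi n * a" using proj_0_eq_iff assms by simp
next
  assume "\<exists>n. a' = lam powi n * a"
  then obtain n where n: "a' = lam powi n * a" by blast
  show "bdry_mult a = bdry_mult a'"
  proof (rule bdry_mult_eqI[OF assms(2)])
    show "bdry_mult a \<in> extensional (reeb_bdry lam \<phi>)" by (simp add: bdry_mult_def)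
    fix z :: complex assume z: "z \<noteq> 0"
    show "bdry_mult a (proj (z, 0)) = proj (a' * z, 0)"
      using bdry_mult_proj[OF assms(1) z] proj_0_eq_iff[of "a * z" "a' * z"] assms z n by auto
  qed
qed

lemma bdry_mult_inverse: "a \<noteq> 0 \<Longrightarrow> P \<in> reeb_bdry lam \<phi> \<Longrightarrow> bdry_mult a P \<in> reeb_bdry lam \<phi> \<and> bdry_mult (inverse a) (bdry_mult a P) = P" (is "_ \<Longrightarrow> _ \<Longrightarrow> ?thesis")
proof -
  assume a: "a \<noteq> 0" and "P \<in> reeb_bdry lam \<phi>"
  then obtain z where z: "z \<noteq> 0" "P = proj (z, 0)" by (auto simp: bdry_iff)
  have e: "inverse a * (a * z) = z" using a by simp
  have "bdry_mult (inverse a) (proj (a * z, 0)) = proj (z, 0)"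
    using bdry_mult_proj[of "inverse a" "a * z"] a z(1) unfolding e by simp
  then show ?thesis using bdry_mult_proj[OF a z(1)] bdry_projI[of "a * z"] a z by simp
qed

lemma bdry_mult_Bij: "a \<noteq> 0 \<Longrightarrow> bdry_mult a \<in> Bij (reeb_bdry lam \<phi>)"
  and inv_into_bdry_mult: "a \<noteq> 0 \<Longrightarrow> P \<in> reeb_bdry lam \<phi> \<Longrightarrow> inv_into (reeb_bdry lam \<phi>) (bdry_mult a) P = bdry_mult (inverse a) P"
proof -
  have *: "bdry_mult a \<in> Bij (reeb_bdry lam \<phi>) \<and> (\<forall>P\<in>reeb_bdry lam \<phi>. inv_into (reeb_bdry lam \<phi>) (bdry_mult a) P = bdry_mult (inverse a) P)"
    if a: "a \<noteq> 0" for a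
  proof -
    have ext: "bdry_mult a \<in> extensional (reeb_bdry lam \<phi>)" by (simp add: bdry_mult_def)
    have ia: "inverse a \<noteq> 0" using a by simp
    show ?thesis
      using Bij_I[of "bdry_mult a" "reeb_bdry lam \<phi>" "bdry_mult (inverse a)", OF ext] bdry_mult_inverse[OF a] bdry_mult_inverse[OF ia] by simp
  qed
  show "a \<noteq> 0 \<Longrightarrow> bdry_mult a \<in> Bij (reeb_bdry lam \<phi>)"
    "a \<noteq> 0 \<Longrightarrow> P \<in> reeb_bdry lam \<phi> \<Longrightarrow> inv_into (reeb_bdry lam \<phi>) (bdry_mult a) P = bdry_mult (inverse a) P"
    using * by blast+
qed

lemma Aut_bdry_iff: "f \<in> carrier (Aut_bdry lam \<phi>) \<longleftrightarrow> f \<in> Bij (reeb_bdry lam \<phi>) \<and>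
    leaf_holomorphic lam \<phi> 0 f \<and> leaf_holomorphic lam \<phi> 0 (inv_into (reeb_bdry lam \<phi>) f)"
  by (simp add: Aut_bdry_def)

lemma bdry_mult_Aut: "a \<noteq> 0 \<Longrightarrow> bdry_mult a \<in> carrier (Aut_bdry lam \<phi>)"
proof -
  have hol: "leaf_holomorphic lam \<phi> 0 f"
    if a: "a \<noteq> 0" and f: "\<And>z. z \<noteq> 0 \<Longrightarrow> f (proj (z, 0)) = proj (a * z, 0)" for f a
    by (rule lift_imp_leaf_holomorphic[where y = 0 and g = "\<lambda>z. a * z"])
      (use a f in \<open>auto simp: level_def intro!: holomorphic_intros\<close>)
  assume a: "a \<noteq> 0"
  have "leaf_holomorphic lam \<phi> 0 (bdry_mult a)" using hol[OF a bdry_mult_proj[OF a]] .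
  moreover have "leaf_holomorphic lam \<phi> 0 (inv_into (reeb_bdry lam \<phi>) (bdry_mult a))"
    using a inv_into_bdry_mult[OF a bdry_projI] bdry_mult_proj[of "inverse a"] by (intro hol[of "inverse a"]) auto
  ultimately show ?thesis using bdry_mult_Bij[OF a] by (simp add: Aut_bdry_iff)
qed

subsection \<open>Automorphisms of the curve in the logarithmic coordinate\<close>

text \<open>The map \<open>\<lambda>w. f (Q w)\<close> of the plane lifts to the cover. The logarithmic derivative of its lift is
  doubly periodic, since the lift is multiplied by a power of \<open>lam\<close> under each period; hence it is
  bounded and constant.\<close>

lemma Aut_bdry_log_lift:
  assumes f: "f \<in> carrier (Aut_bdry lam \<phi>)"
  obtains \<alpha> L where "\<And>w. f (Q w) = Q (\<alpha> * w + L)"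
proof -
  have hol: "leaf_holomorphic lam \<phi> 0 f" and B: "f \<in> Bij (reeb_bdry lam \<phi>)" using f by (auto simp: Aut_bdry_iff)
  have local: "\<exists>V g y. open V \<and> w \<in> V \<and> g holomorphic_on V \<and>
      (\<forall>v\<in>V. (g v, y) \<in> reeb_cover \<and> f (Q v) = proj (g v, y))" for w
  proof -
    have "(exp w, 0) \<in> reeb_cover" by (simp add: bdry_cover)
    then obtain W y W' g where W: "leaf_chart lam \<phi> 0 W" "exp w \<in> W" "leaf_chart lam \<phi> y W'" "g ` W \<subseteq> W'"
      "g holomorphic_on W" "\<forall>u\<in>W. f (proj (u, 0)) = proj (g u, y)"
      using hol unfolding leaf_holomorphic_def by blast
    let ?V = "exp -` W"
    have "open W" using W(1) by (simp add: leaf_chart_def)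
    then have "open ?V" by (intro open_vimage) (auto intro: continuous_intros)
    moreover have "(g \<circ> exp) holomorphic_on ?V"
      using W(5) by (intro holomorphic_on_compose_gen[OF holomorphic_on_exp]) auto
    moreover have "\<forall>v\<in>?V. ((g \<circ> exp) v, y) \<in> reeb_cover \<and> f (Q v) = proj ((g \<circ> exp) v, y)"
      using W(3,4,6) by (auto simp: leaf_chart_def Q_def)
    ultimately show ?thesis using W(2) by (intro exI[of _ ?V] exI[of _ "g \<circ> exp"] exI[of _ y]) auto
  qed
  have lift: "\<exists>U G. openin (top_of_set UNIV) U \<and> w \<in> U \<and> continuous_on U G \<and> G ` U \<subseteq> reeb_cover \<and>
      (\<forall>v\<in>U. (\<lambda>w. f (Q w)) v = proj (G v))" if "w \<in> UNIV" for w
  proof -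
    obtain V g y where V: "open V" "w \<in> V" "g holomorphic_on V"
      "\<forall>v\<in>V. (g v, y) \<in> reeb_cover \<and> f (Q v) = proj (g v, y)" using local[of w] by blast
    have "continuous_on V (\<lambda>v. (g v, y))"
      using holomorphic_on_imp_continuous_on[OF V(3)] by (intro continuous_intros)
    then show ?thesis using V by (intro exI[of _ V] exI[of _ "\<lambda>v. (g v, y)"]) auto
  qed
  have "contractible (UNIV :: complex set)" by (rule convex_imp_contractible) simp
  then obtain F where F: "continuous_on UNIV F" "F ` UNIV \<subseteq> reeb_cover" "\<And>w. w \<in> UNIV \<Longrightarrow> f (Q w) = proj (F w)"
    using lifting[OF _ lift] by blast
  have Fc: "F w \<in> reeb_cover" and Fq: "f (Q w) = proj (F w)" for w using F(2,3) by auto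
  define h where "h w = fst (F w)" for w
  have F_h: "F w = (h w, 0)" "h w \<noteq> 0" for w
  proof -
    have "f (Q w) \<in> reeb_bdry lam \<phi>" using Bij_D(1)[OF B] bdry_Q by blast
    then have "snd (F w) = 0" using proj_bdry_iff[OF Fc] Fq by simp
    then show "F w = (h w, 0)" by (simp add: h_def prod_eq_iff)
    then show "h w \<noteq> 0" using Fc[of w] by (simp add: reeb_cover_iff)
  qed
  have h_hol: "h holomorphic_on UNIV"
  proof -
    have "h field_differentiable (at w)" for w
    proof -
      obtain V g y where V: "open V" "w \<in> V" "g holomorphic_on V"
        "\<forall>v\<in>V. (g v, y) \<in> reeb_cover \<and> f (Q v) = proj (g v, y)" using local[of w] by blast
      have 1: "continuous_on V F" "F ` V \<subseteq> reeb_cover" using F(1) Fc continuous_on_subset by blast+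
      have 2: "continuous_on V (\<lambda>v. (g v, y))" "(\<lambda>v. (g v, y)) ` V \<subseteq> reeb_cover"
        using holomorphic_on_imp_continuous_on[OF V(3)] V(4) by (auto intro: continuous_intros)
      have 3: "proj (F v) = proj (g v, y)" if "v \<in> V" for v using V(4) Fq that by metis
      obtain n V' where V': "openin (top_of_set V) V'" "w \<in> V'" "\<forall>v\<in>V'. F v = T n (g v, y)"
        using two_lifts_local[OF 1 2 3 V(2)] by blast
      have VV: "open V'" "V' \<subseteq> V" using V'(1) V(1) openin_open_trans openin_imp_subset by blast+
      have "(\<lambda>v. lam powi n * g v) holomorphic_on V'"
        using V(3) VV(2) by (intro holomorphic_intros) (rule holomorphic_on_subset)
      then have "h holomorphic_on V'"
        by (rule holomorphic_transform) (use V'(3) in \<open>auto simp: h_def T_pair\<close>)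
      then show ?thesis using VV(1) V'(2) holomorphic_on_imp_differentiable_at by blast
    qed
    then show ?thesis by (simp add: holomorphic_on_def field_differentiable_at_within)
  qed
  define D where "D w = deriv h w / h w" for w
  have D_hol: "D holomorphic_on UNIV"
    unfolding D_def using h_hol F_h(2) by (intro holomorphic_intros holomorphic_deriv) auto
  have h_D: "(h has_field_derivative deriv h w) (at w)" for w
    using h_hol holomorphic_derivI[of h UNIV w] by simp
  have per: "D (w + \<omega>) = D w" if \<omega>: "\<omega> \<in> \<Lambda>" for w \<omega>
  proof -
    have "\<exists>n. \<forall>v\<in>UNIV. F (v + \<omega>) = T n (F v)"
    proof (rule two_lifts)
      show "continuous_on UNIV (\<lambda>v. F (v + \<omega>))"
        by (rule continuous_on_compose2[OF F(1)]) (auto intro: continuous_intros)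
      show "proj (F (v + \<omega>)) = proj (F v)" for v
        using Q_eq_iff[of v "v + \<omega>"] \<omega> Fq by (metis add_diff_cancel_left')
    qed (use F Fc in auto)
    then obtain n where "\<forall>v. F (v + \<omega>) = T n (F v)" by auto
    then have n: "h (v + \<omega>) = lam powi n * h v" for v by (simp add: h_def T_def)
    have "((\<lambda>v. h (v + \<omega>)) has_field_derivative deriv h (w + \<omega>)) (at w)"
      using DERIV_shift[of h "deriv h (w + \<omega>)" w \<omega>] h_D by blast
    moreover have "((\<lambda>v. lam powi n * h v) has_field_derivative lam powi n * deriv h w) (at w)"
      using DERIV_cmult[OF h_D] by blast
    ultimately have "deriv h (w + \<omega>) = lam powi n * deriv h w" unfolding n using DERIV_unique by blast
    then show ?thesis using n[of w] by (simp add: D_def)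
  qed
  let ?\<omega>1 = "2 * of_real pi * \<i> :: complex" and ?\<omega>2 = "Ln lam"
  have \<omega>: "of_int m * ?\<omega>1 + of_int n * ?\<omega>2 \<in> \<Lambda>" for m n :: int
  proof -
    have "exp (of_int m * ?\<omega>1) = 1" by (simp add: exp_eq_1)
    moreover have "exp (of_int n * ?\<omega>2) = lam powi n" using exp_power_int[of ?\<omega>2 n] by simp
    ultimately show ?thesis by (auto simp: \<Lambda>_def exp_add)
  qed
  define r where "r = ln (norm lam)"
  have r: "r > 0" "Re ?\<omega>2 = r" using lam by (simp_all add: r_def Re_Ln)
  let ?K = "cbox (Complex 0 0) (Complex r (2 * pi))"
  have "continuous_on ?K D" using holomorphic_on_imp_continuous_on[OF D_hol] continuous_on_subset by blast
  then have "bounded (D ` ?K)" by (intro compact_imp_bounded compact_continuous_image compact_cbox)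
  then obtain C where C: "\<forall>w\<in>?K. norm (D w) \<le> C" unfolding bounded_iff by blast
  have "norm (D w) \<le> C" for w
  proof -
    define n where "n = - \<lfloor>Re w / r\<rfloor>"
    define w1 where "w1 = w + of_int n * ?\<omega>2"
    define m where "m = - \<lfloor>Im w1 / (2 * pi)\<rfloor>"
    define w2 where "w2 = w + (of_int m * ?\<omega>1 + of_int n * ?\<omega>2)"
    have fl: "0 \<le> t + real_of_int (- \<lfloor>t / s\<rfloor>) * s \<and> t + real_of_int (- \<lfloor>t / s\<rfloor>) * s \<le> s" if "s > 0" for s t :: real
      using that floor_divide_lower[OF that, of t] floor_divide_upper[OF that, of t] by (simp add: algebra_simps)
    have Re2: "Re w2 = Re w + real_of_int n * r" using r(2) by (simp add: w2_def)
    have Im2: "Im w2 = Im w1 + real_of_int m * (2 * pi)" by (simp add: w2_def w1_def)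
    have "w2 \<in> ?K"
      unfolding in_cbox_complex_iff using fl[OF r(1), of "Re w"] fl[of "2 * pi" "Im w1"] Re2 Im2
      by (simp add: n_def m_def)
    moreover have "D w2 = D w" unfolding w2_def by (rule per[OF \<omega>])
    ultimately show ?thesis using C by metis
  qed
  then have "bounded (range D)" unfolding bounded_iff by blast
  then have "D constant_on UNIV" by (rule Liouville_theorem[OF D_hol])
  then obtain \<alpha> where \<alpha>: "\<And>w. D w = \<alpha>" unfolding constant_on_def by blast
  have der: "deriv h w = \<alpha> * h w" for w using \<alpha>[of w] F_h(2)[of w] by (simp add: D_def field_simps)
  define p where "p w = h w * exp (- (\<alpha> * w))" for w
  have "(p has_field_derivative 0) (at w within UNIV)" for w
    unfolding p_def using h_D[of w] der[of w] by (auto intro!: derivative_eq_intros)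
  then obtain c where c: "\<And>w. p w = c" using has_field_derivative_zero_constant[of UNIV p] by auto
  have c0: "c \<noteq> 0" using c[of 0] F_h(2)[of 0] by (simp add: p_def)
  have "h w = exp (\<alpha> * w + Ln c)" for w
    using c[of w] c0 by (simp add: p_def exp_add exp_minus field_simps)
  then have "f (Q w) = Q (\<alpha> * w + Ln c)" for w using Fq[of w] F_h(1)[of w] by (simp add: Q_def)
  then show ?thesis using that by blast
qed

lemma \<Lambda>_diff: "l \<in> \<Lambda> \<Longrightarrow> l' \<in> \<Lambda> \<Longrightarrow> l - l' \<in> \<Lambda>"
proof -
  assume "l \<in> \<Lambda>" "l' \<in> \<Lambda>"
  then obtain m n :: int where "exp l = lam powi m" "exp l' = lam powi n" by (auto simp: \<Lambda>_def)
  then have "exp (l - l') = lam powi (m - n)" by (simp add: exp_diff power_int_diff)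
  then show ?thesis by (auto simp: \<Lambda>_def)
qed

text \<open>The real part of an element \<open>l\<close> with \<open>exp l = lam powi k\<close> is \<open>k * ln (norm lam)\<close>, so a short element
  has \<open>k = 0\<close> and is a multiple of \<open>2 \<pi> \<i>\<close>.\<close>

lemma \<Lambda>_discrete:
  obtains d where "d > 0" "\<And>l. l \<in> \<Lambda> \<Longrightarrow> norm l < d \<Longrightarrow> l = 0"
proof (rule that[of "min (ln (norm lam)) (2 * pi)"])
  show "min (ln (norm lam)) (2 * pi) > 0" using lam by simp
  fix l assume l: "l \<in> \<Lambda>" "norm l < min (ln (norm lam)) (2 * pi)"
  then obtain k :: int where k: "exp l = lam powi k" by (auto simp: \<Lambda>_def)
  have "exp (Re l) = norm lam powi k" using k by (metis norm_exp_eq_Re norm_power_int)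
  then have "ln (exp (Re l)) = of_int k * ln (norm lam)" using ln_power_int[of "norm lam" k] lam by simp
  then have Re: "Re l = of_int k * ln (norm lam)" by simp
  have "\<bar>Re l\<bar> < ln (norm lam)" using abs_Re_le_cmod[of l] l(2) by simp
  then have "\<bar>real_of_int k\<bar> * ln (norm lam) < 1 * ln (norm lam)" using lam by (simp add: Re abs_mult)
  then have "\<bar>real_of_int k\<bar> < 1" using lam by (simp add: mult_less_cancel_right)
  then have "k = 0" by linarith
  then have "exp l = 1" using k by simp
  then obtain n :: int where n: "Re l = 0" "Im l = of_int (2 * n) * pi" by (auto simp: exp_eq_1)
  have "\<bar>Im l\<bar> < 2 * pi" using abs_Im_le_cmod[of l] l(2) by simp
  then have "\<bar>real_of_int n\<bar> * (2 * pi) < 1 * (2 * pi)" using n(2) by (simp add: abs_mult)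
  then have "\<bar>real_of_int n\<bar> < 1" by (simp add: mult_less_cancel_right)
  then have "n = 0" by linarith
  then show "l = 0" using n by (simp add: complex_eq_iff)
qed

subsection \<open>The identity component\<close>

lemma openin_bdry_image:
  assumes "open D" "0 \<notin> D"
  shows "openin (bdry_topology lam \<phi>) ((\<lambda>z. proj (z, 0)) ` D)"
  unfolding openin_bdry_topology
proof
  show "(\<lambda>z. proj (z, 0)) ` D \<subseteq> reeb_bdry lam \<phi>"
  proof (rule image_subsetI)
    fix z assume "z \<in> D"
    then have "z \<noteq> 0" using assms(2) by blast
    then show "proj (z, 0) \<in> reeb_bdry lam \<phi>" by (rule bdry_projI)
  qed
  have "{z. z \<noteq> 0 \<and> proj (z, 0) \<in> (\<lambda>z. proj (z, 0)) ` D} = (\<Union>n. (\<lambda>z. lam powi n * z) -` D)"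
  proof (intro equalityI subsetI)
    fix z assume "z \<in> {z. z \<noteq> 0 \<and> proj (z, 0) \<in> (\<lambda>z. proj (z, 0)) ` D}"
    then obtain w where w: "w \<in> D" "z \<noteq> 0" "proj (z, 0) = proj (w, 0)" by auto
    moreover have "w \<noteq> 0" using w(1) assms(2) by auto
    ultimately show "z \<in> (\<Union>n. (\<lambda>z. lam powi n * z) -` D)" using proj_0_eq_iff[of z w] by auto
  next
    fix z assume "z \<in> (\<Union>n. (\<lambda>z. lam powi n * z) -` D)"
    then obtain n where n: "lam powi n * z \<in> D" by auto
    then have "z \<noteq> 0" "lam powi n * z \<noteq> 0" using assms(2) by auto
    then have "proj (z, 0) = proj (lam powi n * z, 0)" using proj_0_eq_iff by blast
    then show "z \<in> {z. z \<noteq> 0 \<and> proj (z, 0) \<in> (\<lambda>z. proj (z, 0)) ` D}" using n \<open>z \<noteq> 0\<close> by blast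
  qed
  moreover have "open ((\<lambda>z. lam powi n * z) -` D)" for n
    using assms(1) by (intro open_vimage continuous_intros)
  ultimately show "open {z. z \<noteq> 0 \<and> proj (z, 0) \<in> (\<lambda>z. proj (z, 0)) ` D}" by (simp add: open_UN)
qed

lemma topspace_bdry: "topspace (bdry_topology lam \<phi>) = reeb_bdry lam \<phi>"
proof (rule equalityI)
  show "topspace (bdry_topology lam \<phi>) \<subseteq> reeb_bdry lam \<phi>"
    using openin_topspace[of "bdry_topology lam \<phi>"] openin_bdry_topology by blast
  have "reeb_bdry lam \<phi> = (\<lambda>z. proj (z, 0)) ` (- {0})" by (auto simp: reeb_bdry_def)
  then have "openin (bdry_topology lam \<phi>) (reeb_bdry lam \<phi>)" using openin_bdry_image[of "- {0}"] by (simp add: open_Compl)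
  then show "reeb_bdry lam \<phi> \<subseteq> topspace (bdry_topology lam \<phi>)" by (rule openin_subset)
qed

lemma compactin_Q:
  assumes "compact C"
  shows "compactin (bdry_topology lam \<phi>) (Q ` C)"
proof (rule image_compactin[where X = euclidean])
  show "compactin euclidean C" using assms by simp
  show "continuous_map euclidean (bdry_topology lam \<phi>) Q"
    unfolding continuous_map_def
  proof (intro conjI allI impI)
    show "Q \<in> topspace euclidean \<rightarrow> topspace (bdry_topology lam \<phi>)"
      using bdry_Q by (auto simp: topspace_bdry)
    fix W assume "openin (bdry_topology lam \<phi>) W"
    then have "open {z. z \<noteq> 0 \<and> proj (z, 0) \<in> W}" by (simp add: openin_bdry_topology)
    then have "open ((exp :: complex \<Rightarrow> complex) -` {z. z \<noteq> 0 \<and> proj (z, 0) \<in> W})"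
      by (intro open_vimage continuous_intros)
    moreover have "{w \<in> topspace euclidean. Q w \<in> W} = exp -` {z. z \<noteq> 0 \<and> proj (z, 0) \<in> W}"
      by (auto simp: Q_def)
    ultimately show "openin euclidean {w \<in> topspace euclidean. Q w \<in> W}" by simp
  qed
qed

abbreviation "Aut_top \<equiv> Aut_bdry_topology lam \<phi>"

lemma openin_Aut_top_subbasis:
  "compactin (bdry_topology lam \<phi>) C \<Longrightarrow> openin (bdry_topology lam \<phi>) W \<Longrightarrow>
     openin Aut_top {f \<in> carrier (Aut_bdry lam \<phi>). f ` C \<subseteq> W}"
  unfolding Aut_bdry_topology_def by (rule topology_generated_by_Basis) blast

lemma topspace_Aut_top: "topspace Aut_top = carrier (Aut_bdry lam \<phi>)"
proof (rule equalityI)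
  show "topspace Aut_top \<subseteq> carrier (Aut_bdry lam \<phi>)"
    unfolding Aut_bdry_topology_def topology_generated_by_topspace by blast
  have "openin Aut_top {f \<in> carrier (Aut_bdry lam \<phi>). f ` {} \<subseteq> {}}"
    by (rule openin_Aut_top_subbasis) auto
  then show "carrier (Aut_bdry lam \<phi>) \<subseteq> topspace Aut_top" using openin_subset by fastforce
qed

text \<open>The multiplication maps depend continuously on their factor in the compact-open topology: the
  action is jointly continuous and a compact set is covered by finitely many of the
  neighbourhoods on which the image stays in a given open set.\<close>

lemma connectedin_bdry_mult: "connectedin Aut_top (bdry_mult ` (- {0}))"
proof (rule connectedin_continuous_map_image)
  show "connectedin (top_of_set (- {0})) (- {0 :: complex})"
    by (simp add: connectedin_subtopology connected_punctured_universe)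
  show "continuous_map (top_of_set (- {0})) Aut_top bdry_mult"
    unfolding Aut_bdry_topology_def continuous_on_generated_topo_iff
  proof (intro conjI allI impI)
    show "bdry_mult ` topspace (top_of_set (- {0})) \<subseteq>
       \<Union> {{f \<in> carrier (Aut_bdry lam \<phi>). f ` C \<subseteq> W} |C W. compactin (bdry_topology lam \<phi>) C \<and> openin (bdry_topology lam \<phi>) W}"
    proof
      fix f assume "f \<in> bdry_mult ` topspace (top_of_set (- {0}))"
      then have "f \<in> {f \<in> carrier (Aut_bdry lam \<phi>). f ` {} \<subseteq> {}}" using bdry_mult_Aut by auto
      then show "f \<in> \<Union> {{f \<in> carrier (Aut_bdry lam \<phi>). f ` C \<subseteq> W} |C W. compactin (bdry_topology lam \<phi>) C \<and> openin (bdry_topology lam \<phi>) W}"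
        by (intro UnionI[OF CollectI]) (auto intro!: exI[of _ "{}"])
    qed
    fix U assume "U \<in> {{f \<in> carrier (Aut_bdry lam \<phi>). f ` C \<subseteq> W} |C W. compactin (bdry_topology lam \<phi>) C \<and> openin (bdry_topology lam \<phi>) W}"
    then obtain C W where U: "U = {f \<in> carrier (Aut_bdry lam \<phi>). f ` C \<subseteq> W}"
      and C: "compactin (bdry_topology lam \<phi>) C" and W: "openin (bdry_topology lam \<phi>) W" by blast
    let ?W = "{z. z \<noteq> 0 \<and> proj (z, 0) \<in> W}"
    have oW: "open ?W" using W by (simp add: openin_bdry_topology)
    have CB: "C \<subseteq> reeb_bdry lam \<phi>" using compactin_subset_topspace[OF C] topspace_bdry by simp
    have "\<exists>A. open A \<and> a0 \<in> A \<and> A \<subseteq> bdry_mult -` U \<inter> - {0}" if a0: "a0 \<in> bdry_mult -` U \<inter> - {0}" for a0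
    proof -
      have a0': "a0 \<noteq> 0" "bdry_mult a0 ` C \<subseteq> W" using a0 U by auto
      define \<U> where "\<U> = {V. openin (bdry_topology lam \<phi>) V \<and>
          (\<exists>A. open A \<and> a0 \<in> A \<and> (\<forall>a\<in>A - {0}. \<forall>P\<in>V. bdry_mult a P \<in> W))}"
      have "C \<subseteq> \<Union> \<U>"
      proof
        fix P assume P: "P \<in> C"
        then obtain z where z: "z \<noteq> 0" "P = proj (z, 0)" using CB bdry_iff by blast
        have "proj (a0 * z, 0) \<in> W" using a0'(2) P bdry_mult_proj[OF a0'(1) z(1)] z(2) by auto
        then have "(a0, z) \<in> (\<lambda>p. fst p * snd p) -` ?W" using a0'(1) z(1) by simp
        moreover have "open ((\<lambda>p. fst p * snd p) -` ?W)"
          by (intro open_vimage oW continuous_intros)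
        ultimately obtain A D where "open A" "open D" "(a0, z) \<in> A \<times> D"
          "A \<times> D \<subseteq> (\<lambda>p. fst p * snd p) -` ?W"
          using open_prod_elim[of "(\<lambda>p. fst p * snd p) -` ?W" "(a0, z)"] by blast
        then have AD: "open A" "open D" "a0 \<in> A" "z \<in> D" "A \<times> D \<subseteq> (\<lambda>p. fst p * snd p) -` ?W" by auto
        have "openin (bdry_topology lam \<phi>) ((\<lambda>z. proj (z, 0)) ` (D - {0}))"
          using AD(2) by (intro openin_bdry_image) auto
        moreover have "bdry_mult a P' \<in> W" if a: "a \<in> A - {0}" and P': "P' \<in> (\<lambda>z. proj (z, 0)) ` (D - {0})" for a P'
        proof -
          obtain w where w: "w \<in> D" "w \<noteq> 0" "P' = proj (w, 0)" using P' by blast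
          have "(a, w) \<in> (\<lambda>p. fst p * snd p) -` ?W" using AD(5) a w(1) by blast
          then show ?thesis using bdry_mult_proj[of a w] w a by simp
        qed
        ultimately have "(\<lambda>z. proj (z, 0)) ` (D - {0}) \<in> \<U>" using AD(1,3) unfolding \<U>_def by blast
        moreover have "P \<in> (\<lambda>z. proj (z, 0)) ` (D - {0})" using z AD(4) by blast
        ultimately show "P \<in> \<Union> \<U>" by blast
      qed
      moreover have "\<forall>V\<in>\<U>. openin (bdry_topology lam \<phi>) V" by (simp add: \<U>_def)
      ultimately obtain \<F> where \<F>: "finite \<F>" "\<F> \<subseteq> \<U>" "C \<subseteq> \<Union> \<F>"
        using C unfolding compactin_def by meson
      have "\<forall>V\<in>\<F>. \<exists>A. open A \<and> a0 \<in> A \<and> (\<forall>a\<in>A - {0}. \<forall>P\<in>V. bdry_mult a P \<in> W)" using \<F>(2) by (auto simp: \<U>_def)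
      then obtain A where A: "\<forall>V\<in>\<F>. open (A V) \<and> a0 \<in> A V \<and> (\<forall>a\<in>A V - {0}. \<forall>P\<in>V. bdry_mult a P \<in> W)" by metis
      let ?A = "(\<Inter>V\<in>\<F>. A V) \<inter> - {0}"
      have "open ?A" using A \<F>(1) by (intro open_Int open_INT) auto
      moreover have "a0 \<in> ?A" using A a0' by auto
      moreover have "?A \<subseteq> bdry_mult -` U \<inter> - {0}"
      proof
        fix a assume a: "a \<in> ?A"
        have "bdry_mult a P \<in> W" if "P \<in> C" for P
        proof -
          obtain V where "V \<in> \<F>" "P \<in> V" using \<F>(3) \<open>P \<in> C\<close> by blast
          then show ?thesis using A a by blast
        qed
        then show "a \<in> bdry_mult -` U \<inter> - {0}" using a bdry_mult_Aut U by auto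
      qed
      ultimately show ?thesis by blast
    qed
    then have "open (bdry_mult -` U \<inter> - {0})" by (subst open_subopen) blast
    then show "openin (top_of_set (- {0})) (bdry_mult -` U \<inter> topspace (top_of_set (- {0})))"
      by (simp add: openin_open_eq open_Compl)
  qed
qed

text \<open>Along the segment from 0 to \<open>2 \<pi> \<i>\<close>, the logarithmic lifts of two close automorphisms differ by
  a small perturbation of a fixed element of the lattice, so their linear parts agree.\<close>

lemma linear_part_locally_constant:
  assumes f0: "f0 \<in> carrier (Aut_bdry lam \<phi>)" and rep0: "\<And>w. f0 (Q w) = Q (\<alpha>0 * w + L0)"
  obtains N where "openin Aut_top N" "f0 \<in> N"
    "\<And>f \<alpha> L. f \<in> N \<Longrightarrow> (\<And>w. f (Q w) = Q (\<alpha> * w + L)) \<Longrightarrow> \<alpha> = \<alpha>0"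
proof -
  obtain d where d: "d > 0" "\<And>l. l \<in> \<Lambda> \<Longrightarrow> norm l < d \<Longrightarrow> l = 0" using \<Lambda>_discrete by metis
  define \<epsilon> where "\<epsilon> = d / 4"
  have \<epsilon>: "\<epsilon> > 0" using d by (simp add: \<epsilon>_def)
  define \<delta> where "\<delta> = \<epsilon> / (norm \<alpha>0 + 1)"
  have \<delta>: "\<delta> > 0" using \<epsilon> by (simp add: \<delta>_def add_nonneg_pos)
  have \<delta>_le: "norm \<alpha>0 * \<delta> < \<epsilon>"
  proof -
    have "norm \<alpha>0 * \<epsilon> < \<epsilon> * (norm \<alpha>0 + 1)" using \<epsilon> by (simp add: algebra_simps)
    moreover have "norm \<alpha>0 + 1 > 0" by (simp add: add_nonneg_pos)
    ultimately show ?thesis by (simp add: \<delta>_def divide_less_eq)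
  qed
  let ?H = "\<lambda>w. \<alpha>0 * w + L0"
  let ?S = "closed_segment 0 (2 * of_real pi * \<i> :: complex)"
  have "compact ?S" by simp
  moreover have "?S \<subseteq> (\<Union>c\<in>?S. ball c \<delta>)" using \<delta> by force
  ultimately obtain C where C: "C \<subseteq> ?S" "finite C" "?S \<subseteq> (\<Union>c\<in>C. ball c \<delta>)"
    using compactE_image[of ?S ?S "\<lambda>c. ball c \<delta>"] by (metis open_ball)
  define V where "V c = Q ` ball (?H c) \<epsilon>" for c
  have oV: "openin (bdry_topology lam \<phi>) (V c)" for c
  proof -
    have "open (exp ` ball (?H c) \<epsilon>)"
    proof (rule open_mapping_thm[of exp UNIV])
      show "\<not> (exp :: complex \<Rightarrow> complex) constant_on UNIV"
      proof
        assume "(exp :: complex \<Rightarrow> complex) constant_on UNIV"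
        then obtain y :: complex where "\<forall>x\<in>(UNIV :: complex set). exp x = y" unfolding constant_on_def by blast
        then have "exp (0 :: complex) = y" "exp (\<i> * of_real pi) = y" by blast+
        then show False by simp
      qed
    qed (auto intro: holomorphic_on_exp)
    then have "openin (bdry_topology lam \<phi>) ((\<lambda>z. proj (z, 0)) ` exp ` ball (?H c) \<epsilon>)"
      by (rule openin_bdry_image) auto
    then show ?thesis by (simp add: V_def image_image Q_def)
  qed
  define N where "N = {f \<in> carrier (Aut_bdry lam \<phi>). \<forall>c\<in>C. f ` (Q ` cball c \<delta>) \<subseteq> V c}"
  have "openin Aut_top N"
  proof -
    have "N = carrier (Aut_bdry lam \<phi>) \<inter> (\<Inter>c\<in>C. {f \<in> carrier (Aut_bdry lam \<phi>). f ` (Q ` cball c \<delta>) \<subseteq> V c})"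
      by (auto simp: N_def)
    moreover have "openin Aut_top (\<Inter>c\<in>C. {f \<in> carrier (Aut_bdry lam \<phi>). f ` (Q ` cball c \<delta>) \<subseteq> V c})" if "C \<noteq> {}"
      using C(2) that by (intro openin_INT2 openin_Aut_top_subbasis compactin_Q oV) auto
    moreover have "openin Aut_top (carrier (Aut_bdry lam \<phi>))" using openin_topspace[of Aut_top] topspace_Aut_top by simp
    ultimately show ?thesis by (cases "C = {}") (auto intro!: openin_Int)
  qed
  moreover have "f0 \<in> N"
  proof -
    have "f0 (Q w) \<in> V c" if "w \<in> cball c \<delta>" for c w
    proof -
      have "norm (?H w - ?H c) = norm \<alpha>0 * norm (w - c)"
        by (simp add: norm_mult[symmetric] algebra_simps)
      also have "\<dots> \<le> norm \<alpha>0 * \<delta>" using that by (intro mult_left_mono) (auto simp: dist_norm norm_minus_commute)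
      finally have "norm (?H w - ?H c) < \<epsilon>" using \<delta>_le by linarith
      then have "?H w \<in> ball (?H c) \<epsilon>" by (simp add: dist_norm norm_minus_commute)
      then show ?thesis unfolding V_def rep0 by blast
    qed
    then show ?thesis using f0 by (auto simp: N_def)
  qed
  moreover have "\<alpha> = \<alpha>0" if f: "f \<in> N" and rep: "\<And>w. f (Q w) = Q (\<alpha> * w + L)" for f \<alpha> L
  proof -
    let ?F = "\<lambda>w. \<alpha> * w + L" and ?G = "\<lambda>w. (\<alpha> * w + L) - (\<alpha>0 * w + L0)"
    have near: "\<exists>l\<in>\<Lambda>. ?G w \<in> ball l (2 * \<epsilon>)" if w: "w \<in> ?S" for w
    proof -
      obtain c where c: "c \<in> C" "w \<in> ball c \<delta>" using C(3) w by blast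
      have "w \<in> cball c \<delta>" using c(2) by simp
      then have "f (Q w) \<in> V c" using f c(1) unfolding N_def by blast
      then obtain v where v: "v \<in> ball (?H c) \<epsilon>" "Q (?F w) = Q v" unfolding V_def rep by blast
      have l: "?F w - v \<in> \<Lambda>" using v(2) Q_eq_iff[of v "?F w"] by simp
      have "norm (v - ?H c) < \<epsilon>" using v(1) by (simp add: dist_norm norm_minus_commute)
      moreover have "norm (?H c - ?H w) < \<epsilon>"
      proof -
        have "norm (?H c - ?H w) = norm \<alpha>0 * norm (c - w)"
          by (simp add: norm_mult[symmetric] algebra_simps)
        also have "\<dots> \<le> norm \<alpha>0 * \<delta>" using c(2) by (intro mult_left_mono) (auto simp: dist_norm)
        finally show ?thesis using \<delta>_le by linarith
      qed
      ultimately have "norm (v - ?H w) < \<epsilon> + \<epsilon>" by (rule norm_diff_triangle_less)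
      then have "norm (v - ?H w) < 2 * \<epsilon>" by simp
      moreover have "?G w - (?F w - v) = v - ?H w" by simp
      ultimately have "norm (?G w - (?F w - v)) < 2 * \<epsilon>" by (simp only:)
      then have "?G w \<in> ball (?F w - v) (2 * \<epsilon>)"
        unfolding mem_ball dist_norm by (subst norm_minus_commute)
      then show ?thesis using l by blast
    qed
    obtain l0 where l0: "l0 \<in> \<Lambda>" "?G 0 \<in> ball l0 (2 * \<epsilon>)" using near[of 0] by auto
    let ?A = "ball l0 (2 * \<epsilon>)" and ?B = "\<Union>l\<in>\<Lambda> - {l0}. ball l (2 * \<epsilon>)"
    have "continuous_on ?S ?G" by (intro continuous_intros)
    then have con: "connected (?G ` ?S)" by (intro connected_continuous_image) auto
    have disj: "?A \<inter> ?B = {}"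
    proof -
      have "False" if "l \<in> \<Lambda>" "l \<noteq> l0" "u \<in> ball l0 (2 * \<epsilon>)" "u \<in> ball l (2 * \<epsilon>)" for l u
      proof -
        have "norm (l - l0) < d"
          using that(3,4) norm_triangle_ineq[of "l - u" "u - l0"]
          by (simp add: dist_norm norm_minus_commute \<epsilon>_def)
        then have "l - l0 = 0" using d(2) \<Lambda>_diff[OF that(1) l0(1)] by blast
        then show False using that(2) by simp
      qed
      then show ?thesis by blast
    qed
    have cover: "?G ` ?S \<subseteq> ?A \<union> ?B" using near by blast
    have op: "open ?A" "open ?B" by auto
    have "?G 0 \<in> ?G ` ?S" using imageI[of 0 ?S ?G] by simp
    then have "?A \<inter> ?G ` ?S \<noteq> {}" using l0(2) by blast
    then have "?B \<inter> ?G ` ?S = {}" using connectedD[OF con op _ cover] disj by blast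
    then have "?G ` ?S \<subseteq> ?A" using cover by blast
    moreover have "?G (2 * of_real pi * \<i>) \<in> ?G ` ?S" using imageI[of "2 * of_real pi * \<i>" ?S ?G] by simp
    ultimately have e: "?G (2 * of_real pi * \<i>) \<in> ?A" by (rule subsetD)
    let ?x = "(\<alpha> - \<alpha>0) * (2 * of_real pi * \<i>)"
    have "norm (?G (2 * of_real pi * \<i>) - l0) < 2 * \<epsilon>"
      using e unfolding mem_ball dist_norm by (subst norm_minus_commute)
    moreover have "norm (l0 - ?G 0) < 2 * \<epsilon>" using l0(2) unfolding mem_ball dist_norm .
    ultimately have "norm (?G (2 * of_real pi * \<i>) - ?G 0) < 2 * \<epsilon> + 2 * \<epsilon>"
      by (rule norm_diff_triangle_less)
    moreover have "?G (2 * of_real pi * \<i>) - ?G 0 = ?x" by (simp add: algebra_simps)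
    ultimately have "norm ?x < 2 * \<epsilon> + 2 * \<epsilon>" by (simp only:)
    then have "norm ?x < d" by (simp add: \<epsilon>_def)
    moreover have "?x \<in> \<Lambda>"
    proof -
      have mem: "\<beta> * (2 * of_real pi * \<i>) \<in> \<Lambda>" if r: "\<And>w. g (Q w) = Q (\<beta> * w + K)" for g \<beta> K
      proof -
        have "Q (2 * of_real pi * \<i>) = Q 0" by (simp add: Q_def exp_eq_1[of "2 * of_real pi * \<i>"])
        then have "Q (\<beta> * 0 + K) = Q (\<beta> * (2 * of_real pi * \<i>) + K)"
          using r[of 0] r[of "2 * of_real pi * \<i>"] by simp
        then show ?thesis using Q_eq_iff by simp
      qed
      show ?thesis using \<Lambda>_diff[OF mem[OF rep] mem[OF rep0]] by (simp add: left_diff_distrib)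
    qed
    ultimately have "?x = 0" using d(2) by blast
    then show ?thesis by simp
  qed
  ultimately show ?thesis using that[of N] by blast
qed

lemma one_Aut_bdry: "\<one>\<^bsub>Aut_bdry lam \<phi>\<^esub> = bdry_mult 1"
proof -
  have "\<one>\<^bsub>Aut_bdry lam \<phi>\<^esub> = (\<lambda>P\<in>reeb_bdry lam \<phi>. P)" by (simp add: Aut_bdry_def one_BijGroup)
  also have "\<dots> = bdry_mult 1" by (rule bdry_mult_eqI) (auto simp: bdry_projI)
  finally show ?thesis .
qed

text \<open>The linear part in the logarithmic coordinate separates the automorphisms into open sets, so it
  is 1 on the identity component. The automorphisms with linear part 1 are the multiplications.\<close>

lemma carrier_Aut0: "carrier (Aut0_bdry lam \<phi>) = bdry_mult ` (- {0})"
proof -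
  have carrier: "carrier (Aut0_bdry lam \<phi>) = {f. connected_component_of Aut_top (bdry_mult 1) f}"
    by (simp add: Aut0_bdry_def one_Aut_bdry)
  have "connected_component_of Aut_top (bdry_mult 1) (bdry_mult a)" if "a \<noteq> 0" for a
    unfolding connected_component_of_def using connectedin_bdry_mult that by (intro exI[of _ "bdry_mult ` (- {0})"]) auto
  moreover have "f \<in> bdry_mult ` (- {0})" if comp: "connected_component_of Aut_top (bdry_mult 1) f" for f
  proof -
    obtain S where S: "connectedin Aut_top S" "bdry_mult 1 \<in> S" "f \<in> S"
      using comp unfolding connected_component_of_def by blast
    have SA: "S \<subseteq> carrier (Aut_bdry lam \<phi>)" using connectedin_subset_topspace[OF S(1)] topspace_Aut_top by simp
    define A where "A = {f \<in> carrier (Aut_bdry lam \<phi>). \<exists>L. \<forall>w. f (Q w) = Q (1 * w + L)}"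
    define B where "B = carrier (Aut_bdry lam \<phi>) - A"
    have nbhd: "\<exists>N. openin Aut_top N \<and> f0 \<in> N \<and> (f0 \<in> A \<longrightarrow> N \<subseteq> A) \<and> (f0 \<in> B \<longrightarrow> N \<subseteq> B)"
      if f0: "f0 \<in> carrier (Aut_bdry lam \<phi>)" for f0
    proof -
      obtain \<alpha>0 L0 where rep0: "\<And>w. f0 (Q w) = Q (\<alpha>0 * w + L0)" using Aut_bdry_log_lift[OF f0] by metis
      obtain N where N: "openin Aut_top N" "f0 \<in> N"
        "\<And>f \<alpha> L. f \<in> N \<Longrightarrow> (\<And>w. f (Q w) = Q (\<alpha> * w + L)) \<Longrightarrow> \<alpha> = \<alpha>0"
        using linear_part_locally_constant[of f0 \<alpha>0 L0, OF f0 rep0] by metis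
      have Nc: "N \<subseteq> carrier (Aut_bdry lam \<phi>)" using openin_subset[OF N(1)] topspace_Aut_top by simp
      have "g \<in> A \<longleftrightarrow> \<alpha>0 = 1" if g: "g \<in> N" for g
      proof
        assume "g \<in> A"
        then obtain L where "\<And>w. g (Q w) = Q (1 * w + L)" by (auto simp: A_def)
        then show "\<alpha>0 = 1" using N(3)[OF g] by metis
      next
        assume 1: "\<alpha>0 = 1"
        have gc: "g \<in> carrier (Aut_bdry lam \<phi>)" using g Nc by blast
        obtain \<alpha> L where r: "\<And>w. g (Q w) = Q (\<alpha> * w + L)" using Aut_bdry_log_lift[OF gc] by metis
        then have "\<alpha> = 1" using N(3)[OF g r] 1 by simp
        then show "g \<in> A" using r gc by (auto simp: A_def)
      qed
      then show ?thesis using N(1,2) Nc by (intro exI[of _ N]) (auto simp: B_def)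
    qed
    have "openin Aut_top A"
    proof (subst openin_subopen, rule ballI)
      fix g assume g: "g \<in> A"
      then have "g \<in> carrier (Aut_bdry lam \<phi>)" by (simp add: A_def)
      then show "\<exists>T. openin Aut_top T \<and> g \<in> T \<and> T \<subseteq> A" using nbhd[of g] g by blast
    qed
    moreover have "openin Aut_top B"
    proof (subst openin_subopen, rule ballI)
      fix g assume g: "g \<in> B"
      then have "g \<in> carrier (Aut_bdry lam \<phi>)" by (simp add: B_def)
      then show "\<exists>T. openin Aut_top T \<and> g \<in> T \<and> T \<subseteq> B" using nbhd[of g] g by blast
    qed
    moreover have "bdry_mult 1 \<in> A"
    proof -
      have "bdry_mult 1 (Q w) = Q (1 * w + 0)" for w using bdry_mult_proj[of 1 "exp w"] by (simp add: Q_def)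
      then have "\<exists>L. \<forall>w. bdry_mult 1 (Q w) = Q (1 * w + L)" by blast
      moreover have "bdry_mult 1 \<in> carrier (Aut_bdry lam \<phi>)" by (rule bdry_mult_Aut) simp
      ultimately show ?thesis unfolding A_def by simp
    qed
    moreover have "S \<subseteq> A \<union> B" "A \<inter> B \<inter> S = {}" using SA by (auto simp: B_def)
    ultimately have "B \<inter> S = {}" using S(1,2) unfolding connectedin by blast
    then have "f \<in> A" using S(3) \<open>S \<subseteq> A \<union> B\<close> by blast
    then obtain L where fA: "f \<in> carrier (Aut_bdry lam \<phi>)" "\<And>w. f (Q w) = Q (w + L)" by (auto simp: A_def)
    have "f = bdry_mult (exp L)"
    proof (rule bdry_mult_eqI)
      show "f \<in> extensional (reeb_bdry lam \<phi>)" using fA(1) by (auto simp: Aut_bdry_iff Bij_def)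
      show "f (proj (z, 0)) = proj (exp L * z, 0)" if "z \<noteq> 0" for z
        using fA(2)[of "Ln z"] that by (simp add: Q_def exp_add mult.commute)
    qed simp
    moreover have "exp L \<in> - {0}" by simp
    ultimately show ?thesis by (rule image_eqI)
  qed
  ultimately show ?thesis unfolding carrier by (intro equalityI subsetI) auto
qed

section \<open>The two extensions\<close>

lemma restrict_act:
  assumes "(a, b, \<eta>) \<in> params"
  shows "restrict_bdry lam \<phi> (act a b \<eta>) = bdry_mult a"
proof (rule bdry_mult_eqI)
  show "a \<noteq> 0" using assms by (simp add: params_def)
  show "restrict_bdry lam \<phi> (act a b \<eta>) \<in> extensional (reeb_bdry lam \<phi>)" by (simp add: restrict_bdry_def)
  show "restrict_bdry lam \<phi> (act a b \<eta>) (proj (z, 0)) = proj (a * z, 0)" if "z \<noteq> 0" for z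
    using act_bdry[OF assms that] bdry_projI[OF that] by (simp add: restrict_bdry_def)
qed

lemma compose_bdry_mult:
  assumes "a \<noteq> 0" "a' \<noteq> 0"
  shows "compose (reeb_bdry lam \<phi>) (bdry_mult a) (bdry_mult a') = bdry_mult (a * a')"
  by (rule bdry_mult_eqI) (use assms in \<open>simp_all add: compose_eq bdry_projI bdry_mult_proj mult.assoc\<close>)

lemma subgroup_Aut0: "subgroup (carrier (Aut0_bdry lam \<phi>)) (BijGroup (reeb_bdry lam \<phi>))"
proof (rule subgroup_BijGroupI)
  show "carrier (Aut0_bdry lam \<phi>) \<subseteq> Bij (reeb_bdry lam \<phi>)" using bdry_mult_Bij by (auto simp: carrier_Aut0)
  have "(\<lambda>P\<in>reeb_bdry lam \<phi>. P) = bdry_mult 1" by (rule bdry_mult_eqI) (auto simp: bdry_projI)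
  then show "(\<lambda>P\<in>reeb_bdry lam \<phi>. P) \<in> carrier (Aut0_bdry lam \<phi>)" by (auto simp: carrier_Aut0)
  show "compose (reeb_bdry lam \<phi>) f g \<in> carrier (Aut0_bdry lam \<phi>)"
    if "f \<in> carrier (Aut0_bdry lam \<phi>)" "g \<in> carrier (Aut0_bdry lam \<phi>)" for f g
    using that compose_bdry_mult by (auto simp: carrier_Aut0)
  show "restrict (inv_into (reeb_bdry lam \<phi>) f) (reeb_bdry lam \<phi>) \<in> carrier (Aut0_bdry lam \<phi>)"
    if f: "f \<in> carrier (Aut0_bdry lam \<phi>)" for f
  proof -
    obtain a where a: "a \<noteq> 0" "f = bdry_mult a" using f carrier_Aut0 by auto
    have "restrict (inv_into (reeb_bdry lam \<phi>) f) (reeb_bdry lam \<phi>) = bdry_mult (inverse a)"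
      using inv_into_bdry_mult[OF a(1)] a(2) by (intro extensionalityI[of _ "reeb_bdry lam \<phi>"]) (simp_all add: bdry_mult_def)
    then show ?thesis using a(1) carrier_Aut0 by auto
  qed
qed

lemma Aut0_eq: "Aut0_bdry lam \<phi> = BijGroup (reeb_bdry lam \<phi>)\<lparr>carrier := carrier (Aut0_bdry lam \<phi>)\<rparr>"
  by (simp add: Aut0_bdry_def Aut_bdry_def)

lemma mult_Aut0:
  assumes "a \<noteq> 0" "a' \<noteq> 0"
  shows "bdry_mult a \<otimes>\<^bsub>Aut0_bdry lam \<phi>\<^esub> bdry_mult a' = bdry_mult (a * a')"
proof -
  have "bdry_mult a \<otimes>\<^bsub>Aut0_bdry lam \<phi>\<^esub> bdry_mult a' = bdry_mult a \<otimes>\<^bsub>BijGroup (reeb_bdry lam \<phi>)\<^esub> bdry_mult a'"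
    by (simp add: Aut0_bdry_def Aut_bdry_def)
  then show ?thesis using mult_BijGroup[OF bdry_mult_Bij[OF assms(1)] bdry_mult_Bij[OF assms(2)]] compose_bdry_mult[OF assms] by simp
qed

lemma comm_group_Aut0: "comm_group (Aut0_bdry lam \<phi>)"
proof (rule group.group_comm_groupI)
  show "group (Aut0_bdry lam \<phi>)" using group_sub_BijGroup[OF subgroup_Aut0] Aut0_eq by simp
  show "f \<otimes>\<^bsub>Aut0_bdry lam \<phi>\<^esub> g = g \<otimes>\<^bsub>Aut0_bdry lam \<phi>\<^esub> f"
    if "f \<in> carrier (Aut0_bdry lam \<phi>)" "g \<in> carrier (Aut0_bdry lam \<phi>)" for f g
    using that mult_Aut0 by (auto simp: carrier_Aut0 mult.commute)
qed

lemma short_exact_restrict: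
  "short_exact (Aut_reeb_rel lam \<phi>) (Aut_reeb lam \<phi>) (Aut0_bdry lam \<phi>) (\<lambda>f. f) (restrict_bdry lam \<phi>)"
  unfolding short_exact_def
proof (intro conjI)
  show "group (Aut_reeb_rel lam \<phi>)" "group (Aut_reeb lam \<phi>)" "group (Aut0_bdry lam \<phi>)"
    using group_Aut_rel group_Aut comm_group_Aut0 by (simp_all add: comm_group_def)
  show "(\<lambda>f. f) \<in> mon (Aut_reeb_rel lam \<phi>) (Aut_reeb lam \<phi>)"
    by (auto simp: mon_def hom_def Aut_rel_iff Aut_reeb_rel_def)
  have r: "restrict_bdry lam \<phi> f \<in> carrier (Aut0_bdry lam \<phi>)" if f: "f \<in> carrier (Aut_reeb lam \<phi>)" for f
  proof -
    obtain a b \<eta> where p: "(a, b, \<eta>) \<in> params" "f = act a b \<eta>" using f Aut_iff_act by blast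
    then have "a \<noteq> 0" by (simp add: params_def)
    then show ?thesis using restrict_act[OF p(1)] p(2) carrier_Aut0 by auto
  qed
  have "restrict_bdry lam \<phi> (f \<otimes>\<^bsub>Aut_reeb lam \<phi>\<^esub> g) =
      restrict_bdry lam \<phi> f \<otimes>\<^bsub>Aut0_bdry lam \<phi>\<^esub> restrict_bdry lam \<phi> g"
    if fg: "f \<in> carrier (Aut_reeb lam \<phi>)" "g \<in> carrier (Aut_reeb lam \<phi>)" for f g
  proof -
    obtain a b \<eta> where p: "(a, b, \<eta>) \<in> params" "f = act a b \<eta>" using fg(1) Aut_iff_act by blast
    obtain a' b' \<eta>' where q: "(a', b', \<eta>') \<in> params" "g = act a' b' \<eta>'" using fg(2) Aut_iff_act by blast
    have nz: "a \<noteq> 0" "a' \<noteq> 0" using p q by (auto simp: params_def)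
    show ?thesis
      using mult_Aut[OF fg] act_compose[OF p(1) q(1)] restrict_act[OF params_compose(1)[OF p(1) q(1)]]
        restrict_act[OF p(1)] restrict_act[OF q(1)] mult_Aut0[OF nz] p(2) q(2) by simp
  qed
  then have "restrict_bdry lam \<phi> \<in> hom (Aut_reeb lam \<phi>) (Aut0_bdry lam \<phi>)" using r by (auto simp: hom_def)
  moreover have "carrier (Aut0_bdry lam \<phi>) \<subseteq> restrict_bdry lam \<phi> ` carrier (Aut_reeb lam \<phi>)"
  proof
    fix f assume "f \<in> carrier (Aut0_bdry lam \<phi>)"
    then obtain a where a: "a \<noteq> 0" "f = bdry_mult a" using carrier_Aut0 by auto
    have p: "(a, 0, idR) \<in> params" using a zero_K idR_Z by (simp add: params_def)
    show "f \<in> restrict_bdry lam \<phi> ` carrier (Aut_reeb lam \<phi>)"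
      using restrict_act[OF p] act_Aut[OF p] a(2) by (intro image_eqI[of _ _ "act a 0 idR"]) auto
  qed
  ultimately show "restrict_bdry lam \<phi> \<in> epi (Aut_reeb lam \<phi>) (Aut0_bdry lam \<phi>)"
    using r by (auto simp: epi_def)
  have one: "\<one>\<^bsub>Aut0_bdry lam \<phi>\<^esub> = (\<lambda>P\<in>reeb_bdry lam \<phi>. P)"
    by (simp add: Aut0_bdry_def Aut_bdry_def one_BijGroup)
  have "restrict_bdry lam \<phi> f = (\<lambda>P\<in>reeb_bdry lam \<phi>. P) \<longleftrightarrow> (\<forall>P\<in>reeb_bdry lam \<phi>. f P = P)" for f
    by (auto simp: restrict_bdry_def fun_eq_iff restrict_def)
  then show "(\<lambda>f. f) ` carrier (Aut_reeb_rel lam \<phi>) = kernel (Aut_reeb lam \<phi>) (Aut0_bdry lam \<phi>) (restrict_bdry lam \<phi>)"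
    by (auto simp: kernel_def one Aut_rel_iff)
qed

section \<open>The linear part of a lift\<close>

text \<open>A lift takes a boundary point \<open>(z, 0)\<close> to a translate of \<open>(a' * z, 0)\<close>, so \<open>a * z + b 0\<close> has no zero
  with \<open>z \<noteq> 0\<close>. If \<open>b 0 \<noteq> 0\<close>, this leaves \<open>a = 0\<close>; then the points 1 and -1 exhibit \<open>b 0\<close> as translates of
  both \<open>a'\<close> and \<open>- a'\<close>, although a power of \<open>lam\<close> is never the negative of another.\<close>

lemma lift_linear_part:
  assumes f: "f \<in> carrier (Aut_reeb lam \<phi>)" and lift: "is_lift lam \<phi> f F" and aff: "affine_form a b \<eta> F"
  shows "a \<noteq> 0" "restrict_bdry lam \<phi> f = bdry_mult a"
proof -
  obtain a' b' \<eta>' where p: "(a', b', \<eta>') \<in> params" "f = act a' b' \<eta>'" using f Aut_iff_act by blast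
  have a': "a' \<noteq> 0" using p(1) by (simp add: params_def)
  have F: "F (z, 0) \<in> reeb_cover" "f (proj (z, 0)) = proj (F (z, 0))" "F (z, 0) = (a * z + b 0, \<eta> 0)" if "z \<noteq> 0" for z
    using lift aff bdry_cover[OF that] unfolding is_lift_def affine_form_def by blast+
  have shift: "\<exists>n. a * z + b 0 = lam powi n * (a' * z) \<and> \<eta> 0 = 0" if z: "z \<noteq> 0" for z
  proof -
    have c: "(a' * z, 0) \<in> reeb_cover" using a' z by (simp add: bdry_cover)
    have "proj (a' * z, 0) = proj (F (z, 0))" using F(2)[OF z] act_bdry[OF p(1) z] p(2) by simp
    then obtain n where "F (z, 0) = T n (a' * z, 0)" using proj_eq_iff[OF c F(1)[OF z]] by blast
    then show ?thesis using F(3)[OF z] by (auto simp: T_pair itr_zero)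
  qed
  have nz: "a * z + b 0 \<noteq> 0" if "z \<noteq> 0" for z using shift[OF that] a' that by auto
  have b0: "b 0 = 0"
  proof (rule ccontr)
    assume b: "b 0 \<noteq> 0"
    show False
    proof (cases "a = 0")
      case False
      then show False using nz[of "- b 0 / a"] b by simp
    next
      case True
      obtain m where m: "a * 1 + b 0 = lam powi m * (a' * 1)" using shift[of 1] by auto
      obtain n where n: "a * - 1 + b 0 = lam powi n * (a' * - 1)" using shift[of "- 1"] by auto
      have mn: "b 0 = lam powi m * a'" "b 0 = - (lam powi n * a')" using m n True by simp_all
      have "(lam powi m + lam powi n) * a' = 0"
        unfolding distrib_right mn(1)[symmetric] by (subst mn(2)) simp
      then have eq: "lam powi m = - (lam powi n)" using a' by (simp add: eq_neg_iff_add_eq_0)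
      then have "norm lam powi m = norm lam powi n" by (metis norm_minus_cancel norm_power_int)
      then have "ln (norm lam powi m) = ln (norm lam powi n)" by simp
      then have "m = n" using lam by (simp add: ln_power_int)
      then show False using eq by simp
    qed
  qed
  show a: "a \<noteq> 0" using nz[of 1] b0 by auto
  have \<eta>0: "\<eta> 0 = 0" using shift[of 1] by simp
  show "restrict_bdry lam \<phi> f = bdry_mult a"
  proof (rule bdry_mult_eqI[OF a])
    show "restrict_bdry lam \<phi> f \<in> extensional (reeb_bdry lam \<phi>)" by (simp add: restrict_bdry_def)
    show "restrict_bdry lam \<phi> f (proj (z, 0)) = proj (a * z, 0)" if "z \<noteq> 0" for z
      using F(2,3)[OF that] b0 \<eta>0 bdry_projI[OF that] by (simp add: restrict_bdry_def)
  qed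
qed

lemma comm_group_C_star: "comm_group C_star"
proof (rule comm_groupI)
  fix z assume "z \<in> carrier C_star"
  then show "\<exists>w\<in>carrier C_star. w \<otimes>\<^bsub>C_star\<^esub> z = \<one>\<^bsub>C_star\<^esub>"
    by (intro bexI[of _ "inverse z"]) (auto simp: C_star_def)
qed (auto simp: C_star_def)

lemma inv_C_star: "z \<noteq> 0 \<Longrightarrow> inv\<^bsub>C_star\<^esub> z = inverse z"
proof -
  assume z: "z \<noteq> 0"
  interpret comm_group C_star by (rule comm_group_C_star)
  show ?thesis by (rule inv_equality) (use z in \<open>auto simp: C_star_def\<close>)
qed

abbreviation "lamZ \<equiv> range (\<lambda>k::int. lam powi k)"

lemma normal_lamZ: "lamZ \<lhd> C_star"
proof (rule comm_group.subgroup_imp_normal[OF comm_group_C_star])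
  show "subgroup lamZ C_star"
  proof
    show "lamZ \<subseteq> carrier C_star" by (auto simp: C_star_def)
    show "\<one>\<^bsub>C_star\<^esub> \<in> lamZ" by (auto simp: C_star_def intro: range_eqI[of _ _ 0])
    show "x \<otimes>\<^bsub>C_star\<^esub> y \<in> lamZ" if xy: "x \<in> lamZ" "y \<in> lamZ" for x y
    proof -
      obtain m n where "x = lam powi m" "y = lam powi n" using xy by auto
      then have "x \<otimes>\<^bsub>C_star\<^esub> y = lam powi (m + n)" by (simp add: C_star_def power_int_add)
      then show ?thesis by blast
    qed
    show "inv\<^bsub>C_star\<^esub> x \<in> lamZ" if x: "x \<in> lamZ" for x
    proof -
      obtain n where n: "x = lam powi n" using x by auto
      then have "inv\<^bsub>C_star\<^esub> x = lam powi (- n)" by (simp add: inv_C_star power_int_minus)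
      then show ?thesis by blast
    qed
  qed
qed

lemma coset_C_star: "lamZ #>\<^bsub>C_star\<^esub> a = range (\<lambda>k. lam powi k * a)"
  by (auto simp: r_coset_def C_star_def)

lemma coset_eq_iff:
  "lamZ #>\<^bsub>C_star\<^esub> a = lamZ #>\<^bsub>C_star\<^esub> a' \<longleftrightarrow> (\<exists>n. a' = lam powi n * a)"
proof
  assume "lamZ #>\<^bsub>C_star\<^esub> a = lamZ #>\<^bsub>C_star\<^esub> a'"
  moreover have "a' \<in> lamZ #>\<^bsub>C_star\<^esub> a'" unfolding coset_C_star by (rule range_eqI[of _ _ 0]) simp
  ultimately show "\<exists>n. a' = lam powi n * a" unfolding coset_C_star by auto
next
  assume "\<exists>n. a' = lam powi n * a"
  then obtain n where n: "a' = lam powi n * a" by blast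
  have "lam powi k * a' = lam powi (k + n) * a" for k by (simp add: n power_int_add)
  moreover have "lam powi k * a = lam powi (k - n) * a'" for k by (simp add: n power_int_diff)
  ultimately show "lamZ #>\<^bsub>C_star\<^esub> a = lamZ #>\<^bsub>C_star\<^esub> a'" unfolding coset_C_star by blast
qed

definition linear_class :: "((complex \<times> real) set \<Rightarrow> (complex \<times> real) set) \<Rightarrow> complex set" where
  "linear_class f = lamZ #>\<^bsub>C_star\<^esub> (SOME a. a \<noteq> 0 \<and> f = bdry_mult a)"

lemma linear_class_bdry_mult:
  assumes "a \<noteq> 0"
  shows "linear_class (bdry_mult a) = lamZ #>\<^bsub>C_star\<^esub> a"
proof -
  let ?s = "SOME a'. a' \<noteq> 0 \<and> bdry_mult a = bdry_mult a'"
  have "?s \<noteq> 0 \<and> bdry_mult a = bdry_mult ?s" by (rule someI[of _ a]) (use assms in simp)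
  then have "\<exists>n. a = lam powi n * ?s" using bdry_mult_eq_iff[of ?s a] assms by metis
  then show ?thesis unfolding linear_class_def coset_eq_iff .
qed

lemma linear_class_iso: "linear_class \<in> iso (Aut0_bdry lam \<phi>) (C_star Mod lamZ)"
proof -
  have carr: "carrier (C_star Mod lamZ) = (\<lambda>a. lamZ #>\<^bsub>C_star\<^esub> a) ` (- {0})"
    by (auto simp: FactGroup_def RCOSETS_def C_star_def)
  have "linear_class (f \<otimes>\<^bsub>Aut0_bdry lam \<phi>\<^esub> g) = linear_class f \<otimes>\<^bsub>C_star Mod lamZ\<^esub> linear_class g"
    if fg: "f \<in> carrier (Aut0_bdry lam \<phi>)" "g \<in> carrier (Aut0_bdry lam \<phi>)" for f g
  proof -
    obtain a a' where a: "a \<noteq> 0" "f = bdry_mult a" "a' \<noteq> 0" "g = bdry_mult a'" using fg carrier_Aut0 by auto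
    have "(lamZ #>\<^bsub>C_star\<^esub> a) <#>\<^bsub>C_star\<^esub> (lamZ #>\<^bsub>C_star\<^esub> a') = lamZ #>\<^bsub>C_star\<^esub> (a \<otimes>\<^bsub>C_star\<^esub> a')"
      by (rule normal.rcos_sum[OF normal_lamZ]) (use a in \<open>auto simp: C_star_def\<close>)
    moreover have "a \<otimes>\<^bsub>C_star\<^esub> a' = a * a'" by (simp add: C_star_def)
    ultimately show ?thesis
      using a mult_Aut0[OF a(1,3)] linear_class_bdry_mult[of a] linear_class_bdry_mult[of a'] linear_class_bdry_mult[of "a * a'"]
      by (simp add: FactGroup_def)
  qed
  then have "linear_class \<in> hom (Aut0_bdry lam \<phi>) (C_star Mod lamZ)"
    using linear_class_bdry_mult by (auto simp: hom_def carr carrier_Aut0)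
  moreover have "inj_on linear_class (carrier (Aut0_bdry lam \<phi>))"
    unfolding carrier_Aut0
  proof (rule inj_onI)
    fix f g assume "f \<in> bdry_mult ` (- {0})" "g \<in> bdry_mult ` (- {0})" and eq: "linear_class f = linear_class g"
    then obtain a a' where a: "a \<noteq> 0" "f = bdry_mult a" "a' \<noteq> 0" "g = bdry_mult a'" by auto
    then have "\<exists>n. a' = lam powi n * a"
      using eq linear_class_bdry_mult[of a] linear_class_bdry_mult[of a'] coset_eq_iff[of a a'] by simp
    then show "f = g" using bdry_mult_eq_iff[of a a'] a by blast
  qed
  moreover have "linear_class ` carrier (Aut0_bdry lam \<phi>) = carrier (C_star Mod lamZ)"
    unfolding carrier_Aut0 carr image_image using linear_class_bdry_mult by (intro image_cong) auto
  ultimately show ?thesis by (simp add: iso_def bij_betw_def)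
qed

end

lemma hderiv_ident: "hderiv (\<lambda>x. x) 0 = 1"
  by (rule hderiv_unique) (auto intro: has_vector_derivative_id)

lemma jet_eq_hderiv: "jet_eq k f (\<lambda>x. x) \<Longrightarrow> k \<ge> 1 \<Longrightarrow> hderiv f 0 = 1"
  using hderiv_ident half_deriv_1[of f] half_deriv_1[of "\<lambda>x. x"] unfolding jet_eq_def by metis

section \<open>The automorphism group of the Reeb component\<close>

theorem mainTheorem4:
  fixes lam :: complex and \<phi> :: "real \<Rightarrow> real"
  assumes "norm lam > 1"
    and "\<phi> \<in> carrier Diff_half"
    and "expanding \<phi>"
  shows "short_exact (Aut_reeb_rel lam \<phi>) (Aut_reeb lam \<phi>) (Aut0_bdry lam \<phi>)
           (\<lambda>f. f) (restrict_bdry lam \<phi>)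
    \<and> short_exact (K_group lam \<phi>) (Aut_reeb_rel lam \<phi>) (Z_centralizer \<phi>)
           (K_action lam \<phi>) (transverse lam \<phi>)
    \<and> comm_group (Aut0_bdry lam \<phi>) \<and> comm_group (Z_centralizer \<phi>) \<and> comm_group (K_group lam \<phi>)
    \<and> (\<forall>f\<in>carrier (Aut_reeb lam \<phi>). \<exists>F a b \<eta>.
           a \<noteq> 0 \<and> is_lift lam \<phi> f F \<and> affine_form a b \<eta> F)
    \<and> (\<exists>\<Psi> \<in> iso (Aut0_bdry lam \<phi>) (C_star Mod range (\<lambda>k::int. lam powi k)).
         \<forall>f\<in>carrier (Aut_reeb lam \<phi>). \<forall>F a b \<eta>.
           is_lift lam \<phi> f F \<and> affine_form a b \<eta> F \<longrightarrow>
           \<Psi> (restrict_bdry lam \<phi> f) = range (\<lambda>k::int. lam powi k) #>\<^bsub>C_star\<^esub> a)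
    \<and> cfun.subspace (K_space lam \<phi>) \<and> cfun.subspace (Z_space lam \<phi>)
    \<and> \<not> fin_dim (Z_space lam \<phi>)
    \<and> (case2 \<phi> \<or> case3 \<phi> \<longrightarrow> (\<exists>h. linear_iso (K_space lam \<phi>) (Z_space lam \<phi>) h))
    \<and> (case1 \<phi> \<longrightarrow> fin_dim (K_space lam \<phi>) \<and>
         cfun.dim (K_space lam \<phi>) =
           (if \<exists>n::nat. lam = of_real (half_deriv 1 \<phi> 0) ^ n then 1 else 0))"
proof -
  interpret hopf \<phi> lam using assms by unfold_locales
  have tangent: "hderiv \<phi> 0 = 1" if "case2 \<phi> \<or> case3 \<phi>"
  proof -
    obtain k :: nat where "k \<ge> 1" "jet_eq k \<phi> (\<lambda>x. x)"
    proof (cases "case3 \<phi>")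
      case True
      then show thesis using that[of 1] by (simp add: case3_def)
    next
      case False
      then obtain n where "n \<ge> 2" "jet_eq (n - 1) \<phi> (\<lambda>x. x)"
        using \<open>case2 \<phi> \<or> case3 \<phi>\<close> unfolding case2_def by blast
      then show thesis using that[of "n - 1"] by simp
    qed
    then show ?thesis by (intro jet_eq_hderiv)
  qed
  have lifts: "\<forall>f\<in>carrier (Aut_reeb lam \<phi>). \<exists>F a b \<eta>. a \<noteq> 0 \<and> is_lift lam \<phi> f F \<and> affine_form a b \<eta> F"
    using Aut_structure by metis
  have linear: "\<exists>\<Psi> \<in> iso (Aut0_bdry lam \<phi>) (C_star Mod lamZ). \<forall>f\<in>carrier (Aut_reeb lam \<phi>). \<forall>F a b \<eta>.
      is_lift lam \<phi> f F \<and> affine_form a b \<eta> F \<longrightarrow> \<Psi> (restrict_bdry lam \<phi> f) = lamZ #>\<^bsub>C_star\<^esub> a"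
    using linear_class_iso lift_linear_part linear_class_bdry_mult by (intro bexI[of _ linear_class]) auto
  have iso: "case2 \<phi> \<or> case3 \<phi> \<longrightarrow> (\<exists>h. linear_iso (K_space lam \<phi>) (Z_space lam \<phi>) h)"
    using K_eq_Z[OF lam tangent] by (auto simp: linear_iso_def intro!: exI[of _ id])
  have dim: "case1 \<phi> \<longrightarrow> fin_dim (K_space lam \<phi>) \<and> cfun.dim (K_space lam \<phi>) =
      (if \<exists>n::nat. lam = of_real (half_deriv 1 \<phi> 0) ^ n then 1 else 0)"
    using K_case1[OF _ lam] unfolding case1_def half_deriv_1 by blast
  show ?thesis
    using short_exact_restrict short_exact_transverse comm_group_Aut0 comm_group_Z_centralizer comm_group_K
      lifts linear subspace_K subspace_Z not_fin_dim_Z[OF lam_nz] iso dim by blast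
qed

end
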